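(* Let $\Omega\subset\mathbb R^3$ be a bounded Lipschitz domain with connected complement $\mathbb R^3\setminus\overline\Omega$ and $\mathbf 0\in\partial\Omega$, and let $h,M>0$ be such that $(B_h\times(-M,M))\cap\Omega=S_h\times(-M,M)$. Assume the Lamé constant $\lambda\ne0$. Let $\omega\in\mathbb R_+$ and let $\mathbf v,\mathbf w\in H^1(\Omega)^3$ be generalized elastic transmission eigenfunctions, i.e. $$\mathcal L\mathbf v+\omega^2\mathbf v=\mathbf 0\ \text{in }\Omega,\qquad \mathcal L\mathbf w+\omega^2(1+V)\mathbf w=\mathbf 0\ \text{in }\Omega,\qquad \mathbf w=\mathbf v,\ \ T_\nu\mathbf v+\eta\mathbf v=T_\nu\mathbf w\ \text{on }\Gamma,$$ where $\Gamma\subset\partial\Omega$ is an open subset containing $\Gamma_h^\pm\times(-M,M)$. Let $q:=1+V$ and suppose that for some $\alpha\in(0,1)$, $q\mathbf w\in C^\alpha(\overline{S_h}\times[-M,M])^3$, $\mathbf v-\mathbf w\in C^{1,\alpha}(\overline{S_h}\times[-M,M])^3$, and $\eta\in C^\alpha(\overline{\Gamma_h^\pm}\times[-M,M])$. Assume: (a) for given constants $\gamma,\beta_1,\beta_2$ with $\gamma>\max\{\beta_1,\beta_2\}>0$ there is a sequence of Herglotz functions $\mathbf v_j$, $j=1,2,\dots$, with kernels $\mathbf g_{jp},\mathbf g_{js}$ such that for all $j$ $$\|\mathbf v-\mathbf v_j\|_{H^1(S_h\times(-M,M))^3}\le j^{-\gamma},\quad\|\mathbf g_{jp}\|_{L^2(\mathbb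 S^2)^3}\le j^{\beta_1},\quad\|\mathbf g_{js}\|_{L^2(\mathbb S^2)^3}\le j^{\beta_2};$$ (b) $\eta=\eta(\mathbf x')$ is independent of $x_3$ (on $\Gamma_h^\pm\times(-M,M)$) and $\eta(\mathbf 0)\neq0$; (c) $-\pi<\theta_m<\theta_M<\pi$ and $\theta_M-\theta_m\neq\pi$. Then for every edge point $(\mathbf 0,x_3^c)$ with $x_3^c\in(-M,M)$, $$\lim_{\rho\to+0}\frac{1}{m(B((\mathbf 0,x_3^c),\rho)\cap\Omega)}\int_{B((\mathbf 0,x_3^c),\rho)\cap\Omega}|\mathbf v(\mathbf x)|\,\mathrm d\mathbf x=0,$$ where $m(\cdot)$ denotes Lebesgue measure and $B(\mathbf y,\rho)$ is the ball of radius $\rho$ centred at $\mathbf y$.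
   Context: Real constants $\lambda,\mu$ satisfy $\mu>0$ and $3\lambda+2\mu>0$. The Lamé operator is $\mathcal L\mathbf u=\mu\Delta\mathbf u+(\lambda+\mu)\nabla(\nabla\cdot\mathbf u)$. $V\in L^\infty(\Omega)$ is real-valued and nontrivial; $\eta\in L^\infty(\partial\Omega)$ is real-valued. $\mathbf v,\mathbf w$ are $\mathbb C^3$-valued; equations hold in the distributional sense and boundary values in the trace sense. With $\nu$ the outward unit normal, $T_\nu\mathbf v=2\mu\,\partial_\nu\mathbf v+\lambda\nu(\nabla\cdot\mathbf v)+\mu\,\nu\times(\nabla\times\mathbf v)$. Write $\mathbf x=(\mathbf x',x_3)$, $\mathbf x'\in\mathbb R^2$. In $\mathbb R^2$: $W=\{\mathbf x'\ne\mathbf 0:\theta_m<\arg(x_1+\mathrm ix_2)<\theta_M\}$, $\Gamma^-=\{\mathbf x'\ne\mathbf 0:\arg(x_1+\mathrm ix_2)=\theta_m\}$, $\Gamma^+=\{\mathbf x'\ne\mathbf 0:\arg(x_1+\mathrm ix_2)=\theta_M\}$, $B_h$ is the open disk of radius $h$ centred at $\mathbf 0\in\mathbb R^2$, $S_h=W\cap B_h$, $\Gamma_h^\pm=\Gamma^\pm\cap B_h$. Set $k_p=\omega/\sqrt{\lambda+2\mu}$, $k_s=\omega/\sqrt\mu$. The elastic Herglotz wave function with kernels $\mathbf g_{jp},\mathbf g_{js}\in L^2(\mathbb S^2)^3$ is $$\mathbf v_j(\mathbf x)=\int_{\mathbb S^2}\{e^{\mathrm ik_p\mathbf x\cdot\mathbf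 d}\mathbf g_{jp}(\mathbf d)+e^{\mathrm ik_s\mathbf x\cdot\mathbf d}\mathbf g_{js}(\mathbf d)\}\,\mathrm d\sigma(\mathbf d).$$ *)

theory Defs
  imports "HOL-Analysis.Analysis"
begin

section \<open>Function spaces\<close>

definition L2 :: "'a measure \<Rightarrow> ('a \<Rightarrow> 'b::euclidean_space) \<Rightarrow> bool" where
  "L2 M f \<longleftrightarrow> f \<in> borel_measurable M \<and> integrable M (\<lambda>x. (norm (f x))\<^sup>2)"

definition L2_norm :: "'a measure \<Rightarrow> ('a \<Rightarrow> 'b::euclidean_space) \<Rightarrow> real" where
  "L2_norm M f = sqrt (integral\<^sup>L M (\<lambda>x. (norm (f x))\<^sup>2))"

definition L_infty :: "'a measure \<Rightarrow> ('a \<Rightarrow> real) \<Rightarrow> bool" where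
  "L_infty M f \<longleftrightarrow> f \<in> borel_measurable M \<and> (\<exists>C. AE x in M. \<bar>f x\<bar> \<le> C)"

definition holder_on :: "(real^3) set \<Rightarrow> real \<Rightarrow> (real^3 \<Rightarrow> 'b::real_normed_vector) \<Rightarrow> bool" where
  "holder_on K \<alpha> f \<longleftrightarrow> (\<exists>C. \<forall>x\<in>K. \<forall>y\<in>K. norm (f x - f y) \<le> C * dist x y powr \<alpha>)"

text \<open>Meant for compact sets \<open>K\<close> that are the closure of their interior: the function is
  differentiable in the interior, and its derivative extends to \<open>K\<close> as a Hoelder function.\<close>

definition C1_holder_on :: "(real^3) set \<Rightarrow> real \<Rightarrow> (real^3 \<Rightarrow> 'b::real_normed_vector) \<Rightarrow> bool" where
  "C1_holder_on K \<alpha> f \<longleftrightarrow> continuous_on K f \<and>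
     (\<exists>G :: real^3 \<Rightarrow> ((real^3) \<Rightarrow>\<^sub>L 'b). holder_on K \<alpha> G \<and>
       (\<forall>x\<in>interior K. (f has_derivative blinfun_apply (G x)) (at x)))"

definition partial :: "3 \<Rightarrow> (real^3 \<Rightarrow> 'b::real_normed_vector) \<Rightarrow> real^3 \<Rightarrow> 'b" where
  "partial j f x = frechet_derivative f (at x) (axis j 1)"

primrec Ck :: "nat \<Rightarrow> (real^3 \<Rightarrow> 'b::real_normed_vector) \<Rightarrow> bool" where
  "Ck 0 f \<longleftrightarrow> continuous_on UNIV f"
| "Ck (Suc k) f \<longleftrightarrow> (\<forall>x. f differentiable at x) \<and> (\<forall>j. Ck k (partial j f))"

definition smooth :: "(real^3 \<Rightarrow> 'b::real_normed_vector) \<Rightarrow> bool" where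
  "smooth f \<longleftrightarrow> (\<forall>k. Ck k f)"

definition test_fun :: "(real^3) set \<Rightarrow> (real^3 \<Rightarrow> 'b::real_normed_vector) \<Rightarrow> bool" where
  "test_fun S \<phi> \<longleftrightarrow> smooth \<phi> \<and> compact (closure {x. \<phi> x \<noteq> 0}) \<and> closure {x. \<phi> x \<noteq> 0} \<subseteq> S"

text \<open>The entry \<open>G x $ i $ j\<close> is the weak derivative of the \<open>i\<close>-th component in direction \<open>j\<close>.\<close>

definition weak_gradient :: "(real^3) set \<Rightarrow> (real^3 \<Rightarrow> complex^3) \<Rightarrow> (real^3 \<Rightarrow> complex^3^3) \<Rightarrow> bool" where
  "weak_gradient D u G \<longleftrightarrow> (\<forall>\<phi> :: real^3 \<Rightarrow> real. test_fun D \<phi> \<longrightarrow>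
     (\<forall>j. integral\<^sup>L (lebesgue_on D) (\<lambda>x. partial j \<phi> x *\<^sub>R u x)
        = - integral\<^sup>L (lebesgue_on D) (\<lambda>x. \<phi> x *\<^sub>R column j (G x))))"

definition H1 :: "(real^3) set \<Rightarrow> (real^3 \<Rightarrow> complex^3) \<Rightarrow> bool" where
  "H1 D u \<longleftrightarrow> L2 (lebesgue_on D) u \<and> (\<exists>G. L2 (lebesgue_on D) G \<and> weak_gradient D u G)"

text \<open>For \<open>u\<close> in \<open>H1 D\<close> this is determined almost everywhere in \<open>D\<close>.\<close>

definition wgrad :: "(real^3) set \<Rightarrow> (real^3 \<Rightarrow> complex^3) \<Rightarrow> real^3 \<Rightarrow> complex^3^3" where
  "wgrad D u = (SOME G. L2 (lebesgue_on D) G \<and> weak_gradient D u G)"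

definition H1_norm :: "(real^3) set \<Rightarrow> (real^3 \<Rightarrow> complex^3) \<Rightarrow> real" where
  "H1_norm D u = sqrt ((L2_norm (lebesgue_on D) u)\<^sup>2 + (L2_norm (lebesgue_on D) (wgrad D u))\<^sup>2)"

section \<open>Lipschitz domains, surface measure, traces\<close>

definition proj12 :: "real^3 \<Rightarrow> real^2" where
  "proj12 x = vector [x$1, x$2]"

definition cyl :: "(real^2) set \<Rightarrow> real set \<Rightarrow> (real^3) set" where
  "cyl A I = {x. proj12 x \<in> A \<and> x$3 \<in> I}"

text \<open>Near each boundary point \<open>p\<close> the set is, in the rigidly moved coordinates \<open>x = p + T y\<close>,
  the part of a cylinder above a Lipschitz graph.\<close>

definition lipschitz_domain :: "(real^3) set \<Rightarrow> bool" where
  "lipschitz_domain \<Omega> \<longleftrightarrow> open \<Omega> \<and> connected \<Omega> \<and> \<Omega> \<noteq> {} \<and>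
     (\<forall>p\<in>frontier \<Omega>. \<exists>(T :: real^3 \<Rightarrow> real^3) (\<phi> :: real^2 \<Rightarrow> real) L r a.
        orthogonal_transformation T \<and> L-lipschitz_on UNIV \<phi> \<and> 0 < r \<and> 0 < a \<and>
        (\<forall>z\<in>ball 0 r. \<bar>\<phi> z\<bar> < a) \<and>
        \<Omega> \<inter> (\<lambda>y. p + T y) ` cyl (ball 0 r) {-a<..<a}
          = (\<lambda>y. p + T y) ` {y \<in> cyl (ball 0 r) {-a<..<a}. \<phi> (proj12 y) < y$3})"

text \<open>Two-dimensional Hausdorff measure; the factor \<open>pi / 4\<close> makes it agree with the
  usual area on planes and on Lipschitz surfaces.\<close>

definition hausdorff2 :: "(real^3) set \<Rightarrow> ennreal" where
  "hausdorff2 A = (SUP \<delta>\<in>{0::real<..}.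
     INF C\<in>{C :: nat \<Rightarrow> (real^3) set.
              (\<forall>n. bounded (C n) \<and> diameter (C n) \<le> \<delta>) \<and> A \<subseteq> (\<Union>n. C n)}.
       (\<Sum>n. ennreal (pi / 4 * (diameter (C n))\<^sup>2)))"

definition surface_on :: "(real^3) set \<Rightarrow> (real^3) measure" where
  "surface_on S = restrict_space (measure_of UNIV (sets borel) hausdorff2) S"

definition is_trace :: "(real^3) set \<Rightarrow> (real^3 \<Rightarrow> complex^3) \<Rightarrow> (real^3 \<Rightarrow> complex^3) \<Rightarrow> bool" where
  "is_trace \<Omega> u t \<longleftrightarrow> L2 (surface_on (frontier \<Omega>)) t \<and>
     (\<exists>f :: nat \<Rightarrow> real^3 \<Rightarrow> complex^3. (\<forall>n. smooth (f n)) \<and>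
        (\<lambda>n. H1_norm \<Omega> (\<lambda>x. f n x - u x)) \<longlonglongrightarrow> 0 \<and>
        (\<lambda>n. L2_norm (surface_on (frontier \<Omega>)) (\<lambda>x. f n x - t x)) \<longlonglongrightarrow> 0)"

section \<open>The Lame system\<close>

text \<open>Bilinear, without complex conjugation.\<close>

definition cdot :: "complex^3 \<Rightarrow> complex^3 \<Rightarrow> complex" where
  "cdot a b = (\<Sum>i\<in>UNIV. a$i * b$i)"

definition ccross :: "complex^3 \<Rightarrow> complex^3 \<Rightarrow> complex^3" where
  "ccross a b = vector [a$2 * b$3 - a$3 * b$2, a$3 * b$1 - a$1 * b$3, a$1 * b$2 - a$2 * b$1]"

definition cvec :: "real^3 \<Rightarrow> complex^3" where
  "cvec x = (\<chi> i. complex_of_real (x$i))"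

definition divergence :: "(real^3 \<Rightarrow> complex^3) \<Rightarrow> real^3 \<Rightarrow> complex" where
  "divergence \<phi> x = (\<Sum>j\<in>UNIV. partial j (\<lambda>y. \<phi> y $ j) x)"

definition laplacian :: "(real^3 \<Rightarrow> complex^3) \<Rightarrow> real^3 \<Rightarrow> complex^3" where
  "laplacian \<phi> x = (\<Sum>j\<in>UNIV. partial j (partial j \<phi>) x)"

definition lame :: "real \<Rightarrow> real \<Rightarrow> (real^3 \<Rightarrow> complex^3) \<Rightarrow> real^3 \<Rightarrow> complex^3" where
  "lame la mu \<phi> x =
     mu *\<^sub>R laplacian \<phi> x + (la + mu) *\<^sub>R (\<chi> i. partial i (divergence \<phi>) x)"

text \<open>\<open>L u = f\<close> in the sense of distributions; the Lame operator is formally symmetric.\<close>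

definition lame_distr :: "real \<Rightarrow> real \<Rightarrow> (real^3) set \<Rightarrow> (real^3 \<Rightarrow> complex^3) \<Rightarrow> (real^3 \<Rightarrow> complex^3) \<Rightarrow> bool" where
  "lame_distr la mu \<Omega> u f \<longleftrightarrow> (\<forall>\<phi>. test_fun \<Omega> \<phi> \<longrightarrow>
     integral\<^sup>L (lebesgue_on \<Omega>) (\<lambda>x. cdot (u x) (lame la mu \<phi> x))
       = integral\<^sup>L (lebesgue_on \<Omega>) (\<lambda>x. cdot (f x) (\<phi> x)))"

definition curl_mat :: "complex^3^3 \<Rightarrow> complex^3" where
  "curl_mat G = vector [G$3$2 - G$2$3, G$1$3 - G$3$1, G$2$1 - G$1$2]"

text \<open>The traction \<open>T_nu u = 2 mu d_nu u + la nu (div u) + mu nu x (curl u)\<close>, as a function of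
  the vector \<open>\<nu>\<close> and of the gradient matrix \<open>G\<close> of \<open>u\<close>.\<close>

definition traction :: "real \<Rightarrow> real \<Rightarrow> real^3 \<Rightarrow> complex^3^3 \<Rightarrow> complex^3" where
  "traction la mu \<nu> G = (2 * mu) *\<^sub>R (G *v cvec \<nu>) + la *\<^sub>R (trace G *s cvec \<nu>)
     + mu *\<^sub>R ccross (cvec \<nu>) (curl_mat G)"

text \<open>The duality pairing of the boundary distribution \<open>T_nu u\<close> (outward normal) with the
  restriction of \<open>\<psi>\<close> to the boundary, for \<open>u\<close> in \<open>H1 \<Omega>\<close> with \<open>L u = f\<close> in \<open>L2\<close>. Since \<open>traction\<close> is
  linear in the normal and the divergence of its columns is \<open>L u\<close>, this is
  the boundary integral of \<open>cdot (T_nu u) \<psi>\<close> when \<open>u\<close> is regular.\<close>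

definition traction_pairing ::
  "real \<Rightarrow> real \<Rightarrow> (real^3) set \<Rightarrow> (real^3 \<Rightarrow> complex^3) \<Rightarrow> (real^3 \<Rightarrow> complex^3) \<Rightarrow> (real^3 \<Rightarrow> complex^3) \<Rightarrow> complex" where
  "traction_pairing la mu \<Omega> u f \<psi> = integral\<^sup>L (lebesgue_on \<Omega>)
     (\<lambda>x. (\<Sum>j\<in>UNIV. cdot (traction la mu (axis j 1) (wgrad \<Omega> u x)) (partial j \<psi> x))
          + cdot (f x) (\<psi> x))"

text \<open>The traction condition on \<open>\<Gamma>\<close> is an identity of distributions on \<open>\<Gamma>\<close>: the support of a test
  function may meet the boundary only inside \<open>\<Gamma>\<close>.\<close>

definition transmission_eigenfunctions ::
  "real \<Rightarrow> real \<Rightarrow> real \<Rightarrow> (real^3) set \<Rightarrow> (real^3) set \<Rightarrow> (real^3 \<Rightarrow> real) \<Rightarrow> (real^3 \<Rightarrow> real)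
    \<Rightarrow> (real^3 \<Rightarrow> complex^3) \<Rightarrow> (real^3 \<Rightarrow> complex^3) \<Rightarrow> bool" where
  "transmission_eigenfunctions la mu \<omega> \<Omega> \<Gamma> V \<eta> v w \<longleftrightarrow>
     H1 \<Omega> v \<and> H1 \<Omega> w \<and>
     lame_distr la mu \<Omega> v (\<lambda>x. - (\<omega>\<^sup>2 *\<^sub>R v x)) \<and>
     lame_distr la mu \<Omega> w (\<lambda>x. - ((\<omega>\<^sup>2 * (1 + V x)) *\<^sub>R w x)) \<and>
     (\<exists>tv tw. is_trace \<Omega> v tv \<and> is_trace \<Omega> w tw \<and>
        (AE x in surface_on \<Gamma>. tw x = tv x) \<and>
        (\<forall>\<psi>. test_fun (\<Gamma> \<union> - frontier \<Omega>) \<psi> \<longrightarrow>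
           traction_pairing la mu \<Omega> v (\<lambda>x. - (\<omega>\<^sup>2 *\<^sub>R v x)) \<psi>
             + integral\<^sup>L (surface_on (frontier \<Omega>)) (\<lambda>x. cdot (\<eta> x *\<^sub>R tv x) (\<psi> x))
           = traction_pairing la mu \<Omega> w (\<lambda>x. - ((\<omega>\<^sup>2 * (1 + V x)) *\<^sub>R w x)) \<psi>))"

definition herglotz :: "real \<Rightarrow> real \<Rightarrow> (real^3 \<Rightarrow> complex^3) \<Rightarrow> (real^3 \<Rightarrow> complex^3) \<Rightarrow> real^3 \<Rightarrow> complex^3" where
  "herglotz kp ks gp gs x = integral\<^sup>L (surface_on (sphere 0 1))
     (\<lambda>d. exp (\<i> * of_real (kp * (x \<bullet> d))) *s gp d + exp (\<i> * of_real (ks * (x \<bullet> d))) *s gs d)"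

section \<open>The sector\<close>

definition arg2 :: "real^2 \<Rightarrow> real" where
  "arg2 x = Arg (Complex (x$1) (x$2))"

definition sector :: "real \<Rightarrow> real \<Rightarrow> real \<Rightarrow> (real^2) set" where
  "sector \<theta>m \<theta>M h = {x. x \<noteq> 0 \<and> \<theta>m < arg2 x \<and> arg2 x < \<theta>M} \<inter> ball 0 h"

definition ray :: "real \<Rightarrow> real \<Rightarrow> (real^2) set" where
  "ray \<theta> h = {x. x \<noteq> 0 \<and> arg2 x = \<theta>} \<inter> ball 0 h"

end

theory Submission
  imports Defs
begin

text \<open>
  Near the edge point \<open>p\<close> put \<open>u = v - w\<close>. It is \<open>C\<^sup>1\<close> with a Hoelder gradient and vanishes on
  both faces of the wedge; as the faces are not coplanar, its gradient vanishes at \<open>p\<close>, hence is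
  \<open>O(|x - p| powr \<alpha>)\<close>. Test the traction condition with a bump of size \<open>\<rho>\<close> centred on a face at
  distance \<open>\<rho>\<close> from \<open>p\<close>: the volume terms are \<open>O(\<rho> powr (2 + \<alpha>) + \<rho> powr (5/2))\<close>, so the
  mean of \<open>\<eta> v\<close> over a piece of the face of area \<open>\<rho>\<^sup>2\<close> is \<open>O(\<rho> powr \<alpha> + sqrt \<rho>)\<close>.
  There \<open>v\<close> may be replaced by the Herglotz function \<open>v_j\<close> at the cost
  \<open>j powr (-\<gamma>) / sqrt \<rho>\<close>, and \<open>v_j\<close> by \<open>v_j(p)\<close> at the cost \<open>j powr \<beta> * \<rho>\<close>, where \<open>\<beta> = max \<beta>1 \<beta>2\<close>.
  Since \<open>\<eta>\<close> does not vanish at \<open>p\<close>, the choice \<open>\<rho> = j powr (-\<gamma>)\<close> yields \<open>v_j(p) \<rightarrow> 0\<close>.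
  The mean of \<open>|v|\<close> over the ball of radius \<open>\<sigma>\<close> exceeds \<open>|v_j(p)|\<close> by at most
  \<open>O(j powr (-\<gamma>) / sqrt \<sigma> + j powr \<beta> * \<sigma>)\<close>, which tends to \<open>0\<close> with \<open>\<sigma>\<close> when \<open>j\<close> is comparable to
  \<open>\<sigma> powr (-1 / \<gamma>)\<close>.
\<close>

section \<open>Test functions\<close>

text \<open>The obstacle is that \<open>v\<close> is merely an H1 function. Cauchy-Schwarz alone
  gives its integral over a ball of radius \<rho> the size \<rho>^(3/2), which diverges after
  division by the area \<rho>^2. The further power that makes it \<rho>^(5/2) comes from the
  gradient, by integration along rays into the edge point, and is available because the wedge is a
  cone. It lowers the cost of replacing \<open>v\<close> by a function at H1 distance e to e / sqrt
  \<rho>, so that \<rho> = e leaves only sqrt e, while j powr \<beta> * \<rho> tends to zero because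
  \<beta> < \<gamma>. The tractions of \<open>v\<close> and \<open>w\<close> have no pointwise
  meaning; only the difference of their weak pairings is used, and apart from terms of order zero it
  contains just the gradient of \<open>u\<close>. That gradient annihilates the two face directions
  and the edge direction at \<open>p\<close>; these are linearly independent because the opening
  angle is not pi. Since traces are limits of smooth functions, every bound on \<open>v\<close> and
  its trace is proved for C1 functions in terms of their energy and then passed to the
  limit.\<close>

primrec dtimes :: "nat \<Rightarrow> (real \<Rightarrow> real) \<Rightarrow> bool" where
  "dtimes 0 f \<longleftrightarrow> True"
| "dtimes (Suc k) f \<longleftrightarrow> (\<exists>f'. (\<forall>x. (f has_real_derivative f' x) (at x)) \<and> dtimes k f')"

lemma dtimes_SucI: "(\<And>x. (f has_real_derivative f' x) (at x)) \<Longrightarrow> dtimes k f' \<Longrightarrow> dtimes (Suc k) f"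
  by auto

text \<open>The product rule keeps one factor undifferentiated, so an order must be given up before
  the induction hypothesis applies to both factors.\<close>

lemma dtimes_Suc_imp: "dtimes (Suc k) f \<Longrightarrow> dtimes k f"
proof (induction k arbitrary: f)
  case (Suc k)
  then obtain f' where "\<And>x. (f has_real_derivative f' x) (at x)" "dtimes (Suc k) f'"
    by auto
  then show ?case
    by (intro dtimes_SucI[of f f'] Suc.IH)
qed simp

lemma dtimes_add: "dtimes k f \<Longrightarrow> dtimes k g \<Longrightarrow> dtimes k (\<lambda>x. f x + g x)"
proof (induction k arbitrary: f g)
  case (Suc k)
  then obtain f' g' where "\<And>x. (f has_real_derivative f' x) (at x)" "dtimes k f'"
    "\<And>x. (g has_real_derivative g' x) (at x)" "dtimes k g'" by auto
  then show ?case
    by (intro dtimes_SucI[where f' = "\<lambda>x. f' x + g' x"]) (auto intro!: derivative_eq_intros Suc.IH)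
qed auto

lemma dtimes_cmult: "dtimes k f \<Longrightarrow> dtimes k (\<lambda>x. c * f x)"
proof (induction k arbitrary: f)
  case (Suc k)
  then obtain f' where "\<And>x. (f has_real_derivative f' x) (at x)" "dtimes k f'" by auto
  then show ?case
    by (intro dtimes_SucI[where f' = "\<lambda>x. c * f' x"]) (auto intro!: derivative_eq_intros Suc.IH)
qed auto

lemma dtimes_mult: "dtimes k f \<Longrightarrow> dtimes k g \<Longrightarrow> dtimes k (\<lambda>x. f x * g x)"
proof (induction k arbitrary: f g)
  case (Suc k)
  then obtain f' g' where *: "\<And>x. (f has_real_derivative f' x) (at x)" "dtimes k f'"
    "\<And>x. (g has_real_derivative g' x) (at x)" "dtimes k g'" by auto
  show ?case
    using * Suc.IH dtimes_Suc_imp[OF Suc.prems(1)] dtimes_Suc_imp[OF Suc.prems(2)]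
    by (intro dtimes_SucI[where f' = "\<lambda>x. f' x * g x + g' x * f x"])
       (auto intro!: derivative_eq_intros dtimes_add)
qed auto

lemma dtimes_affine: "dtimes k f \<Longrightarrow> dtimes k (\<lambda>x. f (c * x + d))"
proof (induction k arbitrary: f)
  case (Suc k)
  then obtain f' where *: "\<And>x. (f has_real_derivative f' x) (at x)" "dtimes k f'" by auto
  have "((\<lambda>x. f (c * x + d)) has_real_derivative c * f' (c * x + d)) (at x)" for x
    by (rule DERIV_chain2[OF *(1), THEN DERIV_cong]) (auto intro!: derivative_eq_intros)
  then show ?case
    by (rule dtimes_SucI) (intro dtimes_cmult Suc.IH *(2))
qed auto

text \<open>For \<open>m = 0\<close> this is the classical smooth function equal to exp(-1/u) on the
  right half-line. The negative powers are included because the derivative of a member of the family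
  is a linear combination of members, so that one induction yields all orders.\<close>

definition flat :: "nat \<Rightarrow> real \<Rightarrow> real" where
  "flat m u = (if u > 0 then inverse u ^ m * exp (- inverse u) else 0)"

text \<open>Substituting 1/u turns the right-hand limit into that of x^m / exp x at infinity; on the
  left the function is zero.\<close>

lemma flat_tendsto_0: "(flat m \<longlongrightarrow> 0) (at 0)"
proof -
  have "((\<lambda>x::real. x ^ m / exp x) \<longlongrightarrow> 0) at_top"
    by (rule tendsto_power_div_exp_0)
  then have "((\<lambda>u::real. inverse u ^ m / exp (inverse u)) \<longlongrightarrow> 0) (at_right 0)"
    by (rule filterlim_compose[OF _ filterlim_inverse_at_top_right])
  then have "(flat m \<longlongrightarrow> 0) (at_right 0)"
    by (rule Lim_transform_eventually)
       (auto simp: eventually_at_right_field flat_def exp_minus field_simps intro!: exI[of _ 1])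
  moreover have "(flat m \<longlongrightarrow> 0) (at_left 0)"
    by (rule tendsto_eventually) (auto simp: eventually_at_left_field flat_def intro!: exI[of _ "-1"])
  ultimately show ?thesis
    by (simp add: filterlim_at_split)
qed

lemma flat_has_derivative: "(flat m has_real_derivative flat (m + 2) u + (- real m) * flat (m + 1) u) (at u)"
proof -
  consider "u > 0" | "u < 0" | "u = 0" by linarith
  then show ?thesis
  proof cases
    case 1
    have "((\<lambda>u. inverse u ^ m * exp (- inverse u)) has_real_derivative
      flat (m + 2) u + (- real m) * flat (m + 1) u) (at u)"
    proof (cases m)
      case (Suc k)
      have "u ^ k \<noteq> u * u ^ (k - Suc 0) \<Longrightarrow> k = 0"
        by (cases k) auto
      then show ?thesis
        using 1 Suc by (auto intro!: derivative_eq_intros simp: flat_def field_simps power2_eq_square)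
    qed (use 1 in \<open>auto intro!: derivative_eq_intros simp: flat_def field_simps power2_eq_square\<close>)
    then show ?thesis
      by (rule has_field_derivative_transform_within_open[where S = "{0<..}"]) (use 1 in \<open>auto simp: flat_def\<close>)
  next
    case 2
    have "((\<lambda>u. 0) has_real_derivative flat (m + 2) u + (- real m) * flat (m + 1) u) (at u)"
      using 2 by (auto simp: flat_def)
    then show ?thesis
      by (rule has_field_derivative_transform_within_open[where S = "{..<0}"]) (use 2 in \<open>auto simp: flat_def\<close>)
  next
    case 3
    \<comment> \<open>The difference quotient of \<open>flat m\<close> at 0 is
      \<open>flat (m + 1)\<close>, so the limit already proved gives the derivative there.\<close>
    have "((\<lambda>h. (flat m (0 + h) - flat m 0) / h) \<longlongrightarrow> 0) (at 0)"
      by (rule Lim_transform_eventually[OF flat_tendsto_0[of "m + 1"]])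
         (auto simp: flat_def field_simps eventually_at_filter)
    then show ?thesis
      using 3 by (simp add: DERIV_def) (simp add: flat_def)
  qed
qed

lemma dtimes_flat: "dtimes k (flat m)"
proof (induction k arbitrary: m)
  case (Suc k)
  then show ?case
    by (intro dtimes_SucI[OF flat_has_derivative] dtimes_add dtimes_cmult) auto
qed auto

lemma prod_3: "(\<Prod>i\<in>UNIV. f i) = f 1 * f 2 * f 3" for f :: "3 \<Rightarrow> ('a::comm_monoid_mult)"
  unfolding UNIV_3 by (simp add: ac_simps)

lemma prod_comp_has_derivative:
  fixes \<beta> \<beta>' :: "3 \<Rightarrow> real \<Rightarrow> real" and c :: "'b::real_normed_vector"
  assumes "\<And>i x. (\<beta> i has_real_derivative \<beta>' i x) (at x)"
  shows "((\<lambda>x. (\<Prod>i\<in>UNIV. \<beta> i (x $ i)) *\<^sub>R c) has_derivative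
     (\<lambda>e. (\<Sum>j\<in>UNIV. e $ j *\<^sub>R (\<Prod>i\<in>UNIV. (if i = j then \<beta>' i else \<beta> i) (x $ i)) *\<^sub>R c))) (at x)"
proof -
  have *: "((\<lambda>x::real^3. \<beta> i (x $ i)) has_derivative (\<lambda>e. e $ i * \<beta>' i (x $ i))) (at x)" for i
  proof -
    have "((\<lambda>x::real^3. x $ i) has_derivative (\<lambda>e. e $ i)) (at x)"
      by (intro bounded_linear_imp_has_derivative bounded_linear_vec_nth)
    from has_derivative_compose[OF this assms[unfolded has_field_derivative_def, of i "x $ i"]]
    show ?thesis by (simp add: mult.commute)
  qed
  show ?thesis
    unfolding prod_3 sum_3
    by (rule has_derivative_eq_rhs, (rule derivative_intros *)+)
       (auto simp: fun_eq_iff algebra_simps simp flip: scaleR_add_left)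
qed

lemma partial_eqI:
  assumes "(f has_derivative f') (at x)"
  shows "partial j f x = f' (axis j 1)"
  unfolding partial_def by (metis assms frechet_derivative_at)

text \<open>A partial derivative of a product of one-variable functions is a product of the same
  kind with one factor differentiated, so the induction stays inside the class. One order more is
  assumed than obtained, because \<open>Ck 0\<close> asks for continuity and this is read off
  differentiability.\<close>

lemma Ck_prod_comp:
  fixes \<beta> :: "3 \<Rightarrow> real \<Rightarrow> real" and c :: "'b::real_normed_vector"
  assumes "\<And>i. dtimes (Suc k) (\<beta> i)"
  shows "Ck k (\<lambda>x. (\<Prod>i\<in>UNIV. \<beta> i (x $ i)) *\<^sub>R c)"
  using assms
proof (induction k arbitrary: \<beta>)
  case 0
  then have "\<forall>i. \<exists>b. \<forall>x. (\<beta> i has_real_derivative b x) (at x)" by simp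
  then obtain \<beta>' where "\<And>i x. (\<beta> i has_real_derivative \<beta>' i x) (at x)"
    by metis
  from prod_comp_has_derivative[of \<beta> \<beta>', OF this, of c]
  show ?case
    unfolding Ck.simps by (intro continuous_at_imp_continuous_on ballI has_derivative_continuous)
next
  case (Suc k)
  have "\<forall>i. \<exists>b. (\<forall>x. (\<beta> i has_real_derivative b x) (at x)) \<and> dtimes (Suc k) b"
    using Suc.prems by (metis dtimes.simps(2))
  then obtain \<beta>' where b: "\<And>i x. (\<beta> i has_real_derivative \<beta>' i x) (at x)" "\<And>i. dtimes (Suc k) (\<beta>' i)"
    by metis
  note d = prod_comp_has_derivative[of \<beta> \<beta>', OF b(1), of c]
  have "Ck k (partial j (\<lambda>x. (\<Prod>i\<in>UNIV. \<beta> i (x $ i)) *\<^sub>R c))" for j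
  proof -
    have "partial j (\<lambda>x. (\<Prod>i\<in>UNIV. \<beta> i (x $ i)) *\<^sub>R c) =
      (\<lambda>x. (\<Prod>i\<in>UNIV. (if i = j then \<beta>' i else \<beta> i) (x $ i)) *\<^sub>R c)"
    proof
      fix x
      show "partial j (\<lambda>x. (\<Prod>i\<in>UNIV. \<beta> i (x $ i)) *\<^sub>R c) x =
        (\<Prod>i\<in>UNIV. (if i = j then \<beta>' i else \<beta> i) (x $ i)) *\<^sub>R c"
        by (subst partial_eqI[OF d]) (cases j rule: exhaust_3[THEN disjE]; auto simp: sum_3 axis_def)
    qed
    moreover have "dtimes (Suc k) (if i = j then \<beta>' i else \<beta> i)" for i
      using b(2)[of i] dtimes_Suc_imp[OF Suc.prems[of i]] by (cases "i = j") (simp_all del: dtimes.simps)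
    ultimately show ?thesis
      using Suc.IH[of "\<lambda>i. if i = j then \<beta>' i else \<beta> i"] by simp
  qed
  then show ?case
    using d by (auto simp: differentiable_def simp del: dtimes.simps)
qed

text \<open>The factor \<open>n\<close> has two uses. As \<open>n\<close> grows, the function tends
  to the indicator of the open interval, since \<open>flat 0 (n * d)\<close> tends to 1 for
  \<open>d > 0\<close> and is 0 otherwise. With \<open>n = 1 / \<rho>\<close> and an interval of
  length proportional to \<rho> it is an exact rescaling of one profile.\<close>

definition bump1 :: "real \<Rightarrow> real \<Rightarrow> real \<Rightarrow> real \<Rightarrow> real" where
  "bump1 n a b x = flat 0 (n * (x - a)) * flat 0 (n * (b - x))"

lemma dtimes_bump1: "dtimes k (bump1 n a b)"
proof -
  have "bump1 n a b = (\<lambda>x. flat 0 (n * x + (- n * a)) * flat 0 ((- n) * x + n * b))"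
    by (auto simp: bump1_def fun_eq_iff algebra_simps)
  then show ?thesis
    by (simp only:) (intro dtimes_mult dtimes_affine dtimes_flat)
qed

lemma flat0: "flat 0 u \<ge> 0" "flat 0 u \<le> 1" "flat 0 u > 0 \<longleftrightarrow> u > 0" "flat 0 u = 0 \<longleftrightarrow> u \<le> 0"
  by (auto simp: flat_def)

lemma bump1_bounds: "0 \<le> bump1 n a b x" "bump1 n a b x \<le> 1"
  using flat0 by (auto simp: bump1_def intro!: mult_le_one mult_nonneg_nonneg)

lemma bump1_eq_0: "n > 0 \<Longrightarrow> bump1 n a b x = 0 \<longleftrightarrow> \<not> (a < x \<and> x < b)"
  by (auto simp: bump1_def flat0 mult_le_0_iff)

lemma bump1_tendsto: "(\<lambda>n. bump1 (real (Suc n)) a b x) \<longlonglongrightarrow> (if a < x \<and> x < b then 1 else 0)"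
proof (cases "a < x \<and> x < b")
  case True
  have *: "(\<lambda>n. flat 0 (real (Suc n) * d)) \<longlonglongrightarrow> 1" if "d > 0" for d
  proof -
    have "(\<lambda>n. exp (- (inverse (real (Suc n)) * inverse d))) \<longlonglongrightarrow> exp (- (0 * inverse d))"
      by (intro tendsto_intros LIMSEQ_inverse_real_of_nat)
    then show ?thesis
      using that by (simp add: flat_def zero_less_mult_iff)
  qed
  show ?thesis
    using tendsto_mult[OF *[of "x - a"] *[of "b - x"]] True by (simp add: bump1_def)
next
  case False
  then have "bump1 (real (Suc n)) a b x = 0" for n
    by (intro bump1_eq_0[THEN iffD2]) auto
  then show ?thesis
    unfolding if_not_P[OF False] by (simp only: tendsto_const)
qed

definition bump :: "real \<Rightarrow> real^3 \<Rightarrow> real^3 \<Rightarrow> real^3 \<Rightarrow> real" where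
  "bump n a b x = (\<Prod>i\<in>UNIV. bump1 n (a $ i) (b $ i) (x $ i))"

lemma mem_box_vec3: "x \<in> box a b \<longleftrightarrow> (\<forall>i. a $ i < x $ i \<and> x $ i < b $ i)" for x :: "real^3"
  by (auto simp: mem_box Basis_vec_def inner_axis)

lemma bump_bounds: "0 \<le> bump n a b x" "bump n a b x \<le> 1"
  using bump1_bounds by (auto simp: bump_def intro!: prod_nonneg prod_le_1)

lemma bump_eq_0: "n > 0 \<Longrightarrow> bump n a b x = 0 \<longleftrightarrow> x \<notin> box a b"
  by (auto simp: bump_def bump1_eq_0 mem_box_vec3)

lemma bump_tendsto: "(\<lambda>n. bump (real (Suc n)) a b x) \<longlonglongrightarrow> indicator (box a b) x"
proof -
  have "(\<lambda>n. bump (real (Suc n)) a b x) \<longlonglongrightarrow> (\<Prod>i\<in>UNIV. if a $ i < x $ i \<and> x $ i < b $ i then 1 else 0)"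
    unfolding bump_def by (intro tendsto_prod bump1_tendsto)
  also have "(\<Prod>i\<in>UNIV. if a $ i < x $ i \<and> x $ i < b $ i then 1 else 0 :: real) = indicator (box a b) x"
    by (auto simp: mem_box_vec3 indicator_def)
  finally show ?thesis .
qed

lemma smooth_bump: "smooth (\<lambda>x. bump n a b x *\<^sub>R c)"
  unfolding smooth_def bump_def using Ck_prod_comp[of _ "\<lambda>i. bump1 n (a $ i) (b $ i)" c] dtimes_bump1
  by blast

lemma test_fun_bump_scaleR:
  assumes "n > 0" "cbox a b \<subseteq> S"
  shows "test_fun S (\<lambda>x. bump n a b x *\<^sub>R c)"
proof -
  have *: "closure {x. bump n a b x *\<^sub>R c \<noteq> 0} \<subseteq> cbox a b"
    by (rule closure_minimal) (use bump_eq_0[OF assms(1)] box_subset_cbox[of a b] in \<open>auto simp: subset_iff\<close>)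
  then have "bounded (closure {x. bump n a b x *\<^sub>R c \<noteq> 0})"
    using bounded_cbox bounded_subset by blast
  then show ?thesis
    unfolding test_fun_def using * assms smooth_bump by (auto simp: compact_eq_bounded_closed)
qed

lemma test_fun_bump: "n > 0 \<Longrightarrow> cbox a b \<subseteq> S \<Longrightarrow> test_fun S (bump n a b)"
  using test_fun_bump_scaleR[of n a b S "1::real"] by simp

section \<open>Weak gradients\<close>

lemma smooth_has_derivative:
  assumes "smooth f"
  shows "(f has_derivative (\<lambda>e. \<Sum>j\<in>UNIV. e $ j *\<^sub>R partial j f x)) (at x)"
proof -
  have "f differentiable at x"
    using assms unfolding smooth_def by (metis Ck.simps(2))
  then have d: "(f has_derivative frechet_derivative f (at x)) (at x)"
    by (simp add: frechet_derivative_works)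
  then interpret bounded_linear "frechet_derivative f (at x)"
    by (rule has_derivative_bounded_linear)
  have "frechet_derivative f (at x) e = (\<Sum>j\<in>UNIV. e $ j *\<^sub>R partial j f x)" for e
  proof -
    have "frechet_derivative f (at x) (\<Sum>j\<in>UNIV. e $ j *\<^sub>R axis j 1) = (\<Sum>j\<in>UNIV. e $ j *\<^sub>R partial j f x)"
      by (simp add: sum scaleR partial_def)
    then show ?thesis
      by (simp add: basis_expansion scalar_mult_eq_scaleR[symmetric])
  qed
  then show ?thesis using d by (metis (no_types, lifting) ext)
qed

lemma smooth_continuous_on: "smooth f \<Longrightarrow> continuous_on S f"
  unfolding smooth_def by (metis Ck.simps(1) continuous_on_subset subset_UNIV)

lemma smooth_continuous_on_partial: "smooth f \<Longrightarrow> continuous_on S (partial j f)"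
  unfolding smooth_def by (metis Ck.simps continuous_on_subset subset_UNIV)

lemma partial_eq_0_outside:
  assumes "x \<notin> closure {x. f x \<noteq> 0}"
  shows "partial j f x = 0"
proof -
  have "((\<lambda>x. 0) has_derivative (\<lambda>x. 0)) (at x)" by simp
  then have "(f has_derivative (\<lambda>x. 0)) (at x)"
    by (rule has_derivative_transform_within_open[where s = "- closure {x. f x \<noteq> 0}"])
       (use assms closure_subset[of "{x. f x \<noteq> 0}"] in auto)
  from partial_eqI[OF this] show ?thesis by simp
qed

lemma test_fun_eq_0: "test_fun S \<phi> \<Longrightarrow> x \<notin> closure {x. \<phi> x \<noteq> 0} \<Longrightarrow> \<phi> x = 0"
  using closure_subset[of "{x. \<phi> x \<noteq> 0}"] by auto

lemma test_fun_mono: "test_fun S \<phi> \<Longrightarrow> S \<subseteq> T \<Longrightarrow> test_fun T \<phi>"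
  by (auto simp: test_fun_def)

text \<open>\<open>D\<close> and the complement of \<open>S\<close> are open and cover the space; on
  the first the extension is \<open>g\<close>, on the second it is zero.\<close>

lemma continuous_on_extend_0:
  fixes g :: "'a::t2_space \<Rightarrow> 'b::real_normed_vector"
  assumes "open D" "compact S" "S \<subseteq> D" "continuous_on D g" "\<And>x. x \<in> D \<Longrightarrow> x \<notin> S \<Longrightarrow> g x = 0"
  shows "continuous_on T (\<lambda>x. if x \<in> D then g x else 0)" (is "continuous_on T ?g")
proof -
  have "continuous_on D ?g"
    using assms(4) by (rule continuous_on_eq) auto
  moreover have "continuous_on (- S) ?g"
    using continuous_on_const[of _ 0] by (rule continuous_on_eq) (use assms in auto)
  moreover have "open (- S)" using assms(2) by (simp add: compact_imp_closed open_Compl)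
  ultimately have "continuous_on (D \<union> - S) ?g"
    by (intro continuous_on_open_Un assms)
  moreover have "D \<union> - S = UNIV" using assms(3) by auto
  ultimately show ?thesis by (metis continuous_on_subset subset_UNIV)
qed

section \<open>Integration by parts for compactly supported functions\<close>

lemma integrable_compact_support:
  fixes g :: "'a::euclidean_space \<Rightarrow> 'b::euclidean_space"
  assumes "continuous_on UNIV g" "compact S" "\<And>x. x \<notin> S \<Longrightarrow> g x = 0"
  shows "integrable lborel g"
proof -
  have "integrable lborel (\<lambda>x. indicator S x *\<^sub>R g x)"
    using assms by (intro borel_integrable_compact) (auto intro: continuous_on_subset)
  moreover have "(\<lambda>x. indicator S x *\<^sub>R g x) = g"
    using assms by (auto simp: indicator_def)
  ultimately show ?thesis by simp
qed

text \<open>This moves an integral from the completed measure on \<open>D\<close> to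
  \<open>lborel\<close> on the whole space, where translation invariance can be used.\<close>

lemma
  fixes g :: "'a::euclidean_space \<Rightarrow> 'b::euclidean_space"
  assumes "open D" "compact S" "S \<subseteq> D" "continuous_on D g" "\<And>x. x \<in> D \<Longrightarrow> x \<notin> S \<Longrightarrow> g x = 0"
  shows integrable_on_extend_0: "integrable (lebesgue_on D) g"
    and integral_on_extend_0: "integral\<^sup>L (lebesgue_on D) g = integral\<^sup>L lborel (\<lambda>x. if x \<in> D then g x else 0)"
proof -
  let ?g = "\<lambda>x. if x \<in> D then g x else 0"
  have c: "continuous_on UNIV ?g" by (rule continuous_on_extend_0[OF assms])
  have i: "integrable lborel ?g"
    by (rule integrable_compact_support[OF c assms(2)]) (use assms in auto)
  have eq: "?g = (\<lambda>x. indicator D x *\<^sub>R g x)" by auto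
  have D: "D \<in> sets lebesgue" using assms(1) by (simp add: borel_open)
  show "integrable (lebesgue_on D) g"
    using integrable_completion[of ?g lborel] i c D unfolding eq
    by (subst integrable_restrict_space) (auto intro: borel_measurable_continuous_onI)
  show "integral\<^sup>L (lebesgue_on D) g = integral\<^sup>L lborel (\<lambda>x. if x \<in> D then g x else 0)"
    using D borel_measurable_continuous_onI[OF c] unfolding eq
    by (subst integral_restrict_space) (auto simp: integral_completion)
qed

lemma integral_translate:
  fixes F :: "'a::euclidean_space \<Rightarrow> 'b::euclidean_space"
  assumes "F \<in> borel_measurable borel"
  shows "integral\<^sup>L lborel (\<lambda>x. F (x + e)) = integral\<^sup>L lborel F"
proof -
  have "integral\<^sup>L lborel F = integral\<^sup>L (distr lborel borel ((+) e)) F"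
    by (simp add: lborel_distr_plus)
  also have "\<dots> = integral\<^sup>L lborel (\<lambda>x. F (e + x))"
    using assms by (subst integral_distr) auto
  finally show ?thesis by (simp add: add.commute)
qed

lemma integrable_translate:
  fixes F :: "'a::euclidean_space \<Rightarrow> 'b::euclidean_space"
  assumes "integrable lborel F"
  shows "integrable lborel (\<lambda>x. F (x + e))"
proof -
  have "integrable (distr lborel borel ((+) e)) F"
    using assms by (simp add: lborel_distr_plus)
  then have "integrable lborel (\<lambda>x. F (e + x))"
    using assms by (subst (asm) integrable_distr_eq) auto
  then show ?thesis by (simp add: add.commute)
qed

text \<open>Difference quotients integrate to zero by translation invariance. The mean value
  inequality bounds them uniformly on a compact set, so dominated convergence carries the zero over
  to the derivative.\<close>

lemma integral_derivative_compact_support: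
  fixes F :: "'a::euclidean_space \<Rightarrow> 'b::euclidean_space"
  assumes d: "\<And>x. (F has_derivative DF x) (at x)"
    and c: "continuous_on UNIV (\<lambda>x. DF x e)"
    and S: "compact S" "\<And>x. x \<notin> S \<Longrightarrow> F x = 0" "\<And>x. x \<notin> S \<Longrightarrow> DF x e = 0"
  shows "integral\<^sup>L lborel (\<lambda>x. DF x e) = 0"
proof -
  define q where "q n x = real (Suc n) *\<^sub>R (F (x + (1 / real (Suc n)) *\<^sub>R e) - F x)" for n x
  have cF: "continuous_on UNIV F"
    by (intro continuous_at_imp_continuous_on ballI has_derivative_continuous[OF d])
  have mF: "F \<in> borel_measurable borel"
    using cF by (rule borel_measurable_continuous_onI)
  have iF: "integrable lborel F"
    by (rule integrable_compact_support[OF cF S(1,2)])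
  have line: "((\<lambda>t. F (x + t *\<^sub>R e)) has_derivative (\<lambda>s. s *\<^sub>R DF (x + t *\<^sub>R e) e)) (at t)" for x t
  proof -
    have "((\<lambda>t. x + t *\<^sub>R e) has_derivative (\<lambda>s. s *\<^sub>R e)) (at t)"
      by (auto intro!: derivative_eq_intros)
    from has_derivative_compose[OF this d]
    have "((\<lambda>t. F (x + t *\<^sub>R e)) has_derivative (\<lambda>s. DF (x + t *\<^sub>R e) (s *\<^sub>R e))) (at t)" .
    moreover have "linear (DF (x + t *\<^sub>R e))"
      using has_derivative_linear[OF d] .
    ultimately show ?thesis
      by (simp add: linear_cmul)
  qed
  obtain B where B: "\<And>x. norm (DF x e) \<le> B"
  proof -
    have "bounded ((\<lambda>x. DF x e) ` S)"
      using c S(1) by (intro compact_imp_bounded compact_continuous_image) (auto intro: continuous_on_subset)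
    then obtain B where B: "\<And>x. x \<in> S \<Longrightarrow> norm (DF x e) \<le> B"
      by (auto simp: bounded_iff)
    have "norm (DF x e) \<le> max B 0" for x
      using B[of x] S(3)[of x] by (cases "x \<in> S") auto
    then show ?thesis by (rule that)
  qed
  have B0: "B \<ge> 0" using B[of 0] norm_ge_zero order_trans by blast
  \<comment> \<open>The points from which a step \<open>t *\<^sub>R e\<close> with \<open>t\<close>
    between 0 and 1 can reach \<open>S\<close>; all the difference quotients \<open>q n\<close> are
    supported here.\<close>
  define S' where "S' = (\<lambda>(x, t). x - t *\<^sub>R e) ` (S \<times> {0..1::real})"
  have "compact S'"
    unfolding S'_def using S(1)
    by (intro compact_continuous_image compact_Times) (auto simp: case_prod_unfold intro!: continuous_intros)
  have S': "F (x + t *\<^sub>R e) = 0" if "x \<notin> S'" "t \<in> {0..1}" for x t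
  proof (rule S(2), rule)
    assume "x + t *\<^sub>R e \<in> S"
    then have "(\<lambda>(x, t). x - t *\<^sub>R e) (x + t *\<^sub>R e, t) \<in> S'"
      unfolding S'_def using that by (intro imageI) auto
    then show False using that by simp
  qed
  have qb: "norm (q n x) \<le> B * indicator S' x" for n x
  proof (cases "x \<in> S'")
    case True
    have "norm (F (x + (1 / real (Suc n)) *\<^sub>R e) - F (x + 0 *\<^sub>R e)) \<le> B * norm (1 / real (Suc n) - 0)"
    proof (rule differentiable_bound[of UNIV "\<lambda>t. F (x + t *\<^sub>R e)" "\<lambda>t s. s *\<^sub>R DF (x + t *\<^sub>R e) e"])
      show "onorm (\<lambda>s. s *\<^sub>R DF (x + t *\<^sub>R e) e) \<le> B" for t
        using B by (intro onorm_le) (auto simp: mult.commute[of B] intro!: mult_left_mono)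
    qed (auto simp: line)
    then have "norm (F (x + (1 / real (Suc n)) *\<^sub>R e) - F x) * real (Suc n) \<le> B"
      by (simp add: field_simps)
    then show ?thesis
      using True by (simp add: q_def mult.commute)
  next
    case False
    have "F (x + (1 / real (Suc n)) *\<^sub>R e) = 0" "F (x + 0 *\<^sub>R e) = 0"
      by (rule S'[OF False]; simp)+
    then show ?thesis using False by (simp add: q_def)
  qed
  have "(\<lambda>n. integral\<^sup>L lborel (q n)) \<longlonglongrightarrow> integral\<^sup>L lborel (\<lambda>x. DF x e)"
  proof (rule integral_dominated_convergence)
    show "(\<lambda>x. DF x e) \<in> borel_measurable lborel"
      using c by (simp add: borel_measurable_continuous_onI)
    show "q n \<in> borel_measurable lborel" for n
      unfolding q_def using mF by measurable
    show "integrable lborel (\<lambda>x. B * indicator S' x)"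
      using \<open>compact S'\<close>
      using emeasure_compact_finite[of S']
      by (intro integrable_mult_right integrable_real_indicator) (auto simp: borel_compact)
    show "AE x in lborel. (\<lambda>n. q n x) \<longlonglongrightarrow> DF x e"
    proof (rule AE_I2)
      fix x
      have "((\<lambda>t. F (x + t *\<^sub>R e)) has_vector_derivative DF x e) (at 0)"
        using line[of x 0] by (simp add: has_vector_derivative_def)
      then have "(\<lambda>h. norm (F (x + h *\<^sub>R e) - F x - h *\<^sub>R DF x e) / norm h) \<midarrow>0\<rightarrow> 0"
        by (simp add: has_vector_derivative_def has_derivative_at)
      moreover have eq: "norm (F (x + h *\<^sub>R e) - F x - h *\<^sub>R DF x e) / norm h =
          norm ((F (x + h *\<^sub>R e) - F x) /\<^sub>R h - DF x e)" if "h \<noteq> 0" for h :: real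
      proof -
        have "(F (x + h *\<^sub>R e) - F x) /\<^sub>R h - DF x e = (F (x + h *\<^sub>R e) - F x - h *\<^sub>R DF x e) /\<^sub>R h"
          using that by (simp add: scaleR_diff_right)
        then show ?thesis by (simp add: divide_inverse mult.commute)
      qed
      then have "\<forall>\<^sub>F h in at 0. norm (F (x + h *\<^sub>R e) - F x - h *\<^sub>R DF x e) / norm h =
          norm ((F (x + h *\<^sub>R e) - F x) /\<^sub>R h - DF x e)"
        unfolding eventually_at_filter by (intro always_eventually) blast
      ultimately have "(\<lambda>h. norm ((F (x + h *\<^sub>R e) - F x) /\<^sub>R h - DF x e)) \<midarrow>0\<rightarrow> 0"
        by (rule Lim_transform_eventually)
      then have "((\<lambda>h. (F (x + h *\<^sub>R e) - F x) /\<^sub>R h) \<longlongrightarrow> DF x e) (at 0)"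
        by (rule LIM_zero_cancel[OF tendsto_norm_zero_cancel])
      moreover have "filterlim (\<lambda>n. inverse (real (Suc n))) (at 0) sequentially"
        using LIMSEQ_inverse_real_of_nat by (auto simp: filterlim_at)
      ultimately have "((\<lambda>n. (F (x + inverse (real (Suc n)) *\<^sub>R e) - F x) /\<^sub>R inverse (real (Suc n))) \<longlongrightarrow> DF x e) sequentially"
        by (rule filterlim_compose)
      then show "(\<lambda>n. q n x) \<longlonglongrightarrow> DF x e"
        by (simp add: q_def inverse_eq_divide)
    qed
    show "AE x in lborel. norm (q n x) \<le> B * indicator S' x" for n
      using qb by auto
  qed
  moreover have "integral\<^sup>L lborel (q n) = 0" for n
    unfolding q_def
    by (subst integral_scaleR_right, subst Bochner_Integration.integral_diff)
       (auto simp: integral_translate[OF mF] integrable_translate[OF iF] iF)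
  ultimately show ?thesis
    by (simp add: LIMSEQ_unique)
qed

lemma sum_axis_scaleR: "(\<Sum>i\<in>UNIV. axis j (1::real) $ i *\<^sub>R g i) = g j"
  for j :: 3 and g :: "3 \<Rightarrow> ('b::real_normed_vector)"
  using exhaust_3[of j] by (auto simp: sum_3 axis_def)

text \<open>Column \<open>j\<close> of \<open>J\<close> is the derivative in direction
  \<open>j\<close>. This is the convention of \<open>weak_gradient\<close>, so a classical Jacobian
  serves as a weak gradient without transposition.\<close>

definition c1_on :: "(real^3) set \<Rightarrow> (real^3 \<Rightarrow> complex^3) \<Rightarrow> (real^3 \<Rightarrow> complex^3^3) \<Rightarrow> bool" where
  "c1_on D h J \<longleftrightarrow> continuous_on D J \<and>
     (\<forall>x\<in>D. (h has_derivative (\<lambda>e. \<Sum>j\<in>UNIV. e $ j *\<^sub>R column j (J x))) (at x))"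

lemma continuous_on_column: "continuous_on D J \<Longrightarrow> continuous_on D (\<lambda>x. column j (J x))"
  for J :: "'a::topological_space \<Rightarrow> complex^3^3"
  unfolding column_def by (intro continuous_on_vec_lambda continuous_intros) auto

lemma c1_on_subset: "c1_on D h J \<Longrightarrow> D' \<subseteq> D \<Longrightarrow> c1_on D' h J"
  unfolding c1_on_def using continuous_on_subset by blast

lemma c1_on_continuous: "c1_on D h J \<Longrightarrow> continuous_on D h"
  unfolding c1_on_def by (blast intro: continuous_at_imp_continuous_on has_derivative_continuous)

lemma column_diff: "column j (A - B) = column j A - column j (B :: complex^3^3)"
  by (simp add: column_def vec_eq_iff)

lemma c1_on_diff:
  assumes "c1_on D h J" "c1_on D h' J'"
  shows "c1_on D (\<lambda>x. h x - h' x) (\<lambda>x. J x - J' x)"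
proof -
  have "((\<lambda>x. h x - h' x) has_derivative (\<lambda>e. \<Sum>j\<in>UNIV. e $ j *\<^sub>R column j (J x - J' x))) (at x)" if "x \<in> D" for x
  proof (rule has_derivative_eq_rhs[OF has_derivative_diff])
    show "(h has_derivative (\<lambda>e. \<Sum>j\<in>UNIV. e $ j *\<^sub>R column j (J x))) (at x)"
      "(h' has_derivative (\<lambda>e. \<Sum>j\<in>UNIV. e $ j *\<^sub>R column j (J' x))) (at x)"
      using assms that by (auto simp: c1_on_def)
  qed (simp add: column_diff scaleR_diff_right sum_subtractf)
  then show ?thesis
    using assms by (auto simp: c1_on_def intro!: continuous_on_diff)
qed

lemma c1_on_smooth:
  assumes "smooth f"
  shows "c1_on D f (\<lambda>x. \<chi> i j. partial j f x $ i)"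
proof -
  have "column j (\<chi> i j. partial j f x $ i) = partial j f x" for j x
    by (simp add: column_def vec_eq_iff)
  then show ?thesis
    unfolding c1_on_def using smooth_has_derivative[OF assms] smooth_continuous_on_partial[OF assms]
    by (auto intro!: continuous_on_vec_lambda continuous_on_component)
qed

text \<open>The product of \<open>h\<close> with a test function, extended by zero, is
  differentiable on the whole space and compactly supported, so its partial derivatives integrate to
  zero. The product rule splits this into the two sides of the claim.\<close>

lemma c1_on_weak_gradient:
  assumes "open D" and h: "c1_on D h J"
  shows "weak_gradient D h J"
  unfolding weak_gradient_def
proof (intro allI impI)
  fix \<phi> :: "real^3 \<Rightarrow> real" and j
  assume \<phi>: "test_fun D \<phi>"
  define S where "S = closure {x. \<phi> x \<noteq> 0}"
  have S: "compact S" "S \<subseteq> D" and sm: "smooth \<phi>"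
    using \<phi> by (auto simp: test_fun_def S_def)
  have \<phi>0: "x \<notin> S \<Longrightarrow> \<phi> x = 0" for x
    unfolding S_def by (rule test_fun_eq_0[OF \<phi>])
  have \<phi>'0: "x \<notin> S \<Longrightarrow> partial i \<phi> x = 0" for x i
    unfolding S_def by (rule partial_eq_0_outside)
  note cont = smooth_continuous_on[OF sm] smooth_continuous_on_partial[OF sm]
    c1_on_continuous[OF h] continuous_on_column[OF h[unfolded c1_on_def, THEN conjunct1]]
  define DF where "DF x e = (if x \<in> D then (\<Sum>j\<in>UNIV. e $ j *\<^sub>R (partial j \<phi> x *\<^sub>R h x + \<phi> x *\<^sub>R column j (J x))) else 0)" for x e
  have DFj: "(\<lambda>x. DF x (axis j 1)) = (\<lambda>x. if x \<in> D then partial j \<phi> x *\<^sub>R h x + \<phi> x *\<^sub>R column j (J x) else 0)" for j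
    unfolding DF_def sum_axis_scaleR ..
  have "integral\<^sup>L lborel (\<lambda>x. DF x (axis j 1)) = 0"
  proof (rule integral_derivative_compact_support[where S = S and F = "\<lambda>x. if x \<in> D then \<phi> x *\<^sub>R h x else 0"])
    fix x
    show "((\<lambda>x. if x \<in> D then \<phi> x *\<^sub>R h x else 0) has_derivative DF x) (at x)"
    proof (cases "x \<in> D")
      case True
      have "(h has_derivative (\<lambda>e. \<Sum>j\<in>UNIV. e $ j *\<^sub>R column j (J x))) (at x)"
        using h True unfolding c1_on_def by blast
      from has_derivative_scaleR[OF smooth_has_derivative[OF sm, of x] this]
      have "((\<lambda>x. \<phi> x *\<^sub>R h x) has_derivative DF x) (at x)"
        by (rule has_derivative_eq_rhs)
           (simp add: DF_def True fun_eq_iff sum_3 scaleR_add_right scaleR_add_left mult.commute)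
      then show ?thesis
        by (rule has_derivative_transform_within_open[OF _ \<open>open D\<close> True]) auto
    next
      case False
      then have "x \<in> - S" using S by auto
      have "DF x = (\<lambda>e. 0)"
        using False by (simp add: DF_def fun_eq_iff)
      then have "((\<lambda>x. 0) has_derivative DF x) (at x)"
        by simp
      then show ?thesis
        by (rule has_derivative_transform_within_open[of _ _ _ _ "- S"])
           (use \<open>x \<in> - S\<close> S(1) \<phi>0 in \<open>auto simp: compact_imp_closed\<close>)
    qed
  next
    show "continuous_on UNIV (\<lambda>x. DF x (axis j 1))"
      unfolding DFj
      by (rule continuous_on_extend_0[OF \<open>open D\<close> S]) (auto intro!: continuous_intros cont simp: \<phi>0 \<phi>'0)
  qed (auto simp: S \<phi>0 \<phi>'0 DF_def)
  then have "integral\<^sup>L (lebesgue_on D) (\<lambda>x. partial j \<phi> x *\<^sub>R h x + \<phi> x *\<^sub>R column j (J x)) = 0"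
    unfolding DFj
    by (subst integral_on_extend_0[OF \<open>open D\<close> S]) (auto intro!: continuous_intros cont simp: \<phi>0 \<phi>'0)
  moreover have "integrable (lebesgue_on D) (\<lambda>x. partial j \<phi> x *\<^sub>R h x)"
    "integrable (lebesgue_on D) (\<lambda>x. \<phi> x *\<^sub>R column j (J x))"
    by (rule integrable_on_extend_0[OF \<open>open D\<close> S]; auto intro!: continuous_intros cont simp: \<phi>0 \<phi>'0)+
  ultimately show "integral\<^sup>L (lebesgue_on D) (\<lambda>x. partial j \<phi> x *\<^sub>R h x) =
     - integral\<^sup>L (lebesgue_on D) (\<lambda>x. \<phi> x *\<^sub>R column j (J x))"
    by (simp add: eq_neg_iff_add_eq_0)
qed

text \<open>The positive and the negative part of \<open>G\<close> are densities of two measures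
  that agree on open boxes. These generate the Borel sets and are closed under intersection, so the
  measures agree, and hence the densities almost everywhere.\<close>

lemma AE_eq_0_if_integral_box_eq_0:
  fixes G :: "'a::euclidean_space \<Rightarrow> real"
  assumes i: "integrable lborel G" and 0: "\<And>a b. integral\<^sup>L lborel (\<lambda>x. indicator (box a b) x * G x) = 0"
  shows "AE x in lborel. G x = 0"
proof -
  let ?p = "\<lambda>x. max 0 (G x)" and ?n = "\<lambda>x. max 0 (- G x)"
  have [measurable]: "G \<in> borel_measurable borel" using i by auto
  have ip: "integrable lborel (\<lambda>x. indicator A x * ?p x)" "integrable lborel (\<lambda>x. indicator A x * ?n x)"
    if "A \<in> sets borel" for A
    using that i
    by (auto intro!: Bochner_Integration.integrable_bound[OF i] AE_I2 split: split_indicator)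
  have "density lborel (\<lambda>x. ennreal (?p x)) = density lborel (\<lambda>x. ennreal (?n x))"
  proof (rule measure_eqI_generator_eq)
    let ?E = "range (\<lambda>(a, b). box a b::'a set)"
    let ?A = "\<lambda>n::nat. box (- (real n *\<^sub>R One)) (real n *\<^sub>R One) :: 'a set"
    show "Int_stable ?E"
      by (auto simp: Int_stable_def box_Int_box)
    show "?E \<subseteq> Pow UNIV" "sets (density lborel (\<lambda>x. ennreal (?p x))) = sigma_sets UNIV ?E"
      "sets (density lborel (\<lambda>x. ennreal (?n x))) = sigma_sets UNIV ?E"
      by (simp_all add: borel_eq_box)
    show "range ?A \<subseteq> ?E" "(\<Union>i. ?A i) = UNIV"
      unfolding UN_box_eq_UNIV by auto
    have em: "emeasure (density lborel (\<lambda>x. ennreal (?p x))) A = ennreal (integral\<^sup>L lborel (\<lambda>x. indicator A x * ?p x))"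
      "emeasure (density lborel (\<lambda>x. ennreal (?n x))) A = ennreal (integral\<^sup>L lborel (\<lambda>x. indicator A x * ?n x))"
      if A: "A \<in> sets borel" for A
      using A ip[OF A]
      by (auto simp: emeasure_density nn_integral_eq_integral[symmetric] intro!: nn_integral_cong split: split_indicator)
    show "emeasure (density lborel (\<lambda>x. ennreal (?p x))) (?A i) \<noteq> \<infinity>" for i
      by (subst em) auto
    fix X assume "X \<in> ?E"
    then obtain a b where X: "X = box a b" by auto
    have "integral\<^sup>L lborel (\<lambda>x. indicator X x * ?p x) - integral\<^sup>L lborel (\<lambda>x. indicator X x * ?n x)
       = integral\<^sup>L lborel (\<lambda>x. indicator X x * ?p x - indicator X x * ?n x)"
      using ip[of X] X by (subst Bochner_Integration.integral_diff) auto
    also have "(\<lambda>x. indicator X x * ?p x - indicator X x * ?n x) = (\<lambda>x. indicator X x * G x)"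
      by (rule ext) (auto simp: max_def split: split_indicator)
    finally show "emeasure (density lborel (\<lambda>x. ennreal (?p x))) X = emeasure (density lborel (\<lambda>x. ennreal (?n x))) X"
      using 0[of a b] X by (simp add: em)
  qed
  then have "AE x in lborel. ennreal (?p x) = ennreal (?n x)"
    by (intro sigma_finite_measure.density_unique[OF sigma_finite_lborel]) auto
  then show ?thesis
    by eventually_elim (auto simp: max_def split: if_splits)
qed

lemma integral_lebesgue_on:
  "D \<in> sets lebesgue \<Longrightarrow> integral\<^sup>L (lebesgue_on D) f = integral\<^sup>L lebesgue (\<lambda>x. indicator D x *\<^sub>R f x)"
  for f :: "'a::euclidean_space \<Rightarrow> 'b::euclidean_space"
  by (subst integral_restrict_space) auto

lemma integrable_lebesgue_on:
  "D \<in> sets lebesgue \<Longrightarrow> integrable (lebesgue_on D) f \<longleftrightarrow> integrable lebesgue (\<lambda>x. indicator D x *\<^sub>R f x)"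
  for f :: "'a::euclidean_space \<Rightarrow> 'b::euclidean_space"
  by (subst integrable_restrict_space) auto

lemma open_sets_lebesgue: "open D \<Longrightarrow> D \<in> sets lebesgue"
  by (simp add: borel_open)

lemma bump_measurable [measurable]: "bump n a b \<in> borel_measurable borel"
  using smooth_continuous_on[OF smooth_bump[of n a b "1::real"], of UNIV]
  by (simp add: borel_measurable_continuous_onI)

text \<open>The fundamental lemma of the calculus of variations. Bumps tend boundedly to indicators
  of boxes, so \<open>g\<close> integrates to zero over every open box whose closed box lies in
  \<open>D\<close>. On each closed box in \<open>D\<close> the criterion
  \<open>AE_eq_0_if_integral_box_eq_0\<close> then applies, and countably many of them exhaust
  \<open>D\<close>.\<close>

lemma AE_eq_0_if_test_integrals_eq_0:
  fixes g :: "real^3 \<Rightarrow> real"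
  assumes D: "open D" and i: "integrable (lebesgue_on D) g"
    and 0: "\<And>\<phi>. test_fun D \<phi> \<Longrightarrow> integral\<^sup>L (lebesgue_on D) (\<lambda>x. \<phi> x * g x) = 0"
  shows "AE x in lebesgue_on D. g x = 0"
proof -
  note DL = open_sets_lebesgue[OF D]
  let ?h = "\<lambda>x. indicator D x * g x"
  have ih: "integrable lebesgue ?h"
    using i DL by (simp add: integrable_lebesgue_on)
  \<comment> \<open>\<open>g\<close> is measurable only for the completed measure; a Borel
    representative is needed to work with \<open>lborel\<close>.\<close>
  obtain g' where g': "g' \<in> borel_measurable lborel" "AE x in lborel. ?h x = g' x"
    using completion_ex_borel_measurable_real[of ?h lborel] ih by auto
  then have aeq: "AE x in lebesgue. ?h x = g' x" by (simp add: AE_completion)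
  have g'm: "g' \<in> borel_measurable lebesgue"
    using g'(1) by (simp add: measurable_completion)
  have ig': "integrable lborel g'"
  proof -
    have "integrable lebesgue g'"
      using ih by (rule Bochner_Integration.integrable_cong_AE_imp[OF _ g'm]) (use aeq in auto)
    then show ?thesis using g'(1) by (simp add: integrable_completion)
  qed
  have [measurable]: "g' \<in> borel_measurable borel" using g'(1) by simp
  have box0: "integral\<^sup>L lborel (\<lambda>x. indicator (box a b) x * g' x) = 0" if sub: "cbox a b \<subseteq> D" for a b
  proof -
    have z: "integral\<^sup>L lborel (\<lambda>x. bump (real (Suc n)) a b x * g' x) = 0" for n
    proof -
      have "0 = integral\<^sup>L (lebesgue_on D) (\<lambda>x. bump (real (Suc n)) a b x * g x)"
        by (rule 0[symmetric], rule test_fun_bump) (use sub in auto)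
      also have "\<dots> = integral\<^sup>L lebesgue (\<lambda>x. bump (real (Suc n)) a b x * ?h x)"
        using DL by (simp add: integral_lebesgue_on mult_ac)
      also have "\<dots> = integral\<^sup>L lebesgue (\<lambda>x. bump (real (Suc n)) a b x * g' x)"
      proof (rule integral_cong_AE)
        have b: "bump (real (Suc n)) a b \<in> borel_measurable lebesgue"
          by (intro measurable_completion) simp
        show "(\<lambda>x. bump (real (Suc n)) a b x * ?h x) \<in> borel_measurable lebesgue"
          using borel_measurable_times[OF b borel_measurable_integrable[OF ih]] .
        show "(\<lambda>x. bump (real (Suc n)) a b x * g' x) \<in> borel_measurable lebesgue"
          using borel_measurable_times[OF b g'm] .
        show "AE x in lebesgue. bump (real (Suc n)) a b x * ?h x = bump (real (Suc n)) a b x * g' x"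
          using aeq by eventually_elim simp
      qed
      also have "\<dots> = integral\<^sup>L lborel (\<lambda>x. bump (real (Suc n)) a b x * g' x)"
        by (rule integral_completion) auto
      finally show ?thesis by simp
    qed
    have "(\<lambda>n. integral\<^sup>L lborel (\<lambda>x. bump (real (Suc n)) a b x * g' x))
        \<longlonglongrightarrow> integral\<^sup>L lborel (\<lambda>x. indicator (box a b) x * g' x)"
    proof (rule integral_dominated_convergence)
      show "integrable lborel (\<lambda>x. norm (g' x))" using ig' by simp
      show "AE x in lborel. (\<lambda>n. bump (real (Suc n)) a b x * g' x) \<longlonglongrightarrow> indicator (box a b) x * g' x"
        by (intro AE_I2 tendsto_intros bump_tendsto)
      show "AE x in lborel. norm (bump (real (Suc n)) a b x * g' x) \<le> norm (g' x)" for n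
        using bump_bounds by (auto simp: abs_mult intro!: mult_left_le_one_le)
    qed auto
    then show ?thesis unfolding z by (simp add: LIMSEQ_const_iff)
  qed
  have local: "AE x in lborel. x \<in> cbox a b \<longrightarrow> g' x = 0" if sub: "cbox a b \<subseteq> D" for a b
  proof -
    have "AE x in lborel. indicator (box a b) x * g' x = 0"
    proof (rule AE_eq_0_if_integral_box_eq_0)
      show "integrable lborel (\<lambda>x. indicator (box a b) x * g' x)"
        by (rule Bochner_Integration.integrable_bound[OF ig']) (auto split: split_indicator)
      fix c d
      \<comment> \<open>Cutting \<open>g'\<close> off to \<open>box a b\<close> keeps all box
        integrals zero, because two boxes intersect in a box, whose closure is still inside
        \<open>cbox a b\<close>.\<close>
      obtain a' b' where ab: "box c d \<inter> box a b = box a' b'"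
        using that[OF box_Int_box] .
      have "integral\<^sup>L lborel (\<lambda>x. indicator (box a' b') x * g' x) = 0"
      proof (cases "box a' b' = {}")
        case False
        have "cbox a' b' = closure (box a' b')" using False by (simp add: closure_box)
        also have "\<dots> \<subseteq> closure (box a b)" using ab by (intro closure_mono) auto
        also have "\<dots> \<subseteq> cbox a b" by (rule closure_minimal) (auto simp: box_subset_cbox)
        finally show ?thesis using sub by (intro box0) auto
      qed simp
      moreover have "(\<lambda>x. indicator (box c d) x * (indicator (box a b) x * g' x)) = (\<lambda>x. indicator (box a' b') x * g' x)"
        unfolding ab[symmetric] by (auto split: split_indicator)
      ultimately show "integral\<^sup>L lborel (\<lambda>x. indicator (box c d) x * (indicator (box a b) x * g' x)) = 0"
        by simp
    qed
    \<comment> \<open>So far only the open box is controlled; its boundary is a null set.\<close>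
    moreover have "AE x in lborel. x \<notin> cbox a b - box a b"
    proof -
      have "cbox a b - box a b \<in> null_sets lebesgue"
        using negligible_frontier_interval negligible_iff_null_sets by blast
      then have "AE x in lebesgue. x \<notin> cbox a b - box a b" by (rule AE_not_in)
      then show ?thesis by (simp add: AE_completion_iff)
    qed
    ultimately show ?thesis by eventually_elim (auto split: split_indicator_asm)
  qed
  obtain \<D> where \<D>: "countable \<D>" "\<D> \<subseteq> Pow D" "\<And>X. X \<in> \<D> \<Longrightarrow> \<exists>a b. X = cbox a b" "\<Union>\<D> = D"
    using open_countable_Union_open_cbox[OF D] by metis
  have "AE x in lborel. \<forall>X\<in>\<D>. x \<in> X \<longrightarrow> g' x = 0"
    unfolding AE_ball_countable[OF \<D>(1)]
  proof
    fix X assume "X \<in> \<D>"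
    then show "AE x in lborel. x \<in> X \<longrightarrow> g' x = 0"
      using \<D>(2,3) local by blast
  qed
  then have "AE x in lborel. x \<in> D \<longrightarrow> g x = 0"
    using g'(2) by eventually_elim (use \<D>(4) in \<open>auto split: split_indicator_asm\<close>)
  then have "AE x in lebesgue. x \<in> D \<longrightarrow> g x = 0"
    by (rule AE_completion)
  then show ?thesis
    using DL by (simp add: AE_restrict_space_iff)
qed

lemma AE_eq_0_if_vector_test_integrals_eq_0:
  fixes g :: "real^3 \<Rightarrow> 'b::euclidean_space"
  assumes D: "open D" and i: "integrable (lebesgue_on D) g"
    and 0: "\<And>\<phi>. test_fun D \<phi> \<Longrightarrow> integral\<^sup>L (lebesgue_on D) (\<lambda>x. \<phi> x *\<^sub>R g x) = 0"
    and i2: "\<And>\<phi>. test_fun D \<phi> \<Longrightarrow> integrable (lebesgue_on D) (\<lambda>x. \<phi> x *\<^sub>R g x)"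
  shows "AE x in lebesgue_on D. g x = 0"
proof -
  have "AE x in lebesgue_on D. g x \<bullet> b = 0" if "b \<in> Basis" for b
  proof (rule AE_eq_0_if_test_integrals_eq_0[OF D])
    show "integrable (lebesgue_on D) (\<lambda>x. g x \<bullet> b)" using i by simp
    fix \<phi> :: "real^3 \<Rightarrow> real" assume \<phi>: "test_fun D \<phi>"
    have "integral\<^sup>L (lebesgue_on D) (\<lambda>x. (\<phi> x *\<^sub>R g x) \<bullet> b) = 0"
      using i2[OF \<phi>] 0[OF \<phi>] by (subst integral_inner_left) auto
    then show "integral\<^sup>L (lebesgue_on D) (\<lambda>x. \<phi> x * (g x \<bullet> b)) = 0" by simp
  qed
  then have "AE x in lebesgue_on D. \<forall>b\<in>Basis. g x \<bullet> b = 0"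
    by (intro AE_finite_allI) auto
  then show ?thesis
    by eventually_elim (simp add: euclidean_all_zero_iff)
qed

lemma test_fun_bounded:
  fixes \<phi> :: "real^3 \<Rightarrow> 'b::real_normed_vector"
  assumes "test_fun S \<phi>"
  obtains B where "B > 0" "\<And>x. norm (\<phi> x) \<le> B" "\<And>x j. norm (partial j \<phi> x) \<le> B"
proof -
  have b: "\<exists>B. \<forall>x. norm (f x) \<le> B" if "continuous_on UNIV f" "\<And>x. x \<notin> closure {x. \<phi> x \<noteq> 0} \<Longrightarrow> f x = 0"
    for f :: "real^3 \<Rightarrow> 'b"
  proof -
    have "bounded (f ` closure {x. \<phi> x \<noteq> 0})"
      using assms that(1) unfolding test_fun_def
      by (intro compact_imp_bounded compact_continuous_image) (auto intro: continuous_on_subset)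
    then obtain B where B: "\<And>x. x \<in> closure {x. \<phi> x \<noteq> 0} \<Longrightarrow> norm (f x) \<le> B"
      unfolding bounded_iff by blast
    have "norm (f x) \<le> max B 0" for x
      by (cases "x \<in> closure {x. \<phi> x \<noteq> 0}") (use B[of x] that(2)[of x] in auto)
    then show ?thesis by blast
  qed
  have sm: "smooth \<phi>" using assms by (simp add: test_fun_def)
  obtain B0 where B0: "\<And>x. norm (\<phi> x) \<le> B0"
    using b[of \<phi>] smooth_continuous_on[OF sm] test_fun_eq_0[OF assms] by blast
  have "\<forall>j. \<exists>B. \<forall>x. norm (partial j \<phi> x) \<le> B"
    using b smooth_continuous_on_partial[OF sm] partial_eq_0_outside by blast
  then obtain B1 where B1: "\<And>j x. norm (partial j \<phi> x) \<le> B1 j" by metis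
  define B where "B = 1 + \<bar>B0\<bar> + (\<Sum>j\<in>UNIV. \<bar>B1 j\<bar>)"
  have "0 \<le> (\<Sum>j\<in>UNIV. \<bar>B1 j\<bar>)" by (intro sum_nonneg) auto
  moreover have "\<bar>B1 j\<bar> \<le> (\<Sum>j\<in>UNIV. \<bar>B1 j\<bar>)" for j by (intro member_le_sum) auto
  ultimately have "0 < B" "B0 \<le> B" "B1 j \<le> B" for j
    unfolding B_def by (smt (verit))+
  then show ?thesis
    using B0 B1 order_trans by (intro that[of B]) blast+
qed

lemma integrable_bounded_scaleR:
  fixes f :: "'a \<Rightarrow> 'b::{banach, second_countable_topology}"
  assumes "integrable M f" "\<phi> \<in> borel_measurable M" "\<And>x. \<bar>\<phi> x\<bar> \<le> B"
  shows "integrable M (\<lambda>x. \<phi> x *\<^sub>R f x)"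
proof (rule Bochner_Integration.integrable_bound)
  show "integrable M (\<lambda>x. B * norm (f x))" using assms by simp
  show "AE x in M. norm (\<phi> x *\<^sub>R f x) \<le> norm (B * norm (f x))"
    using assms(3) by (intro AE_I2) (simp add: abs_mult mult_right_mono order_trans[OF _ abs_ge_self])
qed (use assms in auto)

lemma continuous_measurable_lebesgue_on:
  assumes "continuous_on UNIV f"
  shows "f \<in> borel_measurable (lebesgue_on D)"
proof -
  have "f \<in> borel_measurable lborel"
    using assms by (simp add: borel_measurable_continuous_onI)
  then show ?thesis
    by (intro measurable_restrict_space1 measurable_completion)
qed

lemma test_fun_integrable:
  fixes \<phi> :: "real^3 \<Rightarrow> real" and f :: "real^3 \<Rightarrow> 'b::{banach, second_countable_topology}"
  assumes \<phi>: "test_fun S \<phi>" and f: "integrable (lebesgue_on D) f"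
  shows "integrable (lebesgue_on D) (\<lambda>x. \<phi> x *\<^sub>R f x)"
    "integrable (lebesgue_on D) (\<lambda>x. partial j \<phi> x *\<^sub>R f x)"
proof -
  obtain B where B: "\<And>x. norm (\<phi> x) \<le> B" "\<And>x j. norm (partial j \<phi> x) \<le> B"
    using test_fun_bounded[OF \<phi>] by metis
  have sm: "smooth \<phi>" using \<phi> by (simp add: test_fun_def)
  show "integrable (lebesgue_on D) (\<lambda>x. \<phi> x *\<^sub>R f x)"
    "integrable (lebesgue_on D) (\<lambda>x. partial j \<phi> x *\<^sub>R f x)"
    using B smooth_continuous_on[OF sm] smooth_continuous_on_partial[OF sm]
    by (auto intro!: integrable_bounded_scaleR[OF f] continuous_measurable_lebesgue_on)
qed

section \<open>Square-integrable functions\<close>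

lemma finite_measure_bounded: "bounded D \<Longrightarrow> D \<in> sets lebesgue \<Longrightarrow> finite_measure (lebesgue_on D)"
  by (intro finite_measure_lebesgue_on bounded_set_imp_lmeasurable)

text \<open>On a finite measure space 1 is integrable, and t <= 1 + t^2 for every real t.\<close>

lemma L2_integrable: "finite_measure M \<Longrightarrow> L2 M f \<Longrightarrow> integrable M f"
proof (rule Bochner_Integration.integrable_bound[of M "\<lambda>x. 1 + (norm (f x))\<^sup>2"])
  assume "finite_measure M" "L2 M f"
  then interpret finite_measure M by simp
  show "integrable M (\<lambda>x. 1 + (norm (f x))\<^sup>2)" using \<open>L2 M f\<close> by (auto simp: L2_def)
  have "norm a \<le> 1 + (norm a)\<^sup>2" for a :: 'b
    using sum_power2_ge_zero[of "norm a - 1" 0] norm_ge_zero[of a]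
    by (simp add: power2_eq_square algebra_simps) (smt (verit) mult_nonneg_nonneg norm_ge_zero mult_left_mono mult_le_cancel_left1 mult_cancel_right1)
  then show "AE x in M. norm (f x) \<le> norm (1 + (norm (f x))\<^sup>2)"
    by (intro AE_I2) (auto intro: order_trans)
qed (auto simp: L2_def)

lemma norm_diff_sq_le: "(norm (a - b))\<^sup>2 \<le> 2 * (norm a)\<^sup>2 + 2 * (norm b)\<^sup>2"
  for a b :: "'a::real_normed_vector"
proof -
  have "(norm (a - b))\<^sup>2 \<le> (norm a + norm b)\<^sup>2"
    by (intro power_mono norm_triangle_ineq4) auto
  also have "\<dots> \<le> 2 * (norm a)\<^sup>2 + 2 * (norm b)\<^sup>2"
    using sum_squares_bound[of "norm a" "norm b"] by (simp add: power2_sum)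
  finally show ?thesis .
qed

lemma L2_diff: "L2 M f \<Longrightarrow> L2 M g \<Longrightarrow> L2 M (\<lambda>x. f x - g x)"
  unfolding L2_def
proof safe
  assume *: "integrable M (\<lambda>x. (norm (f x))\<^sup>2)" "integrable M (\<lambda>x. (norm (g x))\<^sup>2)"
    "f \<in> borel_measurable M" "g \<in> borel_measurable M"
  have "integrable M (\<lambda>x. 2 * (norm (f x))\<^sup>2 + 2 * (norm (g x))\<^sup>2)"
    using * by simp
  then show "integrable M (\<lambda>x. (norm (f x - g x))\<^sup>2)"
    by (rule Bochner_Integration.integrable_bound) (use * norm_diff_sq_le in auto)
qed auto

lemma L2_diff_integral_le:
  assumes "L2 M f" "L2 M g"
  shows "integral\<^sup>L M (\<lambda>x. (norm (f x - g x))\<^sup>2) \<le> 2 * integral\<^sup>L M (\<lambda>x. (norm (f x))\<^sup>2) + 2 * integral\<^sup>L M (\<lambda>x. (norm (g x))\<^sup>2)"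
proof -
  have "integral\<^sup>L M (\<lambda>x. (norm (f x - g x))\<^sup>2) \<le> integral\<^sup>L M (\<lambda>x. 2 * (norm (f x))\<^sup>2 + 2 * (norm (g x))\<^sup>2)"
    using assms L2_diff[OF assms] by (intro integral_mono norm_diff_sq_le) (auto simp: L2_def)
  then show ?thesis using assms by (auto simp: L2_def)
qed

lemma L2_bounded:
  assumes "finite_measure M" "f \<in> borel_measurable M" "\<And>x. x \<in> space M \<Longrightarrow> norm (f x) \<le> B"
  shows "L2 M f"
proof -
  interpret finite_measure M by fact
  have "AE x in M. norm ((norm (f x))\<^sup>2) \<le> B\<^sup>2"
    using assms(3) by (intro AE_I2) (auto intro!: power_mono)
  then have "integrable M (\<lambda>x. (norm (f x))\<^sup>2)"
    using assms(2) by (intro integrable_const_bound) auto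
  then show ?thesis using assms(2) by (simp add: L2_def)
qed

lemma L2_restrict_space:
  assumes "L2 M f" "A \<inter> space M \<in> sets M"
  shows "L2 (restrict_space M A) f"
proof -
  have "integrable M (\<lambda>x. indicator (A \<inter> space M) x *\<^sub>R (norm (f x))\<^sup>2)"
    using assms by (intro integrable_mult_indicator) (auto simp: L2_def)
  also have "?this \<longleftrightarrow> integrable M (\<lambda>x. indicator A x *\<^sub>R (norm (f x))\<^sup>2)"
    by (intro Bochner_Integration.integrable_cong) (auto split: split_indicator)
  finally show ?thesis
    using assms unfolding L2_def
    by (auto intro!: measurable_restrict_space1 simp: integrable_restrict_space)
qed

lemma L2_lebesgue_on_subset:
  assumes "L2 (lebesgue_on D) f" "D' \<subseteq> D" "D' \<in> sets lebesgue" "D \<in> sets lebesgue"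
  shows "L2 (lebesgue_on D') f"
proof -
  have "D' \<inter> space (lebesgue_on D) \<in> sets (lebesgue_on D)"
    using assms(2,3) by (auto simp: sets_restrict_space Int_absorb2 image_iff intro!: bexI[of _ D'])
  with assms(1) have "L2 (restrict_space (lebesgue_on D) D') f"
    by (rule L2_restrict_space)
  moreover have "restrict_space (lebesgue_on D) D' = lebesgue_on D'"
    using assms by (subst restrict_restrict_space) (auto simp: Int_absorb1)
  ultimately show ?thesis by simp
qed

text \<open>Integrability has to come first, from |a b| <= a^2 + b^2; only then can the inequality
  for nonnegative integrals be read as one between real numbers.\<close>

lemma Cauchy_Schwarz_integral:
  fixes f g :: "'a \<Rightarrow> real"
  assumes f: "integrable M (\<lambda>x. (f x)\<^sup>2)" "f \<in> borel_measurable M"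
    and g: "integrable M (\<lambda>x. (g x)\<^sup>2)" "g \<in> borel_measurable M"
  shows "integrable M (\<lambda>x. f x * g x)"
    and "integral\<^sup>L M (\<lambda>x. \<bar>f x * g x\<bar>) \<le> sqrt (integral\<^sup>L M (\<lambda>x. (f x)\<^sup>2)) * sqrt (integral\<^sup>L M (\<lambda>x. (g x)\<^sup>2))"
proof -
  have bound: "\<bar>a * b\<bar> \<le> a\<^sup>2 + b\<^sup>2" for a b :: real
  proof -
    have "0 \<le> \<bar>a\<bar> * \<bar>b\<bar>" "2 * (\<bar>a\<bar> * \<bar>b\<bar>) \<le> a\<^sup>2 + b\<^sup>2"
      using sum_squares_bound[of "\<bar>a\<bar>" "\<bar>b\<bar>"] by (simp_all add: mult.assoc)
    then show ?thesis unfolding abs_mult by linarith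
  qed
  show i: "integrable M (\<lambda>x. f x * g x)"
    by (rule Bochner_Integration.integrable_bound[of M "\<lambda>x. (f x)\<^sup>2 + (g x)\<^sup>2"])
       (use f g bound in \<open>auto intro: order_trans\<close>)
  have "ennreal ((integral\<^sup>L M (\<lambda>x. \<bar>f x * g x\<bar>))\<^sup>2) = (\<integral>\<^sup>+x. ennreal \<bar>f x\<bar> * ennreal \<bar>g x\<bar> \<partial>M)\<^sup>2"
    using nn_integral_eq_integral[OF integrable_abs[OF i]]
    by (subst ennreal_power[symmetric]) (auto simp: abs_mult ennreal_mult)
  also have "\<dots> \<le> (\<integral>\<^sup>+x. (ennreal \<bar>f x\<bar>)\<^sup>2 \<partial>M) * (\<integral>\<^sup>+x. (ennreal \<bar>g x\<bar>)\<^sup>2 \<partial>M)"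
    using f g by (intro Cauchy_Schwarz_nn_integral) auto
  also have "\<dots> = ennreal (integral\<^sup>L M (\<lambda>x. (f x)\<^sup>2) * integral\<^sup>L M (\<lambda>x. (g x)\<^sup>2))"
    using f g by (simp add: ennreal_power nn_integral_eq_integral ennreal_mult)
  finally have "(integral\<^sup>L M (\<lambda>x. \<bar>f x * g x\<bar>))\<^sup>2 \<le> integral\<^sup>L M (\<lambda>x. (f x)\<^sup>2) * integral\<^sup>L M (\<lambda>x. (g x)\<^sup>2)"
    by (subst (asm) ennreal_le_iff) (auto intro!: mult_nonneg_nonneg)
  then have "integral\<^sup>L M (\<lambda>x. \<bar>f x * g x\<bar>) \<le> sqrt (integral\<^sup>L M (\<lambda>x. (f x)\<^sup>2) * integral\<^sup>L M (\<lambda>x. (g x)\<^sup>2))"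
    by (rule real_le_rsqrt)
  then show "integral\<^sup>L M (\<lambda>x. \<bar>f x * g x\<bar>) \<le> sqrt (integral\<^sup>L M (\<lambda>x. (f x)\<^sup>2)) * sqrt (integral\<^sup>L M (\<lambda>x. (g x)\<^sup>2))"
    by (simp add: real_sqrt_mult)
qed

lemma integral_norm_le_L2_norm:
  assumes "finite_measure M" "L2 M f"
  shows "integral\<^sup>L M (\<lambda>x. norm (f x)) \<le> sqrt (measure M (space M)) * L2_norm M f"
proof -
  interpret finite_measure M by fact
  have "integral\<^sup>L M (\<lambda>x. \<bar>1 * norm (f x)\<bar>) \<le> sqrt (integral\<^sup>L M (\<lambda>x. 1\<^sup>2)) * sqrt (integral\<^sup>L M (\<lambda>x. (norm (f x))\<^sup>2))"
    using assms by (intro Cauchy_Schwarz_integral) (auto simp: L2_def)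
  then show ?thesis by (simp add: L2_norm_def)
qed

lemma L2_norm_sq: "(L2_norm M f)\<^sup>2 = integral\<^sup>L M (\<lambda>x. (norm (f x))\<^sup>2)"
  unfolding L2_norm_def by (rule real_sqrt_pow2) (auto intro!: integral_nonneg_AE)

lemma L2_norm_nonneg: "L2_norm M f \<ge> 0"
  unfolding L2_norm_def by (auto intro!: integral_nonneg_AE)

lemma L2_norm_diff_sq_le:
  "L2 M f \<Longrightarrow> L2 M g \<Longrightarrow> (L2_norm M (\<lambda>x. f x - g x))\<^sup>2 \<le> 2 * (L2_norm M f)\<^sup>2 + 2 * (L2_norm M g)\<^sup>2"
  unfolding L2_norm_sq by (rule L2_diff_integral_le)

lemma L2_norm_cong_AE:
  assumes "AE x in M. f x = g x" "f \<in> borel_measurable M" "g \<in> borel_measurable M"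
  shows "L2_norm M f = L2_norm M g"
  unfolding L2_norm_def using assms by (auto intro!: arg_cong[of _ _ sqrt] integral_cong_AE)

lemma L2_add: "L2 M f \<Longrightarrow> L2 M g \<Longrightarrow> L2 M (\<lambda>x. f x + g x)"
  using L2_diff[of M f "\<lambda>x. - g x"] by (simp add: L2_def)

lemma L2_norm_add_sq_le:
  "L2 M f \<Longrightarrow> L2 M g \<Longrightarrow> (L2_norm M (\<lambda>x. f x + g x))\<^sup>2 \<le> 2 * (L2_norm M f)\<^sup>2 + 2 * (L2_norm M g)\<^sup>2"
  using L2_norm_diff_sq_le[of M f "\<lambda>x. - g x"] by (simp add: L2_def L2_norm_def)

lemma L2_continuous_bounded:
  fixes f :: "'a::euclidean_space \<Rightarrow> 'b::euclidean_space"
  assumes "D \<in> sets lebesgue" "bounded D" "continuous_on D f" "bounded (f ` D)"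
  shows "L2 (lebesgue_on D) f"
proof -
  obtain B where B: "\<And>x. x \<in> D \<Longrightarrow> norm (f x) \<le> B"
    using assms(4) by (auto simp: bounded_iff)
  show ?thesis
    by (rule L2_bounded[OF finite_measure_bounded[OF assms(2,1)]])
       (use assms(1,3) B in \<open>auto intro: continuous_imp_measurable_on_sets_lebesgue\<close>)
qed

lemma bounded_continuous_image_bounded:
  fixes f :: "'a::heine_borel \<Rightarrow> 'b::metric_space"
  assumes "bounded D" "continuous_on UNIV f"
  shows "bounded (f ` D)"
proof -
  have "compact (f ` closure D)"
    using assms by (intro compact_continuous_image) (auto intro: continuous_on_subset)
  then show ?thesis
    using closure_subset[of D] by (meson bounded_subset compact_imp_bounded image_mono)
qed

lemma L2_continuous:
  fixes f :: "'a::euclidean_space \<Rightarrow> 'b::euclidean_space"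
  assumes "D \<in> sets lebesgue" "bounded D" "continuous_on UNIV f"
  shows "L2 (lebesgue_on D) f"
  using assms bounded_continuous_image_bounded[OF assms(2,3)]
  by (intro L2_continuous_bounded) (auto intro: continuous_on_subset)

lemma integrable_column:
  "integrable M G \<Longrightarrow> integrable M (\<lambda>x. column j (G x))" for G :: "'a \<Rightarrow> complex^3^3"
proof -
  have "bounded_linear (column j :: complex^3^3 \<Rightarrow> complex^3)"
    by (rule linear_conv_bounded_linear[THEN iffD1], rule linearI)
       (auto simp: column_def vec_eq_iff)
  then show "integrable M G \<Longrightarrow> integrable M (\<lambda>x. column j (G x))"
    by (rule integrable_bounded_linear)
qed

lemma column_eqI: "(\<And>j. column j A = column j B) \<Longrightarrow> A = B"
  by (auto simp: column_def vec_eq_iff)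

section \<open>Weak gradients and H1 functions on a bounded open set\<close>

context
  fixes D :: "(real^3) set"
  assumes D: "open D" "bounded D"
begin

lemma finite_measure_D: "finite_measure (lebesgue_on D)"
  using D by (intro finite_measure_bounded open_sets_lebesgue)

text \<open>\<open>wgrad\<close> is an arbitrary choice among weak gradients, and each later
  identification of it with a concrete matrix field rests on this lemma. The columns of the
  difference integrate to zero against every test function.\<close>

lemma weak_gradient_unique:
  assumes "L2 (lebesgue_on D) G" "weak_gradient D u G" "L2 (lebesgue_on D) H" "weak_gradient D u H"
  shows "AE x in lebesgue_on D. G x = H x"
proof -
  note i = L2_integrable[OF finite_measure_D assms(1)] L2_integrable[OF finite_measure_D assms(3)]
  have "AE x in lebesgue_on D. column j (G x) - column j (H x) = 0" for j
  proof (rule AE_eq_0_if_vector_test_integrals_eq_0[OF D(1)])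
    show "integrable (lebesgue_on D) (\<lambda>x. column j (G x) - column j (H x))"
      using i by (intro Bochner_Integration.integrable_diff integrable_column)
    fix \<phi> :: "real^3 \<Rightarrow> real" assume \<phi>: "test_fun D \<phi>"
    have j: "integrable (lebesgue_on D) (\<lambda>x. \<phi> x *\<^sub>R column j (G x))"
      "integrable (lebesgue_on D) (\<lambda>x. \<phi> x *\<^sub>R column j (H x))"
      using i by (auto intro!: test_fun_integrable[OF \<phi>] integrable_column)
    then show "integrable (lebesgue_on D) (\<lambda>x. \<phi> x *\<^sub>R (column j (G x) - column j (H x)))"
      by (simp add: scaleR_diff_right)
    have "integral\<^sup>L (lebesgue_on D) (\<lambda>x. \<phi> x *\<^sub>R column j (G x)) = integral\<^sup>L (lebesgue_on D) (\<lambda>x. \<phi> x *\<^sub>R column j (H x))"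
    proof -
      have "- integral\<^sup>L (lebesgue_on D) (\<lambda>x. \<phi> x *\<^sub>R column j (G x)) = - integral\<^sup>L (lebesgue_on D) (\<lambda>x. \<phi> x *\<^sub>R column j (H x))"
        using assms(2)[unfolded weak_gradient_def, rule_format, OF \<phi>, of j]
          assms(4)[unfolded weak_gradient_def, rule_format, OF \<phi>, of j] by (rule trans[OF sym])
      then show ?thesis by (simp only: neg_equal_iff_equal)
    qed
    then show "integral\<^sup>L (lebesgue_on D) (\<lambda>x. \<phi> x *\<^sub>R (column j (G x) - column j (H x))) = 0"
      using j by (simp add: scaleR_diff_right)
  qed
  then have "AE x in lebesgue_on D. \<forall>j. column j (G x) - column j (H x) = 0"
    by (intro AE_finite_allI[of UNIV, simplified]) auto
  then show ?thesis
    by eventually_elim (auto intro: column_eqI)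
qed

lemma weak_gradient_diff:
  assumes "L2 (lebesgue_on D) u" "L2 (lebesgue_on D) v" "L2 (lebesgue_on D) G" "L2 (lebesgue_on D) H"
    "weak_gradient D u G" "weak_gradient D v H"
  shows "weak_gradient D (\<lambda>x. u x - v x) (\<lambda>x. G x - H x)"
  unfolding weak_gradient_def
proof (intro allI impI)
  fix \<phi> :: "real^3 \<Rightarrow> real" and j assume \<phi>: "test_fun D \<phi>"
  note i = assms(1-4)[THEN L2_integrable[OF finite_measure_D]]
  show "integral\<^sup>L (lebesgue_on D) (\<lambda>x. partial j \<phi> x *\<^sub>R (u x - v x)) =
      - integral\<^sup>L (lebesgue_on D) (\<lambda>x. \<phi> x *\<^sub>R column j (G x - H x))"
    using i assms(5,6) \<phi>
    by (simp add: scaleR_diff_right column_diff test_fun_integrable[OF \<phi>] integrable_column weak_gradient_def)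
qed

lemma weak_gradient_uminus: "weak_gradient D u G \<Longrightarrow> weak_gradient D (\<lambda>x. - u x) (\<lambda>x. - G x)"
proof -
  have "column j (- A) = - column j A" for j and A :: "complex^3^3"
    by (simp add: column_def vec_eq_iff)
  then show "weak_gradient D u G \<Longrightarrow> weak_gradient D (\<lambda>x. - u x) (\<lambda>x. - G x)"
    by (simp add: weak_gradient_def)
qed

lemma weak_gradient_add:
  assumes "L2 (lebesgue_on D) u" "L2 (lebesgue_on D) v" "L2 (lebesgue_on D) G" "L2 (lebesgue_on D) H"
    "weak_gradient D u G" "weak_gradient D v H"
  shows "weak_gradient D (\<lambda>x. u x + v x) (\<lambda>x. G x + H x)"
  using weak_gradient_diff[of u "\<lambda>x. - v x" G "\<lambda>x. - H x"] assms weak_gradient_uminus[of v H]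
  by (simp add: L2_def)

text \<open>A test function on \<open>E\<close> is one on \<open>D\<close>, and together with its
  partial derivatives it vanishes outside \<open>E\<close>, so the integrals over the two sets
  coincide.\<close>

lemma weak_gradient_subset:
  assumes "weak_gradient D u G" "open E" "E \<subseteq> D"
  shows "weak_gradient E u G"
  unfolding weak_gradient_def
proof (intro allI impI)
  fix \<phi> :: "real^3 \<Rightarrow> real" and j assume \<phi>: "test_fun E \<phi>"
  have *: "integral\<^sup>L (lebesgue_on D) f = integral\<^sup>L (lebesgue_on E) f"
    if "\<And>x. x \<notin> E \<Longrightarrow> f x = 0" for f :: "real^3 \<Rightarrow> complex^3"
    using D(1) assms that
    by (auto simp: integral_lebesgue_on open_sets_lebesgue subset_iff intro!: Bochner_Integration.integral_cong split: split_indicator)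
  have supp: "x \<notin> E \<Longrightarrow> x \<notin> closure {x. \<phi> x \<noteq> 0}" for x
    using \<phi> by (auto simp: test_fun_def)
  show "integral\<^sup>L (lebesgue_on E) (\<lambda>x. partial j \<phi> x *\<^sub>R u x) =
      - integral\<^sup>L (lebesgue_on E) (\<lambda>x. \<phi> x *\<^sub>R column j (G x))"
    using assms(1) test_fun_mono[OF \<phi> assms(3)] partial_eq_0_outside[OF supp] test_fun_eq_0[OF \<phi> supp]
    unfolding weak_gradient_def by (subst (1 2) *[symmetric]) auto
qed

lemma weak_gradient_cong_AE:
  assumes "weak_gradient D u G" "AE x in lebesgue_on D. u x = v x"
    "u \<in> borel_measurable (lebesgue_on D)" "v \<in> borel_measurable (lebesgue_on D)"
  shows "weak_gradient D v G"
  unfolding weak_gradient_def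
proof (intro allI impI)
  fix \<phi> :: "real^3 \<Rightarrow> real" and j assume \<phi>: "test_fun D \<phi>"
  have "partial j \<phi> \<in> borel_measurable (lebesgue_on D)"
    using \<phi> by (intro continuous_measurable_lebesgue_on smooth_continuous_on_partial) (simp add: test_fun_def)
  then have "integral\<^sup>L (lebesgue_on D) (\<lambda>x. partial j \<phi> x *\<^sub>R v x) = integral\<^sup>L (lebesgue_on D) (\<lambda>x. partial j \<phi> x *\<^sub>R u x)"
    using assms(2-4) by (intro integral_cong_AE) auto
  then show "integral\<^sup>L (lebesgue_on D) (\<lambda>x. partial j \<phi> x *\<^sub>R v x) =
      - integral\<^sup>L (lebesgue_on D) (\<lambda>x. \<phi> x *\<^sub>R column j (G x))"
    using assms(1) \<phi> by (simp add: weak_gradient_def)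
qed

lemma H1_wgrad: "H1 D u \<Longrightarrow> L2 (lebesgue_on D) u" "H1 D u \<Longrightarrow> L2 (lebesgue_on D) (wgrad D u)"
  "H1 D u \<Longrightarrow> weak_gradient D u (wgrad D u)"
proof -
  assume "H1 D u"
  then have "\<exists>G. L2 (lebesgue_on D) G \<and> weak_gradient D u G" and 1: "L2 (lebesgue_on D) u"
    by (auto simp: H1_def)
  from someI_ex[OF this(1)] show "L2 (lebesgue_on D) (wgrad D u)" "weak_gradient D u (wgrad D u)"
    by (auto simp: wgrad_def)
  show "L2 (lebesgue_on D) u" by (fact 1)
qed

lemma H1_diff: "H1 D u \<Longrightarrow> H1 D v \<Longrightarrow> H1 D (\<lambda>x. u x - v x)"
  using weak_gradient_diff[of u v "wgrad D u" "wgrad D v"] H1_wgrad[of u] H1_wgrad[of v]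
  unfolding H1_def by (blast intro: L2_diff)

lemma H1_c1_on:
  assumes "c1_on D h J" "bounded (h ` D)" "bounded (J ` D)"
  shows "H1 D h"
  using assms c1_on_weak_gradient[OF D(1)] c1_on_continuous[of D h J] D
  unfolding H1_def c1_on_def by (blast intro: L2_continuous_bounded open_sets_lebesgue)

lemma H1_subset:
  assumes "H1 D u" "open E" "E \<subseteq> D"
  shows "H1 E u"
  using H1_wgrad[OF assms(1)] weak_gradient_subset[OF _ assms(2,3)] D(1) assms
  unfolding H1_def by (blast intro: L2_lebesgue_on_subset open_sets_lebesgue)

lemma H1_norm_sq: "(H1_norm D u)\<^sup>2 = (L2_norm (lebesgue_on D) u)\<^sup>2 + (L2_norm (lebesgue_on D) (wgrad D u))\<^sup>2"
  by (simp add: H1_norm_def)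

lemma H1_norm_nonneg: "0 \<le> H1_norm D u"
  by (simp add: H1_norm_def)

lemma c1_on_wgrad_add:
  assumes "c1_on D h J" "L2 (lebesgue_on D) h" "L2 (lebesgue_on D) J" "H1 D u" "H1 D v"
    "AE x in lebesgue_on D. h x = u x + v x"
  shows "AE x in lebesgue_on D. J x = wgrad D u x + wgrad D v x"
proof -
  note u = H1_wgrad[OF assms(4)] and v = H1_wgrad[OF assms(5)]
  have "weak_gradient D (\<lambda>x. u x + v x) J"
    by (rule weak_gradient_cong_AE[OF c1_on_weak_gradient[OF D(1) assms(1)] assms(6)])
       (use assms(2) u v in \<open>auto simp: L2_def\<close>)
  from weak_gradient_unique[OF assms(3) this L2_add[OF u(2) v(2)] weak_gradient_add[OF u(1) v(1) u(2) v(2) u(3) v(3)]]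
  show ?thesis .
qed

lemma c1_on_wgrad_diff:
  assumes "c1_on D h J" "L2 (lebesgue_on D) h" "L2 (lebesgue_on D) J" "H1 D u" "H1 D v"
    "AE x in lebesgue_on D. h x = u x - v x"
  shows "AE x in lebesgue_on D. J x = wgrad D u x - wgrad D v x"
proof -
  note u = H1_wgrad[OF assms(4)] and v = H1_wgrad[OF assms(5)]
  have "weak_gradient D (\<lambda>x. u x - v x) J"
    by (rule weak_gradient_cong_AE[OF c1_on_weak_gradient[OF D(1) assms(1)] assms(6)])
       (use assms(2) u v in \<open>auto simp: L2_def\<close>)
  from weak_gradient_unique[OF assms(3) this L2_diff[OF u(2) v(2)] weak_gradient_diff[OF u(1) v(1) u(2) v(2) u(3) v(3)]]
  show ?thesis .
qed

text \<open>A bridge from \<open>H1_norm\<close>, which involves chosen weak gradients, to the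
  classical Jacobian of a C1 function. It is meant for the splitting of \<open>f n - g\<close> into
  \<open>f n - v\<close> and \<open>v - g\<close>, where \<open>f n\<close> is smooth and tends to
  \<open>v\<close>: the sum is C1 although neither summand needs to be.\<close>

lemma c1_on_energy_add:
  assumes "c1_on D h J" "L2 (lebesgue_on D) h" "L2 (lebesgue_on D) J" "H1 D u" "H1 D v"
    "AE x in lebesgue_on D. h x = u x + v x"
  shows "(L2_norm (lebesgue_on D) h)\<^sup>2 + (L2_norm (lebesgue_on D) J)\<^sup>2 \<le> 2 * (H1_norm D u)\<^sup>2 + 2 * (H1_norm D v)\<^sup>2"
proof -
  note u = H1_wgrad[OF assms(4)] and v = H1_wgrad[OF assms(5)]
  have "L2_norm (lebesgue_on D) h = L2_norm (lebesgue_on D) (\<lambda>x. u x + v x)"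
    by (rule L2_norm_cong_AE) (use assms(2,6) u v in \<open>auto simp: L2_def\<close>)
  moreover have "L2_norm (lebesgue_on D) J = L2_norm (lebesgue_on D) (\<lambda>x. wgrad D u x + wgrad D v x)"
    by (rule L2_norm_cong_AE) (use assms(3) c1_on_wgrad_add[OF assms] u v in \<open>auto simp: L2_def\<close>)
  ultimately show ?thesis
    using L2_norm_add_sq_le[OF u(1) v(1)] L2_norm_add_sq_le[OF u(2) v(2)] by (simp add: H1_norm_sq)
qed

lemma c1_on_energy_diff:
  assumes "c1_on D h J" "L2 (lebesgue_on D) h" "L2 (lebesgue_on D) J" "H1 D u" "H1 D v"
    "AE x in lebesgue_on D. h x = u x - v x"
  shows "(L2_norm (lebesgue_on D) h)\<^sup>2 + (L2_norm (lebesgue_on D) J)\<^sup>2 \<le> 2 * (H1_norm D u)\<^sup>2 + 2 * (H1_norm D v)\<^sup>2"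
proof -
  note u = H1_wgrad[OF assms(4)] and v = H1_wgrad[OF assms(5)]
  have "L2_norm (lebesgue_on D) h = L2_norm (lebesgue_on D) (\<lambda>x. u x - v x)"
    by (rule L2_norm_cong_AE) (use assms(2,6) u v in \<open>auto simp: L2_def\<close>)
  moreover have "L2_norm (lebesgue_on D) J = L2_norm (lebesgue_on D) (\<lambda>x. wgrad D u x - wgrad D v x)"
    by (rule L2_norm_cong_AE) (use assms(3) c1_on_wgrad_diff[OF assms] u v in \<open>auto simp: L2_def\<close>)
  ultimately show ?thesis
    using L2_norm_diff_sq_le[OF u(1) v(1)] L2_norm_diff_sq_le[OF u(2) v(2)] by (simp add: H1_norm_sq)
qed

lemma L2_norm_subset_le:
  fixes f :: "real^3 \<Rightarrow> 'b::euclidean_space"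
  assumes "L2 (lebesgue_on D) f" "open E" "E \<subseteq> D"
  shows "L2_norm (lebesgue_on E) f \<le> L2_norm (lebesgue_on D) f"
proof -
  have "L2 (lebesgue_on E) f"
    using assms D(1) by (blast intro: L2_lebesgue_on_subset open_sets_lebesgue)
  then have i: "integrable lebesgue (\<lambda>x. indicator E x *\<^sub>R (norm (f x))\<^sup>2)" "integrable lebesgue (\<lambda>x. indicator D x *\<^sub>R (norm (f x))\<^sup>2)"
    using assms D(1) by (auto simp: L2_def integrable_lebesgue_on open_sets_lebesgue simp flip: real_scaleR_def)
  have "integral\<^sup>L lebesgue (\<lambda>x. indicator E x *\<^sub>R (norm (f x))\<^sup>2) \<le> integral\<^sup>L lebesgue (\<lambda>x. indicator D x *\<^sub>R (norm (f x))\<^sup>2)"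
    using assms(3) by (intro integral_mono i) (auto split: split_indicator)
  then show ?thesis
    using assms D(1) by (simp add: L2_norm_def integral_lebesgue_on open_sets_lebesgue)
qed

end

text \<open>The two gradients are chosen independently; the one on \<open>D\<close>, restricted, is
  also a weak gradient on \<open>E\<close>, and uniqueness identifies them.\<close>

lemma wgrad_subset:
  assumes D: "open D" "bounded D" and u: "H1 D u" and E: "open E" "E \<subseteq> D"
  shows "AE x in lebesgue_on E. wgrad E u x = wgrad D u x"
proof (rule weak_gradient_unique[OF E(1)])
  show bE: "bounded E" using D(2) E(2) by (rule bounded_subset)
  have "H1 E u" by (rule H1_subset[OF D u E])
  from H1_wgrad[OF E(1) bE this] show "L2 (lebesgue_on E) (wgrad E u)" "weak_gradient E u (wgrad E u)"
    by auto
  show "weak_gradient E u (wgrad D u)" "L2 (lebesgue_on E) (wgrad D u)"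
    using H1_wgrad[OF D u] weak_gradient_subset[OF D _ E] L2_lebesgue_on_subset[OF _ E(2)] D(1) E(1)
    by (auto intro: open_sets_lebesgue)
qed

lemma H1_norm_subset_le:
  assumes D: "open D" "bounded D" and u: "H1 D u" and E: "open E" "E \<subseteq> D"
  shows "(H1_norm E u)\<^sup>2 \<le> (H1_norm D u)\<^sup>2"
proof -
  note w = H1_wgrad[OF D u]
  have bE: "bounded E" using D(2) E(2) by (rule bounded_subset)
  note wE = H1_wgrad[OF E(1) bE H1_subset[OF D u E]]
  have "L2_norm (lebesgue_on E) (wgrad E u) = L2_norm (lebesgue_on E) (wgrad D u)"
    using wE L2_lebesgue_on_subset[OF w(2) E(2)] D(1) E(1)
    by (intro L2_norm_cong_AE wgrad_subset[OF D u E]) (auto simp: L2_def open_sets_lebesgue)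
  then show ?thesis
    using L2_norm_subset_le[OF D w(1) E] L2_norm_subset_le[OF D w(2) E]
    by (auto simp: H1_norm_sq[OF D] H1_norm_sq[OF E(1) bE] intro!: add_mono power_mono L2_norm_nonneg)
qed

section \<open>Dilation and trace estimates\<close>

lemma norm_column_le: "norm (column j A) \<le> norm (A :: complex^3^3)"
  unfolding norm_vec_def[of A] norm_vec_def[of "column j A"]
  by (rule L2_set_mono) (auto simp: column_def Finite_Cartesian_Product.norm_nth_le)

lemma norm_sum_columns_le: "norm (\<Sum>j\<in>UNIV. e $ j *\<^sub>R column j (A :: complex^3^3)) \<le> 3 * norm e * norm A"
proof -
  have "norm (\<Sum>j\<in>UNIV. e $ j *\<^sub>R column j A) \<le> (\<Sum>j\<in>(UNIV::3 set). norm e * norm A)"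
  proof (rule sum_norm_le)
    fix j :: 3
    have "norm (e $ j *\<^sub>R column j A) = \<bar>e $ j\<bar> * norm (column j A)" by simp
    also have "\<dots> \<le> norm e * norm A"
      using component_le_norm_cart[of e j] norm_column_le[of j A] by (intro mult_mono) auto
    finally show "norm (e $ j *\<^sub>R column j A) \<le> norm e * norm A" .
  qed
  then show ?thesis by simp
qed

lemma norm_diff_le_nn_integral:
  fixes F f :: "real \<Rightarrow> 'b::euclidean_space"
  assumes "a \<le> b" "\<And>t. t \<in> {a..b} \<Longrightarrow> (F has_vector_derivative f t) (at t within {a..b})" "continuous_on {a..b} f"
  shows "ennreal (norm (F b - F a)) \<le> (\<integral>\<^sup>+t. ennreal (norm (f t)) * indicator {a..b} t \<partial>lborel)"
proof -
  have "has_bochner_integral lborel (\<lambda>x. indicator {a..b} x *\<^sub>R f x) (F b - F a)"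
    using assms by (intro has_bochner_integral_FTC_Icc) auto
  then have "integrable lborel (\<lambda>x. indicator {a..b} x *\<^sub>R f x)" "F b - F a = integral\<^sup>L lborel (\<lambda>x. indicator {a..b} x *\<^sub>R f x)"
    by (auto simp: has_bochner_integral_iff)
  then have "ennreal (norm (F b - F a)) \<le> (\<integral>\<^sup>+t. ennreal (norm (indicator {a..b} t *\<^sub>R f t)) \<partial>lborel)"
    using integral_norm_bound_ennreal by metis
  also have "\<dots> = (\<integral>\<^sup>+t. ennreal (norm (f t)) * indicator {a..b} t \<partial>lborel)"
    by (intro nn_integral_cong) (auto split: split_indicator)
  finally show ?thesis .
qed

lemma c1_on_line:
  assumes "c1_on D h J" "p + t *\<^sub>R e \<in> D"
  shows "((\<lambda>t. h (p + t *\<^sub>R e)) has_vector_derivative (\<Sum>j\<in>UNIV. e $ j *\<^sub>R column j (J (p + t *\<^sub>R e)))) (at t within T)"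
proof -
  have h: "(h has_derivative (\<lambda>u. \<Sum>j\<in>UNIV. u $ j *\<^sub>R column j (J (p + t *\<^sub>R e)))) (at (p + t *\<^sub>R e))"
    using assms(1)[unfolded c1_on_def, THEN conjunct2, THEN bspec, OF assms(2)] .
  have "((\<lambda>t. p + t *\<^sub>R e) has_derivative (\<lambda>s. s *\<^sub>R e)) (at t within T)"
    by (auto intro!: derivative_eq_intros)
  from has_derivative_compose[OF this h] show ?thesis
    by (simp add: has_vector_derivative_def scaleR_sum_right)
qed

text \<open>The fundamental theorem of calculus on the segment. The factor 3 counts the columns of
  \<open>J\<close>, each of which contributes at most \<open>norm e * norm J\<close>.\<close>

lemma c1_on_line_le:
  assumes h: "c1_on D h J" and ab: "a \<le> b" and D: "\<And>t. t \<in> {a..b} \<Longrightarrow> p + t *\<^sub>R e \<in> D"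
  shows "ennreal (norm (h (p + b *\<^sub>R e) - h (p + a *\<^sub>R e))) \<le>
    (\<integral>\<^sup>+t. ennreal (3 * norm e * norm (J (p + t *\<^sub>R e))) * indicator {a..b} t \<partial>lborel)"
proof -
  have cJ: "continuous_on {a..b} (\<lambda>t. J (p + t *\<^sub>R e))"
    by (rule continuous_on_compose2[of D J]) (use h D in \<open>auto simp: c1_on_def intro!: continuous_intros\<close>)
  have "ennreal (norm (h (p + b *\<^sub>R e) - h (p + a *\<^sub>R e))) \<le>
    (\<integral>\<^sup>+t. ennreal (norm (\<Sum>j\<in>UNIV. e $ j *\<^sub>R column j (J (p + t *\<^sub>R e)))) * indicator {a..b} t \<partial>lborel)"
    by (rule norm_diff_le_nn_integral[OF ab])
       (auto intro!: c1_on_line[OF h] D continuous_intros continuous_on_column[OF cJ])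
  also have "\<dots> \<le> (\<integral>\<^sup>+t. ennreal (3 * norm e * norm (J (p + t *\<^sub>R e))) * indicator {a..b} t \<partial>lborel)"
    by (intro nn_integral_mono mult_right_mono ennreal_leI norm_sum_columns_le) auto
  finally show ?thesis .
qed

lemma nn_integral_dilation:
  fixes p :: "real^3" and g :: "real^3 \<Rightarrow> ennreal"
  assumes "\<sigma> > 0" and [measurable]: "g \<in> borel_measurable borel"
  shows "(\<integral>\<^sup>+y. g y \<partial>lborel) = ennreal (\<sigma> ^ 3) * (\<integral>\<^sup>+x. g (p + \<sigma> *\<^sub>R (x - p)) \<partial>lborel)"
proof -
  have "(\<integral>\<^sup>+y. g y \<partial>lborel) =
     (\<integral>\<^sup>+y. g y \<partial>density (distr lborel borel (\<lambda>x. (p - \<sigma> *\<^sub>R p) + \<sigma> *\<^sub>R x)) (\<lambda>_. ennreal (\<bar>\<sigma>\<bar> ^ DIM(real^3))))"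
    using lborel_affine[of \<sigma> "p - \<sigma> *\<^sub>R p"] assms(1) by simp
  also have "\<dots> = ennreal (\<sigma> ^ 3) * (\<integral>\<^sup>+x. g ((p - \<sigma> *\<^sub>R p) + \<sigma> *\<^sub>R x) \<partial>lborel)"
    using assms(1) by (simp add: nn_integral_density nn_integral_distr nn_integral_cmult)
  finally show ?thesis by (simp add: algebra_simps)
qed

lemma nn_integral_lebesgue_on:
  fixes f :: "'a::euclidean_space \<Rightarrow> real"
  assumes "D \<in> sets lebesgue" "integrable (lebesgue_on D) f" "\<And>x. x \<in> D \<Longrightarrow> f x \<ge> 0"
  shows "(\<integral>\<^sup>+x. ennreal (f x) * indicator D x \<partial>lborel) = ennreal (integral\<^sup>L (lebesgue_on D) f)"
proof -
  have "(\<integral>\<^sup>+x. ennreal (f x) * indicator D x \<partial>lborel) = (\<integral>\<^sup>+x. ennreal (f x) * indicator D x \<partial>lebesgue)"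
    by (simp add: nn_integral_completion)
  also have "\<dots> = (\<integral>\<^sup>+x. ennreal (f x) \<partial>lebesgue_on D)"
    using assms(1) by (simp add: nn_integral_restrict_space)
  also have "\<dots> = ennreal (integral\<^sup>L (lebesgue_on D) f)"
    using assms by (intro nn_integral_eq_integral AE_I2) auto
  finally show ?thesis .
qed

text \<open>The exponent arises in \<open>dilation_estimate\<close> as the product of \<sigma>^(-3),
  from a change of variables, and \<sigma>^(3/2), from Cauchy-Schwarz on a set of volume
  proportional to \<sigma>^3.\<close>

lemma integral_powr_le:
  assumes "0 < s" "s \<le> 1" "A \<ge> 0"
  shows "(\<integral>\<^sup>+\<sigma>. ennreal (A * \<sigma> powr (-3/2)) * indicator {s..1} \<sigma> \<partial>lborel) \<le> ennreal (2 * A / sqrt s)"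
proof -
  have "(\<integral>\<^sup>+\<sigma>. ennreal (A * \<sigma> powr (-3/2)) * indicator {s..1} \<sigma> \<partial>lborel) =
      ennreal ((- 2 * A * 1 powr (-1/2)) - (- 2 * A * s powr (-1/2)))"
    by (rule nn_integral_FTC_Icc)
       (use assms in \<open>auto intro!: derivative_eq_intros\<close>)
  also have "\<dots> \<le> ennreal (2 * A / sqrt s)"
    using assms by (intro ennreal_leI) (simp add: powr_minus_divide powr_half_sqrt)
  finally show ?thesis .
qed

lemma measure_dilation:
  fixes p :: "real^3"
  assumes "\<sigma> > 0"
  shows "measure lebesgue ((\<lambda>x. p + \<sigma> *\<^sub>R (x - p)) ` U) = \<sigma> ^ 3 * measure lebesgue U"
proof -
  have eq: "(\<lambda>x. p + \<sigma> *\<^sub>R (x - p)) = (\<lambda>x. \<sigma> *\<^sub>R x + (p - \<sigma> *\<^sub>R p))"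
    by (auto simp: algebra_simps)
  have "emeasure lebesgue ((\<lambda>x. p + \<sigma> *\<^sub>R (x - p)) ` U) = ennreal (\<sigma> ^ 3) * emeasure lebesgue U"
    unfolding eq using assms emeasure_lebesgue_affine[of \<sigma> "p - \<sigma> *\<^sub>R p" U] by simp
  then show ?thesis
    using assms by (simp add: measure_def enn2real_mult)
qed

lemma dilation_image_eq:
  fixes p :: "'a::real_normed_vector"
  assumes "\<sigma> > 0"
  shows "(\<lambda>x. p + \<sigma> *\<^sub>R (x - p)) ` U = (\<lambda>y. p + inverse \<sigma> *\<^sub>R (y - p)) -` U"
  using assms by (auto simp: image_iff intro!: bexI[of _ "p + inverse \<sigma> *\<^sub>R (_ - p)"])

lemma open_dilation:
  fixes p :: "real^3"
  assumes "\<sigma> > 0" "open U"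
  shows "open ((\<lambda>x. p + \<sigma> *\<^sub>R (x - p)) ` U)"
  unfolding dilation_image_eq[OF assms(1)]
  by (rule open_vimage[OF assms(2)]) (auto intro!: continuous_intros)

text \<open>The power \<open>s\<^sup>2 * sqrt s\<close> is what Hoelder's inequality gives for \<open>h\<close> in \<open>L\<^sup>6\<close>. Integrating
  \<open>J\<close> along the rays to \<open>p\<close> yields it without the Sobolev embedding.\<close>

lemma dilation_estimate:
  fixes p :: "real^3"
  defines "dil \<equiv> \<lambda>\<sigma> x. p + \<sigma> *\<^sub>R (x - p)"
  assumes U: "open U" "U \<subseteq> cball p R" "R \<ge> 0"
    and star: "\<And>x \<sigma>. x \<in> U \<Longrightarrow> 0 < \<sigma> \<Longrightarrow> \<sigma> \<le> 1 \<Longrightarrow> dil \<sigma> x \<in> U"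
    and h: "c1_on UNIV h J" and s: "0 < s" "s \<le> 1"
  shows "integral\<^sup>L (lebesgue_on (dil s ` U)) (\<lambda>x. norm (h x)) \<le>
    sqrt (measure lebesgue U) * (1 + 6 * R) * s\<^sup>2 * sqrt s *
      sqrt ((L2_norm (lebesgue_on U) h)\<^sup>2 + (L2_norm (lebesgue_on U) J)\<^sup>2)"
proof -
  have bU: "bounded U" using U(2) bounded_cball bounded_subset by blast
  have oU: "open (dil \<sigma> ` U)" "dil \<sigma> ` U \<subseteq> U" if "0 < \<sigma>" "\<sigma> \<le> 1" for \<sigma>
    using that open_dilation[OF _ U(1)] star unfolding dil_def by auto
  have b\<sigma>: "bounded (dil \<sigma> ` U)" if "0 < \<sigma>" "\<sigma> \<le> 1" for \<sigma>
    using oU(2)[OF that] bU bounded_subset by blast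
  have ch: "continuous_on UNIV h" and cJ: "continuous_on UNIV J"
    using h c1_on_continuous[OF h] by (auto simp: c1_on_def)
  have [measurable]: "h \<in> borel_measurable borel" "J \<in> borel_measurable borel"
    using ch cJ by (auto intro: borel_measurable_continuous_onI)
  have [measurable]: "U \<in> sets borel" using U by simp
  let ?m = "sqrt (measure lebesgue U)"
  let ?Jn = "L2_norm (lebesgue_on U) J" and ?hn = "L2_norm (lebesgue_on U) h"
  have nn: "0 \<le> ?m * ?hn" "0 \<le> 3 * R * ?m * ?Jn" "0 \<le> 2 * (3 * R * ?m * ?Jn) / sqrt s"
    using s U(3) L2_norm_nonneg[of "lebesgue_on U" J] L2_norm_nonneg[of "lebesgue_on U" h] by simp_all
  \<comment> \<open>Cauchy-Schwarz on the dilated set, whose volume is \<open>\<sigma> ^ 3\<close>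
    times that of \<open>U\<close>. For \<open>h\<close> it would be too weak at small scales; it is
    applied to \<open>h\<close> only at scale 1, and to \<open>J\<close> at all scales.\<close>
  have int_le: "(\<integral>\<^sup>+y. ennreal (norm (f y)) * indicator (dil \<sigma> ` U) y \<partial>lborel) \<le>
      ennreal (sqrt (\<sigma> ^ 3) * ?m * L2_norm (lebesgue_on U) f)"
    and int_ok: "integrable (lebesgue_on (dil \<sigma> ` U)) (\<lambda>x. norm (f x))"
    if \<sigma>: "0 < \<sigma>" "\<sigma> \<le> 1" and f: "continuous_on UNIV f" for \<sigma> and f :: "real^3 \<Rightarrow> 'b::euclidean_space"
  proof -
    have L: "dil \<sigma> ` U \<in> sets lebesgue" using oU[OF \<sigma>] by (simp add: open_sets_lebesgue)
    have fin: "finite_measure (lebesgue_on (dil \<sigma> ` U))"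
      using L b\<sigma>[OF \<sigma>] by (intro finite_measure_bounded)
    have L2: "L2 (lebesgue_on (dil \<sigma> ` U)) f" "L2 (lebesgue_on U) f"
      using L b\<sigma>[OF \<sigma>] bU U f by (auto intro!: L2_continuous simp: open_sets_lebesgue)
    show i: "integrable (lebesgue_on (dil \<sigma> ` U)) (\<lambda>x. norm (f x))"
      using L2_integrable[OF fin L2(1)] by simp
    have "(\<integral>\<^sup>+y. ennreal (norm (f y)) * indicator (dil \<sigma> ` U) y \<partial>lborel) = ennreal (integral\<^sup>L (lebesgue_on (dil \<sigma> ` U)) (\<lambda>x. norm (f x)))"
      by (rule nn_integral_lebesgue_on[OF L i]) auto
    also have "\<dots> \<le> ennreal (sqrt (measure (lebesgue_on (dil \<sigma> ` U)) (space (lebesgue_on (dil \<sigma> ` U)))) * L2_norm (lebesgue_on (dil \<sigma> ` U)) f)"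
      by (intro ennreal_leI integral_norm_le_L2_norm fin L2)
    also have "measure (lebesgue_on (dil \<sigma> ` U)) (space (lebesgue_on (dil \<sigma> ` U))) = \<sigma> ^ 3 * measure lebesgue U"
      using L measure_dilation[OF \<sigma>(1), of p U] by (simp add: measure_restrict_space dil_def)
    also have "ennreal (sqrt (\<sigma> ^ 3 * measure lebesgue U) * L2_norm (lebesgue_on (dil \<sigma> ` U)) f) \<le>
        ennreal (sqrt (\<sigma> ^ 3 * measure lebesgue U) * L2_norm (lebesgue_on U) f)"
      using L2_norm_subset_le[OF U(1) bU L2(2) oU[OF \<sigma>]] \<sigma>
      by (intro ennreal_leI mult_left_mono) auto
    finally show "(\<integral>\<^sup>+y. ennreal (norm (f y)) * indicator (dil \<sigma> ` U) y \<partial>lborel) \<le>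
      ennreal (sqrt (\<sigma> ^ 3) * ?m * L2_norm (lebesgue_on U) f)"
      by (simp add: real_sqrt_mult)
  qed
  have change: "(\<integral>\<^sup>+y. ennreal (norm (f y)) * indicator (dil \<sigma> ` U) y \<partial>lborel) =
     ennreal (\<sigma> ^ 3) * (\<integral>\<^sup>+x. ennreal (norm (f (dil \<sigma> x))) * indicator U x \<partial>lborel)"
    if \<sigma>: "0 < \<sigma>" "\<sigma> \<le> 1" and f: "continuous_on UNIV f" for \<sigma> and f :: "real^3 \<Rightarrow> 'b::euclidean_space"
  proof -
    have [measurable]: "f \<in> borel_measurable borel" using f by (rule borel_measurable_continuous_onI)
    have [measurable]: "dil \<sigma> ` U \<in> sets borel" using oU[OF \<sigma>] by simp
    have "indicator (dil \<sigma> ` U) (dil \<sigma> x) = (indicator U x :: ennreal)" for x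
    proof -
      have "inj (dil \<sigma>)" using \<sigma> by (auto simp: dil_def inj_on_def)
      then show ?thesis by (auto simp: inj_image_mem_iff split: split_indicator)
    qed
    moreover have m: "(\<lambda>y. ennreal (norm (f y)) * indicator (dil \<sigma> ` U) y) \<in> borel_measurable borel"
      by measurable
    moreover have "p + \<sigma> *\<^sub>R (x - p) = dil \<sigma> x" for x by (simp add: dil_def)
    ultimately show ?thesis
      using nn_integral_dilation[OF \<sigma>(1) m, of p] by simp
  qed
  have pw: "ennreal (norm (h (dil s x))) * indicator U x \<le> ennreal (norm (h x)) * indicator U x +
      (\<integral>\<^sup>+\<sigma>. ennreal (3 * R * norm (J (dil \<sigma> x))) * indicator U x * indicator {s..1} \<sigma> \<partial>lborel)" for x
  proof (cases "x \<in> U")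
    case True
    have R: "norm (x - p) \<le> R" using True U by (auto simp: dist_norm norm_minus_commute)
    have "ennreal (norm (h (dil s x))) \<le> ennreal (norm (h x) + norm (h (p + 1 *\<^sub>R (x - p)) - h (p + s *\<^sub>R (x - p))))"
      using norm_triangle_ineq2[of "h (dil s x)" "h x"] by (intro ennreal_leI) (simp add: dil_def norm_minus_commute)
    also have "\<dots> = ennreal (norm (h x)) + ennreal (norm (h (p + 1 *\<^sub>R (x - p)) - h (p + s *\<^sub>R (x - p))))"
      by simp
    also have "ennreal (norm (h (p + 1 *\<^sub>R (x - p)) - h (p + s *\<^sub>R (x - p)))) \<le>
      (\<integral>\<^sup>+t. ennreal (3 * norm (x - p) * norm (J (p + t *\<^sub>R (x - p)))) * indicator {s..1} t \<partial>lborel)"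
      by (rule c1_on_line_le[OF h]) (use s in auto)
    also have "\<dots> \<le> (\<integral>\<^sup>+\<sigma>. ennreal (3 * R * norm (J (dil \<sigma> x))) * indicator {s..1} \<sigma> \<partial>lborel)"
      using R by (intro nn_integral_mono mult_right_mono ennreal_leI) (auto simp: dil_def intro!: mult_right_mono)
    finally show ?thesis using True by (simp add: add_left_mono)
  qed simp
  have meas2: "(\<lambda>(x, \<sigma>). ennreal (3 * R * norm (J (dil \<sigma> x))) * indicator U x * indicator {s..1} \<sigma>)
      \<in> borel_measurable (lborel \<Otimes>\<^sub>M lborel)"
    unfolding dil_def by measurable
  let ?I = "\<integral>\<^sup>+x. ennreal (norm (h (dil s x))) * indicator U x \<partial>lborel"
  have "?I \<le> (\<integral>\<^sup>+x. (ennreal (norm (h x)) * indicator U x +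
      (\<integral>\<^sup>+\<sigma>. ennreal (3 * R * norm (J (dil \<sigma> x))) * indicator U x * indicator {s..1} \<sigma> \<partial>lborel)) \<partial>lborel)"
    by (intro nn_integral_mono pw)
  also have "\<dots> = (\<integral>\<^sup>+x. ennreal (norm (h x)) * indicator U x \<partial>lborel) +
      (\<integral>\<^sup>+x. (\<integral>\<^sup>+\<sigma>. ennreal (3 * R * norm (J (dil \<sigma> x))) * indicator U x * indicator {s..1} \<sigma> \<partial>lborel) \<partial>lborel)"
    using meas2 by (intro nn_integral_add) (auto intro!: lborel.borel_measurable_nn_integral simp: case_prod_unfold)
  also have "(\<integral>\<^sup>+x. ennreal (norm (h x)) * indicator U x \<partial>lborel) \<le> ennreal (?m * ?hn)"
    using int_le[of 1 h] ch by (simp add: dil_def)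
  also have "(\<integral>\<^sup>+x. (\<integral>\<^sup>+\<sigma>. ennreal (3 * R * norm (J (dil \<sigma> x))) * indicator U x * indicator {s..1} \<sigma> \<partial>lborel) \<partial>lborel)
     = (\<integral>\<^sup>+\<sigma>. (\<integral>\<^sup>+x. ennreal (3 * R * norm (J (dil \<sigma> x))) * indicator U x * indicator {s..1} \<sigma> \<partial>lborel) \<partial>lborel)"
    by (rule lborel_pair.Fubini'[symmetric]) (fact meas2)
  also have "\<dots> \<le> (\<integral>\<^sup>+\<sigma>. ennreal ((3 * R * ?m * ?Jn) * \<sigma> powr (-3/2)) * indicator {s..1} \<sigma> \<partial>lborel)"
  proof (intro nn_integral_mono)
    fix \<sigma> :: real
    show "(\<integral>\<^sup>+x. ennreal (3 * R * norm (J (dil \<sigma> x))) * indicator U x * indicator {s..1} \<sigma> \<partial>lborel) \<le>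
        ennreal ((3 * R * ?m * ?Jn) * \<sigma> powr (-3/2)) * indicator {s..1} \<sigma>"
    proof (cases "\<sigma> \<in> {s..1}")
      case True
      then have \<sigma>: "0 < \<sigma>" "\<sigma> \<le> 1" using s by auto
      let ?X = "\<integral>\<^sup>+x. ennreal (norm (J (dil \<sigma> x))) * indicator U x \<partial>lborel"
      have "(\<integral>\<^sup>+x. ennreal (3 * R * norm (J (dil \<sigma> x))) * indicator U x * indicator {s..1} \<sigma> \<partial>lborel)
          = ennreal (3 * R) * ?X"
        using True U(3) by (subst nn_integral_cmult[symmetric])
          (auto simp: ennreal_mult mult_ac dil_def intro!: nn_integral_cong)
      \<comment> \<open>Multiplying and dividing by the Jacobian \<open>\<sigma> ^ 3\<close> undoes
        the change of variables, so that \<open>J\<close> is integrated over the dilated set, where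
        \<open>int_le\<close> applies.\<close>
      also have "?X = ennreal (inverse (\<sigma> ^ 3)) * (ennreal (\<sigma> ^ 3) * ?X)"
        using \<sigma> by (simp add: ennreal_mult[symmetric] mult.assoc[symmetric])
      also have "\<dots> \<le> ennreal (inverse (\<sigma> ^ 3)) * ennreal (sqrt (\<sigma> ^ 3) * ?m * ?Jn)"
        using int_le[OF \<sigma> cJ] change[OF \<sigma> cJ] by (intro mult_left_mono) auto
      also have "\<dots> = ennreal (inverse (\<sigma> ^ 3) * (sqrt (\<sigma> ^ 3) * ?m * ?Jn))"
        using \<sigma> L2_norm_nonneg[of "lebesgue_on U" J] by (intro ennreal_mult[symmetric]) auto
      also have "inverse (\<sigma> ^ 3) * (sqrt (\<sigma> ^ 3) * ?m * ?Jn) = \<sigma> powr (-3/2) * ?m * ?Jn"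
      proof -
        have "inverse (\<sigma> ^ 3) = \<sigma> powr (-3)" using \<sigma> by (simp add: powr_minus powr_numeral)
        moreover have "sqrt (\<sigma> ^ 3) = \<sigma> powr (3/2)"
          using \<sigma> by (simp add: powr_half_sqrt[symmetric] powr_powr flip: powr_numeral)
        ultimately show ?thesis by (simp add: powr_add[symmetric])
      qed
      also have "ennreal (3 * R) * ennreal (\<sigma> powr (-3/2) * ?m * ?Jn) = ennreal ((3 * R * ?m * ?Jn) * \<sigma> powr (-3/2)) * indicator {s..1} \<sigma>"
        using True U(3) L2_norm_nonneg by (subst ennreal_mult[symmetric]) (auto simp: mult_ac intro!: mult_nonneg_nonneg)
      finally show ?thesis by (simp add: mult_left_mono)
    qed simp
  qed
  also have "\<dots> \<le> ennreal (2 * (3 * R * ?m * ?Jn) / sqrt s)"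
    by (rule integral_powr_le[OF s nn(2)])
  also have "ennreal (?m * ?hn) + ennreal (2 * (3 * R * ?m * ?Jn) / sqrt s) = ennreal (?m * ?hn + 2 * (3 * R * ?m * ?Jn) / sqrt s)"
    using nn by (intro ennreal_plus[symmetric])
  finally have I: "?I \<le> ennreal (?m * ?hn + 2 * (3 * R * ?m * ?Jn) / sqrt s)"
    by (simp add: add_mono)
  have L: "dil s ` U \<in> sets lebesgue" using oU[OF s] by (simp add: open_sets_lebesgue)
  have "ennreal (integral\<^sup>L (lebesgue_on (dil s ` U)) (\<lambda>x. norm (h x))) = ennreal (s ^ 3) * ?I"
    using change[OF s ch] nn_integral_lebesgue_on[OF L int_ok[OF s ch]] by simp
  also have "\<dots> \<le> ennreal (s ^ 3) * ennreal (?m * ?hn + 2 * (3 * R * ?m * ?Jn) / sqrt s)"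
    by (intro mult_left_mono I) auto
  also have "\<dots> = ennreal (s ^ 3 * (?m * ?hn + 2 * (3 * R * ?m * ?Jn) / sqrt s))"
    using s nn by (intro ennreal_mult[symmetric] add_nonneg_nonneg) auto
  finally have "integral\<^sup>L (lebesgue_on (dil s ` U)) (\<lambda>x. norm (h x)) \<le> s ^ 3 * (?m * ?hn + 2 * (3 * R * ?m * ?Jn) / sqrt s)"
    using s nn by (subst (asm) ennreal_le_iff) (auto intro!: mult_nonneg_nonneg add_nonneg_nonneg)
  \<comment> \<open>Both norms are replaced by the root of the joint energy, and the first summand
    is enlarged by 1 / sqrt s, which is at least 1. The common factor s^3 / sqrt s is the claimed
    power.\<close>
  also have "\<dots> \<le> s ^ 3 * (?m * sqrt (?hn\<^sup>2 + ?Jn\<^sup>2) / sqrt s + 6 * R * ?m * sqrt (?hn\<^sup>2 + ?Jn\<^sup>2) / sqrt s)"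
  proof (intro mult_left_mono add_mono)
    have "?hn \<le> sqrt (?hn\<^sup>2 + ?Jn\<^sup>2)" "?Jn \<le> sqrt (?hn\<^sup>2 + ?Jn\<^sup>2)"
      by (simp_all add: real_le_rsqrt)
    moreover have "sqrt s \<le> 1" using s by simp
    moreover have "sqrt s > 0" using s by simp
    moreover have "X \<le> X / sqrt s" if "X \<ge> 0" for X
      using that s mult_left_mono[of "sqrt s" 1 X] by (simp add: field_simps)
    moreover have "?m * ?hn \<le> ?m * sqrt (?hn\<^sup>2 + ?Jn\<^sup>2)"
      by (intro mult_left_mono) (simp_all add: real_le_rsqrt)
    moreover have "0 \<le> ?m * sqrt (?hn\<^sup>2 + ?Jn\<^sup>2)" by simp
    ultimately show "2 * (3 * R * ?m * ?Jn) / sqrt s \<le> 6 * R * ?m * sqrt (?hn\<^sup>2 + ?Jn\<^sup>2) / sqrt s"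
      "?m * ?hn \<le> ?m * sqrt (?hn\<^sup>2 + ?Jn\<^sup>2) / sqrt s"
      using U(3) by (auto intro!: divide_right_mono mult_left_mono intro: order_trans)
  qed (use s in auto)
  also have "\<dots> = ?m * (1 + 6 * R) * s\<^sup>2 * sqrt s * sqrt (?hn\<^sup>2 + ?Jn\<^sup>2)"
  proof -
    have eq: "s ^ 3 = s\<^sup>2 * (sqrt s * sqrt s)" using s by (simp add: power3_eq_cube power2_eq_square)
    have *: "a * (q * q) * (m * E / q + 6 * R * m * E / q) = m * (1 + 6 * R) * a * q * E" if "q > 0" for a m E q :: real
      using that by (simp add: field_simps)
    show ?thesis unfolding eq by (rule *) (use s in simp)
  qed
  finally show ?thesis .
qed

text \<open>The argument is nested as \<open>((t, z), s)\<close> in order that Lebesgue measure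
  splits into the measure of the plane parameters \<open>(t, z)\<close> and that of the normal
  parameter \<open>s\<close>.\<close>

definition frame :: "real^3 \<Rightarrow> real^3 \<Rightarrow> real^3 \<Rightarrow> (real \<times> real) \<times> real \<Rightarrow> real^3" where
  "frame a b n y = fst (fst y) *\<^sub>R a + snd (fst y) *\<^sub>R b + snd y *\<^sub>R n"

definition orthonormal3 :: "real^3 \<Rightarrow> real^3 \<Rightarrow> real^3 \<Rightarrow> bool" where
  "orthonormal3 a b n \<longleftrightarrow> a \<bullet> a = 1 \<and> b \<bullet> b = 1 \<and> n \<bullet> n = 1 \<and> a \<bullet> b = 0 \<and> a \<bullet> n = 0 \<and> b \<bullet> n = 0"

text \<open>It suffices to measure preimages of boxes. Such a preimage is the image of the box under
  the inverse map, which is orthogonal too and so preserves Lebesgue measure.\<close>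

lemma distr_orthogonal:
  fixes R :: "real^3 \<Rightarrow> real^3"
  assumes "orthogonal_transformation R"
  shows "distr lborel borel R = lborel"
proof (rule lborel_eqI[symmetric])
  fix l u :: "real^3" assume lu: "\<And>b. b \<in> Basis \<Longrightarrow> l \<bullet> b \<le> u \<bullet> b"
  have cont: "continuous_on UNIV R"
    using orthogonal_transformation_linear[OF assms] by (simp add: linear_conv_bounded_linear linear_continuous_on)
  then have [measurable]: "R \<in> borel_measurable borel" by (rule borel_measurable_continuous_onI)
  have inv: "orthogonal_transformation (inv R)" "bij R"
    using assms by (simp_all add: orthogonal_transformation_inv orthogonal_transformation_bij)
  have vim: "R -` box l u = inv R ` box l u"
    using inv(2) by (simp add: bij_vimage_eq_inv_image)
  have "emeasure (distr lborel borel R) (box l u) = emeasure lborel (R -` box l u)"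
    by (simp add: emeasure_distr)
  also have "R -` box l u \<in> sets borel"
    using cont by (intro borel_open open_vimage) auto
  then have "emeasure lborel (R -` box l u) = emeasure lebesgue (inv R ` box l u)"
    by (simp add: vim)
  also have "\<dots> = emeasure lebesgue (box l u)"
    using measure_orthogonal_image[OF inv(1), of "box l u"] measurable_orthogonal_image[OF inv(1), of "box l u"]
    by (simp add: emeasure_eq_measure2 fmeasurableD2)
  also have "\<dots> = ennreal (prod ((\<bullet>) (u - l)) Basis)"
    using lu by (simp add: emeasure_lborel_box_eq)
  finally show "emeasure (distr lborel borel R) (box l u) = ennreal (prod ((\<bullet>) (u - l)) Basis)" .
qed simp

lemma continuous_on_vector3 [continuous_intros]:
  assumes "continuous_on S f" "continuous_on S g" "continuous_on S h"
  shows "continuous_on S (\<lambda>x. vector [f x, g x, h x] :: real^3)"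
proof -
  have "(\<lambda>x. vector [f x, g x, h x] :: real^3) = (\<lambda>x. \<chi> i. if i = 1 then f x else if i = 2 then g x else h x)"
    by (auto simp: vec_eq_iff forall_3)
  moreover have "continuous_on S (\<lambda>x. if i = 1 then f x else if i = 2 then g x else h x)" for i :: 3
    using assms exhaust_3[of i] by auto
  ultimately show ?thesis by (simp only: continuous_on_vec_lambda)
qed

text \<open>Three-dimensional vectors are identified with nested pairs, so that integrals over space
  become iterated integrals over a plane and a line.\<close>

lemma distr_coordinates:
  "distr lborel borel (\<lambda>y :: (real \<times> real) \<times> real. vector [fst (fst y), snd (fst y), snd y] :: real^3) = lborel"
  (is "distr lborel borel ?V = _")
proof (rule lborel_eqI[symmetric])
  fix l u :: "real^3" assume lu: "\<And>b. b \<in> Basis \<Longrightarrow> l \<bullet> b \<le> u \<bullet> b"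
  have [measurable]: "?V \<in> borel_measurable borel"
    by (intro borel_measurable_continuous_onI continuous_intros)
  have vim: "?V -` box l u = box ((l$1, l$2), l$3) ((u$1, u$2), u$3)"
    by (auto simp: mem_box_vec3 forall_3 mem_box Basis_prod_def)
  have lu3: "l $ i \<le> u $ i" for i
    using lu[of "axis i 1"] by (simp add: inner_axis axis_in_Basis_iff)
  have "emeasure (distr lborel borel ?V) (box l u) = emeasure lborel (box ((l$1, l$2), l$3) ((u$1, u$2), u$3))"
    by (simp add: emeasure_distr vim)
  also have "\<dots> = ennreal ((u$1 - l$1) * (u$2 - l$2) * (u$3 - l$3))"
    using lu3 by (subst emeasure_lborel_box_eq)
      (auto simp: Basis_prod_def prod.union_disjoint prod.reindex inj_on_def)
  also have "(u$1 - l$1) * (u$2 - l$2) * (u$3 - l$3) = prod ((\<bullet>) (u - l)) Basis"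
  proof -
    have "prod ((\<bullet>) (u - l)) Basis = (\<Prod>i\<in>UNIV. (u - l) $ i)"
      unfolding Basis_vec_def
      by (simp add: UNION_singleton_eq_range image_image[symmetric] prod.reindex inj_on_def axis_eq_axis inner_axis)
    then show ?thesis by (simp add: prod_3)
  qed
  finally show "emeasure (distr lborel borel ?V) (box l u) = ennreal (prod ((\<bullet>) (u - l)) Basis)" .
qed simp

lemma inner_vec3: "x \<bullet> y = x$1 * y$1 + x$2 * y$2 + x$3 * y$3" for x y :: "real^3"
  by (simp add: inner_vec_def sum_3)

lemma continuous_frame [continuous_intros]: "continuous_on S f \<Longrightarrow> continuous_on S (\<lambda>x. frame a b n (f x))"
  unfolding frame_def by (intro continuous_intros)

lemma distr_frame:
  assumes "orthonormal3 a b n"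
  shows "distr lborel borel (\<lambda>y. o' + frame a b n y) = lborel"
proof -
  define V where "V = (\<lambda>y :: (real \<times> real) \<times> real. vector [fst (fst y), snd (fst y), snd y] :: real^3)"
  define R where "R x = x$1 *\<^sub>R a + x$2 *\<^sub>R b + x$3 *\<^sub>R n" for x :: "real^3"
  have R: "orthogonal_transformation R"
    unfolding orthogonal_transformation_def
  proof
    show "linear R" by (rule linearI) (auto simp: R_def algebra_simps)
    show "\<forall>v w. R v \<bullet> R w = v \<bullet> w"
    proof (intro allI)
      fix v w
      show "R v \<bullet> R w = v \<bullet> w"
        using assms unfolding orthonormal3_def R_def inner_vec3[of v w]
        by (simp add: inner_add_left inner_add_right inner_commute[of b a] inner_commute[of n a] inner_commute[of n b])
    qed
  qed
  have [measurable]: "R \<in> borel_measurable borel"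
    unfolding R_def by (intro borel_measurable_continuous_onI continuous_intros)
  have [measurable]: "V \<in> borel_measurable borel"
    unfolding V_def by (intro borel_measurable_continuous_onI continuous_intros)
  have "(\<lambda>y. o' + frame a b n y) = ((+) o') \<circ> (R \<circ> V)"
    by (auto simp: frame_def R_def V_def)
  then have "distr lborel borel (\<lambda>y. o' + frame a b n y) = distr (distr (distr lborel borel V) borel R) borel ((+) o')"
    by (simp add: distr_distr comp_assoc)
  also have "\<dots> = lborel"
    unfolding V_def distr_coordinates distr_orthogonal[OF R] by (rule lborel_distr_plus)
  finally show ?thesis .
qed

text \<open>The value at depth 0 differs from the value at depth \<open>s\<close> by an integral of
  \<open>J\<close> along the normal; averaging over \<open>s\<close> between 0 and \<open>r\<close>
  explains the factor 1 / r. Since \<open>k\<close> need not be differentiable on the face, the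
  boundary value enters only as the limit \<open>lim\<close> from inside.\<close>

lemma trace_estimate:
  fixes k :: "real^3 \<Rightarrow> complex^3"
  defines "\<Psi> \<equiv> \<lambda>o' a b n y s. o' + frame a b n (y, s)"
  assumes on: "orthonormal3 a b n" and r: "r > 0"
    and B: "B \<in> sets borel" and k: "c1_on D k J" and D: "open D"
    and Q: "Q \<in> sets borel" "Q \<subseteq> D"
    and sub: "\<And>y s. y \<in> B \<Longrightarrow> 0 < s \<Longrightarrow> s < r \<Longrightarrow> \<Psi> o' a b n y s \<in> Q"
    and lim: "\<And>y. y \<in> B \<Longrightarrow> ((\<lambda>s. k (\<Psi> o' a b n y s)) \<longlongrightarrow> k (\<Psi> o' a b n y 0)) (at_right 0)"
  shows "(\<integral>\<^sup>+y. ennreal (norm (k (\<Psi> o' a b n y 0))) * indicator B y \<partial>lborel) \<le>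
    ennreal (1 / r) * (\<integral>\<^sup>+x. ennreal (norm (k x)) * indicator Q x \<partial>lborel) +
    3 * (\<integral>\<^sup>+x. ennreal (norm (J x)) * indicator Q x \<partial>lborel)"
proof -
  let ?P = "\<lambda>y s. o' + frame a b n (y, s)"
  have n1: "norm n = 1" using on by (simp add: orthonormal3_def norm_eq_1)
  have line: "?P y t = ?P y 0 + t *\<^sub>R n" for y t by (simp add: frame_def)
  \<comment> \<open>The integral of \<open>g\<close> over the normal segment above \<open>y\<close>.
    The indicator of \<open>Q\<close>, which is 1 on the segment, is kept inside so that integration
    over \<open>y\<close> can be compared with the integral over \<open>Q\<close>.\<close>
  define G where "G g y = (\<integral>\<^sup>+s. (g (?P y s) * indicator Q (?P y s) :: ennreal) * indicator B y * indicator {0<..<r} s \<partial>lborel)" for g y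
  let ?k = "\<lambda>x. ennreal (norm (k x))" and ?J = "\<lambda>x. ennreal (norm (J x))"
  have pw: "ennreal r * (?k (?P y 0) * indicator B y) \<le> G ?k y + ennreal (3 * r) * G ?J y" for y
  proof (cases "y \<in> B")
    case True
    have inQ: "?P y s \<in> Q" if "0 < s" "s < r" for s using sub[OF True that] by (simp add: \<Psi>_def)
    have *: "?k (?P y \<sigma>) \<le> ?k (?P y s) + 3 * G ?J y" if "0 < \<sigma>" "\<sigma> < s" "s < r" for \<sigma> s
    proof -
      have "?k (?P y \<sigma>) \<le> ennreal (norm (k (?P y s)) + norm (k (?P y 0 + s *\<^sub>R n) - k (?P y 0 + \<sigma> *\<^sub>R n)))"
        using norm_triangle_ineq2[of "k (?P y \<sigma>)" "k (?P y s)"]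
        by (intro ennreal_leI) (simp add: line[of y s] line[of y \<sigma>] norm_minus_commute)
      also have "\<dots> = ?k (?P y s) + ennreal (norm (k (?P y 0 + s *\<^sub>R n) - k (?P y 0 + \<sigma> *\<^sub>R n)))"
        by simp
      also have "ennreal (norm (k (?P y 0 + s *\<^sub>R n) - k (?P y 0 + \<sigma> *\<^sub>R n))) \<le>
          (\<integral>\<^sup>+t. ennreal (3 * norm n * norm (J (?P y 0 + t *\<^sub>R n))) * indicator {\<sigma>..s} t \<partial>lborel)"
        by (rule c1_on_line_le[OF k]) (use that inQ Q(2) in \<open>auto simp: line[symmetric]\<close>)
      also have "\<dots> \<le> (\<integral>\<^sup>+t. 3 * (?J (?P y t) * indicator Q (?P y t) * indicator B y * indicator {0<..<r} t) \<partial>lborel)"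
        using that inQ True by (intro nn_integral_mono)
          (auto simp: n1 line[symmetric] ennreal_mult split: split_indicator)
      also have "\<dots> = 3 * G ?J y"
        unfolding G_def
      proof (rule nn_integral_cmult)
        have "(\<lambda>x. ?J x * indicator Q x) = (\<lambda>x. ennreal (indicator Q x * norm (J x)))"
          by (auto split: split_indicator)
        moreover have "(\<lambda>x. indicator Q x * norm (J x)) \<in> borel_measurable borel"
        proof -
          have "(\<lambda>x. indicator Q x *\<^sub>R norm (J x)) \<in> borel_measurable borel"
            using k Q by (intro borel_measurable_continuous_on_indicator continuous_intros)
              (auto simp: c1_on_def intro: continuous_on_subset)
          then show ?thesis by simp
        qed
        ultimately have [measurable]: "(\<lambda>x. ?J x * indicator Q x) \<in> borel_measurable borel" by simp
        have [measurable]: "(\<lambda>t. ?P y t) \<in> borel_measurable borel"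
          by (intro borel_measurable_continuous_onI continuous_intros)
        show "(\<lambda>t. ?J (?P y t) * indicator Q (?P y t) * indicator B y * indicator {0<..<r} t) \<in> borel_measurable lborel"
          using measurable_compose[of "\<lambda>t. ?P y t" borel borel "\<lambda>x. ?J x * indicator Q x" borel]
          by simp
      qed
      finally show ?thesis by (simp add: add_left_mono)
    qed
    \<comment> \<open>The bound between two positive depths is uniform in the lower one, so this can
      tend to 0.\<close>
    have **: "?k (?P y 0) \<le> ?k (?P y s) + 3 * G ?J y" if "0 < s" "s < r" for s
    proof (rule tendsto_upperbound)
      show "((\<lambda>\<sigma>. ?k (?P y \<sigma>)) \<longlongrightarrow> ?k (?P y 0)) (at_right 0)"
        using lim[OF True] unfolding \<Psi>_def by (intro tendsto_intros)
      show "\<forall>\<^sub>F \<sigma> in at_right 0. ?k (?P y \<sigma>) \<le> ?k (?P y s) + 3 * G ?J y"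
        using *[OF _ _ that(2)] that(1) by (auto simp: eventually_at_right_field intro!: exI[of _ s])
    qed simp
    have "ennreal r * (?k (?P y 0) * indicator B y) = (\<integral>\<^sup>+s. ?k (?P y 0) * indicator {0<..<r} s \<partial>lborel)"
      using True r by (subst nn_integral_cmult_indicator) (auto simp: mult.commute)
    also have "\<dots> \<le> (\<integral>\<^sup>+s. ?k (?P y s) * indicator Q (?P y s) * indicator B y * indicator {0<..<r} s
        + 3 * G ?J y * indicator {0<..<r} s \<partial>lborel)"
      using ** inQ True by (intro nn_integral_mono) (auto split: split_indicator)
    also have "\<dots> = G ?k y + (\<integral>\<^sup>+s. 3 * G ?J y * indicator {0<..<r} s \<partial>lborel)"
      unfolding G_def[of ?k]
    proof (rule nn_integral_add)
      have "(\<lambda>x. ?k x * indicator Q x) = (\<lambda>x. ennreal (indicator Q x * norm (k x)))"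
        by (auto split: split_indicator)
      moreover have "(\<lambda>x. indicator Q x * norm (k x)) \<in> borel_measurable borel"
      proof -
        have "(\<lambda>x. indicator Q x *\<^sub>R norm (k x)) \<in> borel_measurable borel"
          using c1_on_continuous[OF k] Q by (intro borel_measurable_continuous_on_indicator continuous_intros)
            (auto intro: continuous_on_subset)
        then show ?thesis by simp
      qed
      ultimately have [measurable]: "(\<lambda>x. ?k x * indicator Q x) \<in> borel_measurable borel" by simp
      have [measurable]: "(\<lambda>t. ?P y t) \<in> borel_measurable borel"
        by (intro borel_measurable_continuous_onI continuous_intros)
      show "(\<lambda>t. ?k (?P y t) * indicator Q (?P y t) * indicator B y * indicator {0<..<r} t) \<in> borel_measurable lborel"
        using measurable_compose[of "\<lambda>t. ?P y t" borel borel "\<lambda>x. ?k x * indicator Q x" borel]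
        by simp
    qed simp
    also have "(\<integral>\<^sup>+s. 3 * G ?J y * indicator {0<..<r} s \<partial>lborel) = ennreal (3 * r) * G ?J y"
      using r by (subst nn_integral_cmult_indicator) (auto simp: ennreal_mult mult_ac)
    finally show ?thesis .
  qed simp
  have swap: "(\<integral>\<^sup>+y. G (\<lambda>x. ennreal (norm (g x))) y \<partial>lborel) \<le> (\<integral>\<^sup>+x. ennreal (norm (g x)) * indicator Q x \<partial>lborel)"
    and meas: "G (\<lambda>x. ennreal (norm (g x))) \<in> borel_measurable borel"
    if g: "continuous_on D g" for g :: "real^3 \<Rightarrow> 'c::euclidean_space"
  proof -
    let ?g = "\<lambda>x. ennreal (norm (g x)) * indicator Q x"
    have "?g = (\<lambda>x. ennreal (indicator Q x * norm (g x)))"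
      by (auto split: split_indicator)
    moreover have "(\<lambda>x. indicator Q x * norm (g x)) \<in> borel_measurable borel"
    proof -
      have "(\<lambda>x. indicator Q x *\<^sub>R norm (g x)) \<in> borel_measurable borel"
        using g Q by (intro borel_measurable_continuous_on_indicator continuous_intros)
          (auto intro: continuous_on_subset)
      then show ?thesis by simp
    qed
    ultimately have gm [measurable]: "?g \<in> borel_measurable borel" by simp
    have P [measurable]: "(\<lambda>z. o' + frame a b n z) \<in> borel_measurable borel"
      by (intro borel_measurable_continuous_onI continuous_intros)
    have gP: "(\<lambda>z. ?g (o' + frame a b n z)) \<in> borel_measurable borel"
      using measurable_compose[OF P gm] .
    note [measurable] = B
    have m: "(\<lambda>(y, s). ?g (?P y s) * indicator B y * indicator {0<..<r} s) \<in> borel_measurable (lborel \<Otimes>\<^sub>M lborel)"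
    proof -
      have [measurable]: "(\<lambda>z. ?g (o' + frame a b n z)) \<in> borel_measurable (borel \<Otimes>\<^sub>M borel)"
        using gP by (simp add: borel_prod)
      have "(\<lambda>z. ?g (o' + frame a b n z) * indicator B (fst z) * indicator {0<..<r} (snd z)) \<in> borel_measurable (borel \<Otimes>\<^sub>M borel)"
        by measurable
      then show ?thesis by (simp add: case_prod_unfold)
    qed
    show "G (\<lambda>x. ennreal (norm (g x))) \<in> borel_measurable borel"
      using lborel.borel_measurable_nn_integral[OF m] by (simp add: G_def[abs_def])
    have "(\<integral>\<^sup>+y. G (\<lambda>x. ennreal (norm (g x))) y \<partial>lborel) = (\<integral>\<^sup>+z. ?g (o' + frame a b n z) * indicator B (fst z) * indicator {0<..<r} (snd z) \<partial>(lborel \<Otimes>\<^sub>M lborel))"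
      unfolding G_def using lborel.nn_integral_fst[OF m] by (simp add: case_prod_unfold)
    also have "\<dots> = (\<integral>\<^sup>+z. ?g (o' + frame a b n z) * indicator B (fst z) * indicator {0<..<r} (snd z) \<partial>lborel)"
      by (simp only: lborel_prod)
    also have "\<dots> \<le> (\<integral>\<^sup>+z. ?g (o' + frame a b n z) \<partial>lborel)"
      by (intro nn_integral_mono) (auto split: split_indicator)
    also have "\<dots> = (\<integral>\<^sup>+x. ?g x \<partial>distr lborel borel (\<lambda>z. o' + frame a b n z))"
      by (subst nn_integral_distr) auto
    also have "\<dots> = (\<integral>\<^sup>+x. ?g x \<partial>lborel)"
      by (simp only: distr_frame[OF on])
    finally show "(\<integral>\<^sup>+y. G (\<lambda>x. ennreal (norm (g x))) y \<partial>lborel) \<le> (\<integral>\<^sup>+x. ennreal (norm (g x)) * indicator Q x \<partial>lborel)" .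
  qed
  have ck: "continuous_on D k" and cJ: "continuous_on D J"
    using k c1_on_continuous[OF k] by (auto simp: c1_on_def)
  have "(\<integral>\<^sup>+y. ?k (?P y 0) * indicator B y \<partial>lborel) \<le>
      (\<integral>\<^sup>+y. ennreal (1 / r) * (G ?k y + ennreal (3 * r) * G ?J y) \<partial>lborel)"
  proof (intro nn_integral_mono)
    fix y
    have "?k (?P y 0) * indicator B y = ennreal (1 / r) * (ennreal r * (?k (?P y 0) * indicator B y))"
      using r by (simp add: mult.assoc[symmetric] ennreal_mult[symmetric])
    also have "\<dots> \<le> ennreal (1 / r) * (G ?k y + ennreal (3 * r) * G ?J y)"
      by (intro mult_left_mono pw) auto
    finally show "?k (?P y 0) * indicator B y \<le> ennreal (1 / r) * (G ?k y + ennreal (3 * r) * G ?J y)" .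
  qed
  also have "\<dots> = ennreal (1 / r) * ((\<integral>\<^sup>+y. G ?k y \<partial>lborel) + ennreal (3 * r) * (\<integral>\<^sup>+y. G ?J y \<partial>lborel))"
    using meas[OF ck] meas[OF cJ] by (simp add: nn_integral_cmult nn_integral_add)
  also have "\<dots> \<le> ennreal (1 / r) * ((\<integral>\<^sup>+x. ?k x * indicator Q x \<partial>lborel) + ennreal (3 * r) * (\<integral>\<^sup>+x. ?J x * indicator Q x \<partial>lborel))"
    by (intro mult_left_mono add_mono swap ck cJ) auto
  also have "\<dots> = ennreal (1 / r) * (\<integral>\<^sup>+x. ?k x * indicator Q x \<partial>lborel) + 3 * (\<integral>\<^sup>+x. ?J x * indicator Q x \<partial>lborel)"
    using r by (simp add: distrib_left mult.assoc[symmetric] ennreal_mult[symmetric])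
  finally show ?thesis unfolding \<Psi>_def .
qed

section \<open>Two-dimensional Hausdorff measure\<close>

definition S2 :: "(real^3) measure" where "S2 = measure_of UNIV (sets borel) hausdorff2"

text \<open>\<open>S2\<close> is the zero measure unless the Hausdorff functional is countably additive on Borel
  sets. This is not proved here: in the degenerate case all Herglotz functions vanish, so that
  the approximation hypothesis forces \<open>v = 0\<close> near the edge.\<close>

definition hausdorff2_measure :: bool where
  "hausdorff2_measure \<longleftrightarrow> measure_space UNIV (sets (borel :: (real^3) measure)) hausdorff2"

lemma space_S2 [simp]: "space S2 = UNIV" and sets_S2 [simp, measurable_cong]: "sets S2 = sets borel"
  using sets.sigma_sets_eq[of "borel :: (real^3) measure"] by (auto simp: S2_def)

lemma sigma_sets_borel: "sigma_sets UNIV (sets borel) = sets (borel :: (real^3) measure)"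
  using sets.sigma_sets_eq[of "borel :: (real^3) measure"] by simp

lemma emeasure_S2: "hausdorff2_measure \<Longrightarrow> A \<in> sets borel \<Longrightarrow> emeasure S2 A = hausdorff2 A"
  unfolding S2_def hausdorff2_measure_def
  by (rule emeasure_measure_of_sigma) (auto simp: measure_space_def sets.sigma_algebra_axioms[of borel, simplified])

lemma emeasure_S2_junk: "\<not> hausdorff2_measure \<Longrightarrow> emeasure S2 A = 0"
  unfolding S2_def hausdorff2_measure_def
  by (subst emeasure_measure_of_conv) (auto simp: sigma_sets_borel)

lemma hausdorff2_mono: "A \<subseteq> B \<Longrightarrow> hausdorff2 A \<le> hausdorff2 B"
  unfolding hausdorff2_def by (intro SUP_mono' INF_superset_mono) auto

text \<open>A plane set of diameter \<open>d\<close> lies in a square of side \<open>2 * d\<close>. Two-sided bounds with crude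
  constants suffice in place of the isodiametric inequality.\<close>

lemma hausdorff2_lower:
  fixes E :: "real \<times> real \<Rightarrow> real^3"
  assumes E: "\<And>y z. dist y z \<le> dist (E y) (E z)"
  shows "ennreal (pi / 16) * emeasure lborel A \<le> hausdorff2 (E ` A)"
proof -
  have "ennreal (pi / 16) * emeasure lborel A \<le> (\<Sum>n. ennreal (pi / 4 * (diameter (C n))\<^sup>2))"
    if C: "\<And>n. bounded (C n)" "E ` A \<subseteq> (\<Union>n. C n)" for C :: "nat \<Rightarrow> (real^3) set"
  proof -
    define d where "d n = diameter (C n)" for n
    have d0: "d n \<ge> 0" for n unfolding d_def using C(1) by (rule diameter_ge_0)
    define z where "z n = (SOME y. E y \<in> C n)" for n
    \<comment> \<open>Centred at a point of the piece, the square must have side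
      \<open>2 * d n\<close>. Its area \<open>4 * (d n)\<^sup>2\<close> is what the factor pi / 16
      converts into the summand pi / 4 times the squared diameter.\<close>
    define X where "X n = cbox (fst (z n) - d n, snd (z n) - d n) (fst (z n) + d n, snd (z n) + d n)" for n
    have "A \<subseteq> (\<Union>n. X n)"
    proof
      fix y assume "y \<in> A"
      then obtain n where n: "E y \<in> C n" using C(2) by auto
      then have "E (z n) \<in> C n" unfolding z_def by (rule someI)
      then have "dist (E y) (E (z n)) \<le> d n"
        unfolding d_def using n C(1) by (intro diameter_bounded_bound)
      then have "dist y (z n) \<le> d n" using E order_trans by blast
      then have "dist (fst y) (fst (z n)) \<le> d n" "dist (snd y) (snd (z n)) \<le> d n"
        using dist_fst_le[of y "z n"] dist_snd_le[of y "z n"] by linarith+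
      then have "y \<in> X n"
        unfolding X_def by (cases y) (auto simp: mem_box Basis_prod_def dist_real_def abs_le_iff)
      then show "y \<in> (\<Union>n. X n)" by blast
    qed
    then have "emeasure lborel A \<le> emeasure lborel (\<Union>n. X n)"
      by (intro emeasure_mono) (auto simp: X_def)
    also have "\<dots> \<le> (\<Sum>n. emeasure lborel (X n))"
      by (intro emeasure_subadditive_countably) (auto simp: X_def)
    also have "\<dots> = (\<Sum>n. ennreal (4 * (d n)\<^sup>2))"
    proof (intro suminf_cong)
      fix n
      show "emeasure lborel (X n) = ennreal (4 * (d n)\<^sup>2)"
        unfolding X_def using d0[of n]
        by (subst emeasure_lborel_cbox_eq)
          (auto simp: Basis_prod_def prod.union_disjoint prod.reindex inj_on_def power2_eq_square)
    qed
    finally have "ennreal (pi / 16) * emeasure lborel A \<le> ennreal (pi / 16) * (\<Sum>n. ennreal (4 * (d n)\<^sup>2))"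
      by (intro mult_left_mono) auto
    also have "\<dots> = (\<Sum>n. ennreal (pi / 16) * ennreal (4 * (d n)\<^sup>2))"
      by (rule ennreal_suminf_cmult[symmetric])
    also have "\<dots> = (\<Sum>n. ennreal (pi / 4 * (diameter (C n))\<^sup>2))"
      by (intro suminf_cong) (simp add: d_def ennreal_mult[symmetric])
    finally show ?thesis .
  qed
  \<comment> \<open>The bound holds for covers of any mesh, so the single value 1 of \<delta>
    already bounds the supremum from below.\<close>
  then show ?thesis
    unfolding hausdorff2_def by (intro SUP_upper2[of 1] INF_greatest) auto
qed

lemma abs_prod_le: "\<bar>fst y - fst z\<bar> \<le> dist y z" "\<bar>snd y - snd z\<bar> \<le> dist y z"
  "dist y z \<le> \<bar>fst y - fst z\<bar> + \<bar>snd y - snd z\<bar>" for y z :: "real \<times> real"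
proof -
  show "\<bar>fst y - fst z\<bar> \<le> dist y z" "\<bar>snd y - snd z\<bar> \<le> dist y z"
    using dist_fst_le[of y z] dist_snd_le[of y z] by (simp_all add: dist_real_def)
  show "dist y z \<le> \<bar>fst y - fst z\<bar> + \<bar>snd y - snd z\<bar>"
    unfolding dist_prod_def dist_real_def by (rule sqrt_sum_squares_le_sum_abs[THEN order_trans]) simp
qed

lemma grid_index:
  assumes "u \<le> t" "t \<le> u + l" "l > 0" "N \<ge> (1::nat)"
  obtains i where "i < N" "\<bar>t - (u + real i * (l / real N))\<bar> \<le> l / real N"
proof -
  define s where "s = (t - u) * real N / l"
  have "(t - u) * real N \<le> l * real N" using assms by (intro mult_right_mono) auto
  then have s: "0 \<le> s" "s \<le> real N"
    using assms by (auto simp: s_def divide_le_eq mult.commute)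
  \<comment> \<open>The minimum guards the right end of the interval, where the floor would be
    \<open>N\<close>, one past the last index.\<close>
  define i where "i = min (N - 1) (nat \<lfloor>s\<rfloor>)"
  have "\<bar>s - real i\<bar> \<le> 1"
  proof (cases "nat \<lfloor>s\<rfloor> \<le> N - 1")
    case True
    then have "real i = of_int \<lfloor>s\<rfloor>" using s by (simp add: i_def min_absorb2)
    then show ?thesis by linarith
  next
    case False
    then have "real N \<le> of_int \<lfloor>s\<rfloor>" "i = N - 1" using s by (auto simp: i_def)
    then show ?thesis using s assms(4) by linarith
  qed
  moreover have "t - (u + real i * (l / real N)) = (s - real i) * (l / real N)"
    using assms by (simp add: s_def field_simps)
  ultimately have "\<bar>t - (u + real i * (l / real N))\<bar> \<le> 1 * (l / real N)"
    using assms by (simp add: abs_mult divide_right_mono)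
  moreover have "i < N" using assms(4) by (simp add: i_def)
  ultimately show ?thesis using that by simp
qed

text \<open>The square is covered by the cells of an N by N grid. The number of cells times the
  squared diameter bound of their images does not depend on N, so the mesh can be refined at no
  cost.\<close>

lemma hausdorff2_upper:
  fixes f :: "real \<times> real \<Rightarrow> real^3"
  assumes l: "l > 0" and f: "L-lipschitz_on (cbox (u, v) (u + l, v + l)) f"
  shows "hausdorff2 (f ` cbox (u, v) (u + l, v + l)) \<le> ennreal (4 * pi * L\<^sup>2 * l\<^sup>2)"
proof -
  let ?Q = "cbox (u, v) (u + l, v + l)"
  have L: "L \<ge> 0" using f by (rule lipschitz_on_nonneg)
  have "(INF C\<in>{C :: nat \<Rightarrow> (real^3) set. (\<forall>n. bounded (C n) \<and> diameter (C n) \<le> \<delta>) \<and> f ` ?Q \<subseteq> (\<Union>n. C n)}.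
       (\<Sum>n. ennreal (pi / 4 * (diameter (C n))\<^sup>2))) \<le> ennreal (4 * pi * L\<^sup>2 * l\<^sup>2)" if \<delta>: "\<delta> > 0" for \<delta>
  proof -
    obtain N :: nat where N: "real N > 4 * L * l / \<delta>" "N \<ge> 1"
    proof -
      obtain n where "real n > 4 * L * l / \<delta>" using reals_Archimedean2 by blast
      then show ?thesis by (intro that[of "Suc n"]) auto
    qed
    have N\<delta>: "4 * L * (l / real N) \<le> \<delta>"
      using N \<delta> by (simp add: field_simps)
    \<comment> \<open>The points within \<open>l / N\<close> of a grid node in each coordinate, so
      that two of them are at most \<open>4 * (l / N)\<close> apart. The pair of node indices is
      encoded as the two base-N digits of \<open>n\<close>.\<close>
    define G where "G n = {y \<in> ?Q. \<bar>fst y - (u + real (n div N) * (l / real N))\<bar> \<le> l / real N \<and>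
      \<bar>snd y - (v + real (n mod N) * (l / real N))\<bar> \<le> l / real N}" for n
    define C where "C n = (if n < N * N then f ` G n else {})" for n
    have near: "norm (x - y) \<le> 4 * L * (l / real N)" if "x \<in> f ` G n" "y \<in> f ` G n" for x y n
    proof -
      obtain x' y' where xy: "x' \<in> G n" "y' \<in> G n" "x = f x'" "y = f y'" using \<open>x \<in> f ` G n\<close> \<open>y \<in> f ` G n\<close> by auto
      have "dist x y \<le> L * dist x' y'"
        unfolding xy using f xy(1,2) by (intro lipschitz_onD) (auto simp: G_def)
      also have "dist x' y' \<le> 4 * (l / real N)"
        using abs_prod_le(3)[of x' y'] xy(1,2) unfolding G_def by auto
      finally show ?thesis using L by (simp add: dist_norm mult_left_mono mult.assoc mult.left_commute)
    qed
    have bC: "bounded (C n)" for n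
    proof -
      have "bounded (f ` G n)"
        unfolding bounded_two_points using near by (intro exI[of _ "4 * L * (l / real N)"]) (auto simp: dist_norm)
      then show ?thesis by (simp add: C_def)
    qed
    have dC: "diameter (C n) \<le> 4 * L * (l / real N)" for n
    proof (rule diameter_le)
      show "C n \<noteq> {} \<or> 0 \<le> 4 * L * (l / real N)" using L l by simp
      fix x y assume "x \<in> C n" "y \<in> C n"
      then show "norm (x - y) \<le> 4 * L * (l / real N)"
        by (intro near[of x n y]) (auto simp: C_def split: if_splits)
    qed
    have cov: "f ` ?Q \<subseteq> (\<Union>n. C n)"
    proof
      fix x assume "x \<in> f ` ?Q"
      then obtain y where y: "y \<in> ?Q" "x = f y" by auto
      have y': "u \<le> fst y" "fst y \<le> u + l" "v \<le> snd y" "snd y \<le> v + l"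
        using y(1) by (cases y; auto simp: mem_box Basis_prod_def)+
      obtain i j where ij: "i < N" "\<bar>fst y - (u + real i * (l / real N))\<bar> \<le> l / real N"
        "j < N" "\<bar>snd y - (v + real j * (l / real N))\<bar> \<le> l / real N"
        using grid_index[OF y'(1,2) l N(2)] grid_index[OF y'(3,4) l N(2)] by metis
      have "i * N + j < N * N"
      proof -
        have "i * N + j < (i + 1) * N" using ij(3) by simp
        also have "\<dots> \<le> N * N" using ij(1) by (intro mult_right_mono) auto
        finally show ?thesis .
      qed
      moreover have "(i * N + j) div N = i" "(i * N + j) mod N = j" using ij by auto
      ultimately have "x \<in> C (i * N + j)"
        using y ij by (auto simp: C_def G_def)
      then show "x \<in> (\<Union>n. C n)" by blast
    qed
    have "(\<Sum>n. ennreal (pi / 4 * (diameter (C n))\<^sup>2)) = (\<Sum>n<N * N. ennreal (pi / 4 * (diameter (C n))\<^sup>2))"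
      by (rule suminf_finite) (auto simp: C_def)
    also have "\<dots> \<le> (\<Sum>n<N * N. ennreal (pi / 4 * (4 * L * (l / real N))\<^sup>2))"
      using dC bC by (intro sum_mono ennreal_leI mult_left_mono power_mono diameter_ge_0) auto
    also have "\<dots> = of_nat (N * N) * ennreal (pi / 4 * (4 * L * (l / real N))\<^sup>2)"
      by simp
    also have "\<dots> = ennreal (real (N * N) * (pi / 4 * (4 * L * (l / real N))\<^sup>2))"
      by (subst ennreal_of_nat_eq_real_of_nat, subst ennreal_mult) auto
    also have "real (N * N) * (pi / 4 * (4 * L * (l / real N))\<^sup>2) = 4 * pi * L\<^sup>2 * l\<^sup>2"
      using N(2) by (simp add: power2_eq_square field_simps)
    finally have *: "(\<Sum>n. ennreal (pi / 4 * (diameter (C n))\<^sup>2)) \<le> ennreal (4 * pi * L\<^sup>2 * l\<^sup>2)" .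
    show ?thesis
    proof (rule INF_lower2[where i = C])
      show "C \<in> {C. (\<forall>n. bounded (C n) \<and> diameter (C n) \<le> \<delta>) \<and> f ` ?Q \<subseteq> (\<Union>n. C n)}"
        using bC cov order_trans[OF dC N\<delta>] by auto
    qed (rule *)
  qed
  then show ?thesis
    unfolding hausdorff2_def by (intro SUP_least) auto
qed

lemma hausdorff2_lipschitz_finite:
  fixes f :: "real \<times> real \<Rightarrow> real^3"
  assumes "L-lipschitz_on UNIV f" "bounded P"
  shows "hausdorff2 (f ` P) < \<infinity>"
proof -
  obtain c where c: "c > 0" "\<And>y. y \<in> P \<Longrightarrow> norm y \<le> c"
    using assms(2) bounded_pos by blast
  have "P \<subseteq> cbox (- c, - c) (- c + 2 * c, - c + 2 * c)"
  proof
    fix y assume "y \<in> P"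
    then have "norm y \<le> c" by (rule c)
    then have "\<bar>fst y\<bar> \<le> c" "\<bar>snd y\<bar> \<le> c"
      using abs_prod_le(1,2)[of y 0] by auto
    then show "y \<in> cbox (- c, - c) (- c + 2 * c, - c + 2 * c)"
      by (cases y) (auto simp: mem_box Basis_prod_def)
  qed
  then have "hausdorff2 (f ` P) \<le> hausdorff2 (f ` cbox (- c, - c) (- c + 2 * c, - c + 2 * c))"
    by (intro hausdorff2_mono image_mono)
  also have "\<dots> \<le> ennreal (4 * pi * L\<^sup>2 * (2 * c)\<^sup>2)"
    using c(1) assms(1) by (intro hausdorff2_upper) (auto intro: lipschitz_on_subset)
  finally show ?thesis using ennreal_less_top[of "4 * pi * L\<^sup>2 * (2 * c)\<^sup>2"] by (simp add: le_less_trans)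
qed

lemma S2_lipschitz_finite:
  fixes f :: "real \<times> real \<Rightarrow> real^3"
  assumes "hausdorff2_measure" "L-lipschitz_on UNIV f" "bounded P" "A \<subseteq> f ` P" "A \<in> sets borel"
  shows "emeasure S2 A < \<infinity>"
  using hausdorff2_lipschitz_finite[OF assms(2,3)] hausdorff2_mono[OF assms(4)] emeasure_S2[OF assms(1,5)]
  by (simp add: le_less_trans)

lemma norm_vec3_le: "norm x \<le> \<bar>x$1\<bar> + \<bar>x$2\<bar> + \<bar>x$3\<bar>" for x :: "real^3"
  using norm_le_l1_cart[of x] by (simp add: sum_3)

text \<open>Spherical coordinates map a rectangle onto the sphere. As only finiteness matters, the
  Lipschitz constant 5 just adds up crude bounds for the three components.\<close>

lemma S2_sphere_finite:
  assumes "hausdorff2_measure"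
  shows "emeasure S2 (sphere 0 1) < \<infinity>"
proof (rule S2_lipschitz_finite[OF assms])
  let ?f = "\<lambda>y. vector [sin (fst y) * cos (snd y), sin (fst y) * sin (snd y), cos (fst y)] :: real^3"
  show "5-lipschitz_on UNIV ?f"
  proof (rule lipschitz_onI)
    fix y z :: "real \<times> real"
    let ?a = "\<bar>fst y - fst z\<bar>" and ?b = "\<bar>snd y - snd z\<bar>"
    have s: "\<bar>sin a - sin b\<bar> \<le> \<bar>a - b\<bar>" "\<bar>cos a - cos b\<bar> \<le> \<bar>a - b\<bar>" for a b :: real
    proof -
      show "\<bar>sin a - sin b\<bar> \<le> \<bar>a - b\<bar>"
        using field_differentiable_bound[of UNIV sin cos 1 a b] by (auto intro!: derivative_eq_intros)
      show "\<bar>cos a - cos b\<bar> \<le> \<bar>a - b\<bar>"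
        using field_differentiable_bound[of UNIV cos "\<lambda>x. - sin x" 1 a b] by (auto intro!: derivative_eq_intros)
    qed
    have p: "\<bar>a * b - a' * b'\<bar> \<le> \<bar>a - a'\<bar> + \<bar>b - b'\<bar>" if "\<bar>b\<bar> \<le> 1" "\<bar>a'\<bar> \<le> 1" for a a' b b' :: real
    proof -
      have "\<bar>a * b - a' * b'\<bar> = \<bar>(a - a') * b + a' * (b - b')\<bar>" by (simp add: algebra_simps)
      also have "\<dots> \<le> \<bar>a - a'\<bar> * \<bar>b\<bar> + \<bar>a'\<bar> * \<bar>b - b'\<bar>"
        by (metis abs_mult abs_triangle_ineq)
      also have "\<dots> \<le> \<bar>a - a'\<bar> * 1 + 1 * \<bar>b - b'\<bar>" using that by (intro add_mono mult_mono) auto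
      finally show ?thesis by simp
    qed
    have "dist (?f y) (?f z) \<le> (?a + ?b) + (?a + ?b) + ?a"
      using norm_vec3_le[of "?f y - ?f z"] s[of "fst y" "fst z"] s[of "snd y" "snd z"]
        p[of "cos (snd y)" "sin (fst z)" "sin (fst y)" "cos (snd z)"] p[of "sin (snd y)" "sin (fst z)" "sin (fst y)" "sin (snd z)"]
      unfolding dist_norm by simp
    then show "dist (?f y) (?f z) \<le> 5 * dist y z"
      using abs_prod_le[of y z] by linarith
  qed simp
  show "bounded (cbox (0, 0) (pi, 2 * pi))" by (rule bounded_cbox)
  show "sphere 0 1 \<subseteq> ?f ` cbox (0, 0) (pi, 2 * pi)"
  proof
    fix x :: "real^3" assume "x \<in> sphere 0 1"
    then have "norm x = 1" by simp
    then have x: "x$1 * x$1 + x$2 * x$2 + x$3 * x$3 = 1"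
      by (simp add: norm_eq_1 inner_vec3)
    have x3: "\<bar>x$3\<bar> \<le> 1"
      using component_le_norm_cart[of x 3] \<open>norm x = 1\<close> by simp
    define t where "t = arccos (x$3)"
    have t: "cos t = x$3" "0 \<le> t" "t \<le> pi" using x3 by (auto simp: t_def arccos_lbound arccos_ubound cos_arccos_abs)
    have st: "(sin t)\<^sup>2 = x$1 * x$1 + x$2 * x$2"
      using x t(1) sin_squared_eq[of t] by (simp add: power2_eq_square)
    \<comment> \<open>At the poles the azimuth is arbitrary and is taken to be 0; elsewhere the
      horizontal part divided by \<open>sin t\<close> is a point of the unit circle.\<close>
    obtain s where s: "0 \<le> s" "s \<le> 2 * pi" "x$1 = sin t * cos s" "x$2 = sin t * sin s"
    proof (cases "sin t = 0")
      case True
      then have "x$1 = 0" "x$2 = 0" using st by (simp_all add: sum_squares_eq_zero_iff)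
      with True show ?thesis by (intro that[of 0]) auto
    next
      case False
      have "(x$1 / sin t)\<^sup>2 + (x$2 / sin t)\<^sup>2 = (x$1 * x$1 + x$2 * x$2) / (sin t)\<^sup>2"
        by (simp add: power_divide add_divide_distrib power2_eq_square)
      also have "\<dots> = 1" unfolding st[symmetric] using False by simp
      finally obtain s where "0 \<le> s" "s < 2 * pi" "x$1 / sin t = cos s" "x$2 / sin t = sin s"
        using sincos_total_2pi by metis
      with False show ?thesis by (intro that[of s]) (auto simp: field_simps)
    qed
    have "x = ?f (t, s)"
      using s t by (simp add: vec_eq_iff forall_3)
    moreover have "(t, s) \<in> cbox (0, 0) (pi, 2 * pi)"
      using s t by (auto simp: mem_box Basis_prod_def)
    ultimately show "x \<in> ?f ` cbox (0, 0) (pi, 2 * pi)" by blast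
  qed
qed simp

text \<open>The bound for squares is extended to Borel sets by covering \<open>A\<close> from
  outside with dyadic squares of almost the same total area. The interiors of the squares are
  disjoint, so their areas add up to at most that of the union.\<close>

lemma S2_affine_upper:
  fixes E :: "real \<times> real \<Rightarrow> real^3"
  assumes H: hausdorff2_measure and E: "1-lipschitz_on UNIV E" and closed: "\<And>K. compact K \<Longrightarrow> E ` K \<in> sets borel"
    and A: "A \<in> sets borel" "bounded A" "E ` A \<in> sets borel"
  shows "emeasure S2 (E ` A) \<le> ennreal (4 * pi) * emeasure lborel A"
proof -
  obtain c where c: "c > 0" "\<And>y. y \<in> A \<Longrightarrow> norm y < c"
    using A(2) bounded_pos_less by blast
  let ?a = "(- c, - c) :: real \<times> real" and ?b = "(c, c) :: real \<times> real"
  have sub: "A \<subseteq> cbox ?a ?b"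
  proof
    fix y assume "y \<in> A"
    then have "norm y \<le> c" using c(2)[of y] by simp
    then have "\<bar>fst y\<bar> \<le> c" "\<bar>snd y\<bar> \<le> c"
      using abs_prod_le(1,2)[of y 0] by auto
    then show "y \<in> cbox ?a ?b" by (cases y) (auto simp: mem_box Basis_prod_def)
  qed
  have Al: "A \<in> lmeasurable" using A by (intro bounded_set_imp_lmeasurable) auto
  have box: "box ?a ?b \<noteq> {}" using c by (auto simp: box_ne_empty Basis_prod_def)
  have "emeasure S2 (E ` A) \<le> ennreal (4 * pi) * emeasure lborel A + ennreal e" if e: "e > 0" for e
  proof -
    \<comment> \<open>The excess area of the cover will be multiplied by 4 pi.\<close>
    define e' where "e' = e / (4 * pi)"
    have e': "e' > 0" using e by (simp add: e'_def)
    obtain \<D> where \<D>: "countable \<D>"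
      "\<And>K. K \<in> \<D> \<Longrightarrow> K \<subseteq> cbox ?a ?b \<and> K \<noteq> {} \<and> (\<exists>c d. K = cbox c d)"
      "pairwise (\<lambda>A B. interior A \<inter> interior B = {}) \<D>"
      "\<And>u v. cbox u v \<in> \<D> \<Longrightarrow> \<exists>n. \<forall>i \<in> Basis. v \<bullet> i - u \<bullet> i = (?b \<bullet> i - ?a \<bullet> i)/2^n"
      "\<And>K. \<lbrakk>K \<in> \<D>; box ?a ?b \<noteq> {}\<rbrakk> \<Longrightarrow> interior K \<noteq> {}"
      "A \<subseteq> \<Union>\<D>" "\<Union>\<D> \<in> lmeasurable" "measure lebesgue (\<Union>\<D>) \<le> measure lebesgue A + e'"
      by (rule measurable_outer_intervals_bounded[OF Al sub e']) blast
    have cube: "compact K" "emeasure S2 (E ` K) \<le> ennreal (4 * pi) * emeasure lborel (interior K)" if K: "K \<in> \<D>" for K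
    proof -
      obtain p q where pq: "K = cbox p q" using \<D>(2)[OF K] by auto
      show "compact K" by (simp add: pq compact_cbox)
      obtain n where n: "\<And>i. i \<in> Basis \<Longrightarrow> q \<bullet> i - p \<bullet> i = (?b \<bullet> i - ?a \<bullet> i)/2^n"
        using \<D>(4) K pq by blast
      \<comment> \<open>The enclosing box is a square of side \<open>2 * c\<close>, so its dyadic
        cells are squares, as \<open>hausdorff2_upper\<close> requires.\<close>
      define l where "l = 2 * c / 2 ^ n"
      have l: "l > 0" using c by (simp add: l_def)
      have q: "q = (fst p + l, snd p + l)"
        using n[of "(1, 0)"] n[of "(0, 1)"] by (cases p; cases q) (auto simp: Basis_prod_def l_def)
      have K': "K = cbox (fst p, snd p) (fst p + l, snd p + l)" by (simp add: pq q)
      have "emeasure S2 (E ` K) = hausdorff2 (E ` K)"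
        by (rule emeasure_S2[OF H closed]) (simp add: pq compact_cbox)
      also have "\<dots> \<le> ennreal (4 * pi * 1\<^sup>2 * l\<^sup>2)"
        unfolding K' by (rule hausdorff2_upper[OF l lipschitz_on_subset[OF E]]) auto
      also have "\<dots> = ennreal (4 * pi) * emeasure lborel (interior K)"
        unfolding K' interior_cbox using l
        by (subst emeasure_lborel_box_eq)
          (cases p; auto simp: Basis_prod_def prod.union_disjoint prod.reindex inj_on_def power2_eq_square ennreal_mult)
      finally show "emeasure S2 (E ` K) \<le> ennreal (4 * pi) * emeasure lborel (interior K)" .
    qed
    \<comment> \<open>An enumeration of the countable family, with the empty set at indices that are
      not taken.\<close>
    define C where "C n = \<Union>{K \<in> \<D>. to_nat_on \<D> K = n}" for n
    have C: "C n = {} \<or> C n \<in> \<D>" for n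
    proof (cases "\<exists>K\<in>\<D>. to_nat_on \<D> K = n")
      case True
      then obtain K where "K \<in> \<D>" "to_nat_on \<D> K = n" by auto
      then have "{K \<in> \<D>. to_nat_on \<D> K = n} = {K}"
        using inj_on_to_nat_on[OF \<D>(1)] by (auto simp: inj_on_def)
      then show ?thesis using \<open>K \<in> \<D>\<close> by (simp add: C_def)
    qed (auto simp: C_def)
    have CU: "(\<Union>n. C n) = \<Union>\<D>" by (auto simp: C_def)
    have Cc: "compact (C n)" for n using C[of n] cube(1) by auto
    have Cb: "(\<Union>n. C n) \<in> sets borel"
      using borel_compact[OF Cc] by (intro sets.countable_UN) auto
    have disj: "disjoint_family (\<lambda>n. interior (C n))"
      unfolding disjoint_family_on_def
    proof (intro ballI impI)
      fix m n :: nat assume "m \<noteq> n"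
      show "interior (C m) \<inter> interior (C n) = {}"
      proof (cases "C m = {} \<or> C n = {}")
        case False
        then have mem: "C m \<in> \<D>" "C n \<in> \<D>" using C by auto
        have "C m \<noteq> C n"
        proof
          assume eq: "C m = C n"
          have "to_nat_on \<D> (C k) = k" if Ck: "C k \<in> \<D>" "C k \<noteq> {}" for k
          proof -
            obtain K where K: "K \<in> \<D>" "to_nat_on \<D> K = k" using Ck(2) by (auto simp: C_def)
            then have "{K \<in> \<D>. to_nat_on \<D> K = k} = {K}"
              using inj_on_to_nat_on[OF \<D>(1)] by (auto simp: inj_on_def)
            then show ?thesis using K by (simp add: C_def)
          qed
          then show False using mem False eq \<open>m \<noteq> n\<close> by metis
        qed
        then show ?thesis using \<D>(3) mem by (auto simp: pairwise_def)
      qed auto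
    qed
    have "emeasure S2 (E ` A) \<le> emeasure S2 (\<Union>n. E ` C n)"
    proof (rule emeasure_mono)
      show "E ` A \<subseteq> (\<Union>n. E ` C n)" using \<D>(6) CU by blast
      show "(\<Union>n. E ` C n) \<in> sets S2" using closed[OF Cc] by auto
    qed
    also have "\<dots> \<le> (\<Sum>n. emeasure S2 (E ` C n))"
      using closed[OF Cc] by (intro emeasure_subadditive_countably) auto
    also have "\<dots> \<le> (\<Sum>n. ennreal (4 * pi) * emeasure lborel (interior (C n)))"
    proof (rule suminf_le)
      show "emeasure S2 (E ` C n) \<le> ennreal (4 * pi) * emeasure lborel (interior (C n))" for n
        using C[of n] cube(2)[of "C n"] by auto
    qed auto
    also have "\<dots> = ennreal (4 * pi) * emeasure lborel (\<Union>n. interior (C n))"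
      using disj by (subst ennreal_suminf_cmult, subst suminf_emeasure) auto
    also have "\<dots> \<le> ennreal (4 * pi) * emeasure lborel (\<Union>n. C n)"
    proof (intro mult_left_mono emeasure_mono)
      show "(\<Union>n. interior (C n)) \<subseteq> (\<Union>n. C n)" using interior_subset by blast
    qed (use Cb in auto)
    also have "emeasure lborel (\<Union>n. C n) = emeasure lebesgue (\<Union>\<D>)"
      using Cb unfolding CU[symmetric] by simp
    also have "\<dots> = ennreal (measure lebesgue (\<Union>\<D>))"
      using \<D>(7) by (simp add: emeasure_eq_measure2)
    also have "ennreal (4 * pi) * \<dots> \<le> ennreal (4 * pi) * ennreal (measure lebesgue A + e')"
      using \<D>(8) by (intro mult_left_mono ennreal_leI) auto
    also have "\<dots> = ennreal (4 * pi) * ennreal (measure lebesgue A) + ennreal (4 * pi) * ennreal e'"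
      using e' by (simp add: distrib_left)
    also have "ennreal (measure lebesgue A) = emeasure lborel A"
      using emeasure_eq_measure2[OF Al] A(1) by simp
    also have "ennreal (4 * pi) * ennreal e' = ennreal e"
      unfolding e'_def using e by (subst ennreal_mult[symmetric]) auto
    finally show ?thesis .
  qed
  then show ?thesis by (rule ennreal_le_epsilon[rotated]) 
qed

section \<open>Surface measure on a plane against planar Lebesgue measure\<close>

definition plane :: "real^3 \<Rightarrow> real^3 \<Rightarrow> real^3 \<Rightarrow> real \<times> real \<Rightarrow> real^3" where
  "plane o' a b y = o' + fst y *\<^sub>R a + snd y *\<^sub>R b"

context
  fixes o' a b :: "real^3"
  assumes ab: "a \<bullet> a = 1" "b \<bullet> b = 1" "a \<bullet> b = 0"
begin

lemma dist_plane: "dist (plane o' a b y) (plane o' a b z) = dist y z"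
proof -
  have "plane o' a b y - plane o' a b z = (fst y - fst z) *\<^sub>R a + (snd y - snd z) *\<^sub>R b"
    by (simp add: plane_def algebra_simps)
  then have "(norm (plane o' a b y - plane o' a b z))\<^sup>2 = (fst y - fst z)\<^sup>2 + (snd y - snd z)\<^sup>2"
    using ab unfolding power2_norm_eq_inner
    by (simp add: inner_add_left inner_add_right inner_commute[of b a] power2_eq_square)
  also have "\<dots> = (dist y z)\<^sup>2"
    by (simp add: dist_prod_def dist_real_def)
  finally show ?thesis by (simp add: dist_norm)
qed

lemma lipschitz_plane: "1-lipschitz_on UNIV (plane o' a b)"
  by (rule lipschitz_onI) (simp_all add: dist_plane)

text \<open>The coordinates of the orthogonal projection onto the plane. Being defined on the whole
  space, this left inverse is Borel and can be used to transport measures.\<close>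

definition plane_inv :: "real^3 \<Rightarrow> real \<times> real" where
  "plane_inv x = ((x - o') \<bullet> a, (x - o') \<bullet> b)"

lemma plane_inv: "plane_inv (plane o' a b y) = y"
  using ab by (cases y) (simp add: plane_inv_def plane_def inner_add_left inner_commute[of b a])

lemma plane_inv_measurable [measurable]: "plane_inv \<in> borel_measurable borel"
  unfolding plane_inv_def by (intro borel_measurable_continuous_onI continuous_intros)

lemma plane_measurable [measurable]: "plane o' a b \<in> borel_measurable borel"
  unfolding plane_def by (intro borel_measurable_continuous_onI continuous_intros)

lemma plane_image: "plane o' a b ` A = plane_inv -` A \<inter> {x. plane o' a b (plane_inv x) = x}"
  by (auto simp: plane_inv image_iff)

lemma plane_image_borel: "A \<in> sets borel \<Longrightarrow> plane o' a b ` A \<in> sets borel"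
proof -
  assume A: "A \<in> sets borel"
  have "closed {x. plane o' a b (plane_inv x) = x}"
    unfolding plane_def plane_inv_def by (intro closed_Collect_eq continuous_intros)
  then have "{x. plane o' a b (plane_inv x) = x} \<in> sets borel"
    by (rule borel_closed)
  moreover have "plane_inv -` A \<in> sets borel"
    using measurable_sets[OF plane_inv_measurable A] by simp
  ultimately show ?thesis unfolding plane_image by (rule sets.Int[rotated])
qed



text \<open>The surface measure on a piece of the plane is carried over to the parameters. There the
  bounds on single sets become an inequality between measures, which passes to integrals.\<close>

lemma distr_plane_inv:
  assumes B: "B \<in> sets borel" and A: "A \<in> sets borel"
  shows "emeasure (distr (density S2 (indicator (plane o' a b ` B))) borel plane_inv) A = emeasure S2 (plane o' a b ` (A \<inter> B))"
proof -
  note [measurable] = plane_image_borel[OF B]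
  have "emeasure (distr (density S2 (indicator (plane o' a b ` B))) borel plane_inv) A =
      (\<integral>\<^sup>+x. indicator (plane o' a b ` B) x * indicator (plane_inv -` A) x \<partial>S2)"
    using A measurable_sets[OF plane_inv_measurable A] by (simp add: emeasure_distr emeasure_density)
  also have "\<dots> = (\<integral>\<^sup>+x. indicator (plane o' a b ` (A \<inter> B)) x \<partial>S2)"
    by (intro nn_integral_cong) (auto simp: plane_inv split: split_indicator)
  also have "\<dots> = emeasure S2 (plane o' a b ` (A \<inter> B))"
    using plane_image_borel[of "A \<inter> B"] A B by simp
  finally show ?thesis .
qed

lemma nn_integral_distr_plane_inv:
  assumes B: "B \<in> sets borel" and g: "g \<in> borel_measurable borel"
  shows "(\<integral>\<^sup>+y. g (plane o' a b y) \<partial>distr (density S2 (indicator (plane o' a b ` B))) borel plane_inv)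
    = (\<integral>\<^sup>+x. g x * indicator (plane o' a b ` B) x \<partial>S2)"
proof -
  note [measurable] = plane_image_borel[OF B] g
  have "(\<integral>\<^sup>+y. g (plane o' a b y) \<partial>distr (density S2 (indicator (plane o' a b ` B))) borel plane_inv)
      = (\<integral>\<^sup>+x. indicator (plane o' a b ` B) x * g (plane o' a b (plane_inv x)) \<partial>S2)"
    by (subst nn_integral_distr) (auto simp: nn_integral_density)
  also have "\<dots> = (\<integral>\<^sup>+x. g x * indicator (plane o' a b ` B) x \<partial>S2)"
    by (intro nn_integral_cong) (auto simp: plane_inv split: split_indicator)
  finally show ?thesis .
qed

text \<open>The transported measure is at most 4 pi times Lebesgue measure on \<open>B\<close> by
  \<open>S2_affine_upper\<close>, and nonnegative integrals are monotone in the measure.\<close>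

lemma nn_integral_S2_plane_le:
  assumes H: hausdorff2_measure and B: "B \<in> sets borel" "bounded B" and g: "g \<in> borel_measurable borel"
  shows "(\<integral>\<^sup>+x. g x * indicator (plane o' a b ` B) x \<partial>S2) \<le> ennreal (4 * pi) * (\<integral>\<^sup>+y. g (plane o' a b y) * indicator B y \<partial>lborel)"
proof -
  note [measurable] = B(1) g
  have comp: "plane o' a b ` K \<in> sets borel" if "compact K" for K
    using that by (intro plane_image_borel borel_compact)
  have "distr (density S2 (indicator (plane o' a b ` B))) borel plane_inv \<le> density lborel (\<lambda>y. ennreal (4 * pi) * indicator B y)"
  proof (subst le_measure)
    show "\<forall>A\<in>sets (distr (density S2 (indicator (plane o' a b ` B))) borel plane_inv).
       emeasure (distr (density S2 (indicator (plane o' a b ` B))) borel plane_inv) A \<le> emeasure (density lborel (\<lambda>y. ennreal (4 * pi) * indicator B y)) A"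
    proof
      fix A assume "A \<in> sets (distr (density S2 (indicator (plane o' a b ` B))) borel plane_inv)"
      then have A [measurable]: "A \<in> sets borel" by simp
      have "emeasure (distr (density S2 (indicator (plane o' a b ` B))) borel plane_inv) A = emeasure S2 (plane o' a b ` (A \<inter> B))"
        by (rule distr_plane_inv[OF B(1) A])
      also have "\<dots> \<le> ennreal (4 * pi) * emeasure lborel (A \<inter> B)"
        using A B by (intro S2_affine_upper[OF H lipschitz_plane comp] plane_image_borel) (auto intro: bounded_subset)
      also have "\<dots> = emeasure (density lborel (\<lambda>y. ennreal (4 * pi) * indicator B y)) A"
        by (subst emeasure_density) (auto simp: mult.assoc indicator_inter_arith[symmetric] Int_commute nn_integral_cmult_indicator)
      finally show "emeasure (distr (density S2 (indicator (plane o' a b ` B))) borel plane_inv) A \<le> emeasure (density lborel (\<lambda>y. ennreal (4 * pi) * indicator B y)) A" .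
    qed
  qed simp
  then have "(\<integral>\<^sup>+y. g (plane o' a b y) \<partial>distr (density S2 (indicator (plane o' a b ` B))) borel plane_inv) \<le>
      (\<integral>\<^sup>+y. g (plane o' a b y) \<partial>density lborel (\<lambda>y. ennreal (4 * pi) * indicator B y))"
    by (intro nn_integral_mono_measure) auto
  also have "\<dots> = ennreal (4 * pi) * (\<integral>\<^sup>+y. g (plane o' a b y) * indicator B y \<partial>lborel)"
    by (subst nn_integral_density, simp, simp, subst nn_integral_cmult[symmetric]) (auto simp: mult_ac)
  finally show ?thesis
    by (simp only: nn_integral_distr_plane_inv[OF B(1) g])
qed

text \<open>This direction turns smallness in the boundary measure into smallness in the parameter
  plane, and bounds the mass of a test function on the boundary from below.\<close>

lemma nn_integral_S2_plane_ge:
  assumes H: hausdorff2_measure and B: "B \<in> sets borel" and g: "g \<in> borel_measurable borel"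
  shows "ennreal (pi / 16) * (\<integral>\<^sup>+y. g (plane o' a b y) * indicator B y \<partial>lborel) \<le> (\<integral>\<^sup>+x. g x * indicator (plane o' a b ` B) x \<partial>S2)"
proof -
  note [measurable] = B(1) g
  have "density lborel (\<lambda>y. ennreal (pi / 16) * indicator B y) \<le> distr (density S2 (indicator (plane o' a b ` B))) borel plane_inv"
  proof (subst le_measure)
    show "\<forall>A\<in>sets (density lborel (\<lambda>y. ennreal (pi / 16) * indicator B y)).
       emeasure (density lborel (\<lambda>y. ennreal (pi / 16) * indicator B y)) A \<le> emeasure (distr (density S2 (indicator (plane o' a b ` B))) borel plane_inv) A"
    proof
      fix A assume "A \<in> sets (density lborel (\<lambda>y. ennreal (pi / 16) * indicator B y))"
      then have A [measurable]: "A \<in> sets borel" by simp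
      have "emeasure (density lborel (\<lambda>y. ennreal (pi / 16) * indicator B y)) A = ennreal (pi / 16) * emeasure lborel (A \<inter> B)"
        by (subst emeasure_density) (auto simp: mult.assoc indicator_inter_arith[symmetric] Int_commute nn_integral_cmult_indicator)
      also have "\<dots> \<le> hausdorff2 (plane o' a b ` (A \<inter> B))"
        by (rule hausdorff2_lower) (simp add: dist_plane)
      also have "\<dots> = emeasure S2 (plane o' a b ` (A \<inter> B))"
        using A B by (intro emeasure_S2[OF H, symmetric] plane_image_borel) auto
      also have "\<dots> = emeasure (distr (density S2 (indicator (plane o' a b ` B))) borel plane_inv) A"
        by (rule distr_plane_inv[OF B A, symmetric])
      finally show "emeasure (density lborel (\<lambda>y. ennreal (pi / 16) * indicator B y)) A \<le> emeasure (distr (density S2 (indicator (plane o' a b ` B))) borel plane_inv) A" .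
    qed
  qed simp
  then have "(\<integral>\<^sup>+y. g (plane o' a b y) \<partial>density lborel (\<lambda>y. ennreal (pi / 16) * indicator B y)) \<le>
      (\<integral>\<^sup>+y. g (plane o' a b y) \<partial>distr (density S2 (indicator (plane o' a b ` B))) borel plane_inv)"
    by (intro nn_integral_mono_measure) auto
  moreover have "(\<integral>\<^sup>+y. g (plane o' a b y) \<partial>density lborel (\<lambda>y. ennreal (pi / 16) * indicator B y)) = ennreal (pi / 16) * (\<integral>\<^sup>+y. g (plane o' a b y) * indicator B y \<partial>lborel)"
    by (subst nn_integral_density, simp, simp, subst nn_integral_cmult[symmetric]) (auto simp: mult_ac)
  ultimately show ?thesis
    by (simp only: nn_integral_distr_plane_inv[OF B(1) g])
qed

end

section \<open>Finiteness of the surface measure of a Lipschitz boundary\<close>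

lemma continuous_on_proj12: "continuous_on S proj12"
proof -
  have eq: "proj12 = (\<lambda>x. \<chi> i. if i = 1 then x$1 else x$2)"
    by (auto simp: proj12_def fun_eq_iff vec_eq_iff forall_2)
  have "continuous_on S (\<lambda>x :: real^3. if i = 1 then x$1 else x$2)" for i :: 2
    by (cases "i = 1") (auto intro!: continuous_intros)
  then show ?thesis unfolding eq by (intro continuous_on_vec_lambda)
qed

text \<open>In a chart every frontier point lies on the graph: points above it belong to the open
  set \<Omega>, and points below it have a neighbourhood disjoint from \<Omega>. The graph of a
  Lipschitz function is a Lipschitz image of the plane, and the rigid motion preserves this.\<close>

lemma frontier_lipschitz_local:
  assumes \<Omega>: "lipschitz_domain \<Omega>" and p: "p \<in> frontier \<Omega>"
  obtains N L P and f :: "real \<times> real \<Rightarrow> real^3"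
  where "open N" "p \<in> N" "L-lipschitz_on UNIV f" "bounded P" "frontier \<Omega> \<inter> N \<subseteq> f ` P"
proof -
  obtain T :: "real^3 \<Rightarrow> real^3" and \<phi> :: "real^2 \<Rightarrow> real" and L r a where
    T: "orthogonal_transformation T" and \<phi>: "L-lipschitz_on UNIV \<phi>" and r: "0 < r" and a: "0 < a"
    and small: "\<forall>z\<in>ball 0 r. \<bar>\<phi> z\<bar> < a"
    and eq: "\<Omega> \<inter> (\<lambda>y. p + T y) ` cyl (ball 0 r) {-a<..<a}
          = (\<lambda>y. p + T y) ` {y \<in> cyl (ball 0 r) {-a<..<a}. \<phi> (proj12 y) < y$3}"
    using \<Omega> p unfolding lipschitz_domain_def by blast
  have o\<Omega>: "open \<Omega>" using \<Omega> by (simp add: lipschitz_domain_def)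
  let ?g = "\<lambda>y. p + T y" and ?Z = "cyl (ball 0 r) {-a<..<a}"
  note c12 = continuous_on_proj12[of UNIV]
  have Z: "open ?Z"
  proof -
    have "?Z = proj12 -` ball 0 r \<inter> (\<lambda>x. x$3) -` {-a<..<a}" by (auto simp: cyl_def)
    then show ?thesis
      using c12 by (auto intro!: open_Int open_vimage continuous_intros)
  qed
  have c\<phi>: "continuous_on UNIV (\<lambda>y. \<phi> (proj12 y))"
    by (rule continuous_on_compose2[OF lipschitz_on_continuous_on[OF \<phi>] c12]) auto
  have og: "open (?g ` X)" if "open X" for X
  proof -
    have "?g ` X = (\<lambda>x. inv T (x - p)) -` X"
    proof -
      have "bij T" using T by (rule orthogonal_transformation_bij)
      then show ?thesis
        by (auto simp: bij_is_inj bij_is_surj surj_f_inv_f image_iff intro!: bexI[of _ "inv T (_ - p)"])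
    qed
    moreover have "linear (inv T)"
      using orthogonal_transformation_inv[OF T] by (rule orthogonal_transformation_linear)
    then have "continuous_on UNIV (\<lambda>x. inv T (x - p))"
      using linear_continuous_on_compose[of UNIV "\<lambda>x. x - p" "inv T"]
      by (simp add: continuous_intros)
    ultimately show ?thesis using that by (simp add: open_vimage)
  qed
  have gi: "inj ?g" using orthogonal_transformation_inj[OF T] by (auto simp: inj_on_def)
  have graph: "\<phi> (proj12 y) = y$3" if y: "y \<in> ?Z" "?g y \<in> frontier \<Omega>" for y
  proof (rule ccontr)
    assume "\<phi> (proj12 y) \<noteq> y$3"
    then consider "\<phi> (proj12 y) < y$3" | "y$3 < \<phi> (proj12 y)" by linarith
    then show False
    proof cases
      case 1
      then have "?g y \<in> \<Omega>" using eq y(1) by blast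
      then show False using y(2) o\<Omega> by (simp add: frontier_def interior_open)
    next
      case 2
      \<comment> \<open>The part of the chart below the graph. Its image is open and misses
        \<Omega>, hence also misses the closure.\<close>
      let ?X = "?Z \<inter> {y. y$3 < \<phi> (proj12 y)}"
      have "open ?X"
        using Z c\<phi> by (intro open_Int open_Collect_less continuous_intros)
      moreover have "?g ` ?X \<inter> \<Omega> = {}"
      proof -
        have "z \<notin> \<Omega>" if z: "z \<in> ?g ` ?X" for z
        proof
          assume "z \<in> \<Omega>"
          obtain x where x: "x \<in> ?X" "z = ?g x" using z by blast
          then have "z \<in> ?g ` {y \<in> ?Z. \<phi> (proj12 y) < y$3}" using eq \<open>z \<in> \<Omega>\<close> by blast
          then obtain y where y: "\<phi> (proj12 y) < y$3" "z = ?g y" by blast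
          then have "x = y" using injD[OF gi, of x y] x(2) by simp
          then show False using y(1) x(1) by simp
        qed
        then show ?thesis by blast
      qed
      ultimately have "?g ` ?X \<inter> closure \<Omega> = {}"
        using og[of ?X] by (simp add: open_Int_closure_eq_empty)
      moreover have "?g y \<in> ?g ` ?X" using y(1) 2 by auto
      moreover have "?g y \<in> closure \<Omega>" using y(2) by (simp add: frontier_def)
      ultimately show False by blast
    qed
  qed
  define f where "f y = p + T (vector [fst y, snd y, \<phi> (vector [fst y, snd y])])" for y :: "real \<times> real"
  have L: "L \<ge> 0" using \<phi> by (rule lipschitz_on_nonneg)
  have "(2 + 2 * L)-lipschitz_on UNIV f"
  proof (rule lipschitz_onI)
    fix y z :: "real \<times> real"
    let ?v = "\<lambda>y :: real \<times> real. vector [fst y, snd y] :: real^2"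
    let ?w = "\<lambda>y :: real \<times> real. vector [fst y, snd y, \<phi> (?v y)] :: real^3"
    have "dist (?v y) (?v z) \<le> 2 * dist y z"
      using norm_le_l1_cart[of "?v y - ?v z"] abs_prod_le[of y z] by (simp add: dist_norm sum_2)
    then have "L * dist (?v y) (?v z) \<le> L * (2 * dist y z)" using L by (rule mult_left_mono)
    moreover have "dist (\<phi> (?v y)) (\<phi> (?v z)) \<le> L * dist (?v y) (?v z)"
      using \<phi> by (rule lipschitz_onD) auto
    ultimately have "\<bar>\<phi> (?v y) - \<phi> (?v z)\<bar> \<le> 2 * L * dist y z"
      by (simp add: dist_real_def)
    moreover have "norm (?w y - ?w z) \<le> \<bar>fst y - fst z\<bar> + \<bar>snd y - snd z\<bar> + \<bar>\<phi> (?v y) - \<phi> (?v z)\<bar>"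
      using norm_vec3_le[of "?w y - ?w z"] by simp
    ultimately have "norm (?w y - ?w z) \<le> (2 + 2 * L) * dist y z"
      using abs_prod_le[of y z] by (simp add: algebra_simps)
    moreover have "dist (f y) (f z) = norm (?w y - ?w z)"
      using orthogonal_transformation_norm[OF T, of "?w y - ?w z"] linear_diff[OF orthogonal_transformation_linear[OF T]]
      by (simp add: f_def dist_norm)
    ultimately show "dist (f y) (f z) \<le> (2 + 2 * L) * dist y z" by simp
  qed (use L in simp)
  moreover have "frontier \<Omega> \<inter> ?g ` ?Z \<subseteq> f ` cbox (- r, - r) (r, r)"
  proof
    fix x assume "x \<in> frontier \<Omega> \<inter> ?g ` ?Z"
    then obtain y where y: "y \<in> ?Z" "x = ?g y" "?g y \<in> frontier \<Omega>" by auto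
    have "y = vector [y$1, y$2, \<phi> (vector [y$1, y$2])]"
      using graph[OF y(1,3)] by (simp add: vec_eq_iff forall_3 proj12_def)
    then have "x = f (y$1, y$2)" by (simp add: f_def y(2))
    moreover have "norm (proj12 y) < r" using y(1) by (simp add: cyl_def)
    then have "\<bar>y$1\<bar> \<le> r" "\<bar>y$2\<bar> \<le> r"
      using component_le_norm_cart[of "proj12 y" 1] component_le_norm_cart[of "proj12 y" 2] by (auto simp: proj12_def)
    then have "(y$1, y$2) \<in> cbox (- r, - r) (r, r)" by (auto simp: mem_box Basis_prod_def)
    ultimately show "x \<in> f ` cbox (- r, - r) (r, r)" by blast
  qed
  moreover have "p \<in> ?g ` ?Z"
  proof (rule image_eqI[of _ _ 0])
    show "p = p + T 0" using linear_0[OF orthogonal_transformation_linear[OF T]] by simp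
    have "proj12 0 = 0" by (simp add: proj12_def vec_eq_iff forall_2)
    then show "0 \<in> ?Z" using r a by (simp add: cyl_def)
  qed
  ultimately show ?thesis
    using that[of "?g ` ?Z" "2 + 2 * L" f "cbox (- r, - r) (r, r)"] og[OF Z] bounded_cbox by blast
qed

text \<open>Finitely many charts cover the compact frontier. Finiteness makes square-integrable
  traces integrable and puts continuous functions into L2 on the frontier.\<close>

lemma S2_frontier_finite:
  assumes H: hausdorff2_measure and \<Omega>: "lipschitz_domain \<Omega>" "bounded \<Omega>"
  shows "emeasure S2 (frontier \<Omega>) < \<infinity>"
proof -
  have "\<forall>p\<in>frontier \<Omega>. \<exists>N. open N \<and> p \<in> N \<and> emeasure S2 (frontier \<Omega> \<inter> N) < \<infinity>"
  proof
    fix p assume "p \<in> frontier \<Omega>"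
    from frontier_lipschitz_local[OF \<Omega>(1) this] obtain N L P and f :: "real \<times> real \<Rightarrow> real^3"
      where *: "open N" "p \<in> N" "L-lipschitz_on UNIV f" "bounded P" "frontier \<Omega> \<inter> N \<subseteq> f ` P" by metis
    have "frontier \<Omega> \<inter> N \<in> sets borel" using *(1) by auto
    with * show "\<exists>N. open N \<and> p \<in> N \<and> emeasure S2 (frontier \<Omega> \<inter> N) < \<infinity>"
      using S2_lipschitz_finite[OF H *(3-5)] by blast
  qed
  then obtain N where N: "\<And>p. p \<in> frontier \<Omega> \<Longrightarrow> open (N p)" "\<And>p. p \<in> frontier \<Omega> \<Longrightarrow> p \<in> N p"
    "\<And>p. p \<in> frontier \<Omega> \<Longrightarrow> emeasure S2 (frontier \<Omega> \<inter> N p) < \<infinity>" by metis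
  have "compact (frontier \<Omega>)" using \<Omega>(2) by (rule compact_frontier_bounded)
  then obtain F where F: "F \<subseteq> frontier \<Omega>" "finite F" "frontier \<Omega> \<subseteq> (\<Union>p\<in>F. N p)"
    using compactE_image[of "frontier \<Omega>" "frontier \<Omega>" N] N by (metis UN_I subsetI)
  have m: "frontier \<Omega> \<inter> N p \<in> sets S2" if "p \<in> F" for p
    using N(1)[of p] F(1) that by auto
  have "emeasure S2 (frontier \<Omega>) \<le> emeasure S2 (\<Union>p\<in>F. frontier \<Omega> \<inter> N p)"
    using F(3) by (intro emeasure_mono sets.finite_UN F(2) m) auto
  also have "\<dots> \<le> (\<Sum>p\<in>F. emeasure S2 (frontier \<Omega> \<inter> N p))"
    using F(2) m by (intro emeasure_subadditive_finite) auto
  also have "\<dots> < \<infinity>"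
    using F N(3) by (simp add: subset_iff)
  finally show ?thesis .
qed

section \<open>Herglotz functions and the traction operator\<close>

lemma norm_vector_smult: "norm (c *s x) = norm c * norm x" for x :: "complex^3"
proof -
  have "norm (c *s x) = L2_set (\<lambda>i. norm c * norm (x $ i)) UNIV"
    by (simp add: norm_vec_def norm_mult)
  also have "\<dots> = norm c * norm x"
    by (simp add: norm_vec_def L2_set_right_distrib)
  finally show ?thesis .
qed

lemma smult_eq_scaleR_cis: "c *s x = Re c *\<^sub>R x + Im c *\<^sub>R (\<i> *s x)" for x :: "complex^3"
  by (simp add: vec_eq_iff complex_eq_iff algebra_simps)

lemma bounded_linear_smult_i: "bounded_linear (\<lambda>x :: complex^3. \<i> *s x)"
  by (rule linear_conv_bounded_linear[THEN iffD1], rule linearI) (auto simp: vec_eq_iff algebra_simps)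

lemma measurable_smult [measurable]:
  fixes g :: "'a \<Rightarrow> complex^3"
  assumes [measurable]: "c \<in> borel_measurable M" "g \<in> borel_measurable M"
  shows "(\<lambda>x. c x *s g x) \<in> borel_measurable M"
proof -
  have [measurable]: "(\<lambda>x :: complex^3. \<i> *s x) \<in> borel_measurable borel"
    using bounded_linear_smult_i by (simp add: borel_measurable_continuous_onI linear_continuous_on)
  have "(\<lambda>x. c x *s g x) = (\<lambda>x. Re (c x) *\<^sub>R g x + Im (c x) *\<^sub>R (\<i> *s g x))"
    by (rule ext) (rule smult_eq_scaleR_cis)
  then show ?thesis by simp
qed

lemma exp_i_bounds:
  "norm (exp (\<i> * of_real t) - 1) \<le> \<bar>t\<bar>"
  "norm (exp (\<i> * of_real t) - 1 - \<i> * of_real t) \<le> t\<^sup>2"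
  using Taylor_exp[of "\<i> * of_real t" 0] Taylor_exp[of "\<i> * of_real t" 1]
  by (simp_all add: norm_mult power2_eq_square diff_diff_eq)

text \<open>A remainder bound of second order takes the place of differentiation under the integral
  sign for the plane-wave integrals below.\<close>

lemma has_derivative_quadratic:
  fixes f :: "'a::real_normed_vector \<Rightarrow> 'b::real_normed_vector"
  assumes "bounded_linear D" "\<And>y. norm (f (x + y) - f x - D y) \<le> C * (norm y)\<^sup>2"
  shows "(f has_derivative D) (at x)"
  unfolding has_derivative_at
proof
  show "(\<lambda>h. norm (f (x + h) - f x - D h) / norm h) \<midarrow>0\<rightarrow> 0"
  proof (rule Lim_null_comparison)
    show "\<forall>\<^sub>F h in at 0. norm (norm (f (x + h) - f x - D h) / norm h) \<le> C * norm h"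
      unfolding eventually_at_filter
      using assms(2) by (auto intro!: always_eventually simp: divide_le_eq power2_eq_square mult.assoc)
    show "((\<lambda>h. C * norm h) \<longlongrightarrow> 0) (at 0)"
      by (auto intro!: tendsto_eq_intros)
  qed
qed (rule assms(1))

section \<open>Superpositions of plane waves\<close>

context
  fixes N :: "(real^3) measure" and g :: "real^3 \<Rightarrow> complex^3" and k :: real
  assumes sets_N: "sets N = sets (restrict_space borel (space N))" and unit: "\<forall>d\<in>space N. norm d = 1"
    and g: "integrable N g"
begin

lemma measurable_N: "f \<in> borel_measurable borel \<Longrightarrow> f \<in> borel_measurable N"
  by (subst measurable_cong_sets[OF sets_N refl]) (rule measurable_restrict_space1)

lemma wave_measurable:
  "(\<lambda>d. (\<i> * of_real (k * (d \<bullet> e))) * exp (\<i> * of_real (k * (x \<bullet> d)))) \<in> borel_measurable N"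
  "(\<lambda>d. exp (\<i> * of_real (k * (x \<bullet> d)))) \<in> borel_measurable N"
  by (intro measurable_N borel_measurable_continuous_onI continuous_intros)+

lemma integrable_smult:
  assumes "c \<in> borel_measurable N" "\<And>d. d \<in> space N \<Longrightarrow> norm (c d) \<le> B"
  shows "integrable N (\<lambda>d. c d *s g d)"
proof (rule Bochner_Integration.integrable_bound)
  show "integrable N (\<lambda>d. B * norm (g d))" using g by simp
  show "(\<lambda>d. c d *s g d) \<in> borel_measurable N" using assms(1) g by measurable
  show "AE d in N. norm (c d *s g d) \<le> norm (B * norm (g d))"
    using assms(2) by (intro AE_I2) (auto simp: norm_vector_smult abs_mult intro!: mult_right_mono order_trans[OF _ abs_ge_self])
qed

lemma integral_smult_bound:
  assumes "c \<in> borel_measurable N" "\<And>d. d \<in> space N \<Longrightarrow> norm (c d) \<le> B"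
  shows "norm (integral\<^sup>L N (\<lambda>d. c d *s g d)) \<le> B * integral\<^sup>L N (\<lambda>d. norm (g d))"
proof -
  have "norm (integral\<^sup>L N (\<lambda>d. c d *s g d)) \<le> integral\<^sup>L N (\<lambda>d. norm (c d *s g d))"
    by (rule integral_norm_bound)
  also have "\<dots> \<le> integral\<^sup>L N (\<lambda>d. B * norm (g d))"
    using integrable_norm[OF integrable_smult[OF assms]] g assms(2)
    by (intro integral_mono) (auto simp: norm_vector_smult intro!: mult_right_mono)
  finally show ?thesis by simp
qed

text \<open>One of the two summands of a Herglotz function, with wave number \<open>k\<close> and
  density \<open>g\<close>; the measure \<open>N\<close> stands for the surface measure of the unit
  sphere.\<close>

definition wave :: "real^3 \<Rightarrow> complex^3" where
  "wave x = integral\<^sup>L N (\<lambda>d. exp (\<i> * of_real (k * (x \<bullet> d))) *s g d)"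

definition wave' :: "real^3 \<Rightarrow> real^3 \<Rightarrow> complex^3" where
  "wave' x e = integral\<^sup>L N (\<lambda>d. ((\<i> * of_real (k * (d \<bullet> e))) * exp (\<i> * of_real (k * (x \<bullet> d)))) *s g d)"

lemma abs_inner_le: "d \<in> space N \<Longrightarrow> \<bar>k * (x \<bullet> d)\<bar> \<le> \<bar>k\<bar> * norm x"
  using Cauchy_Schwarz_ineq2[of x d] unit by (simp add: abs_mult mult_left_mono)

lemma wave_integrable: "integrable N (\<lambda>d. exp (\<i> * of_real (k * (x \<bullet> d))) *s g d)"
  by (rule integrable_smult[OF wave_measurable(2), of _ 1]) (simp add: norm_exp_i_times)

lemma wave'_integrable: "integrable N (\<lambda>d. ((\<i> * of_real (k * (d \<bullet> e))) * exp (\<i> * of_real (k * (x \<bullet> d)))) *s g d)"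
  by (rule integrable_smult[OF wave_measurable(1), of _ _ "\<bar>k\<bar> * norm e"])
     (use abs_inner_le[of _ e] in \<open>auto simp: norm_mult norm_exp_i_times inner_commute abs_mult\<close>)

lemma wave'_linear: "linear (wave' x)"
proof (rule linearI)
  fix e e' :: "real^3" and r :: real
  show "wave' x (e + e') = wave' x e + wave' x e'"
    unfolding wave'_def
    by (subst Bochner_Integration.integral_add[symmetric, OF wave'_integrable wave'_integrable])
       (auto intro!: Bochner_Integration.integral_cong simp: vec_eq_iff algebra_simps inner_add_right)
  have "(\<lambda>d. ((\<i> * of_real (k * (d \<bullet> (r *\<^sub>R e)))) * exp (\<i> * of_real (k * (x \<bullet> d)))) *s g d) =
    (\<lambda>d. r *\<^sub>R (((\<i> * of_real (k * (d \<bullet> e))) * exp (\<i> * of_real (k * (x \<bullet> d)))) *s g d))"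
  proof
    fix d
    show "((\<i> * of_real (k * (d \<bullet> (r *\<^sub>R e)))) * exp (\<i> * of_real (k * (x \<bullet> d)))) *s g d =
      r *\<^sub>R (((\<i> * of_real (k * (d \<bullet> e))) * exp (\<i> * of_real (k * (x \<bullet> d)))) *s g d)"
      unfolding vec_eq_iff by (simp add: scaleR_conv_of_real[where 'a = complex] mult_ac)
  qed
  then show "wave' x (r *\<^sub>R e) = r *\<^sub>R wave' x e"
    unfolding wave'_def by simp
qed

text \<open>Factoring out the wave at \<open>x\<close> leaves the second-order Taylor remainder of
  the exponential at an imaginary argument, which is at most \<open>k * norm y\<close> in modulus up
  to sign because the directions are unit vectors.\<close>

lemma wave_remainder: "norm (wave (x + y) - wave x - wave' x y) \<le> (k\<^sup>2 * integral\<^sup>L N (\<lambda>d. norm (g d))) * (norm y)\<^sup>2"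
proof -
  let ?c = "\<lambda>d. exp (\<i> * of_real (k * (x \<bullet> d))) * (exp (\<i> * of_real (k * (y \<bullet> d))) - 1 - \<i> * of_real (k * (y \<bullet> d)))"
  have "wave (x + y) - wave x - wave' x y = integral\<^sup>L N (\<lambda>d. ?c d *s g d)"
    unfolding wave_def wave'_def
    by (subst Bochner_Integration.integral_diff[symmetric, OF wave_integrable wave_integrable],
        subst Bochner_Integration.integral_diff[symmetric, OF Bochner_Integration.integrable_diff[OF wave_integrable wave_integrable] wave'_integrable])
       (auto intro!: Bochner_Integration.integral_cong simp: vec_eq_iff algebra_simps inner_add_left inner_commute exp_add)
  also have "norm \<dots> \<le> (k\<^sup>2 * (norm y)\<^sup>2) * integral\<^sup>L N (\<lambda>d. norm (g d))"
  proof (rule integral_smult_bound)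
    show "?c \<in> borel_measurable N"
      by (intro measurable_N borel_measurable_continuous_onI continuous_intros)
    fix d assume d: "d \<in> space N"
    have "norm (?c d) \<le> (k * (y \<bullet> d))\<^sup>2"
      unfolding norm_mult norm_exp_i_times using exp_i_bounds(2)[of "k * (y \<bullet> d)"] by simp
    also have "\<dots> \<le> (\<bar>k\<bar> * norm y)\<^sup>2"
      using abs_inner_le[OF d, of y] by (metis abs_ge_zero power2_abs power_mono)
    finally show "norm (?c d) \<le> k\<^sup>2 * (norm y)\<^sup>2" by (simp add: power_mult_distrib)
  qed
  finally show ?thesis by (simp add: mult_ac)
qed

lemma wave_has_derivative: "(wave has_derivative wave' x) (at x)"
  by (rule has_derivative_quadratic[OF _ wave_remainder])
     (simp add: wave'_linear linear_conv_bounded_linear[symmetric])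

lemma wave_lipschitz: "norm (wave x - wave y) \<le> (\<bar>k\<bar> * integral\<^sup>L N (\<lambda>d. norm (g d))) * norm (x - y)"
proof -
  let ?c = "\<lambda>d. exp (\<i> * of_real (k * (y \<bullet> d))) * (exp (\<i> * of_real (k * ((x - y) \<bullet> d))) - 1)"
  have "wave x - wave y = integral\<^sup>L N (\<lambda>d. ?c d *s g d)"
    unfolding wave_def
    by (subst Bochner_Integration.integral_diff[symmetric, OF wave_integrable wave_integrable])
       (auto intro!: Bochner_Integration.integral_cong simp: vec_eq_iff algebra_simps inner_diff_left exp_add[symmetric])
  also have "norm \<dots> \<le> (\<bar>k\<bar> * norm (x - y)) * integral\<^sup>L N (\<lambda>d. norm (g d))"
  proof (rule integral_smult_bound)
    show "?c \<in> borel_measurable N"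
      by (intro measurable_N borel_measurable_continuous_onI continuous_intros)
    fix d assume d: "d \<in> space N"
    have "norm (?c d) \<le> \<bar>k * ((x - y) \<bullet> d)\<bar>"
      unfolding norm_mult norm_exp_i_times using exp_i_bounds(1)[of "k * ((x - y) \<bullet> d)"] by simp
    also have "\<dots> \<le> \<bar>k\<bar> * norm (x - y)" by (rule abs_inner_le[OF d])
    finally show "norm (?c d) \<le> \<bar>k\<bar> * norm (x - y)" .
  qed
  finally show ?thesis by (simp add: mult_ac)
qed

text \<open>This supplies the continuity of the Jacobian that \<open>c1_on\<close> asks for.\<close>

lemma wave'_lipschitz: "norm (wave' x e - wave' y e) \<le> (k\<^sup>2 * norm e * integral\<^sup>L N (\<lambda>d. norm (g d))) * norm (x - y)"
proof -
  let ?c = "\<lambda>d. (\<i> * of_real (k * (d \<bullet> e))) * (exp (\<i> * of_real (k * (y \<bullet> d))) * (exp (\<i> * of_real (k * ((x - y) \<bullet> d))) - 1))"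
  have "wave' x e - wave' y e = integral\<^sup>L N (\<lambda>d. ?c d *s g d)"
    unfolding wave'_def
    by (subst Bochner_Integration.integral_diff[symmetric, OF wave'_integrable wave'_integrable])
       (auto intro!: Bochner_Integration.integral_cong simp: vec_eq_iff algebra_simps inner_diff_left exp_add[symmetric])
  also have "norm \<dots> \<le> (k\<^sup>2 * norm e * norm (x - y)) * integral\<^sup>L N (\<lambda>d. norm (g d))"
  proof (rule integral_smult_bound)
    show "?c \<in> borel_measurable N"
      by (intro measurable_N borel_measurable_continuous_onI continuous_intros)
    fix d assume d: "d \<in> space N"
    have "norm (?c d) = \<bar>k * (e \<bullet> d)\<bar> * norm (exp (\<i> * of_real (k * ((x - y) \<bullet> d))) - 1)"
      unfolding norm_mult norm_exp_i_times by (simp add: norm_mult inner_commute abs_mult)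
    also have "\<dots> \<le> (\<bar>k\<bar> * norm e) * (\<bar>k\<bar> * norm (x - y))"
      using exp_i_bounds(1)[of "k * ((x - y) \<bullet> d)"] abs_inner_le[OF d, of "x - y"] abs_inner_le[OF d, of e]
      by (intro mult_mono) auto
    finally show "norm (?c d) \<le> k\<^sup>2 * norm e * norm (x - y)" by (simp add: power2_eq_square mult_ac)
  qed
  finally show ?thesis by (simp add: mult_ac)
qed

lemma wave_c1: "c1_on UNIV wave (\<lambda>x. \<chi> i j. wave' x (axis j 1) $ i)"
proof -
  have col: "column j (\<chi> i j. wave' x (axis j 1) $ i) = wave' x (axis j 1)" for j x
    by (simp add: column_def vec_eq_iff)
  have "wave' x e = (\<Sum>j\<in>UNIV. e $ j *\<^sub>R wave' x (axis j 1))" for x e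
  proof -
    have "wave' x (\<Sum>j\<in>UNIV. e $ j *\<^sub>R axis j 1) = (\<Sum>j\<in>UNIV. e $ j *\<^sub>R wave' x (axis j 1))"
      using wave'_linear by (simp add: linear_sum linear_cmul)
    then show ?thesis by (simp add: basis_expansion scalar_mult_eq_scaleR[symmetric])
  qed
  then have "(wave has_derivative (\<lambda>e. \<Sum>j\<in>UNIV. e $ j *\<^sub>R wave' x (axis j 1))) (at x)" for x
    using wave_has_derivative[of x] by (metis (no_types, lifting) ext)
  moreover have "continuous_on UNIV (\<lambda>x. wave' x e)" for e
  proof -
    have "(k\<^sup>2 * norm e * integral\<^sup>L N (\<lambda>d. norm (g d)))-lipschitz_on UNIV (\<lambda>x. wave' x e)"
      by (rule lipschitz_onI) (use wave'_lipschitz in \<open>auto simp: dist_norm\<close>)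
    then show ?thesis by (rule lipschitz_on_continuous_on)
  qed
  ultimately show ?thesis
    unfolding c1_on_def col by (auto intro!: continuous_on_vec_lambda continuous_on_component)
qed

end

lemma surface_on_S2: "surface_on S = restrict_space S2 S"
  by (simp add: surface_on_def S2_def)

lemma space_surface_on [simp]: "space (surface_on S) = S"
  by (simp add: surface_on_S2 space_restrict_space)

lemma sets_surface_on: "sets (surface_on S) = sets (restrict_space borel S)"
  by (simp add: surface_on_S2 sets_restrict_space)

lemma finite_measure_surface_on:
  assumes "S \<in> sets borel" "emeasure S2 S < \<infinity>"
  shows "finite_measure (surface_on S)"
  using assms by (intro finite_measureI) (simp add: surface_on_S2 emeasure_restrict_space)

lemma c1_on_add:
  assumes "c1_on D h J" "c1_on D h' J'"
  shows "c1_on D (\<lambda>x. h x + h' x) (\<lambda>x. J x + J' x)"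
proof -
  have "c1_on D (\<lambda>x. - h' x) (\<lambda>x. - J' x)"
    using c1_on_diff[OF _ assms(2), of "\<lambda>_. 0" "\<lambda>_. 0"] by (simp add: c1_on_def column_def zero_vec_def[symmetric])
  from c1_on_diff[OF assms(1) this] show ?thesis by simp
qed

text \<open>The Lipschitz constant is linear in the L2 norms of the kernels, so it grows at most
  like the powers of \<open>j\<close> that bound them. The square root of the area is the price of
  passing from L1 to L2 on the sphere.\<close>

lemma herglotz_regular:
  assumes H: hausdorff2_measure
    and g: "L2 (surface_on (sphere 0 1)) gp" "L2 (surface_on (sphere 0 1)) gs"
  obtains J where "c1_on UNIV (herglotz kp ks gp gs) J"
    and "\<And>x y. norm (herglotz kp ks gp gs x - herglotz kp ks gp gs y) \<le>
      sqrt (measure (surface_on (sphere 0 1)) (sphere 0 1)) *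
      (\<bar>kp\<bar> * L2_norm (surface_on (sphere 0 1)) gp + \<bar>ks\<bar> * L2_norm (surface_on (sphere 0 1)) gs) * norm (x - y)"
proof -
  let ?N = "surface_on (sphere 0 1)"
  have fin: "finite_measure ?N"
    using S2_sphere_finite[OF H] by (intro finite_measure_surface_on) auto
  have N: "sets ?N = sets (restrict_space borel (space ?N))" "\<forall>d\<in>space ?N. norm d = 1"
    by (auto simp: sets_surface_on)
  note i = L2_integrable[OF fin g(1)] L2_integrable[OF fin g(2)]
  have "herglotz kp ks gp gs = (\<lambda>x. wave ?N gp kp x + wave ?N gs ks x)"
  proof
    fix x
    show "herglotz kp ks gp gs x = wave ?N gp kp x + wave ?N gs ks x"
      unfolding herglotz_def wave_def[OF N i(1)] wave_def[OF N i(2)]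
      by (rule Bochner_Integration.integral_add[OF wave_integrable[OF N i(1)] wave_integrable[OF N i(2)]])
  qed
  moreover note c1_on_add[OF wave_c1[OF N i(1), of kp] wave_c1[OF N i(2), of ks]]
  moreover have "norm (wave ?N gp kp x + wave ?N gs ks x - (wave ?N gp kp y + wave ?N gs ks y)) \<le>
      sqrt (measure ?N (sphere 0 1)) * (\<bar>kp\<bar> * L2_norm ?N gp + \<bar>ks\<bar> * L2_norm ?N gs) * norm (x - y)" for x y
  proof -
    have "norm (wave ?N gp kp x + wave ?N gs ks x - (wave ?N gp kp y + wave ?N gs ks y)) \<le>
        norm (wave ?N gp kp x - wave ?N gp kp y) + norm (wave ?N gs ks x - wave ?N gs ks y)"
      by (rule norm_diff_triangle_ineq)
    also have "\<dots> \<le> (\<bar>kp\<bar> * integral\<^sup>L ?N (\<lambda>d. norm (gp d))) * norm (x - y) + (\<bar>ks\<bar> * integral\<^sup>L ?N (\<lambda>d. norm (gs d))) * norm (x - y)"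
      by (intro add_mono wave_lipschitz[OF N i(1)] wave_lipschitz[OF N i(2)])
    also have "\<dots> \<le> (\<bar>kp\<bar> * (sqrt (measure ?N (sphere 0 1)) * L2_norm ?N gp)) * norm (x - y) + (\<bar>ks\<bar> * (sqrt (measure ?N (sphere 0 1)) * L2_norm ?N gs)) * norm (x - y)"
      using integral_norm_le_L2_norm[OF fin g(1)] integral_norm_le_L2_norm[OF fin g(2)]
      by (intro add_mono mult_right_mono mult_left_mono) auto
    finally show ?thesis by (simp add: algebra_simps)
  qed
  ultimately show ?thesis by (intro that) auto
qed

lemma herglotz_junk:
  assumes "\<not> hausdorff2_measure"
  shows "herglotz kp ks gp gs x = 0"
proof -
  have "AE d in surface_on (sphere 0 1). P d" for P
    unfolding surface_on_S2 using emeasure_S2_junk[OF assms]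
    by (intro AE_I[of _ _ "sphere 0 1"]) (auto simp: space_restrict_space sets_restrict_space emeasure_restrict_space intro!: image_eqI[of _ _ UNIV])
  then show ?thesis
    unfolding herglotz_def by (intro integral_eq_zero_AE)
qed

section \<open>The traction as a linear function of the gradient\<close>

lemma traction_linear: "linear (traction la mu \<nu>)"
  by (rule linearI)
     (auto simp: traction_def vec_eq_iff forall_3 curl_mat_def ccross_def trace_def sum_3 matrix_vector_mult_def
       cvec_def algebra_simps scaleR_conv_of_real[where 'a = complex])

lemma traction_bounded:
  obtains C where "C > 0" "\<And>j :: 3. \<And>G i. norm (traction la mu (axis j 1) G $ i) \<le> C * norm G"
proof -
  have "\<forall>j. \<exists>C. C > 0 \<and> (\<forall>G. norm (traction la mu (axis j 1) G) \<le> norm G * C)"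
    using traction_linear linear_conv_bounded_linear bounded_linear.pos_bounded by blast
  then obtain C where C: "\<And>j. C j > 0" "\<And>j G. norm (traction la mu (axis j 1) G) \<le> norm G * C j" by metis
  have le: "C j \<le> (\<Sum>j\<in>UNIV. C j)" for j
    using C(1) by (intro member_le_sum) (auto intro: less_imp_le)
  have "norm (traction la mu (axis j 1) G $ i) \<le> (\<Sum>j\<in>UNIV. C j) * norm G" for j :: 3 and G i
  proof -
    have "norm (traction la mu (axis j 1) G $ i) \<le> norm (traction la mu (axis j 1) G)"
      by (rule Finite_Cartesian_Product.norm_nth_le)
    also have "\<dots> \<le> norm G * C j" by (rule C)
    also have "\<dots> \<le> norm G * (\<Sum>j\<in>UNIV. C j)" using le by (intro mult_left_mono) auto
    finally show ?thesis by (simp add: mult.commute)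
  qed
  moreover have "(\<Sum>j\<in>UNIV. C j) > 0" using C(1)[of 1] le[of 1] by linarith
  ultimately show ?thesis using that by blast
qed

lemma traction_integrable:
  assumes "integrable M G"
  shows "integrable M (\<lambda>x. traction la mu \<nu> (G x) $ i)"
proof -
  have "bounded_linear (\<lambda>G. traction la mu \<nu> G $ i)"
    using bounded_linear_compose[OF bounded_linear_vec_nth, of "traction la mu \<nu>" i] traction_linear
    by (simp add: linear_conv_bounded_linear)
  then show ?thesis using assms by (rule integrable_bounded_linear)
qed

text \<open>Test fields along the coordinate axes turn the vector identity on the boundary into one
  scalar identity per component.\<close>

lemma cdot_axis: "cdot a (r *\<^sub>R axis i 1) = r *\<^sub>R (a $ i)"
  using exhaust_3[of i] by (auto simp: cdot_def sum_3 axis_def scaleR_conv_of_real[where 'a = complex] mult.commute)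

section \<open>Geometry of the wedge\<close>

definition dirv :: "real \<Rightarrow> real^3" where "dirv \<theta> = vector [cos \<theta>, sin \<theta>, 0]"
definition nrmv :: "real \<Rightarrow> real^3" where "nrmv \<theta> = vector [- sin \<theta>, cos \<theta>, 0]"
definition ez :: "real^3" where "ez = vector [0, 0, 1]"

lemma orthonormal3_dirv: "\<epsilon> * \<epsilon> = 1 \<Longrightarrow> orthonormal3 (dirv \<theta>) ez (\<epsilon> *\<^sub>R nrmv \<theta>)"
  using sin_cos_squared_add3[of \<theta>] square_eq_1_iff[of \<epsilon>]
  by (auto simp: orthonormal3_def dirv_def nrmv_def ez_def inner_vec3 algebra_simps)

text \<open>\<open>t\<close> runs along the face away from the edge, \<open>z\<close> along the
  edge, and \<open>s\<close> is the depth. The sign \<epsilon> is 1 for the face at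
  \<open>\<theta>m\<close> and -1 for the face at \<open>\<theta>M\<close>, so that positive depth
  points into the wedge on both.\<close>

definition coord :: "real \<Rightarrow> real \<Rightarrow> real \<Rightarrow> real \<Rightarrow> real \<Rightarrow> real^3" where
  "coord \<theta> \<epsilon> t z s = frame (dirv \<theta>) ez (\<epsilon> *\<^sub>R nrmv \<theta>) ((t, z), s)"

lemma coord_eq: "coord \<theta> \<epsilon> t z s = vector [t * cos \<theta> - \<epsilon> * s * sin \<theta>, t * sin \<theta> + \<epsilon> * s * cos \<theta>, z]"
  by (simp add: coord_def frame_def dirv_def nrmv_def ez_def vec_eq_iff forall_3)

lemma coord_nth [simp]:
  "coord \<theta> \<epsilon> t z s $ 1 = t * cos \<theta> - \<epsilon> * s * sin \<theta>" "coord \<theta> \<epsilon> t z s $ 2 = t * sin \<theta> + \<epsilon> * s * cos \<theta>"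
  "coord \<theta> \<epsilon> t z s $ 3 = z"
  by (simp_all add: coord_eq)

lemma coord_surj:
  assumes "\<epsilon> * \<epsilon> = 1"
  shows "x = coord \<theta> \<epsilon> (x \<bullet> dirv \<theta>) (x $ 3) (\<epsilon> * (x \<bullet> nrmv \<theta>))"
proof -
  have cs: "cos \<theta> * (cos \<theta> * a) + sin \<theta> * (sin \<theta> * a) = a" for a
    by (simp add: mult.assoc[symmetric] distrib_right[symmetric])
  have "(x$1 * cos \<theta> + x$2 * sin \<theta>) * cos \<theta> - (\<epsilon> * \<epsilon>) * (x$2 * cos \<theta> - x$1 * sin \<theta>) * sin \<theta> = x$1 * (cos \<theta> * cos \<theta> + sin \<theta> * sin \<theta>)"
    "(x$1 * cos \<theta> + x$2 * sin \<theta>) * sin \<theta> + (\<epsilon> * \<epsilon>) * (x$2 * cos \<theta> - x$1 * sin \<theta>) * cos \<theta> = x$2 * (cos \<theta> * cos \<theta> + sin \<theta> * sin \<theta>)"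
    unfolding assms by (simp_all add: algebra_simps cs)
  then show ?thesis
    unfolding sin_cos_squared_add3
    by (simp add: vec_eq_iff forall_3 inner_vec3 dirv_def nrmv_def mult.assoc[symmetric] add.commute)
qed

lemma proj12_nth [simp]: "proj12 x $ 1 = x $ 1" "proj12 x $ 2 = x $ 2"
  by (simp_all add: proj12_def)

lemma norm_vec2: "(norm y)\<^sup>2 = (y$1)\<^sup>2 + (y$2)\<^sup>2" for y :: "real^2"
  by (simp add: norm_vec_def L2_set_def sum_2)

lemma norm_vec3: "(norm y)\<^sup>2 = (y$1)\<^sup>2 + (y$2)\<^sup>2 + (y$3)\<^sup>2" for y :: "real^3"
  by (simp add: norm_vec_def L2_set_def sum_3)

lemma coord_norm_sq:
  fixes \<epsilon> s t \<theta> :: real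
  assumes "\<epsilon> * \<epsilon> = 1"
  shows "(t * cos \<theta> - \<epsilon> * s * sin \<theta>)\<^sup>2 + (t * sin \<theta> + \<epsilon> * s * cos \<theta>)\<^sup>2 = t\<^sup>2 + s\<^sup>2"
proof -
  have "(t * c - \<epsilon> * s * d)\<^sup>2 + (t * d + \<epsilon> * s * c)\<^sup>2 = (t * t + (\<epsilon> * \<epsilon>) * (s * s)) * (c * c + d * d)" for c d
    by (simp add: power2_eq_square algebra_simps)
  from this[of "cos \<theta>" "sin \<theta>"] show ?thesis using assms by (simp add: power2_eq_square)
qed

lemma norm_proj12_coord: "\<epsilon> * \<epsilon> = 1 \<Longrightarrow> (norm (proj12 (coord \<theta> \<epsilon> t z s)))\<^sup>2 = t\<^sup>2 + s\<^sup>2"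
  by (simp add: norm_vec2 coord_norm_sq)

lemma coord_diff: "coord \<theta> \<epsilon> t z s - coord \<theta> \<epsilon> t' z' s' = coord \<theta> \<epsilon> (t - t') (z - z') (s - s')"
  by (simp add: vec_eq_iff forall_3 algebra_simps)

lemma norm_coord: "\<epsilon> * \<epsilon> = 1 \<Longrightarrow> (norm (coord \<theta> \<epsilon> t z s))\<^sup>2 = t\<^sup>2 + s\<^sup>2 + z\<^sup>2"
  by (simp add: norm_vec3 coord_norm_sq)

lemma norm_coord_le: "\<epsilon> * \<epsilon> = 1 \<Longrightarrow> norm (coord \<theta> \<epsilon> t z s) \<le> \<bar>t\<bar> + \<bar>s\<bar> + \<bar>z\<bar>"
proof -
  assume e: "\<epsilon> * \<epsilon> = 1"
  have "0 \<le> \<bar>t\<bar> * \<bar>s\<bar> + \<bar>t\<bar> * \<bar>z\<bar> + \<bar>s\<bar> * \<bar>z\<bar>" by simp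
  then have "t\<^sup>2 + s\<^sup>2 + z\<^sup>2 \<le> (\<bar>t\<bar> + \<bar>s\<bar> + \<bar>z\<bar>)\<^sup>2"
    by (simp add: power2_eq_square algebra_simps abs_mult_self_eq)
  then have "(norm (coord \<theta> \<epsilon> t z s))\<^sup>2 \<le> (\<bar>t\<bar> + \<bar>s\<bar> + \<bar>z\<bar>)\<^sup>2" using norm_coord[OF e] by simp
  then show ?thesis by (rule power2_le_imp_le) simp
qed

text \<open>As a complex number the horizontal part is t + i \<epsilon> s rotated by \<theta>, and
  for \<open>t > 0\<close> the unrotated number has argument arctan (\<epsilon> s / t). The range
  condition keeps the sum on the principal branch.\<close>

lemma arg2_coord:
  assumes t: "t > 0" and e: "\<epsilon> * \<epsilon> = 1" and range: "- pi < \<theta> + arctan (\<epsilon> * s / t)" "\<theta> + arctan (\<epsilon> * s / t) \<le> pi"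
  shows "arg2 (proj12 (coord \<theta> \<epsilon> t z s)) = \<theta> + arctan (\<epsilon> * s / t)"
  unfolding arg2_def
proof (rule Arg_unique)
  let ?u = "\<epsilon> * s / t"
  let ?r = "t * sqrt (1 + ?u\<^sup>2)"
  have pos: "sqrt (1 + ?u\<^sup>2) > 0" by (simp add: add_pos_nonneg)
  then show "0 < ?r" using t by simp
  have c: "?r * cos (arctan ?u) = t" using pos by (simp add: cos_arctan)
  have s: "?r * sin (arctan ?u) = \<epsilon> * s"
    unfolding sin_arctan using pos t by simp
  have "?r * cos (\<theta> + arctan ?u) = (?r * cos (arctan ?u)) * cos \<theta> - (?r * sin (arctan ?u)) * sin \<theta>"
    "?r * sin (\<theta> + arctan ?u) = (?r * cos (arctan ?u)) * sin \<theta> + (?r * sin (arctan ?u)) * cos \<theta>"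
    by (simp_all add: cos_add sin_add algebra_simps)
  then have "?r * cos (\<theta> + arctan ?u) = t * cos \<theta> - \<epsilon> * s * sin \<theta>" "?r * sin (\<theta> + arctan ?u) = t * sin \<theta> + \<epsilon> * s * cos \<theta>"
    unfolding c s by simp_all
  then show "of_real ?r * exp (\<i> * of_real (\<theta> + arctan ?u)) = Complex (proj12 (coord \<theta> \<epsilon> t z s) $ 1) (proj12 (coord \<theta> \<epsilon> t z s) $ 2)"
    unfolding complex_eq_iff by (simp add: cis_conv_exp[symmetric] del: of_real_mult of_real_add)
qed (use range in auto)

lemma arg2_scale: "\<sigma> > 0 \<Longrightarrow> arg2 (\<sigma> *\<^sub>R y) = arg2 y"
proof -
  assume "\<sigma> > 0"
  moreover have "Complex ((\<sigma> *\<^sub>R y) $ 1) ((\<sigma> *\<^sub>R y) $ 2) = of_real \<sigma> * Complex (y $ 1) (y $ 2)"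
    by (simp add: complex_eq_iff)
  ultimately show ?thesis unfolding arg2_def by (simp add: Arg_times_of_real)
qed

lemma norm_proj12_le: "norm (proj12 x) \<le> norm x"
proof (rule power2_le_imp_le)
  show "(norm (proj12 x))\<^sup>2 \<le> (norm x)\<^sup>2"
    unfolding norm_vec2[of "proj12 x"] norm_vec3[of x] by simp
qed simp

lemma continuous_on_coord [continuous_intros]:
  "continuous_on S f \<Longrightarrow> continuous_on S g \<Longrightarrow> continuous_on S k \<Longrightarrow> continuous_on S (\<lambda>x. coord \<theta> \<epsilon> (f x) (g x) (k x))"
  unfolding coord_def by (intro continuous_intros)

text \<open>The geometry alone, without any assumption on the surface measure, so that it also
  serves the case in which this measure degenerates.\<close>

locale wedge =
  fixes h M \<theta>m \<theta>M :: real and \<Omega> :: "(real^3) set"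
  assumes hM: "h > 0" "M > 0" and angles: "- pi < \<theta>m" "\<theta>m < \<theta>M" "\<theta>M < pi"
    and \<Omega>: "open \<Omega>" "bounded \<Omega>"
    and edge: "cyl (ball 0 h) {-M<..<M} \<inter> \<Omega> = cyl (sector \<theta>m \<theta>M h) {-M<..<M}"
begin

abbreviation "D \<equiv> cyl (sector \<theta>m \<theta>M h) {-M<..<M}"
abbreviation "K \<equiv> cyl (closure (sector \<theta>m \<theta>M h)) {-M..M}"
abbreviation "face \<theta> \<equiv> cyl (ray \<theta> h) {-M<..<M}"

lemma mem_D: "x \<in> D \<longleftrightarrow> proj12 x \<noteq> 0 \<and> \<theta>m < arg2 (proj12 x) \<and> arg2 (proj12 x) < \<theta>M \<and> norm (proj12 x) < h \<and> \<bar>x$3\<bar> < M"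
  by (auto simp: cyl_def sector_def abs_less_iff)

lemma D_subset: "D \<subseteq> \<Omega>"
  using edge by blast

lemma open_cyl: "open A \<Longrightarrow> open I \<Longrightarrow> open (cyl A I)"
proof -
  assume "open A" "open I"
  moreover have "cyl A I = proj12 -` A \<inter> (\<lambda>x. x$3) -` I" by (auto simp: cyl_def)
  ultimately show ?thesis
    by (auto intro!: open_Int open_vimage continuous_intros continuous_on_proj12)
qed

lemma closed_cyl: "closed A \<Longrightarrow> closed I \<Longrightarrow> closed (cyl A I)"
proof -
  assume "closed A" "closed I"
  moreover have "cyl A I = proj12 -` A \<inter> (\<lambda>x. x$3) -` I" by (auto simp: cyl_def)
  ultimately show ?thesis
    by (auto intro!: closed_Int closed_vimage continuous_intros continuous_on_proj12)
qed

lemma open_D: "open D"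
  using edge \<Omega>(1) by (metis open_Int open_cyl open_ball open_greaterThanLessThan)

lemma bounded_D: "bounded D"
  using D_subset \<Omega>(2) bounded_subset by blast

lemma compact_K: "compact K"
proof -
  have "norm x \<le> h + M" if "x \<in> K" for x
  proof -
    have "closure (sector \<theta>m \<theta>M h) \<subseteq> cball 0 h"
      by (rule closure_minimal) (auto simp: sector_def)
    then have "norm (proj12 x) \<le> h" using that by (auto simp: cyl_def)
    moreover have "\<bar>x$3\<bar> \<le> M" using that by (auto simp: cyl_def)
    moreover have "(norm x)\<^sup>2 \<le> (norm (proj12 x) + \<bar>x$3\<bar>)\<^sup>2"
      using norm_vec2[of "proj12 x"] norm_vec3[of x] by (simp add: power2_sum)
    then have "norm x \<le> norm (proj12 x) + \<bar>x$3\<bar>" by (rule power2_le_imp_le) simp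
    ultimately show ?thesis by linarith
  qed
  then have "bounded K" by (auto simp: bounded_iff)
  then show ?thesis using closed_cyl by (simp add: compact_eq_bounded_closed)
qed

lemma D_subset_K: "D \<subseteq> K" "D \<subseteq> interior K"
proof -
  show "D \<subseteq> K" using closure_subset by (auto simp: cyl_def)
  then show "D \<subseteq> interior K" using open_D by (rule interior_maximal)
qed

text \<open>Around each face, points at distance less than \<open>\<kappa> * t\<close> from the face point at distance \<open>t\<close> from
  the edge stay clear of the other face and of the branch cut of \<open>arg2\<close>.\<close>

definition halfop :: real where
  "halfop = min (pi / 4) (min (\<theta>M - \<theta>m) (min (pi + \<theta>m) (pi - \<theta>M)))"

definition \<kappa> :: real where "\<kappa> = tan halfop"

lemma halfop: "0 < halfop" "halfop \<le> pi / 4" "halfop \<le> \<theta>M - \<theta>m" "halfop \<le> pi + \<theta>m" "halfop \<le> pi - \<theta>M"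
  using angles pi_gt_zero unfolding halfop_def by linarith+

lemma \<kappa>: "0 < \<kappa>" "\<kappa> \<le> 1"
proof -
  show "0 < \<kappa>" unfolding \<kappa>_def using halfop pi_gt_zero by (intro tan_gt_zero) auto
  have "tan halfop \<le> tan (pi / 4)"
    using halfop pi_gt_zero by (intro tan_mono_le) auto
  then show "\<kappa> \<le> 1" by (simp add: \<kappa>_def tan_45)
qed

lemma arctan_less_halfop: "\<bar>u\<bar> < \<kappa> \<Longrightarrow> \<bar>arctan u\<bar> < halfop"
proof -
  assume "\<bar>u\<bar> < \<kappa>"
  then have "arctan u < arctan \<kappa>" "arctan (- u) < arctan \<kappa>"
    unfolding arctan_less_iff by auto
  moreover have "arctan \<kappa> = halfop"
    unfolding \<kappa>_def using halfop pi_gt_zero by (intro arctan_tan) auto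
  ultimately show ?thesis by (simp add: arctan_minus)
qed

lemma arg2_near_face:
  assumes "t > 0" "\<bar>s\<bar> < \<kappa> * t" "\<epsilon> = 1 \<and> \<theta> = \<theta>m \<or> \<epsilon> = -1 \<and> \<theta> = \<theta>M"
  shows "arg2 (proj12 (coord \<theta> \<epsilon> t z s)) = \<theta> + arctan (\<epsilon> * s / t)" "\<bar>arctan (\<epsilon> * s / t)\<bar> < halfop"
proof -
  have "\<bar>\<epsilon> * s / t\<bar> < \<kappa>"
    using assms by (auto simp: abs_mult field_simps)
  then show l: "\<bar>arctan (\<epsilon> * s / t)\<bar> < halfop" by (rule arctan_less_halfop)
  show "arg2 (proj12 (coord \<theta> \<epsilon> t z s)) = \<theta> + arctan (\<epsilon> * s / t)"
    by (rule arg2_coord) (use assms l halfop angles in auto)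
qed

lemma proj12_coord_nonzero: "t > 0 \<Longrightarrow> \<epsilon> * \<epsilon> = 1 \<Longrightarrow> proj12 (coord \<theta> \<epsilon> t z s) \<noteq> 0"
  using norm_proj12_coord[of \<epsilon> \<theta> t z s] by (auto simp: sum_power2_eq_zero_iff)

lemma norm_proj12_coord_less:
  assumes "\<epsilon> * \<epsilon> = 1" "t\<^sup>2 + s\<^sup>2 < h\<^sup>2"
  shows "norm (proj12 (coord \<theta> \<epsilon> t z s)) < h"
proof (rule power2_less_imp_less)
  show "(norm (proj12 (coord \<theta> \<epsilon> t z s)))\<^sup>2 < h\<^sup>2"
    unfolding norm_proj12_coord[OF assms(1)] by (rule assms(2))
qed (use hM in simp)

lemma coord_in_D:
  assumes "t > 0" "0 < s" "s < \<kappa> * t" "\<epsilon> = 1 \<and> \<theta> = \<theta>m \<or> \<epsilon> = -1 \<and> \<theta> = \<theta>M" "t\<^sup>2 + s\<^sup>2 < h\<^sup>2" "\<bar>z\<bar> < M"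
  shows "coord \<theta> \<epsilon> t z s \<in> D"
proof -
  have e: "\<epsilon> * \<epsilon> = 1" using assms(4) by auto
  have "norm (proj12 (coord \<theta> \<epsilon> t z s)) < h"
    using norm_proj12_coord_less[OF e assms(5)] .
  moreover have "\<theta>m < \<theta> + arctan (\<epsilon> * s / t)" "\<theta> + arctan (\<epsilon> * s / t) < \<theta>M"
    using assms arg2_near_face(2)[of t s \<epsilon> \<theta>] halfop by (auto simp: arctan_minus divide_simps)
  ultimately show ?thesis
    using assms arg2_near_face(1)[of t s \<epsilon> \<theta> z] proj12_coord_nonzero[OF assms(1) e] by (auto simp: mem_D)
qed

lemma coord_in_face:
  assumes "0 < t" "t < h" "\<epsilon> = 1 \<and> \<theta> = \<theta>m \<or> \<epsilon> = -1 \<and> \<theta> = \<theta>M" "\<bar>z\<bar> < M"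
  shows "coord \<theta> \<epsilon> t z 0 \<in> face \<theta>"
proof -
  have e: "\<epsilon> * \<epsilon> = 1" using assms(3) by auto
  have "norm (proj12 (coord \<theta> \<epsilon> t z 0)) < h"
    using assms(1,2) by (intro norm_proj12_coord_less[OF e]) (simp add: power_strict_mono)
  then show ?thesis
    using arg2_near_face(1)[of t 0 \<epsilon> \<theta> z] assms proj12_coord_nonzero[OF assms(1) e] \<kappa>
    by (auto simp: cyl_def ray_def)
qed

lemma coord_not_in_D:
  assumes "t > 0" "- \<kappa> * t < s" "s < 0"
  shows "coord \<theta>m 1 t z s \<notin> D"
  using assms arg2_near_face(1)[of t s 1 \<theta>m z] divide_neg_pos[of s t] by (auto simp: mem_D)

text \<open>The point is a limit of points of \<open>D\<close>. The value \<open>t = 0\<close> is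
  allowed, so the edge itself is covered.\<close>

lemma coord_in_K:
  assumes "0 \<le> t" "t < h" "\<epsilon> = 1 \<and> \<theta> = \<theta>m \<or> \<epsilon> = -1 \<and> \<theta> = \<theta>M" "\<bar>z\<bar> < M"
  shows "coord \<theta> \<epsilon> t z 0 \<in> K"
proof (rule Lim_in_closed_set)
  show "closed K" using compact_K by (rule compact_imp_closed)
  \<comment> \<open>Moving outwards by \<delta> along the face as well as inwards by half of
    \<open>\<kappa> * \<delta>\<close> keeps the point in the wedge even if it starts on the
    edge.\<close>
  have "continuous_on UNIV (\<lambda>\<delta>. coord \<theta> \<epsilon> (t + \<delta>) z (\<kappa> * \<delta> / 2))" by (intro continuous_intros) auto
  then have "isCont (\<lambda>\<delta>. coord \<theta> \<epsilon> (t + \<delta>) z (\<kappa> * \<delta> / 2)) 0" by (simp add: continuous_on_eq_continuous_at)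
  then show "((\<lambda>\<delta>. coord \<theta> \<epsilon> (t + \<delta>) z (\<kappa> * \<delta> / 2)) \<longlongrightarrow> coord \<theta> \<epsilon> t z 0) (at_right 0)"
    by (auto simp: isCont_def intro: filterlim_mono[OF _ order_refl at_le])
  have "((\<lambda>\<delta>. (t + \<delta>)\<^sup>2 + (\<kappa> * \<delta> / 2)\<^sup>2) \<longlongrightarrow> (t + 0)\<^sup>2 + (\<kappa> * 0 / 2)\<^sup>2) (at_right 0)"
    by (intro tendsto_intros) auto
  moreover have "(t + 0)\<^sup>2 + (\<kappa> * 0 / 2)\<^sup>2 < h\<^sup>2" using assms by (simp add: power_strict_mono)
  ultimately have "\<forall>\<^sub>F \<delta> in at_right 0. (t + \<delta>)\<^sup>2 + (\<kappa> * \<delta> / 2)\<^sup>2 < h\<^sup>2"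
    by (rule order_tendstoD)
  moreover have "\<forall>\<^sub>F \<delta>::real in at_right 0. \<delta> > 0" by (rule eventually_at_right_less)
  ultimately show "\<forall>\<^sub>F \<delta> in at_right 0. coord \<theta> \<epsilon> (t + \<delta>) z (\<kappa> * \<delta> / 2) \<in> K"
  proof eventually_elim
    case (elim \<delta>)
    have "0 < \<kappa> * \<delta>" "0 \<le> \<kappa> * t" using elim(2) \<kappa> assms(1) by simp_all
    then have "\<kappa> * \<delta> / 2 < \<kappa> * (t + \<delta>)" unfolding distrib_left by linarith
    then have "coord \<theta> \<epsilon> (t + \<delta>) z (\<kappa> * \<delta> / 2) \<in> D"
      using elim \<kappa> assms by (intro coord_in_D) auto
    then show ?case using D_subset_K by blast
  qed
qed simp

text \<open>Points at positive depth lie in the open set \<Omega>, and points at negative depth have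
  a neighbourhood outside it. Consequently a test function supported near the lower face meets the
  boundary only on that face.\<close>

lemma frontier_near_face:
  assumes x: "coord \<theta>m 1 t z s \<in> frontier \<Omega>" and "t > 0" "\<bar>s\<bar> < \<kappa> * t" "t\<^sup>2 + s\<^sup>2 < h\<^sup>2" "\<bar>z\<bar> < M"
  shows "s = 0"
proof (rule ccontr)
  assume "s \<noteq> 0"
  then consider "s > 0" | "s < 0" by linarith
  then show False
  proof cases
    case 1
    then have "coord \<theta>m 1 t z s \<in> \<Omega>"
      using coord_in_D[of t s 1 \<theta>m z] assms D_subset by auto
    then show False using x \<Omega>(1) by (simp add: frontier_def interior_open)
  next
    case 2
    \<comment> \<open>The same inequalities, written in terms of inner products with the face
      direction and the normal, so that openness is evident.\<close>
    define N where "N = {x :: real^3. 0 < x \<bullet> dirv \<theta>m} \<inter> {x. - \<kappa> * (x \<bullet> dirv \<theta>m) < x \<bullet> nrmv \<theta>m} \<inter> {x. x \<bullet> nrmv \<theta>m < 0}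
      \<inter> {x. (x \<bullet> dirv \<theta>m)\<^sup>2 + (x \<bullet> nrmv \<theta>m)\<^sup>2 < h\<^sup>2} \<inter> {x. \<bar>x$3\<bar> < M}"
    have "open N"
      unfolding N_def by (intro open_Int open_Collect_less continuous_intros)
    moreover have "N \<inter> \<Omega> = {}"
    proof -
      have "y \<notin> \<Omega>" if y: "y \<in> N" for y
      proof
        assume "y \<in> \<Omega>"
        have yc: "y = coord \<theta>m 1 (y \<bullet> dirv \<theta>m) (y $ 3) (y \<bullet> nrmv \<theta>m)"
          using coord_surj[of 1 y \<theta>m] by simp
        have "norm (proj12 y) < h"
          using y by (subst yc, intro norm_proj12_coord_less) (auto simp: N_def)
        then have "y \<in> cyl (ball 0 h) {-M<..<M}" using y by (auto simp: cyl_def N_def)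
        then have "y \<in> D" using \<open>y \<in> \<Omega>\<close> edge by blast
        moreover have "y \<notin> D"
          by (subst yc, rule coord_not_in_D) (use y in \<open>auto simp: N_def\<close>)
        ultimately show False by blast
      qed
      then show ?thesis by blast
    qed
    ultimately have "N \<inter> closure \<Omega> = {}" by (simp add: open_Int_closure_eq_empty)
    moreover have "coord \<theta>m 1 t z s \<in> N"
    proof -
      have "coord \<theta>m 1 t z s \<bullet> dirv \<theta>m = t" "coord \<theta>m 1 t z s \<bullet> nrmv \<theta>m = s"
        using orthonormal3_dirv[of 1 \<theta>m]
        by (simp_all add: coord_def frame_def orthonormal3_def inner_add_left inner_commute[of "nrmv \<theta>m" "dirv \<theta>m"]
            inner_commute[of ez "dirv \<theta>m"])
      then show ?thesis using assms 2 by (simp add: N_def)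
    qed
    moreover have "coord \<theta>m 1 t z s \<in> closure \<Omega>" using x by (simp add: frontier_def)
    ultimately show False by blast
  qed
qed

text \<open>The wedge is a cone: scaling about an edge point preserves the angle of the horizontal
  part. Only the truncations by \<open>h\<close> and \<open>M\<close> have to be checked, and
  \<open>r0\<close> is small enough for both points to satisfy them.\<close>

lemma dilation_in_D:
  assumes "\<sigma> > 0" "norm (x - vector [0, 0, c]) < r0" "r0 \<le> h" "r0 \<le> M - \<bar>c\<bar>"
    "\<sigma> * norm (x - vector [0, 0, c]) < r0"
  shows "vector [0, 0, c] + \<sigma> *\<^sub>R (x - vector [0, 0, c]) \<in> D \<longleftrightarrow> x \<in> D"
proof -
  let ?p = "vector [0, 0, c] :: real^3"
  have p: "proj12 (?p + \<sigma> *\<^sub>R (x - ?p)) = \<sigma> *\<^sub>R proj12 x"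
    by (simp add: proj12_def vec_eq_iff forall_2)
  have px: "norm (proj12 x) \<le> norm (x - ?p)"
  proof -
    have "proj12 x = proj12 (x - ?p)" by (simp add: proj12_def)
    then show ?thesis using norm_proj12_le by metis
  qed
  have x3: "\<bar>x$3\<bar> < M" "\<bar>(?p + \<sigma> *\<^sub>R (x - ?p))$3\<bar> < M"
  proof -
    have "\<bar>(x - ?p)$3\<bar> \<le> norm (x - ?p)" by (rule component_le_norm_cart)
    then have d: "\<bar>x$3 - c\<bar> \<le> norm (x - ?p)" by simp
    then show "\<bar>x$3\<bar> < M" using assms by linarith
    have "\<bar>\<sigma> * (x$3 - c)\<bar> \<le> \<sigma> * norm (x - ?p)" using d assms(1) by (simp add: abs_mult)
    then have "\<bar>c + \<sigma> * (x$3 - c)\<bar> < M" using assms by linarith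
    then show "\<bar>(?p + \<sigma> *\<^sub>R (x - ?p))$3\<bar> < M" by simp
  qed
  have "\<sigma> * norm (proj12 x) \<le> \<sigma> * norm (x - ?p)" using px assms(1) by simp
  then have "\<sigma> * norm (proj12 x) < h" "norm (proj12 x) < h" using px assms by linarith+
  then have "norm (\<sigma> *\<^sub>R proj12 x) < h" "norm (proj12 x) < h" using assms(1) by auto
  then show ?thesis
    unfolding mem_D p using x3 assms(1) by (auto simp: arg2_scale)
qed

lemma \<Omega>_near_edge:
  assumes "norm (x - vector [0, 0, c]) < r0" "r0 \<le> h" "r0 \<le> M - \<bar>c\<bar>"
  shows "x \<in> \<Omega> \<longleftrightarrow> x \<in> D"
proof -
  let ?p = "vector [0, 0, c] :: real^3"
  have "proj12 x = proj12 (x - ?p)" by (simp add: proj12_def)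
  then have "norm (proj12 x) < h" using norm_proj12_le[of "x - ?p"] assms by simp
  moreover have "\<bar>(x - ?p)$3\<bar> \<le> norm (x - ?p)" by (rule component_le_norm_cart)
  then have "\<bar>x$3\<bar> < M" using assms by simp
  ultimately have "x \<in> cyl (ball 0 h) {-M<..<M}" by (auto simp: cyl_def)
  then show ?thesis using edge by blast
qed

end

section \<open>Estimates near the edge\<close>

lemma ennreal_linear3:
  assumes "a \<ge> 0" "x \<ge> 0" "y \<ge> 0"
  shows "ennreal a * ennreal x + 3 * ennreal y = ennreal (a * x + 3 * y)"
proof -
  have "3 * ennreal y = ennreal (3 * y)" using assms by (simp add: ennreal_mult)
  moreover have "ennreal a * ennreal x = ennreal (a * x)" using assms by (simp add: ennreal_mult)
  ultimately show ?thesis using assms by (simp only: ennreal_plus mult_nonneg_nonneg zero_le_numeral)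
qed

lemma measurable_norm_indicator:
  fixes g :: "'a::euclidean_space \<Rightarrow> 'b::euclidean_space"
  assumes "B \<in> sets borel" "continuous_on B g"
  shows "(\<lambda>y. ennreal (norm (g y)) * indicator B y) \<in> borel_measurable lborel"
proof -
  have "(\<lambda>y. indicator B y *\<^sub>R norm (g y)) \<in> borel_measurable borel"
    using assms by (intro borel_measurable_continuous_on_indicator continuous_intros)
  then have "(\<lambda>y. indicator B y *\<^sub>R norm (g y)) \<in> borel_measurable lborel"
    by (simp only: measurable_lborel2)
  then have "(\<lambda>y. ennreal (indicator B y *\<^sub>R norm (g y))) \<in> borel_measurable lborel"
    by (rule measurable_compose[OF _ measurable_ennreal])
  also have "(\<lambda>y. ennreal (indicator B y *\<^sub>R norm (g y))) = (\<lambda>y. ennreal (norm (g y)) * indicator B y)"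
    by (auto split: split_indicator)
  finally show ?thesis .
qed

lemma L2_norm_measurable: "L2 M f \<Longrightarrow> (\<lambda>x. ennreal (norm (f x))) \<in> borel_measurable M"
  by (auto simp: L2_def)

lemma nn_integral_norm_le_L2_norm:
  assumes "finite_measure M" "L2 M f"
  shows "(\<integral>\<^sup>+x. ennreal (norm (f x)) \<partial>M) \<le> ennreal (sqrt (measure M (space M)) * L2_norm M f)"
proof -
  have "(\<integral>\<^sup>+x. ennreal (norm (f x)) \<partial>M) = ennreal (integral\<^sup>L M (\<lambda>x. norm (f x)))"
    using L2_integrable[OF assms] by (intro nn_integral_eq_integral) auto
  also have "\<dots> \<le> ennreal (sqrt (measure M (space M)) * L2_norm M f)"
    by (intro ennreal_leI integral_norm_le_L2_norm assms)
  finally show ?thesis .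
qed

lemma nn_integral_open_le_L2_norm:
  fixes f :: "real^3 \<Rightarrow> 'b::euclidean_space"
  assumes D: "open D" "bounded D" and f: "L2 (lebesgue_on D) f"
  shows "(\<integral>\<^sup>+x. ennreal (norm (f x)) * indicator D x \<partial>lborel) \<le> ennreal (sqrt (measure lebesgue D) * L2_norm (lebesgue_on D) f)"
proof -
  have L: "D \<in> sets lebesgue" using D by (simp add: open_sets_lebesgue)
  have fin: "finite_measure (lebesgue_on D)" using D L by (intro finite_measure_bounded)
  have i: "integrable (lebesgue_on D) (\<lambda>x. norm (f x))" using L2_integrable[OF fin f] by simp
  have "(\<integral>\<^sup>+x. ennreal (norm (f x)) * indicator D x \<partial>lborel) = ennreal (integral\<^sup>L (lebesgue_on D) (\<lambda>x. norm (f x)))"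
    by (rule nn_integral_lebesgue_on[OF L i]) simp
  also have "\<dots> \<le> ennreal (sqrt (measure (lebesgue_on D) (space (lebesgue_on D))) * L2_norm (lebesgue_on D) f)"
    by (intro ennreal_leI integral_norm_le_L2_norm fin f)
  finally show ?thesis using L by (simp add: measure_restrict_space)
qed

lemma H1_smooth:
  assumes "open \<Omega>" "bounded \<Omega>" "smooth f"
  shows "H1 \<Omega> f"
proof (rule H1_c1_on[OF assms(1,2)])
  show "c1_on \<Omega> f (\<lambda>x. \<chi> i j. partial j f x $ i)" by (rule c1_on_smooth[OF assms(3)])
  show "bounded (f ` \<Omega>)" "bounded ((\<lambda>x. \<chi> i j. partial j f x $ i) ` \<Omega>)"
    using assms smooth_continuous_on smooth_continuous_on_partial
    by (auto intro!: bounded_continuous_image_bounded continuous_on_vec_lambda continuous_on_component)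
qed

lemma L2_c1_UNIV:
  assumes "open D" "bounded D" "c1_on UNIV h J"
  shows "L2 (lebesgue_on D) h" "L2 (lebesgue_on D) J"
  using assms c1_on_continuous[of UNIV h J]
  by (auto intro!: L2_continuous simp: open_sets_lebesgue c1_on_def)

section \<open>The difference of the two fields on the faces and its gradient on the edge\<close>

locale edge = wedge +
  assumes H: hausdorff2_measure and lip: "lipschitz_domain \<Omega>"
begin

abbreviation "N \<equiv> surface_on (frontier \<Omega>)"

lemma finite_N: "finite_measure N"
  using S2_frontier_finite[OF H lip \<Omega>(2)] by (intro finite_measure_surface_on) auto

lemma nn_integral_N: "(\<integral>\<^sup>+x. f x \<partial>N) = (\<integral>\<^sup>+x. f x * indicator (frontier \<Omega>) x \<partial>S2)"
  unfolding surface_on_S2 by (rule nn_integral_restrict_space) simp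

lemma measurable_N: "f \<in> borel_measurable borel \<Longrightarrow> f \<in> borel_measurable N"
  unfolding surface_on_S2 by (intro measurable_restrict_space1) (simp add: measurable_cong_sets[OF sets_S2 refl])

lemma L2_N_continuous: "continuous_on UNIV f \<Longrightarrow> L2 N f"
  for f :: "real^3 \<Rightarrow> 'b::euclidean_space"
proof -
  assume f: "continuous_on UNIV f"
  have "bounded (frontier \<Omega>)"
    using \<Omega>(2) by (rule compact_imp_bounded[OF compact_frontier_bounded])
  then have "bounded (f ` frontier \<Omega>)" using f by (rule bounded_continuous_image_bounded)
  then obtain B where "\<And>x. x \<in> frontier \<Omega> \<Longrightarrow> norm (f x) \<le> B" by (auto simp: bounded_iff)
  then show "L2 N f"
    using f by (intro L2_bounded[OF finite_N]) (auto intro: measurable_N borel_measurable_continuous_onI)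
qed

lemma trace_L1:
  assumes "L2 N tv" "continuous_on UNIV f"
  shows "(\<integral>\<^sup>+x. ennreal (norm (f x - tv x)) \<partial>N) \<le> ennreal (sqrt (measure N (frontier \<Omega>)) * L2_norm N (\<lambda>x. f x - tv x))"
  using nn_integral_norm_le_L2_norm[OF finite_N L2_diff[OF L2_N_continuous[OF assms(2)] assms(1)]] by simp

lemma plane_coord: "plane 0 (dirv \<theta>) ez y = coord \<theta> \<epsilon> (fst y) (snd y) 0"
  by (simp add: plane_def coord_def frame_def)

lemma dirv_ez: "dirv \<theta> \<bullet> dirv \<theta> = 1" "ez \<bullet> ez = 1" "dirv \<theta> \<bullet> ez = 0"
  using orthonormal3_dirv[of 1 \<theta>] by (auto simp: orthonormal3_def)

text \<open>The traces agree only as limits of smooth functions, while \<open>f\<close> has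
  classical values on the face. With smooth approximations \<open>f1 n\<close> and
  \<open>f2 n\<close>, the function \<open>f1 n - f2 n - f\<close> has small energy in
  \<open>D\<close>, hence a small integral over a rectangle in the face; \<open>f1 n - f2 n\<close>
  is small there because the traces agree. So \<open>f\<close> integrates to zero in norm over the
  rectangle, and continuity makes this pointwise.\<close>

lemma trace_difference_vanishes:
  assumes H1: "H1 \<Omega> v" "H1 \<Omega> w" and tr: "is_trace \<Omega> v tv" "is_trace \<Omega> w tw"
    and \<Gamma>: "\<Gamma> \<subseteq> frontier \<Omega>" "\<Gamma> \<in> sets borel" "AE x in surface_on \<Gamma>. tw x = tv x"
    and \<theta>: "\<epsilon> = 1 \<and> \<theta> = \<theta>m \<or> \<epsilon> = -1 \<and> \<theta> = \<theta>M" "face \<theta> \<subseteq> \<Gamma>"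
    and f: "c1_on D f J" "L2 (lebesgue_on D) f" "L2 (lebesgue_on D) J" "continuous_on K f"
      "AE x in lebesgue_on D. v x - w x = f x"
    and t0: "0 < t0" "t0 < h" "\<bar>z0\<bar> < M"
  shows "f (coord \<theta> \<epsilon> t0 z0 0) = 0"
proof -
  have e: "\<epsilon> * \<epsilon> = 1" using \<theta> by auto
  let ?E = "\<lambda>y. coord \<theta> \<epsilon> (fst y) (snd y) 0"
  have plane: "?E = plane 0 (dirv \<theta>) ez"
    by (rule ext) (rule plane_coord[symmetric])
  \<comment> \<open>These margins ensure that the rectangle of half-side \<open>\<delta>\<close>
    about \<open>(t0, z0)\<close> stays on the face, and that it can be thickened to depth
    \<open>r\<close> inside \<open>D\<close>.\<close>
  define \<delta> where "\<delta> = min (t0 / 2) (min ((h - t0) / 2) ((M - \<bar>z0\<bar>) / 2))"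
  define r where "r = min (\<kappa> * t0 / 4) ((h - t0) / 4)"
  have \<delta>: "0 < \<delta>" "\<delta> \<le> t0 / 2" "\<delta> \<le> (h - t0) / 2" "\<delta> \<le> (M - \<bar>z0\<bar>) / 2"
    unfolding \<delta>_def by (use t0 in simp) (meson min.cobounded1 min.cobounded2 order_trans)+
  have r: "0 < r" "r \<le> \<kappa> * t0 / 4" "r \<le> (h - t0) / 4"
    unfolding r_def by (use t0 \<kappa> in simp) (meson min.cobounded1 min.cobounded2 order_trans)+
  define B where "B = box (t0 - \<delta>, z0 - \<delta>) (t0 + \<delta>, z0 + \<delta>)"
  have B: "B \<in> sets borel" "bounded B" "open B" by (auto simp: B_def open_box)
  have memB: "t0 / 2 \<le> fst y" "fst y < t0 + \<delta>" "\<bar>snd y\<bar> < M" if "y \<in> B" for y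
    using that \<delta> by (cases y; auto simp: B_def mem_box Basis_prod_def)+
  have inD: "coord \<theta> \<epsilon> (fst y) (snd y) s \<in> D" if "y \<in> B" "0 < s" "s \<le> r" for y s
  proof (rule coord_in_D[OF _ that(2) _ \<theta>(1)])
    note m = memB[OF that(1)]
    show "0 < fst y" "\<bar>snd y\<bar> < M" using m t0 by auto
    have "s \<le> \<kappa> * (t0 / 2) / 2" using that r by simp
    also have "\<dots> \<le> \<kappa> * fst y / 2" using m \<kappa> by (intro divide_right_mono mult_left_mono) auto
    also have "\<dots> < \<kappa> * fst y" using m t0 \<kappa> by simp
    finally show "s < \<kappa> * fst y" .
    have "fst y < t0 + (h - t0) / 2" using m(2) \<delta>(3) by linarith
    moreover have "s \<le> (h - t0) / 4" using that(3) r(3) by linarith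
    ultimately have "fst y + s < h" using t0(2) by (simp add: field_simps)
    then have "(fst y + s)\<^sup>2 < h\<^sup>2" using m t0 that by (intro power_strict_mono) auto
    moreover have "(fst y)\<^sup>2 + s\<^sup>2 \<le> (fst y + s)\<^sup>2" using m t0 that by (simp add: power2_sum)
    ultimately show "(fst y)\<^sup>2 + s\<^sup>2 < h\<^sup>2" by simp
  qed
  have inF: "?E y \<in> face \<theta>" "?E y \<in> K" if "y \<in> B" for y
  proof -
    note m = memB[OF that]
    have "0 < fst y" using m(1) t0(1) by linarith
    moreover have "fst y < t0 + (h - t0) / 2" using m(2) \<delta>(3) by linarith
    then have "fst y < h" using t0(2) by (simp add: field_simps)
    moreover note m(3)
    ultimately have *: "0 < fst y" "fst y < h" "\<bar>snd y\<bar> < M" by blast+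
    show "?E y \<in> face \<theta>" by (rule coord_in_face[OF *(1,2) \<theta>(1) *(3)])
    show "?E y \<in> K" using * by (intro coord_in_K[OF _ _ \<theta>(1)]) auto
  qed
  obtain f1 where f1: "\<And>n. smooth (f1 n)" "(\<lambda>n. H1_norm \<Omega> (\<lambda>x. f1 n x - v x)) \<longlonglongrightarrow> 0"
      "(\<lambda>n. L2_norm N (\<lambda>x. f1 n x - tv x)) \<longlonglongrightarrow> 0" and tv: "L2 N tv"
    using tr(1) unfolding is_trace_def by blast
  obtain f2 where f2: "\<And>n. smooth (f2 n)" "(\<lambda>n. H1_norm \<Omega> (\<lambda>x. f2 n x - w x)) \<longlonglongrightarrow> 0"
      "(\<lambda>n. L2_norm N (\<lambda>x. f2 n x - tw x)) \<longlonglongrightarrow> 0" and tw: "L2 N tw"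
    using tr(2) unfolding is_trace_def by blast
  let ?J = "\<lambda>g x. \<chi> i j. partial j g x $ i"
  \<comment> \<open>Up to a null set this is the approximation error for \<open>v\<close> minus that
    for \<open>w\<close>, so its energy tends to zero; yet it is C1 in \<open>D\<close>, and
    \<open>trace_estimate\<close> applies.\<close>
  define k where "k n x = f1 n x - f2 n x - f x" for n x
  define Jk where "Jk n x = ?J (f1 n) x - ?J (f2 n) x - J x" for n x
  have k: "c1_on D (k n) (Jk n)" for n
    unfolding k_def Jk_def
    by (intro c1_on_diff c1_on_smooth f1 f2 f)
  define en where "en n = 2 * (H1_norm \<Omega> (\<lambda>x. f1 n x - v x))\<^sup>2 + 2 * (H1_norm \<Omega> (\<lambda>x. f2 n x - w x))\<^sup>2" for n
  have en0: "en n \<ge> 0" for n by (simp add: en_def)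
  have L2k: "L2 (lebesgue_on D) (k n)" "L2 (lebesgue_on D) (Jk n)" for n
  proof -
    have *: "L2 (lebesgue_on D) g" "L2 (lebesgue_on D) (?J g)" if "smooth g" for g :: "real^3 \<Rightarrow> complex^3"
      using L2_c1_UNIV[OF open_D bounded_D c1_on_smooth[OF that]] .
    show "L2 (lebesgue_on D) (k n)" "L2 (lebesgue_on D) (Jk n)"
      unfolding k_def Jk_def by (intro L2_diff * f1 f2 f)+
  qed
  have energy: "(L2_norm (lebesgue_on D) (k n))\<^sup>2 + (L2_norm (lebesgue_on D) (Jk n))\<^sup>2 \<le> en n" for n
  proof -
    have h1: "H1 \<Omega> (\<lambda>x. f1 n x - v x)" "H1 \<Omega> (\<lambda>x. f2 n x - w x)"
      by (intro H1_diff[OF \<Omega>] H1_smooth[OF \<Omega>] f1 f2 H1)+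
    have "AE x in lebesgue_on D. k n x = (f1 n x - v x) - (f2 n x - w x)"
      using f(5) by eventually_elim (auto simp: k_def algebra_simps)
    from c1_on_energy_diff[OF open_D bounded_D k L2k H1_subset[OF \<Omega> h1(1) open_D D_subset] H1_subset[OF \<Omega> h1(2) open_D D_subset] this]
    show ?thesis
      using H1_norm_subset_le[OF \<Omega> h1(1) open_D D_subset] H1_norm_subset_le[OF \<Omega> h1(2) open_D D_subset]
      by (simp add: en_def)
  qed
  have cont: "continuous_on UNIV (f1 n)" "continuous_on UNIV (f2 n)" for n
    using smooth_continuous_on f1(1) f2(1) by auto
  let ?m = "sqrt (measure lebesgue D)"
  have trace_k: "(\<integral>\<^sup>+y. ennreal (norm (k n (?E y))) * indicator B y \<partial>lborel) \<le> ennreal ((1 / r + 3) * ?m * sqrt (en n))" for n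
  proof -
    have "(\<integral>\<^sup>+y. ennreal (norm (k n (0 + frame (dirv \<theta>) ez (\<epsilon> *\<^sub>R nrmv \<theta>) (y, 0)))) * indicator B y \<partial>lborel) \<le>
      ennreal (1 / r) * (\<integral>\<^sup>+x. ennreal (norm (k n x)) * indicator D x \<partial>lborel) +
      3 * (\<integral>\<^sup>+x. ennreal (norm (Jk n x)) * indicator D x \<partial>lborel)"
    proof (rule trace_estimate[OF orthonormal3_dirv[OF e] r(1) B(1) k open_D])
      show "D \<in> sets borel" using open_D by simp
      fix y assume y: "y \<in> B"
      show "0 + frame (dirv \<theta>) ez (\<epsilon> *\<^sub>R nrmv \<theta>) (y, s) \<in> D" if "0 < s" "s < r" for s
        using inD[OF y, of s] that by (simp add: coord_def)
      have "continuous_on {0..r} (\<lambda>s. k n (coord \<theta> \<epsilon> (fst y) (snd y) s))"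
      proof (rule continuous_on_compose2[of K "k n"])
        show "continuous_on K (k n)"
          unfolding k_def using cont f(4) by (intro continuous_intros) (auto intro: continuous_on_subset)
        have "coord \<theta> \<epsilon> (fst y) (snd y) s \<in> K" if "s \<in> {0..r}" for s
          using inF(2)[OF y] inD[OF y, of s] that D_subset_K by (cases "s = 0") auto
        then show "(\<lambda>s. coord \<theta> \<epsilon> (fst y) (snd y) s) ` {0..r} \<subseteq> K" by blast
      qed (auto intro!: continuous_intros)
      then have "((\<lambda>s. k n (coord \<theta> \<epsilon> (fst y) (snd y) s)) \<longlongrightarrow> k n (coord \<theta> \<epsilon> (fst y) (snd y) 0)) (at 0 within {0..r})"
        using r(1) by (auto simp: continuous_on_def)
      then show "((\<lambda>s. k n (0 + frame (dirv \<theta>) ez (\<epsilon> *\<^sub>R nrmv \<theta>) (y, s))) \<longlongrightarrow>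
        k n (0 + frame (dirv \<theta>) ez (\<epsilon> *\<^sub>R nrmv \<theta>) (y, 0))) (at_right 0)"
        using r(1) by (simp add: coord_def at_within_Icc_at_right)
    qed auto
    also have "(\<integral>\<^sup>+x. ennreal (norm (k n x)) * indicator D x \<partial>lborel) \<le> ennreal (?m * sqrt (en n))"
    proof -
      have "L2_norm (lebesgue_on D) (k n) \<le> sqrt (en n)"
        using energy[of n] by (intro real_le_rsqrt) (smt (verit) zero_le_power2)
      then have "?m * L2_norm (lebesgue_on D) (k n) \<le> ?m * sqrt (en n)" by (intro mult_left_mono) auto
      from order_trans[OF nn_integral_open_le_L2_norm[OF open_D bounded_D L2k(1)] ennreal_leI[OF this]] show ?thesis .
    qed
    also have "(\<integral>\<^sup>+x. ennreal (norm (Jk n x)) * indicator D x \<partial>lborel) \<le> ennreal (?m * sqrt (en n))"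
    proof -
      have "L2_norm (lebesgue_on D) (Jk n) \<le> sqrt (en n)"
        using energy[of n] by (intro real_le_rsqrt) (smt (verit) zero_le_power2)
      then have "?m * L2_norm (lebesgue_on D) (Jk n) \<le> ?m * sqrt (en n)" by (intro mult_left_mono) auto
      from order_trans[OF nn_integral_open_le_L2_norm[OF open_D bounded_D L2k(2)] ennreal_leI[OF this]] show ?thesis .
    qed
    also have "ennreal (1 / r) * ennreal (?m * sqrt (en n)) + 3 * ennreal (?m * sqrt (en n)) = ennreal ((1 / r + 3) * ?m * sqrt (en n))"
      using ennreal_linear3[of "1 / r" "?m * sqrt (en n)" "?m * sqrt (en n)"] r(1) en0 by (simp add: distrib_right mult.assoc)
    finally show ?thesis by (simp add: coord_def add_mono mult_left_mono)
  qed
  define dn where "dn n = sqrt (measure N (frontier \<Omega>)) * L2_norm N (\<lambda>x. f1 n x - tv x) +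
    sqrt (measure N (frontier \<Omega>)) * L2_norm N (\<lambda>x. f2 n x - tw x)" for n
  have dn0: "dn n \<ge> 0" for n by (simp add: dn_def L2_norm_nonneg)
  have trace_f: "(\<integral>\<^sup>+y. ennreal (norm (f1 n (?E y) - f2 n (?E y))) * indicator B y \<partial>lborel) \<le> ennreal (16 / pi * dn n)" for n
  proof -
    let ?g = "\<lambda>x. ennreal (norm (f1 n x - f2 n x))"
    have g: "?g \<in> borel_measurable borel"
      using cont[of n, THEN borel_measurable_continuous_onI] by measurable
    \<comment> \<open>The lower comparison is the relevant one: smallness is known for the surface
      measure and wanted for the parameters.\<close>
    have "ennreal (pi / 16) * (\<integral>\<^sup>+y. ?g (plane 0 (dirv \<theta>) ez y) * indicator B y \<partial>lborel) \<le>
        (\<integral>\<^sup>+x. ?g x * indicator (plane 0 (dirv \<theta>) ez ` B) x \<partial>S2)"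
      by (rule nn_integral_S2_plane_ge[OF dirv_ez H B(1) g])
    then have "ennreal (pi / 16) * (\<integral>\<^sup>+y. ?g (?E y) * indicator B y \<partial>lborel) \<le> (\<integral>\<^sup>+x. ?g x * indicator (?E ` B) x \<partial>S2)"
      unfolding plane[symmetric] .
    also have "\<dots> = (\<integral>\<^sup>+x. ?g x * indicator (?E ` B) x \<partial>N)"
      unfolding nn_integral_N using inF(1) \<theta>(2) \<Gamma>(1)
      by (intro nn_integral_cong) (auto split: split_indicator)
    also have "\<dots> \<le> (\<integral>\<^sup>+x. ennreal (norm (f1 n x - tv x)) + ennreal (norm (f2 n x - tw x)) \<partial>N)"
    proof (rule nn_integral_mono_AE)
      have "AE x in S2. x \<in> \<Gamma> \<longrightarrow> tw x = tv x"
        using \<Gamma>(2,3) unfolding surface_on_S2 by (subst (asm) AE_restrict_space_iff) auto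
      then have "AE x in N. x \<in> \<Gamma> \<longrightarrow> tw x = tv x"
        unfolding surface_on_S2 by (subst AE_restrict_space_iff) auto
      then show "AE x in N. ?g x * indicator (?E ` B) x \<le> ennreal (norm (f1 n x - tv x)) + ennreal (norm (f2 n x - tw x))"
      proof eventually_elim
        case (elim x)
        show ?case
        proof (cases "x \<in> ?E ` B")
          case True
          then have "tw x = tv x" using elim inF(1) \<theta>(2) by blast
          then have "norm (f1 n x - f2 n x) \<le> norm (f1 n x - tv x) + norm (f2 n x - tw x)"
            using norm_triangle_ineq4[of "f1 n x - tv x" "f2 n x - tw x"] by simp
          then show ?thesis using True by (simp flip: ennreal_plus)
        qed simp
      qed
    qed
    also have "\<dots> = (\<integral>\<^sup>+x. ennreal (norm (f1 n x - tv x)) \<partial>N) + (\<integral>\<^sup>+x. ennreal (norm (f2 n x - tw x)) \<partial>N)"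
      by (intro nn_integral_add L2_norm_measurable L2_diff L2_N_continuous cont tv tw)
    also have "\<dots> \<le> ennreal (sqrt (measure N (frontier \<Omega>)) * L2_norm N (\<lambda>x. f1 n x - tv x)) +
      ennreal (sqrt (measure N (frontier \<Omega>)) * L2_norm N (\<lambda>x. f2 n x - tw x))"
      by (intro add_mono trace_L1 tv tw cont)
    also have "\<dots> = ennreal (dn n)"
      by (simp add: dn_def L2_norm_nonneg)
    finally have le: "ennreal (pi / 16) * (\<integral>\<^sup>+y. ?g (?E y) * indicator B y \<partial>lborel) \<le> ennreal (dn n)" .
    have "(\<integral>\<^sup>+y. ?g (?E y) * indicator B y \<partial>lborel) = ennreal (16 / pi) * (ennreal (pi / 16) * (\<integral>\<^sup>+y. ?g (?E y) * indicator B y \<partial>lborel))"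
      by (simp add: mult.assoc[symmetric] ennreal_mult[symmetric])
    also have "\<dots> \<le> ennreal (16 / pi) * ennreal (dn n)"
      using le by (intro mult_left_mono) auto
    also have "\<dots> = ennreal (16 / pi * dn n)"
      using dn0 by (intro ennreal_mult[symmetric]) auto
    finally show ?thesis .
  qed
  have cfE: "continuous_on B (\<lambda>y. f (?E y))"
    by (rule continuous_on_compose2[OF f(4)]) (use inF(2) in \<open>auto intro!: continuous_intros\<close>)
  have bound: "(\<integral>\<^sup>+y. ennreal (norm (f (?E y))) * indicator B y \<partial>lborel) \<le> ennreal ((1 / r + 3) * ?m * sqrt (en n) + 16 / pi * dn n)" for n
  proof -
    note mk = measurable_norm_indicator[OF B(1)]
    have cE: "continuous_on B (\<lambda>y. g (?E y))" if "continuous_on UNIV g" for g :: "real^3 \<Rightarrow> complex^3"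
      by (rule continuous_on_compose2[OF that]) (auto intro!: continuous_intros)
    have "(\<integral>\<^sup>+y. ennreal (norm (f (?E y))) * indicator B y \<partial>lborel) \<le>
        (\<integral>\<^sup>+y. (ennreal (norm (k n (?E y))) * indicator B y + ennreal (norm (f1 n (?E y) - f2 n (?E y))) * indicator B y) \<partial>lborel)"
    proof (intro nn_integral_mono)
      fix y
      have "norm (f (?E y)) \<le> norm (k n (?E y)) + norm (f1 n (?E y) - f2 n (?E y))"
        using norm_triangle_ineq4[of "f1 n (?E y) - f2 n (?E y)" "k n (?E y)"] by (simp add: k_def)
      then show "ennreal (norm (f (?E y))) * indicator B y \<le>
        ennreal (norm (k n (?E y))) * indicator B y + ennreal (norm (f1 n (?E y) - f2 n (?E y))) * indicator B y"
        by (auto simp flip: ennreal_plus split: split_indicator)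
    qed
    also have "\<dots> = (\<integral>\<^sup>+y. ennreal (norm (k n (?E y))) * indicator B y \<partial>lborel) +
        (\<integral>\<^sup>+y. ennreal (norm (f1 n (?E y) - f2 n (?E y))) * indicator B y \<partial>lborel)"
      unfolding k_def by (intro nn_integral_add mk continuous_on_diff cfE cE cont)
    also have "\<dots> \<le> ennreal ((1 / r + 3) * ?m * sqrt (en n)) + ennreal (16 / pi * dn n)"
      by (intro add_mono trace_k trace_f)
    also have "\<dots> = ennreal ((1 / r + 3) * ?m * sqrt (en n) + 16 / pi * dn n)"
      using r(1) en0 dn0 by (intro ennreal_plus[symmetric]) auto
    finally show ?thesis .
  qed
  have "(\<lambda>n. (1 / r + 3) * ?m * sqrt (en n) + 16 / pi * dn n) \<longlonglongrightarrow> (1 / r + 3) * ?m * sqrt (2 * 0\<^sup>2 + 2 * 0\<^sup>2) +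
      16 / pi * (sqrt (measure N (frontier \<Omega>)) * 0 + sqrt (measure N (frontier \<Omega>)) * 0)"
    unfolding en_def dn_def by (intro tendsto_intros f1 f2)
  then have "(\<lambda>n. ennreal ((1 / r + 3) * ?m * sqrt (en n) + 16 / pi * dn n)) \<longlonglongrightarrow> ennreal 0"
    by (intro tendsto_ennrealI) simp
  then have "(\<integral>\<^sup>+y. ennreal (norm (f (?E y))) * indicator B y \<partial>lborel) \<le> ennreal 0"
    by (rule LIMSEQ_le_const) (use bound in auto)
  then have int0: "(\<integral>\<^sup>+y. ennreal (norm (f (?E y))) * indicator B y \<partial>lborel) = 0" by simp
  show ?thesis
  proof (rule ccontr)
    assume ne: "f (coord \<theta> \<epsilon> t0 z0 0) \<noteq> 0"
    \<comment> \<open>A nonzero value would persist on a nonempty open subset of the rectangle,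
      which is not negligible.\<close>
    define X where "X = {y \<in> B. f (?E y) \<noteq> 0}"
    have "X = B \<inter> (\<lambda>y. f (?E y)) -` (- {0})" by (auto simp: X_def)
    then have oX: "open X"
      using continuous_on_open_vimage[OF B(3), of "\<lambda>y. f (?E y)"] cfE by (auto simp: Int_commute)
    have "(t0, z0) \<in> X"
      using ne \<delta> by (auto simp: X_def B_def mem_box Basis_prod_def)
    then have "\<not> negligible X" using open_not_negligible[OF oX] by blast
    moreover have "AE y in lborel. ennreal (norm (f (?E y))) * indicator B y = 0"
      using int0 measurable_norm_indicator[OF B(1) cfE] by (subst (asm) nn_integral_0_iff_AE) auto
    then have "AE y in lborel. y \<notin> X"
      by eventually_elim (auto simp: X_def)
    then have "X \<in> null_sets lborel"
      using oX by (simp add: AE_iff_null_sets)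
    then have "negligible X"
      by (simp add: negligible_iff_null_sets null_sets_completionI)
    ultimately show False by blast
  qed
qed

end

lemma sum_squares_le_square_sum: "0 \<le> x \<Longrightarrow> 0 \<le> y \<Longrightarrow> x\<^sup>2 + y\<^sup>2 \<le> (x + y)\<^sup>2" for x y :: real
  by (simp add: power2_sum)

context wedge
begin

text \<open>Increments of \<open>f\<close> along each face and along the edge direction vanish, so
  its derivative at the edge annihilates three directions, which are independent when the faces are
  not coplanar. As \<open>f\<close> is differentiable only inside \<open>D\<close>, increments are
  taken along segments at depth \<open>s\<close> parallel to a face, and \<open>s\<close> then tends
  to 0 by continuity on \<open>K\<close>.\<close>

lemma gradient_vanishes_at_edge:
  fixes f :: "real^3 \<Rightarrow> complex^3" and G :: "real^3 \<Rightarrow> (real^3) \<Rightarrow>\<^sub>L (complex^3)"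
  assumes nz: "sin (\<theta>M - \<theta>m) \<noteq> 0" and c: "\<bar>c\<bar> < M" and \<alpha>: "\<alpha> > 0"
    and f: "continuous_on K f" and G: "\<And>x y. x \<in> K \<Longrightarrow> y \<in> K \<Longrightarrow> norm (G x - G y) \<le> C * dist x y powr \<alpha>"
    and d: "\<And>x. x \<in> D \<Longrightarrow> (f has_derivative blinfun_apply (G x)) (at x)"
    and f0: "\<And>\<epsilon> \<theta> t z. \<epsilon> = 1 \<and> \<theta> = \<theta>m \<or> \<epsilon> = -1 \<and> \<theta> = \<theta>M \<Longrightarrow> 0 < t \<Longrightarrow> t < h \<Longrightarrow> \<bar>z\<bar> < M \<Longrightarrow> f (coord \<theta> \<epsilon> t z 0) = 0"
  shows "G (vector [0, 0, c]) = 0"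
proof -
  let ?p = "vector [0, 0, c] :: real^3"
  have p: "?p = coord \<theta> \<epsilon> 0 c 0" for \<theta> \<epsilon> by (simp add: coord_eq)
  have pK: "?p \<in> K" unfolding p[of \<theta>m 1] using hM c by (intro coord_in_K) auto
  have main: "blinfun_apply (G ?p) (coord \<theta> \<epsilon> d1 d2 0) = 0"
    if \<theta>: "\<epsilon> = 1 \<and> \<theta> = \<theta>m \<or> \<epsilon> = -1 \<and> \<theta> = \<theta>M" and d12: "d1 = 1 \<and> d2 = 0 \<or> d1 = 0 \<and> d2 = (1::real)" for \<epsilon> \<theta> d1 d2
  proof -
    have e: "\<epsilon> * \<epsilon> = 1" using \<theta> by auto
    let ?v = "coord \<theta> \<epsilon> d1 d2 0"
    have est: "norm (blinfun_apply (G ?p) ?v) \<le> \<bar>C\<bar> * (4 * \<tau>) powr \<alpha>" if \<tau>: "0 < \<tau>" "4 * \<tau> < h" "\<tau> < M - \<bar>c\<bar>" for \<tau>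
    proof -
      \<comment> \<open>A segment of length \<tau>, starting at distance \<tau> from the edge to
        leave room inside \<open>D\<close>. Both scales are equal, so the Hoelder error of the
        derivative times the length, divided by the length, still tends to zero with \<tau>.\<close>
      let ?x = "\<lambda>u s. coord \<theta> \<epsilon> (\<tau> + u * (d1 * \<tau>)) (c + u * (d2 * \<tau>)) s"
      have range: "\<tau> \<le> \<tau> + u * (d1 * \<tau>)" "\<tau> + u * (d1 * \<tau>) \<le> 2 * \<tau>" "\<bar>u * (d2 * \<tau>)\<bar> \<le> \<tau>" if "0 \<le> u" "u \<le> 1" for u
        using that d12 \<tau>(1) mult_right_mono[of u 1 \<tau>] by auto
      have inD: "?x u s \<in> D" if u: "0 \<le> u" "u \<le> 1" and s: "0 < s" "s < \<kappa> * \<tau>" for u s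
      proof (rule coord_in_D[OF _ s(1) _ \<theta>])
        note r = range[OF u]
        show "0 < \<tau> + u * (d1 * \<tau>)" using r \<tau> by linarith
        have "\<kappa> * \<tau> \<le> \<kappa> * (\<tau> + u * (d1 * \<tau>))" using r \<kappa> by (intro mult_left_mono) auto
        then show "s < \<kappa> * (\<tau> + u * (d1 * \<tau>))" using s by linarith
        have "\<kappa> * \<tau> \<le> 1 * \<tau>" using \<kappa> \<tau> by (intro mult_right_mono) auto
        then have "(\<tau> + u * (d1 * \<tau>)) + s < h" using s r \<tau> by linarith
        then have "((\<tau> + u * (d1 * \<tau>)) + s)\<^sup>2 < h\<^sup>2" using r s \<tau> by (intro power_strict_mono) auto
        moreover have "(\<tau> + u * (d1 * \<tau>))\<^sup>2 + s\<^sup>2 \<le> ((\<tau> + u * (d1 * \<tau>)) + s)\<^sup>2"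
          by (rule sum_squares_le_square_sum) (use r s \<tau> in auto)
        ultimately show "(\<tau> + u * (d1 * \<tau>))\<^sup>2 + s\<^sup>2 < h\<^sup>2" by simp
        show "\<bar>c + u * (d2 * \<tau>)\<bar> < M" using r \<tau> by linarith
      qed
      have near: "dist (?x u s) ?p \<le> 4 * \<tau>" if u: "0 \<le> u" "u \<le> 1" and s: "0 \<le> s" "s \<le> \<kappa> * \<tau>" for u s
      proof -
        have "dist (?x u s) ?p = norm (coord \<theta> \<epsilon> (\<tau> + u * (d1 * \<tau>)) (u * (d2 * \<tau>)) s)"
          unfolding p[of \<theta> \<epsilon>] dist_norm coord_diff by simp
        also have "\<dots> \<le> \<bar>\<tau> + u * (d1 * \<tau>)\<bar> + \<bar>s\<bar> + \<bar>u * (d2 * \<tau>)\<bar>" by (rule norm_coord_le[OF e])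
        also have "\<dots> \<le> 4 * \<tau>"
        proof -
          have "\<kappa> * \<tau> \<le> 1 * \<tau>" using \<kappa> \<tau> by (intro mult_right_mono) auto
          then show ?thesis using range[OF u] s \<tau> by linarith
        qed
        finally show ?thesis .
      qed
      have xv: "?x u s = ?x 0 s + (u * \<tau>) *\<^sub>R ?v" for u s
        by (simp add: vec_eq_iff forall_3 algebra_simps)
      have nv: "norm ?v \<le> 1" using norm_coord[OF e, of \<theta> d1 d2 0] d12 by (auto simp: power2_eq_1_iff)
      have step: "norm (f (?x 1 s) - f (?x 0 s) - \<tau> *\<^sub>R blinfun_apply (G ?p) ?v) \<le> \<bar>C\<bar> * (4 * \<tau>) powr \<alpha> * \<tau>"
        if s: "0 < s" "s < \<kappa> * \<tau>" for s
      proof -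
        let ?S = "closed_segment (?x 0 s) (?x 1 s)"
        have seg: "\<exists>u. 0 \<le> u \<and> u \<le> 1 \<and> y = ?x u s" if yS: "y \<in> ?S" for y
        proof -
          obtain u where u: "0 \<le> u" "u \<le> 1" "y = (1 - u) *\<^sub>R ?x 0 s + u *\<^sub>R ?x 1 s"
            using yS by (auto simp: closed_segment_def)
          have "y = ?x u s" unfolding u(3) by (simp add: vec_eq_iff forall_3 algebra_simps)
          with u show ?thesis by blast
        qed
        \<comment> \<open>Subtracting the linear map \<open>G p\<close> makes the mean value
          inequality measure the deviation of \<open>f\<close> from its would-be linear
          part.\<close>
        have "norm ((f (?x 1 s) - G ?p (?x 1 s)) - (f (?x 0 s) - G ?p (?x 0 s))) \<le> (\<bar>C\<bar> * (4 * \<tau>) powr \<alpha>) * norm (?x 1 s - ?x 0 s)"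
        proof (rule differentiable_bound[of ?S "\<lambda>y. f y - G ?p y" "\<lambda>y v. G y v - G ?p v"])
          fix y assume "y \<in> ?S"
          then obtain u where u: "0 \<le> u" "u \<le> 1" "y = ?x u s" using seg by blast
          have yD: "y \<in> D" using inD[OF u(1,2) s] u(3) by simp
          show "((\<lambda>y. f y - G ?p y) has_derivative (\<lambda>v. G y v - G ?p v)) (at y within ?S)"
            by (intro has_derivative_diff has_derivative_at_withinI[OF d[OF yD]] bounded_linear_imp_has_derivative blinfun.bounded_linear_right)
          have "norm (G y - G ?p) \<le> C * dist y ?p powr \<alpha>"
            using yD D_subset_K pK by (intro G) auto
          also have "\<dots> \<le> \<bar>C\<bar> * (4 * \<tau>) powr \<alpha>"
            using near[of u s] u s \<alpha> by (intro mult_mono powr_mono2) auto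
          finally have "norm (G y - G ?p) \<le> \<bar>C\<bar> * (4 * \<tau>) powr \<alpha>" .
          then show "onorm (\<lambda>v. G y v - G ?p v) \<le> \<bar>C\<bar> * (4 * \<tau>) powr \<alpha>"
            by (simp add: norm_blinfun.rep_eq blinfun.diff_left[symmetric])
        qed auto
        also have v: "?x 1 s - ?x 0 s = \<tau> *\<^sub>R ?v" using xv[of 1 s] by simp
        also have "(\<bar>C\<bar> * (4 * \<tau>) powr \<alpha>) * norm (\<tau> *\<^sub>R ?v) \<le> (\<bar>C\<bar> * (4 * \<tau>) powr \<alpha>) * \<tau>"
          using nv \<tau> by (intro mult_left_mono) (auto simp: mult_left_le)
        also have "(f (?x 1 s) - G ?p (?x 1 s)) - (f (?x 0 s) - G ?p (?x 0 s)) = f (?x 1 s) - f (?x 0 s) - G ?p (?x 1 s - ?x 0 s)"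
          by (simp only: blinfun.diff_right) (simp only: algebra_simps)
        also have "\<dots> = f (?x 1 s) - f (?x 0 s) - \<tau> *\<^sub>R blinfun_apply (G ?p) ?v"
          unfolding v blinfun.scaleR_right ..
        finally show ?thesis .
      qed
      have lim: "((\<lambda>s. f (?x u s)) \<longlongrightarrow> 0) (at_right 0)" if u: "u = 0 \<or> u = 1" for u
      proof -
        have *: "?x u 0 \<in> K" "f (?x u 0) = 0"
        proof -
          have "0 \<le> u" "u \<le> 1" using u by auto
          note r = range[OF this]
          have a: "0 < \<tau> + u * (d1 * \<tau>)" "\<tau> + u * (d1 * \<tau>) < h" using r \<tau> by linarith+
          have b: "\<bar>c + u * (d2 * \<tau>)\<bar> < M" using r \<tau> by linarith
          show "?x u 0 \<in> K" by (rule coord_in_K[OF less_imp_le[OF a(1)] a(2) \<theta> b])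
          show "f (?x u 0) = 0" by (rule f0[OF \<theta> a b])
        qed
        have \<kappa>\<tau>: "0 < \<kappa> * \<tau> / 2" using \<kappa> \<tau> by simp
        have "continuous_on {0..\<kappa> * \<tau> / 2} (\<lambda>s. f (?x u s))"
        proof (rule continuous_on_compose2[OF f])
          have "?x u s \<in> K" if "s \<in> {0..\<kappa> * \<tau> / 2}" for s
          proof (cases "s = 0")
            case False
            then have "s < \<kappa> * \<tau>" using that \<kappa>\<tau> by auto
            then show ?thesis using inD[of u s] D_subset_K that False u by auto
          qed (use * in simp)
          then show "(\<lambda>s. ?x u s) ` {0..\<kappa> * \<tau> / 2} \<subseteq> K" by blast
        qed (auto intro!: continuous_intros)
        then have "((\<lambda>s. f (?x u s)) \<longlongrightarrow> f (?x u 0)) (at 0 within {0..\<kappa> * \<tau> / 2})"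
          using \<kappa>\<tau> by (auto simp: continuous_on_def)
        then show ?thesis using *(2) \<kappa>\<tau> by (simp add: at_within_Icc_at_right)
      qed
      have "norm (0 - 0 - \<tau> *\<^sub>R blinfun_apply (G ?p) ?v) \<le> \<bar>C\<bar> * (4 * \<tau>) powr \<alpha> * \<tau>"
      proof (rule tendsto_upperbound)
        show "((\<lambda>s. norm (f (?x 1 s) - f (?x 0 s) - \<tau> *\<^sub>R blinfun_apply (G ?p) ?v)) \<longlongrightarrow> norm (0 - 0 - \<tau> *\<^sub>R blinfun_apply (G ?p) ?v)) (at_right 0)"
          by (intro tendsto_intros lim) auto
        show "\<forall>\<^sub>F s in at_right 0. norm (f (?x 1 s) - f (?x 0 s) - \<tau> *\<^sub>R blinfun_apply (G ?p) ?v) \<le> \<bar>C\<bar> * (4 * \<tau>) powr \<alpha> * \<tau>"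
          unfolding eventually_at_right_field using step \<kappa> \<tau> by (intro exI[of _ "\<kappa> * \<tau>"]) auto
      qed simp
      then show ?thesis using \<tau> by (simp add: mult.commute)
    qed
    have "norm (blinfun_apply (G ?p) ?v) \<le> \<bar>C\<bar> * 0"
    proof (rule tendsto_lowerbound)
      have "((\<lambda>\<tau>. (4 * \<tau>) powr \<alpha>) \<longlongrightarrow> 0) (at_right 0)"
      proof (rule tendsto_zero_powrI)
        show "((\<lambda>\<tau>::real. 4 * \<tau>) \<longlongrightarrow> 0) (at_right 0)" by (auto intro!: tendsto_eq_intros)
        show "((\<lambda>\<tau>::real. \<alpha>) \<longlongrightarrow> \<alpha>) (at_right 0)" by simp
        show "\<alpha> > 0" by fact
        show "\<forall>\<^sub>F \<tau>::real in at_right 0. 0 \<le> 4 * \<tau>" by (auto simp: eventually_at_right_field intro!: exI[of _ 1])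
      qed
      then show "((\<lambda>\<tau>. \<bar>C\<bar> * (4 * \<tau>) powr \<alpha>) \<longlongrightarrow> \<bar>C\<bar> * 0) (at_right 0)" by (intro tendsto_intros)
      show "\<forall>\<^sub>F \<tau> in at_right 0. norm (blinfun_apply (G ?p) ?v) \<le> \<bar>C\<bar> * (4 * \<tau>) powr \<alpha>"
        unfolding eventually_at_right_field using est hM c by (intro exI[of _ "min (h / 4) (M - \<bar>c\<bar>)"]) auto
    qed simp
    then show ?thesis by simp
  qed
  have "blinfun_apply (G ?p) x = 0" for x
  proof -
    let ?\<Delta> = "sin (\<theta>M - \<theta>m)"
    let ?a = "coord \<theta>m 1 1 0 0" and ?b = "coord \<theta>M (-1) 1 0 0" and ?e = "coord \<theta>m 1 0 1 0"
    \<comment> \<open>Cramer's rule for the horizontal part of \<open>x\<close> in the basis formed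
      by the two face directions, whose determinant is the sine of the opening angle.\<close>
    have "x = ((x$1 * sin \<theta>M - x$2 * cos \<theta>M) / ?\<Delta>) *\<^sub>R ?a + ((x$2 * cos \<theta>m - x$1 * sin \<theta>m) / ?\<Delta>) *\<^sub>R ?b + x$3 *\<^sub>R ?e"
      using nz by (simp add: vec_eq_iff forall_3 field_simps) (simp add: sin_diff algebra_simps)
    then have "G ?p x = G ?p (((x$1 * sin \<theta>M - x$2 * cos \<theta>M) / ?\<Delta>) *\<^sub>R ?a + ((x$2 * cos \<theta>m - x$1 * sin \<theta>m) / ?\<Delta>) *\<^sub>R ?b + x$3 *\<^sub>R ?e)"
      by simp
    also have "\<dots> = 0"
      using main[of 1 \<theta>m 1 0] main[of "-1" \<theta>M 1 0] main[of 1 \<theta>m 0 1]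
      by (simp add: blinfun.add_right blinfun.scaleR_right)
    finally show ?thesis .
  qed
  then show ?thesis by (intro blinfun_eqI) simp
qed

end

section \<open>Estimates at a fixed edge point on a small scale\<close>

context edge
begin

context
  fixes c r0 :: real
  assumes r0: "0 < r0" "r0 \<le> h" "r0 \<le> M - \<bar>c\<bar>"
begin

abbreviation "p \<equiv> vector [0, 0, c] :: real^3"

definition nbhd :: "real \<Rightarrow> (real^3) set" where "nbhd r = D \<inter> ball p r"

lemma open_nbhd: "open (nbhd r)" and bounded_nbhd: "bounded (nbhd r)" and nbhd_subset: "nbhd r \<subseteq> D"
  using open_D bounded_D by (auto simp: nbhd_def intro: bounded_subset)

lemma nbhd_lebesgue: "nbhd r \<in> sets lebesgue"
  using open_nbhd by (rule open_sets_lebesgue)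

text \<open>Up to radius \<open>r0\<close> the truncations of \<open>D\<close> are not felt, and
  what remains is a cone with vertex \<open>p\<close>. All neighbourhoods are thus copies of the one
  at radius \<open>r0\<close>, which is what makes the constants independent of the scale.\<close>

lemma dilation_nbhd:
  assumes \<sigma>: "0 < \<sigma>" "\<sigma> \<le> 1"
  shows "(\<lambda>x. p + \<sigma> *\<^sub>R (x - p)) ` nbhd r0 = nbhd (\<sigma> * r0)"
proof (intro equalityI subsetI)
  fix y assume "y \<in> (\<lambda>x. p + \<sigma> *\<^sub>R (x - p)) ` nbhd r0"
  then obtain x where x: "x \<in> D" "norm (x - p) < r0" "y = p + \<sigma> *\<^sub>R (x - p)"
    by (auto simp: nbhd_def dist_norm norm_minus_commute)
  have "\<sigma> * norm (x - p) < \<sigma> * r0" using x \<sigma> by simp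
  moreover have "\<sigma> * r0 \<le> r0" using \<sigma> r0 by (simp add: mult_left_le_one_le)
  ultimately have "y \<in> D" using dilation_in_D[OF \<sigma>(1) x(2) r0(2,3)] x by simp
  moreover have "dist p y = \<sigma> * norm (x - p)" unfolding x(3) dist_norm using \<sigma> by simp
  ultimately show "y \<in> nbhd (\<sigma> * r0)" using \<open>\<sigma> * norm (x - p) < \<sigma> * r0\<close> by (simp add: nbhd_def)
next
  fix y assume "y \<in> nbhd (\<sigma> * r0)"
  then have y: "y \<in> D" "norm (y - p) < \<sigma> * r0" by (auto simp: nbhd_def dist_norm norm_minus_commute)
  define x where "x = p + inverse \<sigma> *\<^sub>R (y - p)"
  have "\<sigma> * r0 \<le> r0" using \<sigma> r0 by (simp add: mult_left_le_one_le)
  then have "norm (y - p) < r0" using y by linarith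
  moreover have nx: "inverse \<sigma> * norm (y - p) < r0" using y \<sigma> by (simp add: field_simps)
  ultimately have "x \<in> D" unfolding x_def using dilation_in_D[of "inverse \<sigma>" y c r0] \<sigma> y r0 by simp
  moreover have "dist p x = inverse \<sigma> * norm (y - p)" unfolding x_def dist_norm using \<sigma> by simp
  ultimately have "x \<in> nbhd r0" using nx by (simp add: nbhd_def)
  moreover have "y = p + \<sigma> *\<^sub>R (x - p)" using \<sigma> by (simp add: x_def)
  ultimately show "y \<in> (\<lambda>x. p + \<sigma> *\<^sub>R (x - p)) ` nbhd r0" by blast
qed

lemma measure_nbhd: "0 < \<sigma> \<Longrightarrow> \<sigma> \<le> 1 \<Longrightarrow> measure lebesgue (nbhd (\<sigma> * r0)) = \<sigma> ^ 3 * measure lebesgue (nbhd r0)"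
  using measure_dilation[of \<sigma> p "nbhd r0"] dilation_nbhd by simp

abbreviation "m0 \<equiv> sqrt (measure lebesgue (nbhd r0))"

definition energy :: "(real^3 \<Rightarrow> complex^3) \<Rightarrow> (real^3 \<Rightarrow> complex^3^3) \<Rightarrow> real" where
  "energy u J = (L2_norm (lebesgue_on D) u)\<^sup>2 + (L2_norm (lebesgue_on D) J)\<^sup>2"

lemma energy_nonneg: "energy u J \<ge> 0"
  by (simp add: energy_def)

text \<open>The function gains a power over its gradient: \<open>dilation_estimate\<close> gives
  \<sigma>^(5/2) for \<open>u\<close>, while Cauchy-Schwarz gives \<sigma>^(3/2) for
  \<open>J\<close>. The two balance in a trace estimate at a depth comparable to \<sigma>.\<close>

lemma bulk_estimate:
  assumes h: "c1_on UNIV u J" and \<sigma>: "0 < \<sigma>" "\<sigma> \<le> 1"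
  shows "integral\<^sup>L (lebesgue_on (nbhd (\<sigma> * r0))) (\<lambda>x. norm (u x)) \<le> m0 * (1 + 6 * r0) * \<sigma>\<^sup>2 * sqrt \<sigma> * sqrt (energy u J)"
    and "integral\<^sup>L (lebesgue_on (nbhd (\<sigma> * r0))) (\<lambda>x. norm (J x)) \<le> m0 * \<sigma> * sqrt \<sigma> * sqrt (energy u J)"
proof -
  note L2D = L2_c1_UNIV[OF open_D bounded_D h]
  have "integral\<^sup>L (lebesgue_on ((\<lambda>x. p + \<sigma> *\<^sub>R (x - p)) ` nbhd r0)) (\<lambda>x. norm (u x)) \<le>
    m0 * (1 + 6 * r0) * \<sigma>\<^sup>2 * sqrt \<sigma> * sqrt ((L2_norm (lebesgue_on (nbhd r0)) u)\<^sup>2 + (L2_norm (lebesgue_on (nbhd r0)) J)\<^sup>2)"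
  proof (rule dilation_estimate[OF open_nbhd _ _ _ h \<sigma>])
    show "nbhd r0 \<subseteq> cball p r0" by (auto simp: nbhd_def)
    show "r0 \<ge> 0" using r0 by simp
    fix x s assume x: "x \<in> nbhd r0" and s: "0 < s" "s \<le> (1::real)"
    have "p + s *\<^sub>R (x - p) \<in> nbhd (s * r0)" using dilation_nbhd[OF s] x by blast
    moreover have "s * r0 \<le> r0" using s r0 by (simp add: mult_left_le_one_le)
    ultimately show "p + s *\<^sub>R (x - p) \<in> nbhd r0" by (auto simp: nbhd_def)
  qed
  also have "\<dots> \<le> m0 * (1 + 6 * r0) * \<sigma>\<^sup>2 * sqrt \<sigma> * sqrt (energy u J)"
    unfolding energy_def using \<sigma> r0
    by (intro mult_left_mono real_sqrt_le_mono add_mono power_mono L2_norm_nonneg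
        L2_norm_subset_le[OF open_D bounded_D L2D(1) open_nbhd nbhd_subset]
        L2_norm_subset_le[OF open_D bounded_D L2D(2) open_nbhd nbhd_subset]) auto
  finally show "integral\<^sup>L (lebesgue_on (nbhd (\<sigma> * r0))) (\<lambda>x. norm (u x)) \<le> m0 * (1 + 6 * r0) * \<sigma>\<^sup>2 * sqrt \<sigma> * sqrt (energy u J)"
    using dilation_nbhd[OF \<sigma>] by simp
  let ?U = "nbhd (\<sigma> * r0)"
  have "integral\<^sup>L (lebesgue_on ?U) (\<lambda>x. norm (J x)) \<le> sqrt (measure (lebesgue_on ?U) (space (lebesgue_on ?U))) * L2_norm (lebesgue_on ?U) J"
    using L2_c1_UNIV[OF open_nbhd bounded_nbhd h]
    by (intro integral_norm_le_L2_norm finite_measure_bounded bounded_nbhd nbhd_lebesgue)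
  also have "\<dots> \<le> sqrt (measure (lebesgue_on ?U) (space (lebesgue_on ?U))) * sqrt (energy u J)"
  proof (intro mult_left_mono)
    have "L2_norm (lebesgue_on ?U) J \<le> L2_norm (lebesgue_on D) J"
      by (rule L2_norm_subset_le[OF open_D bounded_D L2D(2) open_nbhd nbhd_subset])
    also have "\<dots> \<le> sqrt (energy u J)" unfolding energy_def by (intro real_le_rsqrt) simp
    finally show "L2_norm (lebesgue_on ?U) J \<le> sqrt (energy u J)" .
  qed simp
  also have "measure (lebesgue_on ?U) (space (lebesgue_on ?U)) = \<sigma> ^ 3 * measure lebesgue (nbhd r0)"
    using nbhd_lebesgue measure_nbhd[OF \<sigma>] by (simp add: measure_restrict_space)
  also have "sqrt (\<sigma> ^ 3 * measure lebesgue (nbhd r0)) = m0 * \<sigma> * sqrt \<sigma>"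
    using \<sigma> by (simp add: real_sqrt_mult power3_eq_cube)
  finally show "integral\<^sup>L (lebesgue_on ?U) (\<lambda>x. norm (J x)) \<le> m0 * \<sigma> * sqrt \<sigma> * sqrt (energy u J)" .
qed

text \<open>The parameters of a square of side \<rho> on a face, centred at distance \<rho> from the
  edge at height \<open>c\<close>, so that all its points are at a distance from the edge comparable
  to its size.\<close>

definition patch :: "real \<Rightarrow> (real \<times> real) set" where
  "patch \<rho> = box (\<rho> / 2, c - \<rho> / 2) (3 * \<rho> / 2, c + \<rho> / 2)"

abbreviation "face_point \<equiv> \<lambda>y :: real \<times> real. coord \<theta>m 1 (fst y) (snd y) 0"

lemma patch_borel: "patch \<rho> \<in> sets borel" "bounded (patch \<rho>)"
  by (auto simp: patch_def)

lemma mem_patch: "y \<in> patch \<rho> \<longleftrightarrow> \<rho> / 2 < fst y \<and> fst y < 3 * \<rho> / 2 \<and> \<bar>snd y - c\<bar> < \<rho> / 2"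
proof (cases y)
  case (Pair a b)
  have "y \<in> patch \<rho> \<longleftrightarrow> \<rho> / 2 < a \<and> a < 3 * \<rho> / 2 \<and> c - \<rho> / 2 < b \<and> b < c + \<rho> / 2"
    by (auto simp: Pair patch_def mem_box Basis_prod_def)
  then show ?thesis unfolding Pair fst_conv snd_conv abs_diff_less_iff by blast
qed

lemma coord_patch_D:
  assumes y: "y \<in> patch \<rho>" and \<rho>: "0 < \<rho>" "3 * \<rho> \<le> r0" and s: "0 \<le> s" "s < \<kappa> * \<rho> / 2"
  shows "coord \<theta>m 1 (fst y) (snd y) s \<in> ball p (3 * \<rho>)" "s > 0 \<Longrightarrow> coord \<theta>m 1 (fst y) (snd y) s \<in> D"
    "s = 0 \<Longrightarrow> coord \<theta>m 1 (fst y) (snd y) s \<in> face \<theta>m" 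
proof -
  note m = y[unfolded mem_patch]
  have "\<kappa> * \<rho> \<le> 1 * \<rho>" using \<kappa> \<rho> by (intro mult_right_mono) auto
  then have s2: "s < \<rho> / 2" using s by linarith
  have pp: "p = coord \<theta>m 1 0 c 0" by (simp add: coord_eq)
  have "dist p (coord \<theta>m 1 (fst y) (snd y) s) = norm (coord \<theta>m 1 (fst y) (snd y) s - p)"
    by (metis dist_commute dist_norm)
  also have "\<dots> = norm (coord \<theta>m 1 (fst y) (snd y - c) s)"
    unfolding pp coord_diff by simp
  also have "\<dots> \<le> \<bar>fst y\<bar> + \<bar>s\<bar> + \<bar>snd y - c\<bar>" by (rule norm_coord_le) simp
  also have "\<dots> < 3 * \<rho>" using m s s2 \<rho> by linarith
  finally show "coord \<theta>m 1 (fst y) (snd y) s \<in> ball p (3 * \<rho>)" by simp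
  have f: "0 < fst y" "fst y + s < h" "\<bar>snd y\<bar> < M" using m s s2 \<rho> r0 by linarith+
  show "coord \<theta>m 1 (fst y) (snd y) s \<in> D" if "s > 0"
  proof (rule coord_in_D[OF f(1) that _ _ _ f(3)])
    have "\<kappa> * (\<rho> / 2) \<le> \<kappa> * fst y" using m \<kappa> by (intro mult_left_mono) auto
    then show "s < \<kappa> * fst y" using s by simp
    have "(fst y + s)\<^sup>2 < h\<^sup>2" using f s by (intro power_strict_mono) auto
    moreover have "(fst y)\<^sup>2 + s\<^sup>2 \<le> (fst y + s)\<^sup>2" using f s by (simp add: power2_sum)
    ultimately show "(fst y)\<^sup>2 + s\<^sup>2 < h\<^sup>2" by simp
  qed simp
  show "coord \<theta>m 1 (fst y) (snd y) s \<in> face \<theta>m" if "s = 0"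
    using that f s by (auto intro!: coord_in_face)
qed

text \<open>The factor 4 pi compares surface measure with Lebesgue measure, 3 is the coefficient of
  \<open>J\<close> in \<open>trace_estimate\<close>, and 12 / (\<kappa> r0) is the quotient of the
  scale 3 \<rho> / r0 by the depth \<kappa> \<rho> / 4.\<close>

definition C1 :: real where "C1 = 4 * pi * (12 / (\<kappa> * r0) * (1 + 6 * r0) + 3) * m0"

lemma C1_nonneg: "C1 \<ge> 0"
  unfolding C1_def using \<kappa> r0 by (intro mult_nonneg_nonneg add_nonneg_nonneg divide_nonneg_nonneg) auto

lemma boundary_estimate:
  assumes h: "c1_on UNIV u J" and \<rho>: "0 < \<rho>" "3 * \<rho> \<le> r0"
  defines "\<sigma> \<equiv> 3 * \<rho> / r0"
  shows "(\<integral>\<^sup>+x. ennreal (norm (u x)) * indicator (face_point ` patch \<rho>) x \<partial>S2) \<le> ennreal (C1 * \<sigma> * sqrt \<sigma> * sqrt (energy u J))"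
proof -
  have \<sigma>: "0 < \<sigma>" "\<sigma> \<le> 1" "\<sigma> * r0 = 3 * \<rho>" using \<rho> r0 by (auto simp: \<sigma>_def)
  have plane: "face_point = plane 0 (dirv \<theta>m) ez"
    by (rule ext) (rule plane_coord[symmetric])
  have hm: "u \<in> borel_measurable borel"
    using c1_on_continuous[OF h] by (rule borel_measurable_continuous_onI)
  \<comment> \<open>Segments normal to the patch stay in \<open>D\<close> up to depth \<kappa>
    \<rho> / 2; half of that is taken. Depth and patch are of the same size, so both terms of the
    trace estimate scale like \<rho>^(3/2).\<close>
  define r where "r = \<kappa> * \<rho> / 4"
  have r: "r > 0" using \<kappa> \<rho> by (simp add: r_def)
  let ?U = "nbhd (3 * \<rho>)"
  have "(\<integral>\<^sup>+x. ennreal (norm (u x)) * indicator (plane 0 (dirv \<theta>m) ez ` patch \<rho>) x \<partial>S2) \<le>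
      ennreal (4 * pi) * (\<integral>\<^sup>+y. ennreal (norm (u (plane 0 (dirv \<theta>m) ez y))) * indicator (patch \<rho>) y \<partial>lborel)"
    using hm by (intro nn_integral_S2_plane_le[OF dirv_ez H patch_borel]) simp
  then have "(\<integral>\<^sup>+x. ennreal (norm (u x)) * indicator (face_point ` patch \<rho>) x \<partial>S2) \<le>
      ennreal (4 * pi) * (\<integral>\<^sup>+y. ennreal (norm (u (face_point y))) * indicator (patch \<rho>) y \<partial>lborel)"
    unfolding plane[symmetric] .
  also have "(\<integral>\<^sup>+y. ennreal (norm (u (face_point y))) * indicator (patch \<rho>) y \<partial>lborel) \<le>
      ennreal (1 / r) * (\<integral>\<^sup>+x. ennreal (norm (u x)) * indicator ?U x \<partial>lborel) +
      3 * (\<integral>\<^sup>+x. ennreal (norm (J x)) * indicator ?U x \<partial>lborel)"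
  proof -
    have "(\<integral>\<^sup>+y. ennreal (norm (u (0 + frame (dirv \<theta>m) ez (1 *\<^sub>R nrmv \<theta>m) (y, 0)))) * indicator (patch \<rho>) y \<partial>lborel) \<le>
      ennreal (1 / r) * (\<integral>\<^sup>+x. ennreal (norm (u x)) * indicator ?U x \<partial>lborel) +
      3 * (\<integral>\<^sup>+x. ennreal (norm (J x)) * indicator ?U x \<partial>lborel)"
    proof (rule trace_estimate[OF orthonormal3_dirv r patch_borel(1) h open_UNIV])
      show "?U \<in> sets borel" using open_nbhd by simp
      fix y assume y: "y \<in> patch \<rho>"
      show "0 + frame (dirv \<theta>m) ez (1 *\<^sub>R nrmv \<theta>m) (y, s) \<in> ?U" if s: "0 < s" "s < r" for s
      proof -
        have "s < \<kappa> * \<rho> / 2" using s r by (simp add: r_def)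
        then show ?thesis using coord_patch_D[OF y \<rho>, of s] s by (simp add: nbhd_def coord_def)
      qed
      have "isCont (\<lambda>s. u (0 + frame (dirv \<theta>m) ez (1 *\<^sub>R nrmv \<theta>m) (y, s))) 0"
      proof -
        have "continuous_on UNIV (\<lambda>s. u (0 + frame (dirv \<theta>m) ez (1 *\<^sub>R nrmv \<theta>m) (y, s)))"
          by (rule continuous_on_compose2[OF c1_on_continuous[OF h]]) (auto intro!: continuous_intros)
        then show ?thesis by (simp add: continuous_on_eq_continuous_at)
      qed
      then show "((\<lambda>s. u (0 + frame (dirv \<theta>m) ez (1 *\<^sub>R nrmv \<theta>m) (y, s))) \<longlongrightarrow>
         u (0 + frame (dirv \<theta>m) ez (1 *\<^sub>R nrmv \<theta>m) (y, 0))) (at_right 0)"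
        unfolding isCont_def by (rule filterlim_mono[OF _ order_refl at_le]) simp
    qed auto
    then show ?thesis by (simp add: coord_def)
  qed
  also have "(\<integral>\<^sup>+x. ennreal (norm (u x)) * indicator ?U x \<partial>lborel) \<le> ennreal (m0 * (1 + 6 * r0) * \<sigma>\<^sup>2 * sqrt \<sigma> * sqrt (energy u J))"
  proof -
    have "integrable (lebesgue_on ?U) (\<lambda>x. norm (u x))"
      using L2_integrable[OF finite_measure_bounded[OF bounded_nbhd nbhd_lebesgue] L2_c1_UNIV(1)[OF open_nbhd bounded_nbhd h]] by simp
    from nn_integral_lebesgue_on[OF nbhd_lebesgue this] show ?thesis
      using bulk_estimate(1)[OF h \<sigma>(1,2)] \<sigma>(3) by (auto intro!: ennreal_leI)
  qed
  also have "(\<integral>\<^sup>+x. ennreal (norm (J x)) * indicator ?U x \<partial>lborel) \<le> ennreal (m0 * \<sigma> * sqrt \<sigma> * sqrt (energy u J))"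
  proof -
    have "integrable (lebesgue_on ?U) (\<lambda>x. norm (J x))"
      using L2_integrable[OF finite_measure_bounded[OF bounded_nbhd nbhd_lebesgue] L2_c1_UNIV(2)[OF open_nbhd bounded_nbhd h]] by simp
    from nn_integral_lebesgue_on[OF nbhd_lebesgue this] show ?thesis
      using bulk_estimate(2)[OF h \<sigma>(1,2)] \<sigma>(3) by (auto intro!: ennreal_leI)
  qed
  also have "ennreal (4 * pi) * (ennreal (1 / r) * ennreal (m0 * (1 + 6 * r0) * \<sigma>\<^sup>2 * sqrt \<sigma> * sqrt (energy u J)) +
      3 * ennreal (m0 * \<sigma> * sqrt \<sigma> * sqrt (energy u J))) =
      ennreal (4 * pi * (1 / r * (m0 * (1 + 6 * r0) * \<sigma>\<^sup>2 * sqrt \<sigma> * sqrt (energy u J)) + 3 * (m0 * \<sigma> * sqrt \<sigma> * sqrt (energy u J))))"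
  proof -
    have nn: "0 \<le> m0 * (1 + 6 * r0) * \<sigma>\<^sup>2 * sqrt \<sigma> * sqrt (energy u J)" "0 \<le> m0 * \<sigma> * sqrt \<sigma> * sqrt (energy u J)"
      using r0 \<sigma> energy_nonneg by simp_all
    have "0 \<le> 1 / r" using r by simp
    then show ?thesis
      using nn by (subst ennreal_linear3, simp_all only:) (rule ennreal_mult[symmetric]; simp)
  qed
  also have "4 * pi * (1 / r * (m0 * (1 + 6 * r0) * \<sigma>\<^sup>2 * sqrt \<sigma> * sqrt (energy u J)) + 3 * (m0 * \<sigma> * sqrt \<sigma> * sqrt (energy u J)))
      = C1 * \<sigma> * sqrt \<sigma> * sqrt (energy u J)"
  proof -
    have gen: "4 * pi * (R * (m * q * s\<^sup>2 * a * b) + 3 * (m * s * a * b)) = 4 * pi * (k * q + 3) * m * s * a * b"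
      if "R * s = k" for R k m q a b s :: real
      unfolding that[symmetric] by (simp add: algebra_simps power2_eq_square)
    show ?thesis unfolding C1_def
      by (rule gen) (use \<rho> r0 \<kappa> in \<open>simp add: r_def \<sigma>_def field_simps\<close>)
  qed
  finally show ?thesis by (simp add: mult_left_mono add_mono)
qed

text \<open>Neither \<open>v\<close> nor its trace \<open>tv\<close> is regular enough for the
  estimates above. These are applied to \<open>f n - g\<close> with the smooth \<open>f n\<close>
  from the definition of the trace, whose energy is bounded by the error of \<open>f n\<close> plus
  \<open>e\<^sup>2\<close>, up to a factor 2; then \<open>n\<close> tends to infinity.\<close>

lemma approximation:
  assumes v: "H1 \<Omega> v" "is_trace \<Omega> v tv" and g: "c1_on UNIV g Jg" and e: "H1_norm D (\<lambda>x. v x - g x) \<le> e" "e > 0"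
  shows "0 < \<sigma> \<Longrightarrow> \<sigma> \<le> 1 \<Longrightarrow> integral\<^sup>L (lebesgue_on (nbhd (\<sigma> * r0))) (\<lambda>x. norm (v x - g x)) \<le> 2 * m0 * (1 + 6 * r0) * \<sigma>\<^sup>2 * sqrt \<sigma> * e"
    and "0 < \<rho> \<Longrightarrow> 3 * \<rho> \<le> r0 \<Longrightarrow> face \<theta>m \<subseteq> frontier \<Omega> \<Longrightarrow>
      (\<integral>\<^sup>+x. ennreal (norm (tv x - g x)) * indicator (face_point ` patch \<rho>) x \<partial>N) \<le> ennreal (2 * C1 * (3 * \<rho> / r0) * sqrt (3 * \<rho> / r0) * e)"
proof -
  obtain f where f: "\<And>n. smooth (f n)" "(\<lambda>n. H1_norm \<Omega> (\<lambda>x. f n x - v x)) \<longlonglongrightarrow> 0"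
      "(\<lambda>n. L2_norm N (\<lambda>x. f n x - tv x)) \<longlonglongrightarrow> 0" and tv: "L2 N tv"
    using v(2) unfolding is_trace_def by blast
  let ?J = "\<lambda>g x. \<chi> i j. partial j g x $ i"
  have hc: "c1_on UNIV (\<lambda>x. f n x - g x) (\<lambda>x. ?J (f n) x - Jg x)" for n
    by (intro c1_on_diff c1_on_smooth f g)
  have cf: "continuous_on UNIV (f n)" for n using smooth_continuous_on f(1) by blast
  have cg: "continuous_on UNIV g" using g by (rule c1_on_continuous)
  have H1f: "H1 \<Omega> (\<lambda>x. f n x - v x)" for n by (intro H1_diff[OF \<Omega>] H1_smooth[OF \<Omega>] f v)
  have H1vg: "H1 D (\<lambda>x. v x - g x)"
  proof (rule H1_diff[OF open_D bounded_D H1_subset[OF \<Omega> v(1) open_D D_subset]])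
    show "H1 D g"
    proof (rule H1_c1_on[OF open_D bounded_D c1_on_subset[OF g]])
      show "bounded (g ` D)" "bounded (Jg ` D)"
        using g cg bounded_D by (auto intro!: bounded_continuous_image_bounded simp: c1_on_def)
    qed auto
  qed
  define en where "en n = H1_norm \<Omega> (\<lambda>x. f n x - v x)" for n
  have en: "en \<longlonglongrightarrow> 0" "\<And>n. en n \<ge> 0"
    using f(2) unfolding en_def[abs_def] by (simp_all add: H1_norm_nonneg[OF \<Omega>])
  have en_le: "energy (\<lambda>x. f n x - g x) (\<lambda>x. ?J (f n) x - Jg x) \<le> 2 * (en n)\<^sup>2 + 2 * e\<^sup>2" for n
  proof -
    have "energy (\<lambda>x. f n x - g x) (\<lambda>x. ?J (f n) x - Jg x) \<le> 2 * (H1_norm D (\<lambda>x. f n x - v x))\<^sup>2 + 2 * (H1_norm D (\<lambda>x. v x - g x))\<^sup>2"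
      unfolding energy_def
      by (rule c1_on_energy_add[OF open_D bounded_D c1_on_subset[OF hc subset_UNIV] L2_c1_UNIV[OF open_D bounded_D hc]
            H1_subset[OF \<Omega> H1f open_D D_subset] H1vg]) simp
    also have "\<dots> \<le> 2 * (en n)\<^sup>2 + 2 * e\<^sup>2"
      using H1_norm_subset_le[OF \<Omega> H1f open_D D_subset] e(1)
      by (intro add_mono mult_left_mono power_mono) (auto simp: en_def H1_norm_def)
    finally show ?thesis .
  qed
  have sq: "(\<lambda>n. sqrt (2 * (en n)\<^sup>2 + 2 * e\<^sup>2)) \<longlonglongrightarrow> sqrt (2 * 0\<^sup>2 + 2 * e\<^sup>2)" by (intro tendsto_intros en)
  \<comment> \<open>The limit of the energy bound is sqrt 2 times \<open>e\<close>, rounded up to a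
    factor 2.\<close>
  have sq_le: "sqrt (2 * 0\<^sup>2 + 2 * e\<^sup>2) \<le> 2 * e" using e(2) by (intro real_le_lsqrt) (auto simp: power_mult_distrib)
  {
    assume \<sigma>: "0 < \<sigma>" "\<sigma> \<le> 1"
    let ?U = "nbhd (\<sigma> * r0)"
    let ?A = "m0 * (1 + 6 * r0) * \<sigma>\<^sup>2 * sqrt \<sigma>"
    have A0: "?A \<ge> 0" using r0 \<sigma> by simp
    have finU: "finite_measure (lebesgue_on ?U)" by (rule finite_measure_bounded[OF bounded_nbhd nbhd_lebesgue])
    have L2v: "L2 (lebesgue_on ?U) (\<lambda>x. f n x - v x)" for n
      by (rule L2_lebesgue_on_subset[OF H1_wgrad(1)[OF \<Omega> H1f] _ nbhd_lebesgue open_sets_lebesgue[OF \<Omega>(1)]])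
         (rule subset_trans[OF nbhd_subset D_subset])
    have bnd: "integral\<^sup>L (lebesgue_on ?U) (\<lambda>x. norm (v x - g x)) \<le> sqrt (measure (lebesgue_on ?U) (space (lebesgue_on ?U))) * en n + ?A * sqrt (2 * (en n)\<^sup>2 + 2 * e\<^sup>2)" for n
    proof -
      have i1: "integrable (lebesgue_on ?U) (\<lambda>x. norm (f n x - v x))" using L2_integrable[OF finU L2v] by simp
      have i2: "integrable (lebesgue_on ?U) (\<lambda>x. norm (f n x - g x))"
        using L2_integrable[OF finU L2_c1_UNIV(1)[OF open_nbhd bounded_nbhd hc]] by simp
      have i3: "integrable (lebesgue_on ?U) (\<lambda>x. norm (v x - g x))"
      proof -
        have "integrable (lebesgue_on ?U) (\<lambda>x. (f n x - g x) - (f n x - v x))"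
          by (rule Bochner_Integration.integrable_diff[OF L2_integrable[OF finU L2_c1_UNIV(1)[OF open_nbhd bounded_nbhd hc]]
                L2_integrable[OF finU L2v]])
        then show ?thesis by simp
      qed
      have "integral\<^sup>L (lebesgue_on ?U) (\<lambda>x. norm (v x - g x)) \<le> integral\<^sup>L (lebesgue_on ?U) (\<lambda>x. norm (f n x - v x) + norm (f n x - g x))"
      proof (rule integral_mono[OF i3])
        show "integrable (lebesgue_on ?U) (\<lambda>x. norm (f n x - v x) + norm (f n x - g x))" using i1 i2 by simp
        show "norm (v x - g x) \<le> norm (f n x - v x) + norm (f n x - g x)" for x
          using norm_triangle_ineq4[of "f n x - g x" "f n x - v x"] by simp
      qed
      also have "\<dots> = integral\<^sup>L (lebesgue_on ?U) (\<lambda>x. norm (f n x - v x)) + integral\<^sup>L (lebesgue_on ?U) (\<lambda>x. norm (f n x - g x))"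
        using i1 i2 by simp
      also have "integral\<^sup>L (lebesgue_on ?U) (\<lambda>x. norm (f n x - v x)) \<le> sqrt (measure (lebesgue_on ?U) (space (lebesgue_on ?U))) * en n"
      proof -
        have "L2_norm (lebesgue_on ?U) (\<lambda>x. f n x - v x) \<le> L2_norm (lebesgue_on \<Omega>) (\<lambda>x. f n x - v x)"
          using nbhd_subset D_subset by (intro L2_norm_subset_le[OF \<Omega> H1_wgrad(1)[OF \<Omega> H1f] open_nbhd]) blast
        also have "\<dots> \<le> en n" unfolding en_def H1_norm_def by (intro real_le_rsqrt) simp
        finally have "sqrt (measure (lebesgue_on ?U) (space (lebesgue_on ?U))) * L2_norm (lebesgue_on ?U) (\<lambda>x. f n x - v x) \<le>
            sqrt (measure (lebesgue_on ?U) (space (lebesgue_on ?U))) * en n" by (intro mult_left_mono) auto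
        from order_trans[OF integral_norm_le_L2_norm[OF finU L2v] this] show ?thesis .
      qed
      also have "integral\<^sup>L (lebesgue_on ?U) (\<lambda>x. norm (f n x - g x)) \<le> ?A * sqrt (2 * (en n)\<^sup>2 + 2 * e\<^sup>2)"
        by (rule order_trans[OF bulk_estimate(1)[OF hc \<sigma>]]) (intro mult_left_mono real_sqrt_le_mono en_le A0)
      finally show ?thesis by simp
    qed
    have "integral\<^sup>L (lebesgue_on ?U) (\<lambda>x. norm (v x - g x)) \<le> sqrt (measure (lebesgue_on ?U) (space (lebesgue_on ?U))) * 0 + ?A * sqrt (2 * 0\<^sup>2 + 2 * e\<^sup>2)"
      by (rule LIMSEQ_le_const[OF tendsto_add[OF tendsto_mult_left[OF en(1)] tendsto_mult_left[OF sq]]]) (use bnd in auto)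
    also have "\<dots> \<le> ?A * (2 * e)" using mult_left_mono[OF sq_le A0] by simp
    finally show "integral\<^sup>L (lebesgue_on ?U) (\<lambda>x. norm (v x - g x)) \<le> 2 * m0 * (1 + 6 * r0) * \<sigma>\<^sup>2 * sqrt \<sigma> * e"
      by (simp add: mult_ac)
  }
  {
    assume \<rho>: "0 < \<rho>" "3 * \<rho> \<le> r0" and F: "face \<theta>m \<subseteq> frontier \<Omega>"
    define \<sigma> where "\<sigma> = 3 * \<rho> / r0"
    have \<sigma>: "0 < \<sigma>" using \<rho> r0 by (simp add: \<sigma>_def)
    let ?P = "face_point ` patch \<rho>"
    let ?B = "C1 * \<sigma> * sqrt \<sigma>"
    have B0: "?B \<ge> 0" using C1_nonneg \<sigma> by simp
    have PF: "?P \<subseteq> frontier \<Omega>"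
    proof
      fix x assume "x \<in> ?P"
      then obtain y where y: "y \<in> patch \<rho>" "x = face_point y" by auto
      have "0 < \<kappa> * \<rho> / 2" using \<kappa> \<rho> by simp
      then show "x \<in> frontier \<Omega>" using coord_patch_D(3)[OF y(1) \<rho>, of 0] y(2) F by auto
    qed
    have Pb: "?P \<in> sets borel"
    proof -
      have eq: "face_point = plane 0 (dirv \<theta>m) ez" by (rule ext) (rule plane_coord[symmetric])
      show ?thesis unfolding eq by (rule plane_image_borel[OF dirv_ez patch_borel(1)])
    qed
    have bnd: "(\<integral>\<^sup>+x. ennreal (norm (tv x - g x)) * indicator ?P x \<partial>N) \<le>
      ennreal (sqrt (measure N (frontier \<Omega>)) * L2_norm N (\<lambda>x. f n x - tv x) + ?B * sqrt (2 * (en n)\<^sup>2 + 2 * e\<^sup>2))" for n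
    proof -
      have m1: "(\<lambda>x. ennreal (norm (f n x - tv x))) \<in> borel_measurable N"
        by (intro L2_norm_measurable L2_diff L2_N_continuous cf tv)
      have m2: "(\<lambda>x. ennreal (norm (f n x - g x)) * indicator ?P x) \<in> borel_measurable N"
        using cf[of n, THEN borel_measurable_continuous_onI] cg[THEN borel_measurable_continuous_onI] Pb
        by (intro measurable_N) simp
      have "(\<integral>\<^sup>+x. ennreal (norm (tv x - g x)) * indicator ?P x \<partial>N) \<le>
          (\<integral>\<^sup>+x. ennreal (norm (f n x - tv x)) + ennreal (norm (f n x - g x)) * indicator ?P x \<partial>N)"
      proof (intro nn_integral_mono)
        fix x
        have "norm (tv x - g x) \<le> norm (f n x - tv x) + norm (f n x - g x)"
          using norm_triangle_ineq4[of "f n x - g x" "f n x - tv x"] by simp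
        then show "ennreal (norm (tv x - g x)) * indicator ?P x \<le> ennreal (norm (f n x - tv x)) + ennreal (norm (f n x - g x)) * indicator ?P x"
          by (auto simp flip: ennreal_plus split: split_indicator)
      qed
      also have "\<dots> = (\<integral>\<^sup>+x. ennreal (norm (f n x - tv x)) \<partial>N) + (\<integral>\<^sup>+x. ennreal (norm (f n x - g x)) * indicator ?P x \<partial>N)"
        by (rule nn_integral_add[OF m1 m2])
      also have "(\<integral>\<^sup>+x. ennreal (norm (f n x - g x)) * indicator ?P x \<partial>N) = (\<integral>\<^sup>+x. ennreal (norm (f n x - g x)) * indicator ?P x \<partial>S2)"
        unfolding nn_integral_N using PF by (intro nn_integral_cong) (auto split: split_indicator)
      also have "\<dots> \<le> ennreal (?B * sqrt (2 * (en n)\<^sup>2 + 2 * e\<^sup>2))"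
        by (rule order_trans[OF boundary_estimate[OF hc \<rho>, folded \<sigma>_def]])
           (intro ennreal_leI mult_left_mono real_sqrt_le_mono en_le B0)
      also have "(\<integral>\<^sup>+x. ennreal (norm (f n x - tv x)) \<partial>N) \<le> ennreal (sqrt (measure N (frontier \<Omega>)) * L2_norm N (\<lambda>x. f n x - tv x))"
        by (rule trace_L1[OF tv cf])
      also have "ennreal (sqrt (measure N (frontier \<Omega>)) * L2_norm N (\<lambda>x. f n x - tv x)) + ennreal (?B * sqrt (2 * (en n)\<^sup>2 + 2 * e\<^sup>2)) =
        ennreal (sqrt (measure N (frontier \<Omega>)) * L2_norm N (\<lambda>x. f n x - tv x) + ?B * sqrt (2 * (en n)\<^sup>2 + 2 * e\<^sup>2))"
        using B0 L2_norm_nonneg by (intro ennreal_plus[symmetric]) (auto intro!: mult_nonneg_nonneg)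
      finally show ?thesis by (simp add: add_mono)
    qed
    have "(\<integral>\<^sup>+x. ennreal (norm (tv x - g x)) * indicator ?P x \<partial>N) \<le> ennreal (sqrt (measure N (frontier \<Omega>)) * 0 + ?B * sqrt (2 * 0\<^sup>2 + 2 * e\<^sup>2))"
      by (rule LIMSEQ_le_const[OF tendsto_ennrealI[OF tendsto_add[OF tendsto_mult_left[OF f(3)] tendsto_mult_left[OF sq]]]]) (use bnd in auto)
    also have "\<dots> \<le> ennreal (?B * (2 * e))" using mult_left_mono[OF sq_le B0] by (intro ennreal_leI) simp
    finally show "(\<integral>\<^sup>+x. ennreal (norm (tv x - g x)) * indicator ?P x \<partial>N) \<le> ennreal (2 * C1 * (3 * \<rho> / r0) * sqrt (3 * \<rho> / r0) * e)"
      by (simp add: \<sigma>_def mult_ac)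
  }
qed

end

end

section \<open>Testing the traction condition\<close>

lemma flat0_mono: "u \<le> u' \<Longrightarrow> flat 0 u \<le> flat 0 u'"
  by (auto simp: flat_def le_imp_inverse_le)

context edge
begin

context
  fixes c r0 :: real
  assumes r0: "0 < r0" "r0 \<le> h" "r0 \<le> M - \<bar>c\<bar>"
begin

text \<open>Any width below \<open>\<kappa> / 6\<close> keeps the support of the test function away from the edge and from the
  other face.\<close>

definition width :: real where "width = \<kappa> / 7"
definition centre :: "real \<Rightarrow> real^3" where "centre \<rho> = coord \<theta>m 1 \<rho> c 0"
definition corner :: "real \<Rightarrow> real \<Rightarrow> real^3" where "corner \<rho> s = centre \<rho> + (\<chi> i. s * width * \<rho>)"
definition \<phi> :: "real \<Rightarrow> real^3 \<Rightarrow> real" where "\<phi> \<rho> = bump (1 / \<rho>) (corner \<rho> (- 1)) (corner \<rho> 1)"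

lemma width: "0 < width" "7 * width = \<kappa>" "width \<le> 1 / 7"
  using \<kappa> by (auto simp: width_def)

lemma mem_support: "x \<in> cbox (corner \<rho> (- 1)) (corner \<rho> 1) \<longleftrightarrow> (\<forall>i. \<bar>(x - centre \<rho>) $ i\<bar> \<le> width * \<rho>)"
proof -
  have "x \<in> cbox (corner \<rho> (- 1)) (corner \<rho> 1) \<longleftrightarrow> (\<forall>i. corner \<rho> (- 1) $ i \<le> x $ i \<and> x $ i \<le> corner \<rho> 1 $ i)"
    by (auto simp: mem_box Basis_vec_def inner_axis)
  also have "\<dots> \<longleftrightarrow> (\<forall>i. \<bar>(x - centre \<rho>) $ i\<bar> \<le> width * \<rho>)"
    by (intro iff_allI) (auto simp: corner_def abs_le_iff)
  finally show ?thesis .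
qed

context
  fixes \<rho> :: real
  assumes \<rho>: "0 < \<rho>" "3 * \<rho> \<le> r0"
begin

text \<open>All test functions are rescalings of one fixed bump. Their derivatives are therefore
  bounded by a constant over \<rho>, and lower bounds for their values do not depend on
  \<rho>.\<close>

lemma \<phi>_eq: "\<phi> \<rho> x = bump 1 (\<chi> i. - width) (\<chi> i. width) ((1 / \<rho>) *\<^sub>R (x - centre \<rho>))"
proof -
  have "1 / \<rho> * (x $ i - corner \<rho> (- 1) $ i) = 1 * (((1 / \<rho>) *\<^sub>R (x - centre \<rho>)) $ i - (- width))"
    "1 / \<rho> * (corner \<rho> 1 $ i - x $ i) = 1 * (width - ((1 / \<rho>) *\<^sub>R (x - centre \<rho>)) $ i)" for i
    using \<rho> by (simp_all add: corner_def field_simps)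
  then show ?thesis unfolding \<phi>_def bump_def bump1_def by simp
qed

lemma \<phi>_bounds: "0 \<le> \<phi> \<rho> x" "\<phi> \<rho> x \<le> 1"
  by (simp_all add: \<phi>_def bump_bounds)

lemma \<phi>_smooth: "smooth (\<phi> \<rho>)"
  using smooth_bump[of "1 / \<rho>" "corner \<rho> (- 1)" "corner \<rho> 1" "1 :: real"] by (simp add: \<phi>_def)

lemma support_closure: "closure {x. \<phi> \<rho> x \<noteq> 0} \<subseteq> cbox (corner \<rho> (- 1)) (corner \<rho> 1)"
  by (rule closure_minimal)
     (use \<rho> bump_eq_0[of "1 / \<rho>" "corner \<rho> (- 1)" "corner \<rho> 1"] box_subset_cbox[of "corner \<rho> (- 1)" "corner \<rho> 1"] in \<open>auto simp: \<phi>_def\<close>)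

lemma \<phi>_eq_0: "x \<notin> cbox (corner \<rho> (- 1)) (corner \<rho> 1) \<Longrightarrow> \<phi> \<rho> x = 0"
  using support_closure closure_subset[of "{x. \<phi> \<rho> x \<noteq> 0}"] by blast

lemma partial_\<phi>_eq_0: "x \<notin> cbox (corner \<rho> (- 1)) (corner \<rho> 1) \<Longrightarrow> partial j (\<phi> \<rho>) x = 0"
  using support_closure by (intro partial_eq_0_outside) blast

text \<open>The support is a box parallel to the axes, whereas the face is rotated. Face coordinates
  are therefore controlled through the norm, which is at most three times
  \<open>width * \<rho>\<close>; as \<open>7 * width = \<kappa>\<close>, this is below both \<rho> /
  2 and \<kappa> \<rho> / 2.\<close>

lemma support_location:
  assumes x: "x \<in> cbox (corner \<rho> (- 1)) (corner \<rho> 1)"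
  obtains y s where "y \<in> patch c \<rho>" "x = coord \<theta>m 1 (fst y) (snd y) s" "x \<in> ball (p c) (3 * \<rho>)"
    "x \<in> frontier \<Omega> \<Longrightarrow> s = 0"
proof -
  define t z s where "t = x \<bullet> dirv \<theta>m" "z = x $ 3" "s = x \<bullet> nrmv \<theta>m"
  have xc: "x = coord \<theta>m 1 t z s" using coord_surj[of 1 x \<theta>m] by (simp add: t_z_s_def)
  have comp: "\<bar>(x - centre \<rho>) $ i\<bar> \<le> width * \<rho>" for i using x mem_support by blast
  have n: "norm (x - centre \<rho>) \<le> 3 * (width * \<rho>)"
    using norm_vec3_le[of "x - centre \<rho>"] comp[of 1] comp[of 2] comp[of 3] by linarith
  have on: "norm (dirv \<theta>m) = 1" "norm (nrmv \<theta>m) = 1" "dirv \<theta>m \<bullet> nrmv \<theta>m = 0" "ez \<bullet> dirv \<theta>m = 0" "ez \<bullet> nrmv \<theta>m = 0"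
    using orthonormal3_dirv[of 1 \<theta>m] by (auto simp: orthonormal3_def norm_eq_1 inner_commute)
  have c0: "centre \<rho> \<bullet> dirv \<theta>m = \<rho>" "centre \<rho> \<bullet> nrmv \<theta>m = 0"
    using on by (simp_all add: centre_def coord_def frame_def inner_add_left norm_eq_1)
  have t: "\<bar>t - \<rho>\<bar> \<le> 3 * (width * \<rho>)"
    using Cauchy_Schwarz_ineq2[of "x - centre \<rho>" "dirv \<theta>m"] n on c0 by (simp add: t_z_s_def inner_diff_left)
  have s: "\<bar>s\<bar> \<le> 3 * (width * \<rho>)"
    using Cauchy_Schwarz_ineq2[of "x - centre \<rho>" "nrmv \<theta>m"] n on c0 by (simp add: t_z_s_def inner_diff_left)
  have z: "\<bar>z - c\<bar> \<le> width * \<rho>" using comp[of 3] by (simp add: t_z_s_def centre_def)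
  have width_\<rho>: "0 < width * \<rho>" "width * \<rho> \<le> 1 / 7 * \<rho>" "7 * (width * \<rho>) = \<kappa> * \<rho>"
    using width \<rho> by (auto intro!: mult_right_mono simp: mult.assoc[symmetric])
  have patch: "(t, z) \<in> patch c \<rho>"
    unfolding mem_patch[OF r0] fst_conv snd_conv using t z width_\<rho> by linarith
  have pp: "(p c) = coord \<theta>m 1 0 c 0" by (simp add: coord_eq)
  have "norm (x - (p c)) = norm (coord \<theta>m 1 t (z - c) s)" unfolding xc pp coord_diff by simp
  also have "\<dots> \<le> \<bar>t\<bar> + \<bar>s\<bar> + \<bar>z - c\<bar>" by (rule norm_coord_le) simp
  also have "\<dots> < 3 * \<rho>" using t s z width_\<rho> \<rho> by linarith
  finally have ball: "x \<in> ball (p c) (3 * \<rho>)" by (simp add: dist_norm norm_minus_commute)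
  have "s = 0" if "x \<in> frontier \<Omega>"
  proof (rule frontier_near_face)
    show "coord \<theta>m 1 t z s \<in> frontier \<Omega>" using that xc by simp
    show t0: "t > 0" using t width_\<rho> \<rho> by linarith
    have "\<kappa> * (\<rho> / 2) < \<kappa> * t" using t width_\<rho> \<rho> \<kappa> by (intro mult_strict_left_mono) linarith+
    then show "\<bar>s\<bar> < \<kappa> * t" using s width_\<rho> by linarith
    have "t + \<bar>s\<bar> < h" using t s width_\<rho> \<rho> r0 by linarith
    then have "(t + \<bar>s\<bar>)\<^sup>2 < h\<^sup>2" using t0 by (intro power_strict_mono) auto
    moreover have "t\<^sup>2 + \<bar>s\<bar>\<^sup>2 \<le> (t + \<bar>s\<bar>)\<^sup>2" using t0 by (intro sum_squares_le_square_sum) auto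
    ultimately show "t\<^sup>2 + s\<^sup>2 < h\<^sup>2" by simp
    show "\<bar>z\<bar> < M" using z width_\<rho> \<rho> r0 by linarith
  qed
  then show ?thesis using that[of "(t, z)" s] patch xc ball by simp
qed

lemma support_frontier: "x \<in> cbox (corner \<rho> (- 1)) (corner \<rho> 1) \<Longrightarrow> x \<in> frontier \<Omega> \<Longrightarrow> x \<in> face_point ` patch c \<rho>"
  by (erule support_location) auto

lemma support_\<Omega>: "x \<in> cbox (corner \<rho> (- 1)) (corner \<rho> 1) \<Longrightarrow> x \<in> \<Omega> \<Longrightarrow> x \<in> nbhd c (3 * \<rho>)"
proof (erule support_location)
  assume x: "x \<in> \<Omega>" "x \<in> ball (p c) (3 * \<rho>)"
  then have "norm (x - (p c)) < r0" using \<rho> by (simp add: dist_norm norm_minus_commute)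
  then have "x \<in> D" using \<Omega>_near_edge[OF _ r0(2,3)] x(1) by blast
  then show "x \<in> nbhd c (3 * \<rho>)" using x(2) by (simp add: nbhd_def[OF r0])
qed

lemma E_patch_face: "y \<in> patch c \<rho> \<Longrightarrow> face_point y \<in> face \<theta>m" "y \<in> patch c \<rho> \<Longrightarrow> dist (face_point y) (p c) < 3 * \<rho>"
proof -
  assume y: "y \<in> patch c \<rho>"
  have "0 < \<kappa> * \<rho> / 2" using \<kappa> \<rho> by simp
  then show "face_point y \<in> face \<theta>m" "dist (face_point y) (p c) < 3 * \<rho>"
    using coord_patch_D(1,3)[OF r0 y \<rho>, of 0] by (auto simp: dist_commute)
qed

text \<open>The surface comparison gives pi / 16, and the area of a square of side
  \<open>width * \<rho>\<close> gives the last factor after division by \<rho>^2. The cube bounds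
  the bump from below on that square, one factor for each space coordinate.\<close>

definition mass_const :: real where "mass_const = pi / 16 * (flat 0 (width / 2) * flat 0 (width / 2)) ^ 3 * width\<^sup>2"

lemma mass_const_pos: "mass_const > 0"
  using width by (simp add: mass_const_def flat0)

lemma integrable_\<phi>_N: "integrable N (\<phi> \<rho>)"
proof -
  have "L2 N (\<phi> \<rho>)" by (intro L2_N_continuous smooth_continuous_on \<phi>_smooth)
  then show ?thesis by (rule L2_integrable[OF finite_N])
qed

lemma \<phi>_mass:
  assumes F: "face \<theta>m \<subseteq> frontier \<Omega>"
  shows "mass_const * \<rho>\<^sup>2 \<le> integral\<^sup>L N (\<phi> \<rho>)"
proof -
  let ?f = "(flat 0 (width / 2) * flat 0 (width / 2)) ^ 3"
  \<comment> \<open>A square of half the size of the support: there both arguments of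
    \<open>flat 0\<close> in every coordinate are at least half of \<open>width\<close>.\<close>
  define B' where "B' = cbox (\<rho> - width * \<rho> / 2, c - width * \<rho> / 2) (\<rho> + width * \<rho> / 2, c + width * \<rho> / 2)"
  have width_\<rho>: "0 < width * \<rho>" "width * \<rho> \<le> 1 / 7 * \<rho>" using width \<rho> by (auto intro!: mult_right_mono)
  have y': "\<bar>fst y - \<rho>\<bar> \<le> width * \<rho> / 2" "\<bar>snd y - c\<bar> \<le> width * \<rho> / 2" if "y \<in> B'" for y
  proof -
    obtain a b where ab: "y = (a, b)" by (cases y)
    have "\<rho> - width * \<rho> / 2 \<le> a \<and> a \<le> \<rho> + width * \<rho> / 2 \<and> c - width * \<rho> / 2 \<le> b \<and> b \<le> c + width * \<rho> / 2"
      using that by (simp add: B'_def ab mem_box Basis_prod_def)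
    then show "\<bar>fst y - \<rho>\<bar> \<le> width * \<rho> / 2" "\<bar>snd y - c\<bar> \<le> width * \<rho> / 2"
      unfolding ab fst_conv snd_conv abs_diff_le_iff by blast+
  qed
  have patch: "y \<in> patch c \<rho>" if "y \<in> B'" for y
    unfolding mem_patch[OF r0] using y'[OF that] width_\<rho> by linarith
  have low: "?f \<le> \<phi> \<rho> (face_point y)" if y: "y \<in> B'" for y
  proof -
    have "\<bar>(face_point y - centre \<rho>) $ i\<bar> \<le> width * \<rho> / 2" for i
    proof -
      have "(face_point y - centre \<rho>) = coord \<theta>m 1 (fst y - \<rho>) (snd y - c) 0" by (simp add: centre_def coord_diff)
      moreover have "\<bar>(fst y - \<rho>) * cos \<theta>m\<bar> \<le> \<bar>fst y - \<rho>\<bar> * 1" "\<bar>(fst y - \<rho>) * sin \<theta>m\<bar> \<le> \<bar>fst y - \<rho>\<bar> * 1"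
        unfolding abs_mult by (intro mult_left_mono; simp)+
      ultimately show ?thesis using y'[OF y] exhaust_3[of i] by auto
    qed
    then have "\<bar>((1 / \<rho>) *\<^sub>R (face_point y - centre \<rho>)) $ i\<bar> \<le> width / 2" for i
      using \<rho> by (simp add: abs_mult field_simps)
    then have b: "width / 2 \<le> ((1 / \<rho>) *\<^sub>R (face_point y - centre \<rho>)) $ i + width" "width / 2 \<le> width - ((1 / \<rho>) *\<^sub>R (face_point y - centre \<rho>)) $ i" for i
      by (smt (verit) field_sum_of_halves)+
    have "flat 0 (width / 2) * flat 0 (width / 2) \<le> bump1 1 (- width) width (((1 / \<rho>) *\<^sub>R (face_point y - centre \<rho>)) $ i)" for i
      unfolding bump1_def using b[of i] by (intro mult_mono flat0_mono flat0) auto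
    then have "(\<Prod>i\<in>(UNIV::3 set). flat 0 (width / 2) * flat 0 (width / 2)) \<le> \<phi> \<rho> (face_point y)"
      unfolding \<phi>_eq bump_def by (intro prod_mono) (auto simp: flat0 intro!: mult_nonneg_nonneg)
    then show ?thesis by simp
  qed
  have eq: "face_point = plane 0 (dirv \<theta>m) ez" by (rule ext) (rule plane_coord[symmetric])
  have B: "B' \<in> sets borel" by (simp add: B'_def)
  have g: "(\<lambda>x. ennreal (\<phi> \<rho> x)) \<in> borel_measurable borel"
    using smooth_continuous_on[OF \<phi>_smooth, of UNIV] by (intro measurable_compose[OF _ measurable_ennreal] borel_measurable_continuous_onI)
  have "emeasure lborel B' = ennreal ((width * \<rho>)\<^sup>2)"
    unfolding B'_def using width_\<rho>
    by (subst emeasure_lborel_cbox_eq)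
       (auto simp: Basis_prod_def prod.union_disjoint prod.reindex inj_on_def power2_eq_square)
  then have "ennreal (mass_const * \<rho>\<^sup>2) = ennreal (pi / 16) * (ennreal ?f * emeasure lborel B')"
    using width flat0(1)[of "width / 2"] by (simp add: mass_const_def ennreal_mult[symmetric] power_mult_distrib mult.assoc)
  also have "ennreal ?f * emeasure lborel B' = (\<integral>\<^sup>+y. ennreal ?f * indicator B' y \<partial>lborel)"
    using B by (simp add: nn_integral_cmult_indicator)
  also have "\<dots> \<le> (\<integral>\<^sup>+y. ennreal (\<phi> \<rho> (plane 0 (dirv \<theta>m) ez y)) * indicator B' y \<partial>lborel)"
    unfolding eq[symmetric] using low by (intro nn_integral_mono) (auto split: split_indicator intro!: ennreal_leI)
  also have "ennreal (pi / 16) * \<dots> \<le> (\<integral>\<^sup>+x. ennreal (\<phi> \<rho> x) * indicator (plane 0 (dirv \<theta>m) ez ` B') x \<partial>S2)"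
    by (rule nn_integral_S2_plane_ge[OF dirv_ez H B g])
  also have "\<dots> \<le> (\<integral>\<^sup>+x. ennreal (\<phi> \<rho> x) \<partial>N)"
    unfolding nn_integral_N eq[symmetric] using patch E_patch_face(1) F
    by (intro nn_integral_mono mult_left_mono) (auto split: split_indicator)
  also have "\<dots> = ennreal (integral\<^sup>L N (\<phi> \<rho>))"
    using \<phi>_bounds by (intro nn_integral_eq_integral integrable_\<phi>_N AE_I2)
  finally have "ennreal (mass_const * \<rho>\<^sup>2) \<le> ennreal (integral\<^sup>L N (\<phi> \<rho>))" by (simp add: mult_left_mono)
  then show ?thesis
    using \<phi>_bounds by (subst (asm) ennreal_le_iff) (auto intro!: integral_nonneg_AE)
qed

end

end

end

lemma partial_scaleR_const:
  fixes f :: "real^3 \<Rightarrow> real"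
  assumes "smooth f"
  shows "partial j (\<lambda>x. f x *\<^sub>R c) x = partial j f x *\<^sub>R c"
proof -
  note d = smooth_has_derivative[OF assms, of x]
  have "((\<lambda>x. f x *\<^sub>R c) has_derivative (\<lambda>e. (\<Sum>j\<in>UNIV. e $ j *\<^sub>R partial j f x) *\<^sub>R c)) (at x)"
    by (rule has_derivative_scaleR_left[OF d])
  from partial_eqI[OF this] show ?thesis by (simp only: sum_axis_scaleR)
qed

lemma integrable_vec_nth: "integrable M f \<Longrightarrow> integrable M (\<lambda>x. f x $ i)" for f :: "'a \<Rightarrow> complex^3"
  by (rule integrable_bounded_linear[OF bounded_linear_vec_nth])

lemma integrable_L_infty_scaleR:
  fixes f :: "'a \<Rightarrow> 'b::{banach, second_countable_topology}"
  assumes "L_infty M V" "integrable M f"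
  shows "integrable M (\<lambda>x. V x *\<^sub>R f x)"
proof -
  obtain C where C: "AE x in M. \<bar>V x\<bar> \<le> C" and V: "V \<in> borel_measurable M"
    using assms(1) by (auto simp: L_infty_def)
  show ?thesis
  proof (rule Bochner_Integration.integrable_bound)
    show "integrable M (\<lambda>x. C * norm (f x))" using assms(2) by simp
    show "AE x in M. norm (V x *\<^sub>R f x) \<le> norm (C * norm (f x))"
      using C by eventually_elim (auto simp: abs_mult intro!: mult_right_mono order_trans[OF _ abs_ge_self])
  qed (use V assms(2) in auto)
qed

section \<open>The volume terms of the tested identity\<close>

context edge
begin

context
  fixes c r0 :: real
  assumes r0: "0 < r0" "r0 \<le> h" "r0 \<le> M - \<bar>c\<bar>"
begin

lemma partial_\<phi>_bound:
  obtains B1 where "B1 > 0" "\<And>\<rho> x j. 0 < \<rho> \<Longrightarrow> 3 * \<rho> \<le> r0 \<Longrightarrow> \<bar>partial j (\<phi> c \<rho>) x\<bar> \<le> B1 / \<rho>"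
proof -
  let ?\<Phi> = "bump 1 (\<chi> i. - width) (\<chi> i. width)"
  have t: "test_fun UNIV ?\<Phi>" by (rule test_fun_bump) auto
  then have sm: "smooth ?\<Phi>" by (simp add: test_fun_def)
  obtain B1 where B1: "B1 > 0" "\<And>x j. norm (partial j ?\<Phi> x) \<le> B1"
    using test_fun_bounded[OF t] by metis
  have "\<bar>partial j (\<phi> c \<rho>) x\<bar> \<le> B1 / \<rho>" if \<rho>: "0 < \<rho>" "3 * \<rho> \<le> r0" for \<rho> x j
  proof -
    let ?A = "\<lambda>x. (1 / \<rho>) *\<^sub>R (x - centre c \<rho>)"
    have A: "(?A has_derivative (\<lambda>e. (1 / \<rho>) *\<^sub>R e)) (at x)"
      by (auto intro!: derivative_eq_intros)
    have "((\<lambda>x. ?\<Phi> (?A x)) has_derivative (\<lambda>e. \<Sum>j\<in>UNIV. ((1 / \<rho>) *\<^sub>R e) $ j *\<^sub>R partial j ?\<Phi> (?A x))) (at x)"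
      by (rule has_derivative_compose[OF A smooth_has_derivative[OF sm]])
    moreover have "\<phi> c \<rho> = (\<lambda>x. ?\<Phi> (?A x))"
      using \<phi>_eq[OF r0 \<rho>] by (rule ext)
    ultimately have "(\<phi> c \<rho> has_derivative (\<lambda>e. \<Sum>j\<in>UNIV. ((1 / \<rho>) *\<^sub>R e) $ j *\<^sub>R partial j ?\<Phi> (?A x))) (at x)"
      by simp
    from partial_eqI[OF this, of j]
    have "partial j (\<phi> c \<rho>) x = (\<Sum>i\<in>UNIV. (axis j 1 :: real^3) $ i *\<^sub>R ((1 / \<rho>) *\<^sub>R partial i ?\<Phi> (?A x)))"
      by (simp add: mult.assoc mult.left_commute)
    also have "\<dots> = (1 / \<rho>) *\<^sub>R partial j ?\<Phi> (?A x)" by (rule sum_axis_scaleR)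
    finally show ?thesis using B1(2)[of j "?A x"] \<rho> by (simp add: divide_right_mono)
  qed
  then show ?thesis using that B1(1) by blast
qed

text \<open>The approximation lemma with the zero function in place of \<open>g\<close>. Adding 1 to
  the norm makes the error bound strictly positive, as that lemma requires.\<close>

lemma v_bulk:
  assumes "H1 \<Omega> v" "is_trace \<Omega> v tv" and \<rho>: "0 < \<rho>" "3 * \<rho> \<le> r0"
  shows "integral\<^sup>L (lebesgue_on (nbhd c (3 * \<rho>))) (\<lambda>x. norm (v x)) \<le>
    2 * m0 c r0 * (1 + 6 * r0) * (3 * \<rho> / r0)\<^sup>2 * sqrt (3 * \<rho> / r0) * (H1_norm D v + 1)"
proof -
  have z: "c1_on UNIV (\<lambda>x. 0) (\<lambda>x. 0)"
    by (auto simp: c1_on_def column_def zero_vec_def[symmetric])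
  have "0 < 3 * \<rho> / r0" "3 * \<rho> / r0 \<le> 1" "3 * \<rho> / r0 * r0 = 3 * \<rho>" using \<rho> r0 by auto
  moreover have "H1_norm D (\<lambda>x. v x - 0) \<le> H1_norm D v + 1" "H1_norm D v + 1 > 0"
    by (simp_all add: H1_norm_nonneg[OF open_D bounded_D] add_nonneg_pos)
  ultimately show ?thesis
    using approximation(1)[OF r0 assms(1,2) z, of "H1_norm D v + 1" "3 * \<rho> / r0"] by simp
qed

context
  fixes la mu \<omega> :: real and V :: "real^3 \<Rightarrow> real" and v w fq :: "real^3 \<Rightarrow> complex^3" and J :: "real^3 \<Rightarrow> complex^3^3"
    and \<alpha> CJ Bq :: real and tv :: "real^3 \<Rightarrow> complex^3"
  assumes H1: "H1 \<Omega> v" "H1 \<Omega> w" and tv: "is_trace \<Omega> v tv" and V: "L_infty (lebesgue_on \<Omega>) V" and \<alpha>: "\<alpha> > 0"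
    and J: "AE x in lebesgue_on D. wgrad \<Omega> v x - wgrad \<Omega> w x = J x"
      "CJ \<ge> 0" "\<And>x. x \<in> D \<Longrightarrow> norm (J x) \<le> CJ * dist x (p c) powr \<alpha>"
    and q: "AE x in lebesgue_on D. (1 + V x) *\<^sub>R w x = fq x" "\<And>x. x \<in> D \<Longrightarrow> norm (fq x) \<le> Bq"
begin

text \<open>In the difference of the pairings the gradients combine to \<open>J\<close>, of size
  \<rho> powr \<alpha> on the support, against derivatives of size 1 / \<rho> on a volume \<rho>^3.
  The terms of order zero combine to \<omega>^2 (v - q w); the bounded part \<open>fq\<close>
  contributes \<rho>^3, and \<open>v\<close> contributes \<rho>^(5/2) by
  \<open>v_bulk\<close>.\<close>

lemma interior_bound:
  obtains C2 where "C2 \<ge> 0"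
    "\<And>\<rho> i. 0 < \<rho> \<Longrightarrow> 3 * \<rho> \<le> r0 \<Longrightarrow> \<rho> \<le> 1 \<Longrightarrow>
       norm (traction_pairing la mu \<Omega> w (\<lambda>x. - ((\<omega>\<^sup>2 * (1 + V x)) *\<^sub>R w x)) (\<lambda>x. \<phi> c \<rho> x *\<^sub>R axis i 1)
         - traction_pairing la mu \<Omega> v (\<lambda>x. - (\<omega>\<^sup>2 *\<^sub>R v x)) (\<lambda>x. \<phi> c \<rho> x *\<^sub>R axis i 1)) \<le> C2 * (\<rho> powr \<alpha> + sqrt \<rho>) * \<rho>\<^sup>2"
proof -
  obtain B1 where B1: "B1 > 0" "\<And>\<rho> x j. 0 < \<rho> \<Longrightarrow> 3 * \<rho> \<le> r0 \<Longrightarrow> \<bar>partial j (\<phi> c \<rho>) x\<bar> \<le> B1 / \<rho>"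
    by (rule partial_\<phi>_bound) metis
  obtain CT where CT: "CT > 0" "\<And>j :: 3. \<And>G i. norm (traction la mu (axis j 1) G $ i) \<le> CT * norm G"
    by (rule traction_bounded[of la mu]) metis
  define U0 where "U0 = measure lebesgue (nbhd c r0)"
  \<comment> \<open>The constants \<open>a1\<close>, \<open>a2\<close> and \<open>a3\<close> belong
    to the gradient term, to \<open>fq\<close> and to \<open>v\<close>. The number 27 / r0^3 relates
    the volume of the neighbourhood of radius 3 \<rho> to that of radius \<open>r0\<close>.\<close>
  define a1 where "a1 = 3 * B1 * CT * CJ * 3 powr \<alpha> * (27 / r0 ^ 3 * U0)"
  define a2 where "a2 = \<omega>\<^sup>2 * \<bar>Bq\<bar> * (27 / r0 ^ 3 * U0)"
  define a3 where "a3 = \<omega>\<^sup>2 * (2 * m0 c r0 * (1 + 6 * r0) * (9 / r0\<^sup>2) * sqrt (3 / r0) * (H1_norm D v + 1))"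
  have U0: "U0 \<ge> 0" by (simp add: U0_def)
  have a: "a1 \<ge> 0" "a2 \<ge> 0" "a3 \<ge> 0"
    unfolding a1_def a2_def a3_def using B1 CT J(2) r0 U0 H1_norm_nonneg[OF open_D bounded_D, of v]
    by (auto intro!: mult_nonneg_nonneg)
  have main: "norm (traction_pairing la mu \<Omega> w (\<lambda>x. - ((\<omega>\<^sup>2 * (1 + V x)) *\<^sub>R w x)) (\<lambda>x. \<phi> c \<rho> x *\<^sub>R axis i 1)
         - traction_pairing la mu \<Omega> v (\<lambda>x. - (\<omega>\<^sup>2 *\<^sub>R v x)) (\<lambda>x. \<phi> c \<rho> x *\<^sub>R axis i 1)) \<le> (a1 + a2 + a3) * (\<rho> powr \<alpha> + sqrt \<rho>) * \<rho>\<^sup>2"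
    if \<rho>: "0 < \<rho>" "3 * \<rho> \<le> r0" "\<rho> \<le> 1" for \<rho> i
  proof -
    note \<rho>' = \<rho>(1,2)
    let ?\<phi> = "\<phi> c \<rho>" and ?U = "nbhd c (3 * \<rho>)" and ?T = "\<lambda>j G. traction la mu (axis j 1) G $ i"
    let ?X = "cbox (corner c \<rho> (- 1)) (corner c \<rho> 1)"
    have sm: "smooth ?\<phi>" by (rule \<phi>_smooth[OF r0 \<rho>'])
    have \<Omega>L: "\<Omega> \<in> sets lebesgue" using \<Omega>(1) by (rule open_sets_lebesgue)
    have fin: "finite_measure (lebesgue_on \<Omega>)" by (rule finite_measure_bounded[OF \<Omega>(2) \<Omega>L])
    \<comment> \<open>The integrand of the pairing for a test field in direction \<open>i\<close>:
      only the i-th component of each traction column and of the source remains.\<close>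
    define A where "A u F x = (\<Sum>j\<in>UNIV. partial j ?\<phi> x *\<^sub>R ?T j (wgrad \<Omega> u x)) + ?\<phi> x *\<^sub>R (F x $ i)"
      for u F :: "real^3 \<Rightarrow> complex^3" and x
    have pairing: "traction_pairing la mu \<Omega> u F (\<lambda>x. ?\<phi> x *\<^sub>R axis i 1) = integral\<^sup>L (lebesgue_on \<Omega>) (A u F)" for u F
      unfolding traction_pairing_def A_def by (simp add: partial_scaleR_const[OF sm] cdot_axis)
    have iA: "integrable (lebesgue_on \<Omega>) (A u F)" if "H1 \<Omega> u" "integrable (lebesgue_on \<Omega>) F" for u F
    proof -
      have iw: "integrable (lebesgue_on \<Omega>) (wgrad \<Omega> u)"
        by (rule L2_integrable[OF fin H1_wgrad(2)[OF \<Omega> that(1)]])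
      have "integrable (lebesgue_on \<Omega>) (\<lambda>x. partial j ?\<phi> x *\<^sub>R ?T j (wgrad \<Omega> u x))" for j
        by (rule integrable_bounded_scaleR[OF traction_integrable[OF iw], of _ "B1 / \<rho>"])
           (use B1(2)[OF \<rho>'] in \<open>auto intro!: continuous_measurable_lebesgue_on smooth_continuous_on_partial[OF sm]\<close>)
      moreover have "integrable (lebesgue_on \<Omega>) (\<lambda>x. ?\<phi> x *\<^sub>R (F x $ i))"
        by (rule integrable_bounded_scaleR[OF integrable_vec_nth[OF that(2)], of _ 1])
           (use \<phi>_bounds[OF r0 \<rho>'] in \<open>auto intro!: continuous_measurable_lebesgue_on smooth_continuous_on[OF sm]\<close>)
      ultimately show ?thesis
        unfolding A_def by (intro Bochner_Integration.integrable_add Bochner_Integration.integrable_sum)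
    qed
    let ?Fw = "\<lambda>x. - ((\<omega>\<^sup>2 * (1 + V x)) *\<^sub>R w x)" and ?Fv = "\<lambda>x. - (\<omega>\<^sup>2 *\<^sub>R v x)"
    have iv: "integrable (lebesgue_on \<Omega>) v" and iw: "integrable (lebesgue_on \<Omega>) w"
      using L2_integrable[OF fin] H1_wgrad(1)[OF \<Omega>] H1 by blast+
    have iFv: "integrable (lebesgue_on \<Omega>) ?Fv" using iv by simp
    have iFw: "integrable (lebesgue_on \<Omega>) ?Fw"
    proof -
      have eq: "?Fw = (\<lambda>x. - (\<omega>\<^sup>2 *\<^sub>R w x) - \<omega>\<^sup>2 *\<^sub>R (V x *\<^sub>R w x))"
        by (simp add: fun_eq_iff algebra_simps)
      show ?thesis unfolding eq
        by (intro Bochner_Integration.integrable_diff Bochner_Integration.integrable_minus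
          integrable_scaleR_right integrable_L_infty_scaleR[OF V iw] iw)
    qed
    \<comment> \<open>A pointwise bound for everything except \<open>v\<close> itself, which is not
      bounded and has to be integrated separately.\<close>
    define K1 where "K1 = 3 * (B1 / \<rho>) * CT * (CJ * (3 * \<rho>) powr \<alpha>) + \<omega>\<^sup>2 * \<bar>Bq\<bar>"
    have K1: "K1 \<ge> 0" unfolding K1_def using B1 CT J(2) \<rho> by (intro add_nonneg_nonneg mult_nonneg_nonneg) auto
    have ptw: "AE x in lebesgue_on \<Omega>. norm (A w ?Fw x - A v ?Fv x) \<le> indicator ?U x *\<^sub>R (K1 + \<omega>\<^sup>2 * norm (v x))"
    proof -
      have DL: "D \<in> sets lebesgue" using open_D by (rule open_sets_lebesgue)
      have 1: "AE x in lebesgue_on \<Omega>. x \<in> D \<longrightarrow> wgrad \<Omega> v x - wgrad \<Omega> w x = J x"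
        using J(1) DL \<Omega>L by (auto simp: AE_restrict_space_iff elim!: eventually_mono)
      have 2: "AE x in lebesgue_on \<Omega>. x \<in> D \<longrightarrow> (1 + V x) *\<^sub>R w x = fq x"
        using q(1) DL \<Omega>L by (auto simp: AE_restrict_space_iff elim!: eventually_mono)
      have 3: "AE x in lebesgue_on \<Omega>. x \<in> \<Omega>" by (rule AE_I2) simp
      show ?thesis using 1 2 3
      proof eventually_elim
        case (elim x)
        show ?case
        proof (cases "x \<in> ?X")
          case False
          then have "A w ?Fw x - A v ?Fv x = 0"
            using \<phi>_eq_0[OF r0 \<rho>' False] partial_\<phi>_eq_0[OF r0 \<rho>' False] by (simp add: A_def)
          then show ?thesis using K1 by (auto split: split_indicator)
        next
          case True
          then have xU: "x \<in> ?U" using support_\<Omega>[OF r0 \<rho>'] elim(3) by blast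
          then have xD: "x \<in> D" and dx: "dist x (p c) < 3 * \<rho>"
            by (auto simp: nbhd_def[OF r0] dist_commute)
          have Jx: "norm (J x) \<le> CJ * (3 * \<rho>) powr \<alpha>"
            by (rule order_trans[OF J(3)[OF xD]]) (use dx \<alpha> J(2) in \<open>intro mult_left_mono powr_mono2; simp\<close>)
          have T: "norm (?T j (wgrad \<Omega> w x) - ?T j (wgrad \<Omega> v x)) \<le> CT * (CJ * (3 * \<rho>) powr \<alpha>)" for j
          proof -
            have "?T j (wgrad \<Omega> w x) - ?T j (wgrad \<Omega> v x) = ?T j (wgrad \<Omega> w x - wgrad \<Omega> v x)"
              using linear_diff[OF traction_linear] by simp
            also have "norm \<dots> \<le> CT * norm (wgrad \<Omega> w x - wgrad \<Omega> v x)" by (rule CT)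
            also have "norm (wgrad \<Omega> w x - wgrad \<Omega> v x) = norm (J x)"
              using elim(1) xD by (metis norm_minus_commute)
            also have "CT * norm (J x) \<le> CT * (CJ * (3 * \<rho>) powr \<alpha>)" using Jx CT by (intro mult_left_mono) auto
            finally show ?thesis .
          qed
          have fq: "fq x = (1 + V x) *\<^sub>R w x" using elim(2) xD by simp
          have eq: "?Fw x - ?Fv x = \<omega>\<^sup>2 *\<^sub>R (v x - fq x)"
            unfolding fq by (simp add: scaleR_diff_right)
          have F: "norm ((?Fw x - ?Fv x) $ i) \<le> \<omega>\<^sup>2 * (norm (v x) + \<bar>Bq\<bar>)"
          proof -
            have "norm ((?Fw x - ?Fv x) $ i) \<le> norm (?Fw x - ?Fv x)" by (rule Finite_Cartesian_Product.norm_nth_le)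
            also have "\<dots> = \<omega>\<^sup>2 * norm (v x - fq x)" unfolding eq by simp
            also have "\<dots> \<le> \<omega>\<^sup>2 * (norm (v x) + \<bar>Bq\<bar>)"
              using norm_triangle_ineq4[of "v x" "fq x"] q(2)[OF xD] by (intro mult_left_mono) auto
            finally show ?thesis .
          qed
          have "A w ?Fw x - A v ?Fv x = (\<Sum>j\<in>UNIV. partial j ?\<phi> x *\<^sub>R (?T j (wgrad \<Omega> w x) - ?T j (wgrad \<Omega> v x))) + ?\<phi> x *\<^sub>R ((?Fw x - ?Fv x) $ i)"
            unfolding A_def by (simp add: sum_subtractf scaleR_diff_right)
          also have "norm \<dots> \<le> (\<Sum>j\<in>(UNIV::3 set). (B1 / \<rho>) * (CT * (CJ * (3 * \<rho>) powr \<alpha>))) + 1 * (\<omega>\<^sup>2 * (norm (v x) + \<bar>Bq\<bar>))"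
          proof (rule norm_triangle_le, rule add_mono)
            show "norm (\<Sum>j\<in>UNIV. partial j ?\<phi> x *\<^sub>R (?T j (wgrad \<Omega> w x) - ?T j (wgrad \<Omega> v x))) \<le>
              (\<Sum>j\<in>(UNIV::3 set). (B1 / \<rho>) * (CT * (CJ * (3 * \<rho>) powr \<alpha>)))"
            proof (rule sum_norm_le)
              fix j :: 3
              show "norm (partial j ?\<phi> x *\<^sub>R (?T j (wgrad \<Omega> w x) - ?T j (wgrad \<Omega> v x))) \<le> (B1 / \<rho>) * (CT * (CJ * (3 * \<rho>) powr \<alpha>))"
                unfolding norm_scaleR using B1(2)[OF \<rho>', of j x] T[of j] B1(1) \<rho> by (intro mult_mono) auto
            qed
            show "norm (?\<phi> x *\<^sub>R ((?Fw x - ?Fv x) $ i)) \<le> 1 * (\<omega>\<^sup>2 * (norm (v x) + \<bar>Bq\<bar>))"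
              unfolding norm_scaleR using \<phi>_bounds[OF r0 \<rho>', of x] F by (intro mult_mono) auto
          qed
          also have "\<dots> = K1 + \<omega>\<^sup>2 * norm (v x)" by (simp add: K1_def algebra_simps)
          finally show ?thesis using xU by simp
        qed
      qed
    qed
    have UL: "?U \<in> sets lebesgue" by (rule nbhd_lebesgue[OF r0])
    have finU: "finite_measure (lebesgue_on ?U)" by (rule finite_measure_bounded[OF bounded_nbhd[OF r0] UL])
    have U\<Omega>: "?U \<subseteq> \<Omega>" using nbhd_subset[OF r0] D_subset by blast
    have ivU: "integrable (lebesgue_on ?U) (\<lambda>x. norm (v x))"
      using L2_integrable[OF finU L2_lebesgue_on_subset[OF H1_wgrad(1)[OF \<Omega> H1(1)] U\<Omega> UL \<Omega>L]] by simp
    interpret U: finite_measure "lebesgue_on ?U" by (rule finU)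
    have eqi: "(\<lambda>x. indicator \<Omega> x *\<^sub>R (indicator ?U x *\<^sub>R g x)) = (\<lambda>x. indicator ?U x *\<^sub>R g x)" for g :: "real^3 \<Rightarrow> real"
      using U\<Omega> by (auto simp: fun_eq_iff split: split_indicator)
    have ig: "integrable (lebesgue_on ?U) (\<lambda>x. K1 + \<omega>\<^sup>2 * norm (v x))" using ivU by simp
    have ig\<Omega>: "integrable (lebesgue_on \<Omega>) (\<lambda>x. indicator ?U x *\<^sub>R (K1 + \<omega>\<^sup>2 * norm (v x)))"
      unfolding integrable_lebesgue_on[OF \<Omega>L] eqi using ig unfolding integrable_lebesgue_on[OF UL] .
    have "norm (integral\<^sup>L (lebesgue_on \<Omega>) (A w ?Fw) - integral\<^sup>L (lebesgue_on \<Omega>) (A v ?Fv)) =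
        norm (integral\<^sup>L (lebesgue_on \<Omega>) (\<lambda>x. A w ?Fw x - A v ?Fv x))"
      by (subst Bochner_Integration.integral_diff[OF iA[OF H1(2) iFw] iA[OF H1(1) iFv]]) simp
    also have "\<dots> \<le> integral\<^sup>L (lebesgue_on \<Omega>) (\<lambda>x. norm (A w ?Fw x - A v ?Fv x))"
      by (rule integral_norm_bound)
    also have "\<dots> \<le> integral\<^sup>L (lebesgue_on \<Omega>) (\<lambda>x. indicator ?U x *\<^sub>R (K1 + \<omega>\<^sup>2 * norm (v x)))"
      by (rule integral_mono_AE[OF integrable_norm[OF Bochner_Integration.integrable_diff[OF iA[OF H1(2) iFw] iA[OF H1(1) iFv]]] ig\<Omega> ptw])
    also have "\<dots> = integral\<^sup>L (lebesgue_on ?U) (\<lambda>x. K1 + \<omega>\<^sup>2 * norm (v x))"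
      unfolding integral_lebesgue_on[OF \<Omega>L] eqi integral_lebesgue_on[OF UL] ..
    also have "\<dots> = K1 * measure (lebesgue_on ?U) (space (lebesgue_on ?U)) + \<omega>\<^sup>2 * integral\<^sup>L (lebesgue_on ?U) (\<lambda>x. norm (v x))"
      using ivU by simp
    also have "measure (lebesgue_on ?U) (space (lebesgue_on ?U)) = 27 / r0 ^ 3 * U0 * \<rho> ^ 3"
    proof -
      have "0 < 3 * \<rho> / r0" "3 * \<rho> / r0 \<le> 1" "3 * \<rho> / r0 * r0 = 3 * \<rho>" using \<rho> r0 by auto
      from measure_nbhd[OF r0 this(1,2)] this(3) show ?thesis
        using UL by (simp add: measure_restrict_space U0_def power_divide power_mult_distrib)
    qed
    also have "K1 * (27 / r0 ^ 3 * U0 * \<rho> ^ 3) = a1 * (\<rho> powr \<alpha> * \<rho>\<^sup>2) + a2 * \<rho> ^ 3"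
    proof -
      have "(3 * \<rho>) powr \<alpha> = 3 powr \<alpha> * \<rho> powr \<alpha>" using \<rho> by (simp add: powr_mult)
      moreover have "B1 / \<rho> * \<rho> ^ 3 = B1 * \<rho>\<^sup>2" using \<rho> by (simp add: power3_eq_cube power2_eq_square)
      moreover have "(3 * b * t * (j * (x * y)) + o') * (zu * s) = 3 * b' * t * j * x * zu * (y * s') + o' * zu * s"
        if "b * s = b' * s'" for b b' t j x y o' zu s s' :: real
      proof -
        have "(3 * b * t * (j * (x * y)) + o') * (zu * s) = 3 * (b * s) * t * j * x * zu * y + o' * zu * s"
          by (simp add: algebra_simps)
        then show ?thesis unfolding that by (simp add: mult_ac)
      qed
      ultimately show ?thesis unfolding K1_def a1_def a2_def by (simp only:)
    qed
    also have "\<omega>\<^sup>2 * integral\<^sup>L (lebesgue_on ?U) (\<lambda>x. norm (v x)) \<le> a3 * (\<rho>\<^sup>2 * sqrt \<rho>)"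
    proof -
      have "\<omega>\<^sup>2 * integral\<^sup>L (lebesgue_on ?U) (\<lambda>x. norm (v x)) \<le>
          \<omega>\<^sup>2 * (2 * m0 c r0 * (1 + 6 * r0) * (3 * \<rho> / r0)\<^sup>2 * sqrt (3 * \<rho> / r0) * (H1_norm D v + 1))"
        by (intro mult_left_mono v_bulk[OF H1(1) tv \<rho>']) simp
      also have "(3 * \<rho> / r0)\<^sup>2 = (9 / r0\<^sup>2) * \<rho>\<^sup>2" by (simp add: power_divide power_mult_distrib)
      also have "sqrt (3 * \<rho> / r0) = sqrt (3 / r0) * sqrt \<rho>" by (simp add: real_sqrt_mult[symmetric])
      also have "\<omega>\<^sup>2 * (2 * m0 c r0 * (1 + 6 * r0) * ((9 / r0\<^sup>2) * \<rho>\<^sup>2) * (sqrt (3 / r0) * sqrt \<rho>) * (H1_norm D v + 1)) = a3 * (\<rho>\<^sup>2 * sqrt \<rho>)"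
        unfolding a3_def by (simp only: mult_ac)
      finally show ?thesis .
    qed
    finally have "norm (integral\<^sup>L (lebesgue_on \<Omega>) (A w ?Fw) - integral\<^sup>L (lebesgue_on \<Omega>) (A v ?Fv)) \<le>
      a1 * (\<rho> powr \<alpha> * \<rho>\<^sup>2) + a2 * \<rho> ^ 3 + a3 * (\<rho>\<^sup>2 * sqrt \<rho>)" by simp
    also have "\<dots> \<le> (a1 + a2 + a3) * (\<rho> powr \<alpha> + sqrt \<rho>) * \<rho>\<^sup>2"
    proof -
      \<comment> \<open>For \<rho> at most 1 the term of order \<rho>^3 is absorbed by the one of
        order \<rho>^(5/2).\<close>
      have "\<rho> \<le> sqrt \<rho>"
      proof (rule real_le_rsqrt)
        show "\<rho>\<^sup>2 \<le> \<rho>" using \<rho> by (simp add: power2_eq_square mult_left_le)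
      qed
      then have "\<rho> ^ 3 \<le> sqrt \<rho> * \<rho>\<^sup>2" using \<rho> by (simp add: power3_eq_cube power2_eq_square mult_right_mono)
      then have 1: "a2 * \<rho> ^ 3 \<le> a2 * (sqrt \<rho> * \<rho>\<^sup>2)" using a by (intro mult_left_mono)
      have nn: "0 \<le> \<rho> powr \<alpha> * \<rho>\<^sup>2" "0 \<le> sqrt \<rho> * \<rho>\<^sup>2" using \<rho> by auto
      have 2: "0 \<le> a1 * (sqrt \<rho> * \<rho>\<^sup>2)" "0 \<le> a2 * (\<rho> powr \<alpha> * \<rho>\<^sup>2)" "0 \<le> a3 * (\<rho> powr \<alpha> * \<rho>\<^sup>2)"
        using a nn by (simp_all only: mult_nonneg_nonneg)
      have "(a1 + a2 + a3) * (\<rho> powr \<alpha> + sqrt \<rho>) * \<rho>\<^sup>2 =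
        a1 * (\<rho> powr \<alpha> * \<rho>\<^sup>2) + a2 * (\<rho> powr \<alpha> * \<rho>\<^sup>2) + a3 * (\<rho> powr \<alpha> * \<rho>\<^sup>2) + a1 * (sqrt \<rho> * \<rho>\<^sup>2) + a2 * (sqrt \<rho> * \<rho>\<^sup>2) + a3 * (sqrt \<rho> * \<rho>\<^sup>2)"
        by (simp add: algebra_simps)
      then show ?thesis using 1 2 by (simp add: mult.commute[of "\<rho>\<^sup>2"])
    qed
    finally show ?thesis unfolding pairing .
  qed
  show ?thesis by (rule that[of "a1 + a2 + a3"]) (use a main in auto)
qed

end

end

end

lemma integral_norm_le_indicator:
  fixes f :: "'a \<Rightarrow> 'b::{banach, second_countable_topology}"
  assumes "integrable M (\<lambda>x. \<phi> x *\<^sub>R f x)" "\<And>x. 0 \<le> \<phi> x" "\<And>x. \<phi> x \<le> 1"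
    and "AE x in M. \<phi> x \<noteq> 0 \<longrightarrow> x \<in> A"
    and "(\<integral>\<^sup>+x. ennreal (norm (f x)) * indicator A x \<partial>M) \<le> ennreal B" "B \<ge> 0"
  shows "integral\<^sup>L M (\<lambda>x. \<phi> x * norm (f x)) \<le> B"
proof -
  have i: "integrable M (\<lambda>x. \<phi> x * norm (f x))"
    using integrable_norm[OF assms(1)] assms(2) by simp
  have "ennreal (integral\<^sup>L M (\<lambda>x. \<phi> x * norm (f x))) = (\<integral>\<^sup>+x. ennreal (\<phi> x * norm (f x)) \<partial>M)"
    using assms(2) by (intro nn_integral_eq_integral[symmetric] i AE_I2) simp
  also have "\<dots> \<le> (\<integral>\<^sup>+x. ennreal (norm (f x)) * indicator A x \<partial>M)"
  proof (rule nn_integral_mono_AE)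
    show "AE x in M. ennreal (\<phi> x * norm (f x)) \<le> ennreal (norm (f x)) * indicator A x"
      using assms(4)
    proof eventually_elim
      case (elim x)
      have "\<phi> x * norm (f x) \<le> norm (f x)" using assms(2,3)[of x] by (simp add: mult_left_le_one_le)
      then show ?case using elim by (cases "\<phi> x = 0") (auto intro!: ennreal_leI)
    qed
  qed
  also note assms(5)
  finally show ?thesis using assms(6) by simp
qed

section \<open>The value of an approximating field at the edge point\<close>

context edge
begin

context
  fixes c r0 :: real
  assumes r0: "0 < r0" "r0 \<le> h" "r0 \<le> M - \<bar>c\<bar>"
begin

text \<open>Write \<eta> g(p) as \<eta> tv - \<eta> (tv - g) - \<eta> (g - g(p)) and integrate
  against the bump. The three terms are bounded by the tested identity, by the trace approximation
  and by the Lipschitz constant. On the small support \<eta> stays within half of |\<eta>0| from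
  \<eta>0, so the left side is at least |g(p)| times half of |\<eta>0| times the mass of the bump,
  componentwise.\<close>

lemma value_estimate:
  assumes F: "face \<theta>m \<subseteq> frontier \<Omega>" and v: "H1 \<Omega> v" "is_trace \<Omega> v tv" and \<alpha>: "\<alpha> > 0"
    and \<eta>: "L_infty N \<eta>" "\<eta>0 \<noteq> 0" "\<And>x. x \<in> face \<theta>m \<Longrightarrow> \<bar>\<eta> x - \<eta>0\<bar> \<le> C\<eta> * dist x (p c) powr \<alpha>"
    and C2: "C2 \<ge> 0" "\<And>\<rho> i. 0 < \<rho> \<Longrightarrow> 3 * \<rho> \<le> r0 \<Longrightarrow> \<rho> \<le> 1 \<Longrightarrow>
      norm (integral\<^sup>L N (\<lambda>x. (\<phi> c \<rho> x * \<eta> x) *\<^sub>R (tv x $ i))) \<le> C2 * (\<rho> powr \<alpha> + sqrt \<rho>) * \<rho>\<^sup>2"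
  obtains C \<rho>0 where "C \<ge> 0" "\<rho>0 > 0"
    "\<And>\<rho> g Jg L e. 0 < \<rho> \<Longrightarrow> \<rho> \<le> \<rho>0 \<Longrightarrow> c1_on UNIV g Jg \<Longrightarrow> (\<And>x. norm (g x - g (p c)) \<le> L * norm (x - p c)) \<Longrightarrow> L \<ge> 0 \<Longrightarrow>
       H1_norm D (\<lambda>x. v x - g x) \<le> e \<Longrightarrow> e > 0 \<Longrightarrow> norm (g (p c)) \<le> C * (\<rho> powr \<alpha> + sqrt \<rho> + L * \<rho> + e / sqrt \<rho>)"
proof -
  obtain B' where B': "AE x in N. \<bar>\<eta> x\<bar> \<le> B'" and \<eta>m: "\<eta> \<in> borel_measurable N" using \<eta>(1) by (auto simp: L_infty_def)
  define B where "B = \<bar>B'\<bar>"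
  have B: "AE x in N. \<bar>\<eta> x\<bar> \<le> B" "B \<ge> 0" using B' by (auto simp: B_def elim!: eventually_mono)
  \<comment> \<open>At this scale the Hoelder bound for \<eta> on points within 3 \<rho>1 of the
    edge point is at most half of |\<eta>0|. The added 1 keeps the quotient defined when the Hoelder
    constant is zero.\<close>
  define \<rho>1 where "\<rho>1 = ((\<bar>\<eta>0\<bar> / (2 * (\<bar>C\<eta>\<bar> + 1))) powr (1 / \<alpha>)) / 3"
  define \<rho>0 where "\<rho>0 = min (min 1 (r0 / 3)) \<rho>1"
  have \<rho>1: "\<rho>1 > 0" "(3 * \<rho>1) powr \<alpha> = \<bar>\<eta>0\<bar> / (2 * (\<bar>C\<eta>\<bar> + 1))" using \<alpha> \<eta>(2) by (simp_all add: \<rho>1_def powr_powr)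
  have \<rho>0: "\<rho>0 > 0" "\<rho>0 \<le> 1" "\<rho>0 \<le> r0 / 3" "\<rho>0 \<le> \<rho>1" using r0 \<rho>1 by (simp_all add: \<rho>0_def)
  \<comment> \<open>The constant does not depend on the scale; r0 / 3 is just an admissible scale
    for citing the lemma.\<close>
  have mp: "mass_const > 0" using mass_const_pos[OF r0, of "r0 / 3"] r0 by simp
  define a where "a = 2 / \<bar>\<eta>0\<bar> * (C2 / mass_const + B * (2 * C1 c r0 * (3 / r0) * sqrt (3 / r0)) / mass_const + 3 * B)"
  have a0: "0 \<le> C2 / mass_const" "0 \<le> B * (2 * C1 c r0 * (3 / r0) * sqrt (3 / r0)) / mass_const" "0 \<le> 3 * B" "0 < 2 / \<bar>\<eta>0\<bar>"
    using C2(1) B(2) mp C1_nonneg[OF r0] r0 \<eta>(2) by simp_all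
  then have a: "a \<ge> 0" unfolding a_def by (intro mult_nonneg_nonneg add_nonneg_nonneg) auto
  have tvL: "L2 N tv" using v(2) by (simp add: is_trace_def)
  interpret N: finite_measure N by (rule finite_N)
  have comp: "norm (g (p c) $ i) \<le> a * (\<rho> powr \<alpha> + sqrt \<rho> + L * \<rho> + e / sqrt \<rho>)"
    if \<rho>: "0 < \<rho>" "\<rho> \<le> \<rho>0" and g: "c1_on UNIV g Jg" and L: "\<And>x. norm (g x - g (p c)) \<le> L * norm (x - p c)" "L \<ge> 0"
      and e: "H1_norm D (\<lambda>x. v x - g x) \<le> e" "e > 0" for \<rho> g Jg L e i
  proof -
    have \<rho>': "0 < \<rho>" "3 * \<rho> \<le> r0" "\<rho> \<le> 1" using \<rho> \<rho>0 by auto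
    note r\<rho> = r0 \<rho>'(1,2)
    let ?\<phi> = "\<phi> c \<rho>" and ?V = "g (p c)"
    define S where "S = \<rho> powr \<alpha> + sqrt \<rho>"
    have S0: "S \<ge> 0" using \<rho> by (simp add: S_def)
    define \<Phi> where "\<Phi> = integral\<^sup>L N ?\<phi>"
    have \<Phi>m: "mass_const * \<rho>\<^sup>2 \<le> \<Phi>" unfolding \<Phi>_def by (rule \<phi>_mass[OF r\<rho> F])
    have mass_\<rho>: "0 < mass_const * \<rho>\<^sup>2" using mp \<rho> by simp
    have \<Phi>0: "\<Phi> > 0" using \<Phi>m mass_\<rho> by linarith
    have i\<phi>: "integrable N ?\<phi>" by (rule integrable_\<phi>_N[OF r\<rho>])
    have \<phi>b: "0 \<le> ?\<phi> x" "?\<phi> x \<le> 1" for x by (rule \<phi>_bounds[OF r\<rho>])+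
    have \<phi>m: "?\<phi> \<in> borel_measurable N" using i\<phi> by simp
    have supp: "AE x in N. ?\<phi> x \<noteq> 0 \<longrightarrow> x \<in> face_point ` patch c \<rho>"
    proof (rule AE_I2)
      fix x assume "x \<in> space N"
      then show "?\<phi> x \<noteq> 0 \<longrightarrow> x \<in> face_point ` patch c \<rho>"
        using \<phi>_eq_0[OF r\<rho>, of x] support_frontier[OF r\<rho>, of x] by auto
    qed
    have near: "x \<in> face \<theta>m" "dist x (p c) < 3 * \<rho>" if "x \<in> face_point ` patch c \<rho>" for x
      using that E_patch_face[OF r\<rho>] by blast+
    have small: "\<bar>\<eta> x - \<eta>0\<bar> \<le> \<bar>\<eta>0\<bar> / 2" if "x \<in> face_point ` patch c \<rho>" for x
    proof -
      have "\<bar>\<eta> x - \<eta>0\<bar> \<le> C\<eta> * dist x (p c) powr \<alpha>" by (rule \<eta>(3)[OF near(1)[OF that]])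
      also have "\<dots> \<le> \<bar>C\<eta>\<bar> * (3 * \<rho>1) powr \<alpha>"
        using near(2)[OF that] \<alpha> \<rho> \<rho>0 by (intro mult_mono powr_mono2) auto
      also have "\<dots> \<le> \<bar>\<eta>0\<bar> / 2" unfolding \<rho>1(2) by (simp add: field_simps)
      finally show ?thesis .
    qed
    have \<phi>\<eta>: "L_infty N (\<lambda>x. ?\<phi> x * \<eta> x)"
      unfolding L_infty_def
    proof (intro conjI exI)
      show "(\<lambda>x. ?\<phi> x * \<eta> x) \<in> borel_measurable N" using \<phi>m \<eta>m by simp
      show "AE x in N. \<bar>?\<phi> x * \<eta> x\<bar> \<le> 1 * B"
        using B(1)
      proof eventually_elim
        case (elim x)
        then show ?case unfolding abs_mult using \<phi>b[of x] by (intro mult_mono) auto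
      qed
    qed
    have igN: "integrable N g" by (rule L2_integrable[OF finite_N L2_N_continuous[OF c1_on_continuous[OF g]]])
    have itv: "integrable N tv" by (rule L2_integrable[OF finite_N tvL])
    have i\<phi>\<eta>: "integrable N (\<lambda>x. ?\<phi> x * \<eta> x)"
      using integrable_L_infty_scaleR[OF \<phi>\<eta>, of "\<lambda>x. 1 :: real"] by simp
    have i1: "integrable N (\<lambda>x. (?\<phi> x * \<eta> x) *\<^sub>R (tv x $ i))"
      by (rule integrable_L_infty_scaleR[OF \<phi>\<eta> integrable_vec_nth[OF itv]])
    have i2: "integrable N (\<lambda>x. (?\<phi> x * \<eta> x) *\<^sub>R ((tv x - g x) $ i))"
      by (rule integrable_L_infty_scaleR[OF \<phi>\<eta> integrable_vec_nth[OF Bochner_Integration.integrable_diff[OF itv igN]]])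
    have i3: "integrable N (\<lambda>x. (?\<phi> x * \<eta> x) *\<^sub>R ((g x - ?V) $ i))"
      by (rule integrable_L_infty_scaleR[OF \<phi>\<eta> integrable_vec_nth[OF Bochner_Integration.integrable_diff[OF igN]]]) simp
    have i4: "integrable N (\<lambda>x. (?\<phi> x * \<eta> x) *\<^sub>R (?V $ i))" using i\<phi>\<eta> by simp
    have i5: "integrable N (\<lambda>x. ?\<phi> x *\<^sub>R (tv x - g x))"
      by (rule integrable_bounded_scaleR[OF Bochner_Integration.integrable_diff[OF itv igN] \<phi>m, of 1]) (use \<phi>b in auto)
    have n1: "norm (integral\<^sup>L N (\<lambda>x. (?\<phi> x * \<eta> x) *\<^sub>R (tv x $ i))) \<le> C2 * S * \<rho>\<^sup>2"
      using C2(2)[OF \<rho>'] by (simp add: S_def)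
    have n2: "norm (integral\<^sup>L N (\<lambda>x. (?\<phi> x * \<eta> x) *\<^sub>R ((tv x - g x) $ i))) \<le> B * (2 * C1 c r0 * (3 * \<rho> / r0) * sqrt (3 * \<rho> / r0) * e)"
    proof -
      have "norm (integral\<^sup>L N (\<lambda>x. (?\<phi> x * \<eta> x) *\<^sub>R ((tv x - g x) $ i))) \<le> integral\<^sup>L N (\<lambda>x. B * (?\<phi> x * norm (tv x - g x)))"
      proof (rule order_trans[OF integral_norm_bound])
        show "integral\<^sup>L N (\<lambda>x. norm ((?\<phi> x * \<eta> x) *\<^sub>R ((tv x - g x) $ i))) \<le> integral\<^sup>L N (\<lambda>x. B * (?\<phi> x * norm (tv x - g x)))"
        proof (rule integral_mono_AE)
          show "integrable N (\<lambda>x. norm ((?\<phi> x * \<eta> x) *\<^sub>R ((tv x - g x) $ i)))" using i2 by (rule integrable_norm)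
          show "integrable N (\<lambda>x. B * (?\<phi> x * norm (tv x - g x)))"
            using integrable_norm[OF i5] \<phi>b by simp
          show "AE x in N. norm ((?\<phi> x * \<eta> x) *\<^sub>R ((tv x - g x) $ i)) \<le> B * (?\<phi> x * norm (tv x - g x))"
            using B(1)
          proof eventually_elim
            case (elim x)
            have "norm ((?\<phi> x * \<eta> x) *\<^sub>R ((tv x - g x) $ i)) = \<bar>\<eta> x\<bar> * (?\<phi> x * norm ((tv x - g x) $ i))"
              using \<phi>b[of x] by (simp add: abs_mult)
            also have "\<dots> \<le> B * (?\<phi> x * norm (tv x - g x))"
              using elim \<phi>b[of x] B(2) by (intro mult_mono mult_left_mono Finite_Cartesian_Product.norm_nth_le) auto
            finally show ?case .
          qed
        qed
      qed
      also have "\<dots> = B * integral\<^sup>L N (\<lambda>x. ?\<phi> x * norm (tv x - g x))" by simp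
      also have "\<dots> \<le> B * (2 * C1 c r0 * (3 * \<rho> / r0) * sqrt (3 * \<rho> / r0) * e)"
      proof (intro mult_left_mono B(2))
        show "integral\<^sup>L N (\<lambda>x. ?\<phi> x * norm (tv x - g x)) \<le> 2 * C1 c r0 * (3 * \<rho> / r0) * sqrt (3 * \<rho> / r0) * e"
          by (rule integral_norm_le_indicator[OF i5 \<phi>b supp approximation(2)[OF r0 v g e \<rho>'(1,2) F]])
             (use C1_nonneg[OF r0] r0 \<rho> e in simp)
      qed
      finally show ?thesis .
    qed
    have n3: "norm (integral\<^sup>L N (\<lambda>x. (?\<phi> x * \<eta> x) *\<^sub>R ((g x - ?V) $ i))) \<le> B * (3 * L * \<rho>) * \<Phi>"
    proof -
      have "norm (integral\<^sup>L N (\<lambda>x. (?\<phi> x * \<eta> x) *\<^sub>R ((g x - ?V) $ i))) \<le> integral\<^sup>L N (\<lambda>x. B * (3 * L * \<rho>) * ?\<phi> x)"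
      proof (rule order_trans[OF integral_norm_bound])
        show "integral\<^sup>L N (\<lambda>x. norm ((?\<phi> x * \<eta> x) *\<^sub>R ((g x - ?V) $ i))) \<le> integral\<^sup>L N (\<lambda>x. B * (3 * L * \<rho>) * ?\<phi> x)"
        proof (rule integral_mono_AE)
          show "integrable N (\<lambda>x. norm ((?\<phi> x * \<eta> x) *\<^sub>R ((g x - ?V) $ i)))" using i3 by (rule integrable_norm)
          show "integrable N (\<lambda>x. B * (3 * L * \<rho>) * ?\<phi> x)" using i\<phi> by simp
          show "AE x in N. norm ((?\<phi> x * \<eta> x) *\<^sub>R ((g x - ?V) $ i)) \<le> B * (3 * L * \<rho>) * ?\<phi> x"
            using B(1) supp
          proof eventually_elim
            case (elim x)
            show ?case
            proof (cases "?\<phi> x = 0")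
              case False
              then have "norm (x - p c) \<le> 3 * \<rho>" using elim near(2)[of x] by (simp add: dist_norm)
              then have "L * norm (x - p c) \<le> L * (3 * \<rho>)" using L(2) by (rule mult_left_mono)
              then have "norm ((g x - ?V) $ i) \<le> 3 * L * \<rho>"
                using L(1)[of x] Finite_Cartesian_Product.norm_nth_le[of "g x - ?V" i] by simp
              then have "?\<phi> x * (\<bar>\<eta> x\<bar> * norm ((g x - ?V) $ i)) \<le> ?\<phi> x * (B * (3 * L * \<rho>))"
                using elim \<phi>b[of x] B(2) by (intro mult_mono mult_left_mono) auto
              then show ?thesis using \<phi>b[of x] by (simp add: abs_mult mult_ac)
            qed simp
          qed
        qed
      qed
      also have "\<dots> = B * (3 * L * \<rho>) * \<Phi>" by (simp add: \<Phi>_def)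
      finally show ?thesis .
    qed
    have low: "\<bar>\<eta>0\<bar> / 2 * \<Phi> \<le> \<bar>integral\<^sup>L N (\<lambda>x. ?\<phi> x * \<eta> x)\<bar>"
    proof -
      have "\<bar>integral\<^sup>L N (\<lambda>x. ?\<phi> x * \<eta> x) - \<eta>0 * \<Phi>\<bar> = \<bar>integral\<^sup>L N (\<lambda>x. ?\<phi> x * \<eta> x - \<eta>0 * ?\<phi> x)\<bar>"
        unfolding \<Phi>_def using i\<phi> i\<phi>\<eta> by simp
      also have "\<dots> \<le> integral\<^sup>L N (\<lambda>x. \<bar>?\<phi> x * \<eta> x - \<eta>0 * ?\<phi> x\<bar>)" by (rule integral_abs_bound)
      also have "\<dots> \<le> integral\<^sup>L N (\<lambda>x. \<bar>\<eta>0\<bar> / 2 * ?\<phi> x)"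
      proof (rule integral_mono_AE)
        show "integrable N (\<lambda>x. \<bar>?\<phi> x * \<eta> x - \<eta>0 * ?\<phi> x\<bar>)" "integrable N (\<lambda>x. \<bar>\<eta>0\<bar> / 2 * ?\<phi> x)" using i\<phi> i\<phi>\<eta> by auto
        show "AE x in N. \<bar>?\<phi> x * \<eta> x - \<eta>0 * ?\<phi> x\<bar> \<le> \<bar>\<eta>0\<bar> / 2 * ?\<phi> x"
          using supp
        proof eventually_elim
          case (elim x)
          have eq: "?\<phi> x * \<eta> x - \<eta>0 * ?\<phi> x = ?\<phi> x * (\<eta> x - \<eta>0)" by (simp add: algebra_simps)
          show ?case
          proof (cases "?\<phi> x = 0")
            case False
            then have "?\<phi> x * \<bar>\<eta> x - \<eta>0\<bar> \<le> ?\<phi> x * (\<bar>\<eta>0\<bar> / 2)" using elim small \<phi>b by (intro mult_left_mono) auto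
            then show ?thesis unfolding eq using \<phi>b[of x] by (simp add: abs_mult mult.commute)
          qed simp
        qed
      qed
      also have "\<dots> = \<bar>\<eta>0\<bar> / 2 * \<Phi>" by (simp add: \<Phi>_def)
      finally have "\<bar>integral\<^sup>L N (\<lambda>x. ?\<phi> x * \<eta> x) - \<eta>0 * \<Phi>\<bar> \<le> \<bar>\<eta>0\<bar> / 2 * \<Phi>" .
      moreover have "\<bar>\<eta>0 * \<Phi>\<bar> = \<bar>\<eta>0\<bar> * \<Phi>" using \<Phi>0 by (simp add: abs_mult)
      ultimately show ?thesis by linarith
    qed
    have "\<bar>\<eta>0\<bar> / 2 * \<Phi> * norm (?V $ i) \<le> \<bar>integral\<^sup>L N (\<lambda>x. ?\<phi> x * \<eta> x)\<bar> * norm (?V $ i)"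
      by (intro mult_right_mono low) simp
    also have "\<dots> = norm (integral\<^sup>L N (\<lambda>x. (?\<phi> x * \<eta> x) *\<^sub>R (?V $ i)))" using i\<phi>\<eta> by simp
    also have "(\<lambda>x. (?\<phi> x * \<eta> x) *\<^sub>R (?V $ i)) = (\<lambda>x. (?\<phi> x * \<eta> x) *\<^sub>R (tv x $ i)
        - (?\<phi> x * \<eta> x) *\<^sub>R ((tv x - g x) $ i) - (?\<phi> x * \<eta> x) *\<^sub>R ((g x - ?V) $ i))"
      by (simp add: fun_eq_iff algebra_simps)
    also have "integral\<^sup>L N \<dots> = integral\<^sup>L N (\<lambda>x. (?\<phi> x * \<eta> x) *\<^sub>R (tv x $ i))
        - integral\<^sup>L N (\<lambda>x. (?\<phi> x * \<eta> x) *\<^sub>R ((tv x - g x) $ i)) - integral\<^sup>L N (\<lambda>x. (?\<phi> x * \<eta> x) *\<^sub>R ((g x - ?V) $ i))"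
      by (simp only: Bochner_Integration.integral_diff[OF Bochner_Integration.integrable_diff[OF i1 i2] i3]
          Bochner_Integration.integral_diff[OF i1 i2])
    also have "norm \<dots> \<le> C2 * S * \<rho>\<^sup>2 + B * (2 * C1 c r0 * (3 * \<rho> / r0) * sqrt (3 * \<rho> / r0) * e) + B * (3 * L * \<rho>) * \<Phi>"
      by (intro norm_triangle_le_diff add_mono n1 n2 n3)
    also have "C2 * S * \<rho>\<^sup>2 = C2 / mass_const * S * (mass_const * \<rho>\<^sup>2)" using mp by simp
    \<comment> \<open>Since \<rho> sqrt \<rho> equals \<rho>^2 / sqrt \<rho>, comparing the trace
      error with the area produces the factor e / sqrt \<rho>.\<close>
    also have "B * (2 * C1 c r0 * (3 * \<rho> / r0) * sqrt (3 * \<rho> / r0) * e) = B * (2 * C1 c r0 * (3 / r0) * sqrt (3 / r0)) / mass_const * (e / sqrt \<rho>) * (mass_const * \<rho>\<^sup>2)"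
    proof -
      have "sqrt (3 * \<rho> / r0) = sqrt (3 / r0) * sqrt \<rho>" by (simp add: real_sqrt_mult[symmetric])
      moreover have "\<rho> * sqrt \<rho> = \<rho>\<^sup>2 / sqrt \<rho>" using \<rho> by (simp add: field_simps power2_eq_square)
      moreover have "b * (2 * t * (3 * r / s) * (q * z) * e) = b * (2 * t * (3 / s) * q) / n * (e / z) * (n * r\<^sup>2)"
        if "r * z = r\<^sup>2 / z" "n \<noteq> 0" for b t r s q z n e :: real
      proof -
        have "b * (2 * t * (3 * r / s) * (q * z) * e) = b * (2 * t * (3 / s) * q) * e * (r * z)" by simp
        then show ?thesis unfolding that(1) using that(2) by simp
      qed
      ultimately show ?thesis using mp by (simp only: less_irrefl not_False_eq_True simp_thms less_imp_neq[symmetric])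
    qed
    \<comment> \<open>The lower bound on the mass replaces
      \<open>mass_const * \<rho>\<^sup>2\<close> by \<open>\<Phi>\<close> in the first two terms, so
      that \<open>\<Phi>\<close> becomes a common factor of both sides and cancels.\<close>
    also have "C2 / mass_const * S * (mass_const * \<rho>\<^sup>2) + B * (2 * C1 c r0 * (3 / r0) * sqrt (3 / r0)) / mass_const * (e / sqrt \<rho>) * (mass_const * \<rho>\<^sup>2) + B * (3 * L * \<rho>) * \<Phi>
      \<le> C2 / mass_const * S * \<Phi> + B * (2 * C1 c r0 * (3 / r0) * sqrt (3 / r0)) / mass_const * (e / sqrt \<rho>) * \<Phi> + B * (3 * L * \<rho>) * \<Phi>"
      using a0 S0 e \<rho> by (intro add_mono mult_left_mono \<Phi>m mult_nonneg_nonneg order_refl) auto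
    also have "\<dots> = (C2 / mass_const * S + B * (2 * C1 c r0 * (3 / r0) * sqrt (3 / r0)) / mass_const * (e / sqrt \<rho>) + 3 * B * (L * \<rho>)) * \<Phi>"
      by (simp add: algebra_simps)
    also have "\<bar>\<eta>0\<bar> / 2 * \<Phi> * norm (?V $ i) = (\<bar>\<eta>0\<bar> / 2 * norm (?V $ i)) * \<Phi>" by simp
    finally have "\<bar>\<eta>0\<bar> / 2 * norm (?V $ i) \<le> C2 / mass_const * S + B * (2 * C1 c r0 * (3 / r0) * sqrt (3 / r0)) / mass_const * (e / sqrt \<rho>) + 3 * B * (L * \<rho>)"
      using \<Phi>0 by (simp only: mult_le_cancel_right_pos)
    also have "\<dots> \<le> (C2 / mass_const + B * (2 * C1 c r0 * (3 / r0) * sqrt (3 / r0)) / mass_const + 3 * B) * (S + L * \<rho> + e / sqrt \<rho>)"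
    proof -
      have "x * s + y * e' + z * l \<le> (x + y + z) * (s + l + e')" if "0 \<le> x" "0 \<le> y" "0 \<le> z" "0 \<le> s" "0 \<le> l" "0 \<le> e'" for x y z s l e' :: real
      proof -
        have "0 \<le> x * l" "0 \<le> x * e'" "0 \<le> y * s" "0 \<le> y * l" "0 \<le> z * s" "0 \<le> z * e'" using that by simp_all
        then show ?thesis by (simp add: algebra_simps)
      qed
      from this[OF a0(1,2,3) S0, of "L * \<rho>" "e / sqrt \<rho>"] show ?thesis using L(2) e \<rho> by (simp only: mult_nonneg_nonneg divide_nonneg_nonneg less_imp_le real_sqrt_ge_zero)
    qed
    finally have fin: "\<bar>\<eta>0\<bar> / 2 * norm (?V $ i) \<le> (C2 / mass_const + B * (2 * C1 c r0 * (3 / r0) * sqrt (3 / r0)) / mass_const + 3 * B) * (S + L * \<rho> + e / sqrt \<rho>)" .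
    have "norm (?V $ i) = 2 / \<bar>\<eta>0\<bar> * (\<bar>\<eta>0\<bar> / 2 * norm (?V $ i))" using \<eta>(2) by simp
    also have "\<dots> \<le> 2 / \<bar>\<eta>0\<bar> * ((C2 / mass_const + B * (2 * C1 c r0 * (3 / r0) * sqrt (3 / r0)) / mass_const + 3 * B) * (S + L * \<rho> + e / sqrt \<rho>))"
      by (intro mult_left_mono fin) simp
    also have "\<dots> = a * (S + L * \<rho> + e / sqrt \<rho>)" by (simp only: a_def mult.assoc)
    finally show ?thesis by (simp add: S_def)
  qed
  have "norm (g (p c)) \<le> 3 * a * (\<rho> powr \<alpha> + sqrt \<rho> + L * \<rho> + e / sqrt \<rho>)"
    if "0 < \<rho>" "\<rho> \<le> \<rho>0" "c1_on UNIV g Jg" "\<And>x. norm (g x - g (p c)) \<le> L * norm (x - p c)" "L \<ge> 0"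
      "H1_norm D (\<lambda>x. v x - g x) \<le> e" "e > 0" for \<rho> g Jg L e
  proof -
    have "norm (g (p c)) \<le> (\<Sum>i\<in>UNIV. norm (g (p c) $ i))"
      unfolding norm_vec_def by (rule L2_set_le_sum) simp
    also have "\<dots> \<le> (\<Sum>i\<in>(UNIV::3 set). a * (\<rho> powr \<alpha> + sqrt \<rho> + L * \<rho> + e / sqrt \<rho>))"
      by (intro sum_mono comp[OF that])
    finally show ?thesis by simp
  qed
  then show ?thesis using that[of "3 * a" \<rho>0] a \<rho>0(1) by simp
qed

end

end

text \<open>With \<open>j\<close> between \<sigma> powr (-1/\<gamma>) and twice that, the first term
  is at most sqrt \<sigma>, and the second at most a constant times \<sigma> powr (1 -
  \<beta>/\<gamma>), whose exponent is positive. As \<open>j\<close> tends to infinity when \<sigma>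
  tends to 0, \<open>W\<close> vanishes along it.\<close>

lemma approximation_limit:
  fixes F :: "real \<Rightarrow> real" and W :: "nat \<Rightarrow> real"
  assumes \<beta>: "0 < \<beta>" "\<beta> < \<gamma>" and W: "W \<longlonglongrightarrow> 0" and C: "C \<ge> 0"
    and F0: "\<And>\<sigma>. 0 < \<sigma> \<Longrightarrow> \<sigma> \<le> 1 \<Longrightarrow> 0 \<le> F \<sigma>"
    and F: "\<And>\<sigma> j. 0 < \<sigma> \<Longrightarrow> \<sigma> \<le> 1 \<Longrightarrow> j \<ge> 1 \<Longrightarrow> F \<sigma> \<le> C * (real j powr (-\<gamma>) / sqrt \<sigma> + real j powr \<beta> * \<sigma>) + W j"
  shows "(F \<longlongrightarrow> 0) (at_right 0)"
proof -
  \<comment> \<open>Rounding up makes \<open>j powr (-\<gamma>)\<close> at most \<sigma>, and since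
    \<sigma> powr (-1/\<gamma>) is at least 1, it costs at most a factor 2.\<close>
  define j where "j \<sigma> = nat \<lceil>\<sigma> powr (-1 / \<gamma>)\<rceil>" for \<sigma> :: real
  have \<gamma>: "\<gamma> > 0" using \<beta> by simp
  have j: "\<sigma> powr (-1 / \<gamma>) \<le> j \<sigma>" "real (j \<sigma>) \<le> 2 * \<sigma> powr (-1 / \<gamma>)" "j \<sigma> \<ge> 1" if "0 < \<sigma>" "\<sigma> \<le> 1" for \<sigma>
  proof -
    have "1 powr (-1 / \<gamma>) \<le> \<sigma> powr (-1 / \<gamma>)" using that \<gamma> by (intro powr_mono2') auto
    then have 1: "1 \<le> \<sigma> powr (-1 / \<gamma>)" by simp
    then have r: "real (j \<sigma>) = of_int \<lceil>\<sigma> powr (-1 / \<gamma>)\<rceil>" unfolding j_def by (intro of_nat_nat) linarith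
    show "\<sigma> powr (-1 / \<gamma>) \<le> j \<sigma>" unfolding r by (rule le_of_int_ceiling)
    then show "j \<sigma> \<ge> 1" using 1 by linarith
    show "real (j \<sigma>) \<le> 2 * \<sigma> powr (-1 / \<gamma>)" unfolding r using 1 by linarith
  qed
  have "filterlim (\<lambda>\<sigma>. real (j \<sigma>)) at_top (at_right 0)"
    unfolding filterlim_at_top
  proof
    fix Z :: real
    let ?Z = "max Z 1"
    have "Z \<le> real (j \<sigma>)" if \<sigma>: "0 < \<sigma>" "\<sigma> < min 1 (?Z powr (-\<gamma>))" for \<sigma>
    proof -
      have "?Z = (?Z powr (-\<gamma>)) powr (-1 / \<gamma>)" using \<gamma> by (simp add: powr_powr)
      also have "\<dots> \<le> \<sigma> powr (-1 / \<gamma>)" using \<sigma> \<gamma> by (intro powr_mono2') auto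
      also have "\<dots> \<le> j \<sigma>" using \<sigma> by (intro j) auto
      finally show ?thesis by simp
    qed
    moreover have "0 < min 1 (?Z powr (-\<gamma>))" by simp
    ultimately show "\<forall>\<^sub>F \<sigma> in at_right 0. Z \<le> real (j \<sigma>)" unfolding eventually_at_right_field by blast
  qed
  then have Wj: "((\<lambda>\<sigma>. W (j \<sigma>)) \<longlongrightarrow> 0) (at_right 0)"
    by (intro filterlim_compose[OF W]) (simp add: filterlim_sequentially_iff_filterlim_real)
  show ?thesis
  proof (rule tendsto_sandwich[OF _ _ tendsto_const])
    show "\<forall>\<^sub>F \<sigma> in at_right 0. 0 \<le> F \<sigma>"
      unfolding eventually_at_right_field using F0 by (intro exI[of _ 1]) auto
    show "\<forall>\<^sub>F \<sigma> in at_right 0. F \<sigma> \<le> C * (sqrt \<sigma> + 2 powr \<beta> * \<sigma> powr (1 - \<beta> / \<gamma>)) + W (j \<sigma>)"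
      unfolding eventually_at_right_field
    proof (intro exI[of _ 1] conjI allI impI)
      fix \<sigma> :: real assume "\<sigma> > 0" "\<sigma> < 1"
      then have \<sigma>: "0 < \<sigma>" "\<sigma> \<le> 1" by auto
      note j = j[OF \<sigma>]
      have "real (j \<sigma>) powr (-\<gamma>) \<le> (\<sigma> powr (-1 / \<gamma>)) powr (-\<gamma>)" using j \<gamma> \<sigma> by (intro powr_mono2') auto
      also have "\<dots> = \<sigma>" using \<gamma> \<sigma> by (simp add: powr_powr)
      finally have "real (j \<sigma>) powr (-\<gamma>) / sqrt \<sigma> \<le> \<sigma> / sqrt \<sigma>" using \<sigma> by (intro divide_right_mono) auto
      then have 1: "real (j \<sigma>) powr (-\<gamma>) / sqrt \<sigma> \<le> sqrt \<sigma>" using \<sigma> by (simp add: real_div_sqrt)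
      have "real (j \<sigma>) powr \<beta> \<le> (2 * \<sigma> powr (-1 / \<gamma>)) powr \<beta>" using j \<beta> by (intro powr_mono2) auto
      also have "\<dots> = 2 powr \<beta> * \<sigma> powr (- (\<beta> / \<gamma>))" by (simp add: powr_mult powr_powr)
      finally have "real (j \<sigma>) powr \<beta> * \<sigma> \<le> 2 powr \<beta> * \<sigma> powr (- (\<beta> / \<gamma>)) * \<sigma>" using \<sigma> by (intro mult_right_mono) auto
      also have "\<dots> = 2 powr \<beta> * (\<sigma> powr (- (\<beta> / \<gamma>)) * \<sigma> powr 1)" using \<sigma> by simp
      also have "\<dots> = 2 powr \<beta> * \<sigma> powr (1 - \<beta> / \<gamma>)" by (simp only: powr_add[symmetric]) simp
      finally have "C * (real (j \<sigma>) powr (-\<gamma>) / sqrt \<sigma> + real (j \<sigma>) powr \<beta> * \<sigma>) \<le> C * (sqrt \<sigma> + 2 powr \<beta> * \<sigma> powr (1 - \<beta> / \<gamma>))"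
        using 1 C by (intro mult_left_mono add_mono)
      with F[OF \<sigma> j(3)] show "F \<sigma> \<le> C * (sqrt \<sigma> + 2 powr \<beta> * \<sigma> powr (1 - \<beta> / \<gamma>)) + W (j \<sigma>)" by linarith
    qed simp
    have "((\<lambda>\<sigma>::real. \<sigma> powr (1 - \<beta> / \<gamma>)) \<longlongrightarrow> 0) (at_right 0)"
    proof (rule tendsto_zero_powrI)
      show "((\<lambda>\<sigma>::real. \<sigma>) \<longlongrightarrow> 0) (at_right 0)" by (rule tendsto_ident_at)
      show "((\<lambda>\<sigma>::real. 1 - \<beta> / \<gamma>) \<longlongrightarrow> 1 - \<beta> / \<gamma>) (at_right 0)" by simp
      show "0 < 1 - \<beta> / \<gamma>" using \<beta> \<gamma> by simp
      show "\<forall>\<^sub>F \<sigma>::real in at_right 0. 0 \<le> \<sigma>" unfolding eventually_at_right_field by (intro exI[of _ 1]) auto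
    qed
    moreover have "((\<lambda>\<sigma>::real. sqrt \<sigma>) \<longlongrightarrow> sqrt 0) (at_right 0)" by (intro tendsto_real_sqrt tendsto_ident_at)
    ultimately have "((\<lambda>\<sigma>. C * (sqrt \<sigma> + 2 powr \<beta> * \<sigma> powr (1 - \<beta> / \<gamma>)) + W (j \<sigma>)) \<longlongrightarrow> C * (sqrt 0 + 2 powr \<beta> * 0) + 0) (at_right 0)"
      using Wj by (intro tendsto_intros)
    then show "((\<lambda>\<sigma>. C * (sqrt \<sigma> + 2 powr \<beta> * \<sigma> powr (1 - \<beta> / \<gamma>)) + W (j \<sigma>)) \<longlongrightarrow> 0) (at_right 0)" by simp
  qed
qed

lemma holder_on_continuous:
  assumes "holder_on K \<alpha> f" "\<alpha> > 0"
  shows "continuous_on K f"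
  unfolding continuous_on_def
proof
  fix x assume x: "x \<in> K"
  obtain C where C: "\<And>x y. x \<in> K \<Longrightarrow> y \<in> K \<Longrightarrow> norm (f x - f y) \<le> C * dist x y powr \<alpha>"
    using assms(1) by (auto simp: holder_on_def)
  have "((\<lambda>y. f y - f x) \<longlongrightarrow> 0) (at x within K)"
  proof (rule Lim_null_comparison)
    show "\<forall>\<^sub>F y in at x within K. norm (f y - f x) \<le> C * dist y x powr \<alpha>"
      unfolding eventually_at_filter using C x by (intro always_eventually) auto
    have "((\<lambda>y. dist y x powr \<alpha>) \<longlongrightarrow> 0) (at x within K)"
    proof (rule tendsto_zero_powrI[OF _ tendsto_const _ assms(2)])
      have "((\<lambda>y. dist y x) \<longlongrightarrow> dist x x) (at x within K)" by (intro tendsto_intros)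
      then show "((\<lambda>y. dist y x) \<longlongrightarrow> 0) (at x within K)" by simp
    qed simp
    then have "((\<lambda>y. C * dist y x powr \<alpha>) \<longlongrightarrow> C * 0) (at x within K)" by (intro tendsto_intros)
    then show "((\<lambda>y. C * dist y x powr \<alpha>) \<longlongrightarrow> 0) (at x within K)" by simp
  qed
  then show "(f \<longlongrightarrow> f x) (at x within K)" by (simp add: LIM_zero_iff)
qed

text \<open>This converts a derivative given as a bounded linear map, as in
  \<open>C1_holder_on\<close>, to the matrix convention of \<open>weak_gradient\<close>.\<close>

definition jacobian :: "((real^3) \<Rightarrow>\<^sub>L (complex^3)) \<Rightarrow> complex^3^3" where
  "jacobian G = (\<chi> i j. blinfun_apply G (axis j 1) $ i)"

lemma column_jacobian: "column j (jacobian G) = blinfun_apply G (axis j 1)"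
  by (simp add: jacobian_def column_def vec_eq_iff)

lemma jacobian_apply: "(\<Sum>j\<in>UNIV. e $ j *\<^sub>R column j (jacobian G)) = blinfun_apply G e"
proof -
  have "e = (\<Sum>j\<in>UNIV. e $ j *\<^sub>R axis j 1)"
    using basis_expansion[of e] by (simp add: scalar_mult_eq_scaleR)
  then have "blinfun_apply G e = blinfun_apply G (\<Sum>j\<in>UNIV. e $ j *\<^sub>R axis j 1)" by simp
  then show ?thesis by (simp add: blinfun.sum_right blinfun.scaleR_right column_jacobian)
qed

lemma norm_jacobian: "norm (jacobian G) \<le> 9 * norm G"
proof -
  have "norm (jacobian G) \<le> (\<Sum>i\<in>UNIV. norm (jacobian G $ i))"
    unfolding norm_vec_def[of "jacobian G"] by (rule L2_set_le_sum) simp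
  also have "\<dots> \<le> (\<Sum>i\<in>(UNIV::3 set). 3 * norm G)"
  proof (rule sum_mono)
    fix i :: 3
    have "norm (jacobian G $ i) \<le> (\<Sum>j\<in>UNIV. norm (jacobian G $ i $ j))"
      unfolding norm_vec_def[of "jacobian G $ i"] by (rule L2_set_le_sum) simp
    also have "\<dots> \<le> (\<Sum>j\<in>(UNIV::3 set). norm G)"
    proof (rule sum_mono)
      fix j :: 3
      have "norm (jacobian G $ i $ j) \<le> norm (blinfun_apply G (axis j 1))"
        by (simp add: jacobian_def Finite_Cartesian_Product.norm_nth_le)
      also have "\<dots> \<le> norm G * norm (axis j (1::real) :: real^3)" by (rule norm_blinfun)
      finally show "norm (jacobian G $ i $ j) \<le> norm G" by simp
    qed
    finally show "norm (jacobian G $ i) \<le> 3 * norm G" by simp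
  qed
  finally show ?thesis by simp
qed

lemma continuous_on_jacobian: "continuous_on S G \<Longrightarrow> continuous_on S (\<lambda>x. jacobian (G x))"
  unfolding jacobian_def
  by (intro continuous_on_vec_lambda continuous_on_component blinfun.continuous_on continuous_on_const)

section \<open>Averages over small neighbourhoods of an edge point\<close>

context edge
begin

context
  fixes c r0 :: real
  assumes r0: "0 < r0" "r0 \<le> h" "r0 \<le> M - \<bar>c\<bar>"
begin

lemma measure_nbhd_pos: "measure lebesgue (nbhd c r0) > 0"
proof -
  define t where "t = r0 / 4"
  have t: "0 < t" "4 * t = r0" using r0 by (simp_all add: t_def)
  have "coord \<theta>m 1 t c (\<kappa> * t / 2) \<in> nbhd c r0"
  proof -
    have k: "0 < \<kappa> * t" "\<kappa> * t \<le> 1 * t" using \<kappa> t by (auto intro!: mult_right_mono)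
    have lt: "t + \<kappa> * t / 2 < h" using k r0 t by linarith
    have "(t + \<kappa> * t / 2)\<^sup>2 < h\<^sup>2" by (rule power_strict_mono[OF lt]) (use k t in auto)
    moreover have "t\<^sup>2 + (\<kappa> * t / 2)\<^sup>2 \<le> (t + \<kappa> * t / 2)\<^sup>2" using k r0 t by (intro sum_squares_le_square_sum) auto
    ultimately have 1: "coord \<theta>m 1 t c (\<kappa> * t / 2) \<in> D" by (intro coord_in_D) ((use k r0 t in linarith) | simp)+
    have p: "p c = coord \<theta>m 1 0 c 0" by (simp add: coord_eq)
    have "norm (p c - coord \<theta>m 1 t c (\<kappa> * t / 2)) \<le> \<bar>0 - t\<bar> + \<bar>0 - \<kappa> * t / 2\<bar> + \<bar>c - c\<bar>"
      unfolding p coord_diff by (rule norm_coord_le) simp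
    also have "\<dots> < r0" using k r0 t by linarith
    finally show ?thesis using 1 by (simp add: nbhd_def[OF r0] dist_norm)
  qed
  then have "\<not> negligible (nbhd c r0)" using open_not_negligible[OF open_nbhd[OF r0]] by blast
  moreover have "nbhd c r0 \<in> lmeasurable"
    by (rule bounded_set_imp_lmeasurable[OF bounded_nbhd[OF r0] nbhd_lebesgue[OF r0]])
  ultimately have "measure lebesgue (nbhd c r0) \<noteq> 0" by (auto simp: negligible_iff_measure)
  then show ?thesis using measure_nonneg[of lebesgue "nbhd c r0"] by linarith
qed

text \<open>The integral of \<open>norm (v x - g x)\<close> is of order \<sigma>^(5/2) times
  \<open>e\<close> and the volume of order \<sigma>^3, hence the quotient e / sqrt \<sigma>. The
  remaining terms bound \<open>g\<close> pointwise by its value at the edge point and its Lipschitz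
  constant.\<close>

lemma average_estimate:
  assumes v: "H1 \<Omega> v" "is_trace \<Omega> v tv" and \<sigma>: "0 < \<sigma>" "\<sigma> \<le> 1"
    and g: "c1_on UNIV g Jg" and L: "\<And>x. norm (g x - g (p c)) \<le> L * norm (x - p c)" "L \<ge> 0"
    and e: "H1_norm D (\<lambda>x. v x - g x) \<le> e" "e > 0"
  shows "integral\<^sup>L (lebesgue_on (nbhd c (\<sigma> * r0))) (\<lambda>x. norm (v x)) / measure lebesgue (nbhd c (\<sigma> * r0)) \<le>
    2 * m0 c r0 * (1 + 6 * r0) / measure lebesgue (nbhd c r0) * (e / sqrt \<sigma>) + norm (g (p c)) + L * (\<sigma> * r0)"
proof -
  let ?U = "nbhd c (\<sigma> * r0)" and ?B = "norm (g (p c)) + L * (\<sigma> * r0)" and ?u = "measure lebesgue (nbhd c r0)"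
  have UL: "?U \<in> sets lebesgue" by (rule nbhd_lebesgue[OF r0])
  have finU: "finite_measure (lebesgue_on ?U)" by (rule finite_measure_bounded[OF bounded_nbhd[OF r0] UL])
  interpret U: finite_measure "lebesgue_on ?U" by (rule finU)
  have sub: "?U \<subseteq> \<Omega>" using nbhd_subset[OF r0] D_subset by blast
  have iv: "integrable (lebesgue_on ?U) v"
    by (rule L2_integrable[OF finU L2_lebesgue_on_subset[OF H1_wgrad(1)[OF \<Omega> v(1)] sub UL open_sets_lebesgue[OF \<Omega>(1)]]])
  have ig: "integrable (lebesgue_on ?U) g"
    by (rule L2_integrable[OF finU L2_c1_UNIV(1)[OF open_nbhd[OF r0] bounded_nbhd[OF r0] g]])
  have ivg: "integrable (lebesgue_on ?U) (\<lambda>x. norm (v x - g x))" using iv ig by simp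
  have "integral\<^sup>L (lebesgue_on ?U) (\<lambda>x. norm (v x)) \<le> integral\<^sup>L (lebesgue_on ?U) (\<lambda>x. norm (v x - g x) + ?B)"
  proof (rule integral_mono)
    fix x assume "x \<in> space (lebesgue_on ?U)"
    then have "x \<in> ?U" by simp
    then have "norm (x - p c) \<le> \<sigma> * r0" by (auto simp: nbhd_def[OF r0] dist_norm norm_minus_commute)
    then have "norm (g x - g (p c)) \<le> L * (\<sigma> * r0)" using L(1)[of x] L(2) by (meson mult_left_mono order_trans)
    moreover have "norm (v x) \<le> norm (v x - g x) + (norm (g x - g (p c)) + norm (g (p c)))"
      using norm_triangle_ineq[of "v x - g x" "g x"] norm_triangle_ineq[of "g x - g (p c)" "g (p c)"] by simp
    ultimately show "norm (v x) \<le> norm (v x - g x) + ?B" by linarith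
  qed (use iv ivg in auto)
  also have "\<dots> = integral\<^sup>L (lebesgue_on ?U) (\<lambda>x. norm (v x - g x)) + ?B * measure lebesgue ?U"
    using ivg UL by (simp add: measure_restrict_space)
  also have "integral\<^sup>L (lebesgue_on ?U) (\<lambda>x. norm (v x - g x)) \<le> 2 * m0 c r0 * (1 + 6 * r0) * \<sigma>\<^sup>2 * sqrt \<sigma> * e"
    by (rule approximation(1)[OF r0 v g e \<sigma>])
  also have "2 * m0 c r0 * (1 + 6 * r0) * \<sigma>\<^sup>2 * sqrt \<sigma> * e = 2 * m0 c r0 * (1 + 6 * r0) / ?u * (e / sqrt \<sigma>) * measure lebesgue ?U"
  proof -
    have "sqrt \<sigma> * \<sigma>\<^sup>2 = \<sigma> ^ 3 / sqrt \<sigma>" using \<sigma> by (simp add: field_simps power2_eq_square power3_eq_cube)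
    moreover have "Q * s2 * s * e = Q / u * (e / s) * (s3 * u)" if "s * s2 = s3 / s" "u \<noteq> 0" for Q s2 s s3 u :: real
    proof -
      have "Q * s2 * s * e = Q * e * (s * s2)" by simp
      then show ?thesis unfolding that(1) using that(2) by simp
    qed
    ultimately show ?thesis unfolding measure_nbhd[OF r0 \<sigma>]
      using measure_nbhd_pos by (simp only: less_imp_neq[symmetric] not_False_eq_True)
  qed
  finally have "integral\<^sup>L (lebesgue_on ?U) (\<lambda>x. norm (v x)) \<le>
      (2 * m0 c r0 * (1 + 6 * r0) / ?u * (e / sqrt \<sigma>) + ?B) * measure lebesgue ?U" by (simp only: distrib_right)
  moreover have "measure lebesgue ?U > 0" unfolding measure_nbhd[OF r0 \<sigma>] using measure_nbhd_pos \<sigma> by simp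
  ultimately have "integral\<^sup>L (lebesgue_on ?U) (\<lambda>x. norm (v x)) / measure lebesgue ?U \<le>
      2 * m0 c r0 * (1 + 6 * r0) / ?u * (e / sqrt \<sigma>) + ?B" by (simp only: pos_divide_le_eq)
  then show ?thesis by (simp only: add.assoc)
qed

text \<open>Hypothesis \<open>C\<close> is used with one scale for each \<open>j\<close>, to show
  that \<open>g j\<close> tends to zero at the edge point; \<open>average_estimate\<close> is then
  used for all \<open>j\<close> at every scale. The two scales are chosen independently.\<close>

lemma average_vanishes:
  assumes v: "H1 \<Omega> v" "is_trace \<Omega> v tv" and \<alpha>: "\<alpha> > 0" and \<beta>: "0 < \<beta>" "\<beta> < \<gamma>" and A: "A \<ge> 0"
    and C: "C \<ge> 0" "\<rho>0 > 0"
      "\<And>\<rho> g Jg L e. 0 < \<rho> \<Longrightarrow> \<rho> \<le> \<rho>0 \<Longrightarrow> c1_on UNIV g Jg \<Longrightarrow> (\<And>x. norm (g x - g (p c)) \<le> L * norm (x - p c)) \<Longrightarrow> L \<ge> 0 \<Longrightarrow>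
         H1_norm D (\<lambda>x. v x - g x) \<le> e \<Longrightarrow> e > 0 \<Longrightarrow> norm (g (p c)) \<le> C * (\<rho> powr \<alpha> + sqrt \<rho> + L * \<rho> + e / sqrt \<rho>)"
    and g: "\<And>j. j \<ge> 1 \<Longrightarrow> c1_on UNIV (g j) (Jg j)" "\<And>j x y. j \<ge> 1 \<Longrightarrow> norm (g j x - g j y) \<le> A * real j powr \<beta> * norm (x - y)"
      "\<And>j. j \<ge> 1 \<Longrightarrow> H1_norm D (\<lambda>x. v x - g j x) \<le> real j powr (-\<gamma>)"
  shows "((\<lambda>\<sigma>. integral\<^sup>L (lebesgue_on (nbhd c (\<sigma> * r0))) (\<lambda>x. norm (v x)) / measure lebesgue (nbhd c (\<sigma> * r0))) \<longlongrightarrow> 0) (at_right 0)"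
proof -
  have \<gamma>: "\<gamma> > 0" using \<beta> by simp
  have gp: "(\<lambda>j. norm (g j (p c))) \<longlonglongrightarrow> 0"
  proof (rule tendsto_sandwich[OF _ _ tendsto_const])
    have neg: "(\<lambda>j. real j powr s) \<longlonglongrightarrow> 0" if "s < 0" for s
      using that by (intro tendsto_neg_powr filterlim_real_sequentially)
    \<comment> \<open>The value estimate is available only up to scale \<open>\<rho>0\<close>, so
      finitely many \<open>j\<close> are dropped.\<close>
    have "\<forall>\<^sub>F j in sequentially. real j powr (-\<gamma>) < \<rho>0"
      using order_tendstoD(2)[OF neg[of "-\<gamma>"] C(2)] \<gamma> by simp
    moreover have "\<forall>\<^sub>F j in sequentially. 1 \<le> j" by (rule eventually_ge_at_top)
    ultimately show "\<forall>\<^sub>F j in sequentially. norm (g j (p c)) \<le>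
        C * (real j powr (-\<gamma> * \<alpha>) + real j powr (-\<gamma> / 2) + A * real j powr (\<beta> - \<gamma>) + real j powr (-\<gamma> / 2))"
    proof eventually_elim
      case (elim j)
      let ?\<rho> = "real j powr (-\<gamma>)"
      have j: "real j > 0" using elim by simp
      have s: "sqrt ?\<rho> = real j powr (-\<gamma> / 2)" using j by (simp add: powr_half_sqrt[symmetric] powr_powr)
      have "?\<rho> = sqrt ?\<rho> * sqrt ?\<rho>" by simp
      then have d: "?\<rho> / sqrt ?\<rho> = sqrt ?\<rho>" using j by (simp add: real_div_sqrt)
      have "norm (g j (p c)) \<le> C * (?\<rho> powr \<alpha> + sqrt ?\<rho> + A * real j powr \<beta> * ?\<rho> + ?\<rho> / sqrt ?\<rho>)"
        using j elim A by (intro C(3)[OF _ _ g(1) g(2) _ g(3)]) auto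
      moreover have "A * real j powr \<beta> * ?\<rho> = A * real j powr (\<beta> - \<gamma>)" by (simp add: powr_add[symmetric] mult.assoc)
      ultimately show ?case unfolding d unfolding s by (simp add: powr_powr)
    qed
    have "(\<lambda>j. C * (real j powr (-\<gamma> * \<alpha>) + real j powr (-\<gamma> / 2) + A * real j powr (\<beta> - \<gamma>) + real j powr (-\<gamma> / 2)))
        \<longlonglongrightarrow> C * (0 + 0 + A * 0 + 0)"
      using \<gamma> \<alpha> \<beta> by (intro tendsto_intros neg) auto
    then show "(\<lambda>j. C * (real j powr (-\<gamma> * \<alpha>) + real j powr (-\<gamma> / 2) + A * real j powr (\<beta> - \<gamma>) + real j powr (-\<gamma> / 2))) \<longlonglongrightarrow> 0"
      by simp
  qed simp
  define B where "B = 2 * m0 c r0 * (1 + 6 * r0) / measure lebesgue (nbhd c r0)"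
  have B: "B \<ge> 0" using r0 by (simp add: B_def)
  show ?thesis
  proof (rule approximation_limit[OF \<beta> gp, of "B + A * r0"])
    show "0 \<le> B + A * r0" using A B r0 by simp
    fix \<sigma> :: real and j :: nat assume \<sigma>: "0 < \<sigma>" "\<sigma> \<le> 1" and j: "j \<ge> 1"
    have Aj: "0 \<le> A * real j powr \<beta>" and jp: "0 < real j powr (-\<gamma>)" using A j by auto
    have "integral\<^sup>L (lebesgue_on (nbhd c (\<sigma> * r0))) (\<lambda>x. norm (v x)) / measure lebesgue (nbhd c (\<sigma> * r0)) \<le>
        B * (real j powr (-\<gamma>) / sqrt \<sigma>) + norm (g j (p c)) + A * real j powr \<beta> * (\<sigma> * r0)"
      unfolding B_def by (rule average_estimate[OF v \<sigma> g(1)[OF j] g(2)[OF j] Aj g(3)[OF j] jp])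
    moreover have "B * x + A * y * (\<sigma> * r0) \<le> (B + A * r0) * (x + y * \<sigma>)" if "0 \<le> x" "0 \<le> y" for x y
    proof -
      have "0 \<le> B * (y * \<sigma>)" "0 \<le> A * r0 * x" using A B r0 \<sigma> that by simp_all
      then show ?thesis by (simp add: algebra_simps)
    qed
    from this[of "real j powr (-\<gamma>) / sqrt \<sigma>" "real j powr \<beta>"]
    have "B * (real j powr (-\<gamma>) / sqrt \<sigma>) + A * real j powr \<beta> * (\<sigma> * r0) \<le> (B + A * r0) * (real j powr (-\<gamma>) / sqrt \<sigma> + real j powr \<beta> * \<sigma>)"
      using \<sigma> by simp
    ultimately show "integral\<^sup>L (lebesgue_on (nbhd c (\<sigma> * r0))) (\<lambda>x. norm (v x)) / measure lebesgue (nbhd c (\<sigma> * r0)) \<le>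
        (B + A * r0) * (real j powr (-\<gamma>) / sqrt \<sigma> + real j powr \<beta> * \<sigma>) + norm (g j (p c))" by linarith
  qed (auto intro!: divide_nonneg_nonneg integral_nonneg_AE)
qed

end

end

section \<open>The degenerate case, and the boundary coefficient near the edge\<close>

context wedge
begin

lemma ball_near_edge:
  assumes "r \<le> h" "r \<le> M - \<bar>c\<bar>"
  shows "ball (vector [0, 0, c]) r \<inter> \<Omega> = D \<inter> ball (vector [0, 0, c]) r"
  using \<Omega>_near_edge[OF _ assms] by (auto simp: dist_norm norm_minus_commute)

text \<open>Intended for the case of a vanishing surface measure: a zero norm makes \<open>v\<close>
  vanish almost everywhere in \<open>D\<close>, and small balls about the edge point meet \<Omega>
  only inside \<open>D\<close>.\<close>

lemma average_vanishes_of_norm_zero: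
  assumes v: "H1 D v" "H1_norm D v = 0" and c: "\<bar>c\<bar> < M"
  shows "((\<lambda>\<rho>. integral\<^sup>L (lebesgue_on (ball (vector [0, 0, c]) \<rho> \<inter> \<Omega>)) (\<lambda>x. norm (v x))
          / measure lebesgue (ball (vector [0, 0, c]) \<rho> \<inter> \<Omega>)) \<longlongrightarrow> 0) (at_right 0)"
proof (rule tendsto_eventually)
  let ?p = "vector [0, 0, c] :: real^3"
  have DL: "D \<in> sets lebesgue" using open_D by (rule open_sets_lebesgue)
  have L2v: "L2 (lebesgue_on D) v" using v(1) by (simp add: H1_def)
  have "(L2_norm (lebesgue_on D) v)\<^sup>2 = 0"
    using H1_norm_sq[OF open_D bounded_D, of v] v(2) zero_le_power2[of "L2_norm (lebesgue_on D) v"]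
      zero_le_power2[of "L2_norm (lebesgue_on D) (wgrad D v)"] by (simp add: add_nonneg_eq_0_iff)
  then have "integral\<^sup>L (lebesgue_on D) (\<lambda>x. (norm (v x))\<^sup>2) = 0" by (simp add: L2_norm_def)
  then have "AE x in lebesgue_on D. v x = 0"
    using L2v by (subst (asm) integral_nonneg_eq_0_iff_AE) (auto simp: L2_def)
  then have AE: "AE x in lebesgue. x \<in> D \<longrightarrow> v x = 0" using DL by (simp add: AE_restrict_space_iff)
  have "integral\<^sup>L (lebesgue_on (ball ?p \<rho> \<inter> \<Omega>)) (\<lambda>x. norm (v x)) = 0" if \<rho>: "\<rho> < min h (M - \<bar>c\<bar>)" for \<rho>
  proof -
    have eq: "ball ?p \<rho> \<inter> \<Omega> = D \<inter> ball ?p \<rho>" using \<rho> by (intro ball_near_edge) auto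
    have "open (D \<inter> ball ?p \<rho>)" using open_D by auto
    then have "D \<inter> ball ?p \<rho> \<in> sets lebesgue" by (rule open_sets_lebesgue)
    then have "AE x in lebesgue_on (D \<inter> ball ?p \<rho>). norm (v x) = 0"
      using AE by (auto simp: AE_restrict_space_iff elim!: eventually_mono)
    then show ?thesis unfolding eq by (rule integral_eq_zero_AE)
  qed
  then show "\<forall>\<^sub>F \<rho> in at_right 0. integral\<^sup>L (lebesgue_on (ball ?p \<rho> \<inter> \<Omega>)) (\<lambda>x. norm (v x)) / measure lebesgue (ball ?p \<rho> \<inter> \<Omega>) = 0"
    unfolding eventually_at_right_field using hM c by (intro exI[of _ "min h (M - \<bar>c\<bar>)"]) auto
qed

text \<open>The origin lies on the edge, not on the open ray, and is reached as a limit along the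
  face. This gives \<open>\<eta> 0\<close> its meaning as the value to which the Hoelder bound on
  the closed face refers.\<close>

lemma zero_in_closed_face: "0 \<in> cyl (closure (ray \<theta>m h)) {-M..M}"
proof -
  have "proj12 (coord \<theta>m 1 0 0 0) \<in> closure (ray \<theta>m h)"
  proof (rule Lim_in_closed_set[of _ "\<lambda>t. proj12 (coord \<theta>m 1 t 0 0)" "at_right 0"])
    show "\<forall>\<^sub>F t in at_right 0. proj12 (coord \<theta>m 1 t 0 0) \<in> closure (ray \<theta>m h)"
      unfolding eventually_at_right_field
    proof (intro exI[of _ h] conjI allI impI)
      fix t :: real assume "t > 0" "t < h"
      then have "coord \<theta>m 1 t 0 0 \<in> face \<theta>m" using hM by (intro coord_in_face) auto
      then show "proj12 (coord \<theta>m 1 t 0 0) \<in> closure (ray \<theta>m h)" using closure_subset by (auto simp: cyl_def)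
    qed (rule hM(1))
    have "continuous_on UNIV (\<lambda>t. proj12 (coord \<theta>m 1 t 0 0))"
      by (intro continuous_on_compose2[OF continuous_on_proj12] continuous_intros) auto
    then show "((\<lambda>t. proj12 (coord \<theta>m 1 t 0 0)) \<longlongrightarrow> proj12 (coord \<theta>m 1 0 0 0)) (at_right 0)"
      by (auto simp: continuous_on_def intro: tendsto_mono[OF at_le])
  qed auto
  moreover have "coord \<theta>m 1 0 0 0 = 0" by (simp add: vec_eq_iff forall_3)
  ultimately show ?thesis using hM by (simp add: cyl_def)
qed

text \<open>Because \<eta> does not change with height, \<open>x\<close> may be moved along the edge
  direction to height 0. Its distance to the origin is then the horizontal one, which is at most the
  distance from \<open>x\<close> to any edge point.\<close>

lemma face_holder_estimate:
  assumes \<eta>: "\<And>x y. x \<in> cyl (closure (ray \<theta>m h)) {-M..M} \<Longrightarrow> y \<in> cyl (closure (ray \<theta>m h)) {-M..M} \<Longrightarrow> \<bar>\<eta> x - \<eta> y\<bar> \<le> C * dist x y powr \<alpha>"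
    and indep: "\<And>x y. x \<in> face \<theta>m \<Longrightarrow> y \<in> face \<theta>m \<Longrightarrow> proj12 x = proj12 y \<Longrightarrow> \<eta> x = \<eta> y"
    and \<alpha>: "\<alpha> > 0" and x: "x \<in> face \<theta>m"
  shows "\<bar>\<eta> x - \<eta> 0\<bar> \<le> \<bar>C\<bar> * dist x (vector [0, 0, c]) powr \<alpha>"
proof -
  define y :: "real^3" where "y = vector [x$1, x$2, 0]"
  have py: "proj12 y = proj12 x" by (simp add: y_def vec_eq_iff forall_2)
  have y: "y \<in> face \<theta>m" using x py hM by (simp add: cyl_def) (simp add: y_def)
  then have yc: "y \<in> cyl (closure (ray \<theta>m h)) {-M..M}" using closure_subset by (auto simp: cyl_def)
  have "\<eta> x = \<eta> y" using indep[OF x y] py by simp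
  then have "\<bar>\<eta> x - \<eta> 0\<bar> \<le> C * dist y 0 powr \<alpha>" using \<eta>[OF yc zero_in_closed_face] by simp
  also have "\<dots> \<le> \<bar>C\<bar> * dist x (vector [0, 0, c]) powr \<alpha>"
  proof (intro mult_mono powr_mono2)
    have "norm y \<le> norm (x - vector [0, 0, c])"
    proof (rule power2_le_imp_le)
      show "(norm y)\<^sup>2 \<le> (norm (x - vector [0, 0, c]))\<^sup>2"
        unfolding norm_vec3 by (simp add: y_def)
    qed simp
    then show "dist y 0 \<le> dist x (vector [0, 0, c])" by (simp add: dist_norm)
  qed (use \<alpha> in auto)
  finally show ?thesis .
qed

end

section \<open>Assembly when the surface measure does not degenerate\<close>

context edge
begin

lemma average_tends_to_zero:
  fixes V \<eta> :: "real^3 \<Rightarrow> real" and v w :: "real^3 \<Rightarrow> complex^3"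
    and gp gs :: "nat \<Rightarrow> real^3 \<Rightarrow> complex^3"
  assumes V: "L_infty (lebesgue_on \<Omega>) V" and \<eta>: "L_infty N \<eta>"
    and \<Gamma>: "openin (top_of_set (frontier \<Omega>)) \<Gamma>" "face \<theta>m \<union> face \<theta>M \<subseteq> \<Gamma>"
    and eigen: "transmission_eigenfunctions la mu \<omega> \<Omega> \<Gamma> V \<eta> v w"
    and \<alpha>: "0 < \<alpha>"
    and qw: "holder_on K \<alpha> fq" "AE x in lebesgue_on D. (1 + V x) *\<^sub>R w x = fq x"
    and vw: "C1_holder_on K \<alpha> f" "AE x in lebesgue_on D. v x - w x = f x"
    and \<eta>_holder: "holder_on (cyl (closure (ray \<theta>m h)) {-M..M}) \<alpha> \<eta>"
    and rates: "\<gamma> > max \<beta>1 \<beta>2" "max \<beta>1 \<beta>2 > 0"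
    and kernels: "\<And>j. j \<ge> 1 \<Longrightarrow> L2 (surface_on (sphere 0 1)) (gp j)"
      "\<And>j. j \<ge> 1 \<Longrightarrow> L2 (surface_on (sphere 0 1)) (gs j)"
    and approx: "\<And>j. j \<ge> 1 \<Longrightarrow> H1_norm D (\<lambda>x. v x - herglotz kp ks (gp j) (gs j) x) \<le> real j powr (-\<gamma>)"
      "\<And>j. j \<ge> 1 \<Longrightarrow> L2_norm (surface_on (sphere 0 1)) (gp j) \<le> real j powr \<beta>1"
      "\<And>j. j \<ge> 1 \<Longrightarrow> L2_norm (surface_on (sphere 0 1)) (gs j) \<le> real j powr \<beta>2"
    and \<eta>_indep: "\<And>x y. x \<in> face \<theta>m \<Longrightarrow> y \<in> face \<theta>m \<Longrightarrow> proj12 x = proj12 y \<Longrightarrow> \<eta> x = \<eta> y"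
    and \<eta>_nonzero: "\<eta> 0 \<noteq> 0"
    and not_flat: "\<theta>M - \<theta>m \<noteq> pi" and c: "\<bar>c\<bar> < M"
  shows "((\<lambda>\<rho>. integral\<^sup>L (lebesgue_on (ball (vector [0, 0, c]) \<rho> \<inter> \<Omega>)) (\<lambda>x. norm (v x))
          / measure lebesgue (ball (vector [0, 0, c]) \<rho> \<inter> \<Omega>)) \<longlongrightarrow> 0) (at_right 0)"
proof -
  \<comment> \<open>Within this distance of the edge point, \<Omega> is a cone with vertex
    there.\<close>
  define r0 where "r0 = min h (M - \<bar>c\<bar>)"
  have r0: "0 < r0" "r0 \<le> h" "r0 \<le> M - \<bar>c\<bar>" using hM c by (auto simp: r0_def)
  obtain tv tw where H1: "H1 \<Omega> v" "H1 \<Omega> w" and tr: "is_trace \<Omega> v tv" "is_trace \<Omega> w tw"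
    and twtv: "AE x in surface_on \<Gamma>. tw x = tv x"
    and traction: "\<And>\<psi>. test_fun (\<Gamma> \<union> - frontier \<Omega>) \<psi> \<Longrightarrow>
           traction_pairing la mu \<Omega> v (\<lambda>x. - (\<omega>\<^sup>2 *\<^sub>R v x)) \<psi> + integral\<^sup>L N (\<lambda>x. cdot (\<eta> x *\<^sub>R tv x) (\<psi> x))
           = traction_pairing la mu \<Omega> w (\<lambda>x. - ((\<omega>\<^sup>2 * (1 + V x)) *\<^sub>R w x)) \<psi>"
    using eigen unfolding transmission_eigenfunctions_def by blast
  have \<Gamma>f: "\<Gamma> \<subseteq> frontier \<Omega>" "\<Gamma> \<in> sets borel"
    using \<Gamma>(1) by (auto simp: openin_open)
  have DL: "D \<in> sets lebesgue" using open_D by (rule open_sets_lebesgue)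
  have bK: "bounded (u ` D)" if "continuous_on K u" for u :: "real^3 \<Rightarrow> 'b::metric_space"
    by (rule bounded_subset[OF compact_imp_bounded[OF compact_continuous_image[OF that compact_K]] image_mono[OF D_subset_K(1)]])
  obtain G where f: "continuous_on K f" and G: "holder_on K \<alpha> G"
    and df: "\<And>x. x \<in> interior K \<Longrightarrow> (f has_derivative blinfun_apply (G x)) (at x)"
    using vw(1) unfolding C1_holder_on_def by blast
  obtain CG where CG: "\<And>x y. x \<in> K \<Longrightarrow> y \<in> K \<Longrightarrow> norm (G x - G y) \<le> CG * dist x y powr \<alpha>"
    using G by (auto simp: holder_on_def)
  let ?J = "\<lambda>x. jacobian (G x)"
  have cJ: "continuous_on K ?J" by (rule continuous_on_jacobian[OF holder_on_continuous[OF G \<alpha>]])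
  have dD: "(f has_derivative blinfun_apply (G x)) (at x)" if "x \<in> D" for x
    using df that D_subset_K(2) by blast
  have c1: "c1_on D f ?J"
    unfolding c1_on_def jacobian_apply using dD continuous_on_subset[OF cJ D_subset_K(1)] by blast
  have L2f: "L2 (lebesgue_on D) f" and L2J: "L2 (lebesgue_on D) ?J"
    using bK[OF f] bK[OF cJ] continuous_on_subset[OF _ D_subset_K(1)] f cJ
    by (auto intro!: L2_continuous_bounded[OF DL bounded_D])
  have f0: "f (coord \<theta> \<epsilon> t z 0) = 0"
    if "\<epsilon> = 1 \<and> \<theta> = \<theta>m \<or> \<epsilon> = -1 \<and> \<theta> = \<theta>M" "0 < t" "t < h" "\<bar>z\<bar> < M" for \<epsilon> \<theta> t z
  proof (rule trace_difference_vanishes[OF H1 tr \<Gamma>f twtv that(1) _ c1 L2f L2J f vw(2) that(2-4)])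
    show "face \<theta> \<subseteq> \<Gamma>" using that(1) \<Gamma>(2) by auto
  qed
  \<comment> \<open>The opening angle lies strictly between 0 and 2 pi and differs from pi, so its
    sine is positive for a convex wedge and negative for a reentrant one.\<close>
  have nz: "sin (\<theta>M - \<theta>m) \<noteq> 0"
  proof (cases "\<theta>M - \<theta>m < pi")
    case True
    then have "sin (\<theta>M - \<theta>m) > 0" using angles by (intro sin_gt_zero) auto
    then show ?thesis by simp
  next
    case False
    then have "sin (\<theta>M - \<theta>m) < 0" using angles not_flat by (intro sin_lt_zero) auto
    then show ?thesis by simp
  qed
  have Gp: "G (p c) = 0" by (rule gradient_vanishes_at_edge[OF nz c \<alpha> f CG dD f0])
  have pK: "p c \<in> K"
  proof -
    have "p c = coord \<theta>m 1 0 c 0" by (simp add: coord_eq)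
    then show ?thesis using coord_in_K[of 0 1 \<theta>m c] hM c by simp
  qed
  have Jb: "norm (?J x) \<le> 9 * \<bar>CG\<bar> * dist x (p c) powr \<alpha>" if "x \<in> D" for x
  proof -
    have "norm (G x) \<le> CG * dist x (p c) powr \<alpha>" using CG[of x "p c"] that D_subset_K(1) pK Gp by auto
    also have "\<dots> \<le> \<bar>CG\<bar> * dist x (p c) powr \<alpha>" by (intro mult_right_mono) auto
    finally show ?thesis using norm_jacobian[of "G x"] by simp
  qed
  have HD: "H1 D v" "H1 D w" using H1_subset[OF \<Omega> _ open_D D_subset] H1 by auto
  have "AE x in lebesgue_on D. f x = v x - w x" using vw(2) by (auto elim!: eventually_mono)
  \<comment> \<open>The traction pairing contains the gradients chosen on \<Omega>, the comparison
    with \<open>f\<close> those chosen on \<open>D\<close>; almost everywhere in \<open>D\<close>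
    they are the same.\<close>
  from c1_on_wgrad_diff[OF open_D bounded_D c1 L2f L2J HD this] wgrad_subset[OF \<Omega> H1(1) open_D D_subset]
    wgrad_subset[OF \<Omega> H1(2) open_D D_subset]
  have Jae: "AE x in lebesgue_on D. wgrad \<Omega> v x - wgrad \<Omega> w x = ?J x"
    by eventually_elim simp
  obtain Bq where Bq: "\<And>x. x \<in> D \<Longrightarrow> norm (fq x) \<le> Bq"
    using bK[OF holder_on_continuous[OF qw(1) \<alpha>]] by (auto simp: bounded_iff)
  obtain C2 where C2: "C2 \<ge> 0" "\<And>\<rho> i. 0 < \<rho> \<Longrightarrow> 3 * \<rho> \<le> r0 \<Longrightarrow> \<rho> \<le> 1 \<Longrightarrow>
       norm (traction_pairing la mu \<Omega> w (\<lambda>x. - ((\<omega>\<^sup>2 * (1 + V x)) *\<^sub>R w x)) (\<lambda>x. \<phi> c \<rho> x *\<^sub>R axis i 1)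
         - traction_pairing la mu \<Omega> v (\<lambda>x. - (\<omega>\<^sup>2 *\<^sub>R v x)) (\<lambda>x. \<phi> c \<rho> x *\<^sub>R axis i 1)) \<le> C2 * (\<rho> powr \<alpha> + sqrt \<rho>) * \<rho>\<^sup>2"
    by (rule interior_bound[OF r0 H1 tr(1) V \<alpha> Jae _ Jb qw(2) Bq, of la mu \<omega>]) auto
  have boundary: "norm (integral\<^sup>L N (\<lambda>x. (\<phi> c \<rho> x * \<eta> x) *\<^sub>R (tv x $ i))) \<le> C2 * (\<rho> powr \<alpha> + sqrt \<rho>) * \<rho>\<^sup>2"
    if \<rho>: "0 < \<rho>" "3 * \<rho> \<le> r0" "\<rho> \<le> 1" for \<rho> i
  proof -
    \<comment> \<open>The test field is admissible because its support meets the boundary only in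
      the patch, which lies on the lower face and so in \<Gamma>.\<close>
    have "test_fun (\<Gamma> \<union> - frontier \<Omega>) (\<lambda>x. \<phi> c \<rho> x *\<^sub>R axis i (1::complex))"
      unfolding \<phi>_def[OF r0]
    proof (rule test_fun_bump_scaleR)
      show "cbox (corner c \<rho> (- 1)) (corner c \<rho> 1) \<subseteq> \<Gamma> \<union> - frontier \<Omega>"
        using support_frontier[OF r0 \<rho>(1,2)] E_patch_face(1)[OF r0 \<rho>(1,2)] \<Gamma>(2) by blast
    qed (use \<rho> in simp)
    from traction[OF this] have "integral\<^sup>L N (\<lambda>x. cdot (\<eta> x *\<^sub>R tv x) (\<phi> c \<rho> x *\<^sub>R axis i 1)) =
        traction_pairing la mu \<Omega> w (\<lambda>x. - ((\<omega>\<^sup>2 * (1 + V x)) *\<^sub>R w x)) (\<lambda>x. \<phi> c \<rho> x *\<^sub>R axis i 1)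
         - traction_pairing la mu \<Omega> v (\<lambda>x. - (\<omega>\<^sup>2 *\<^sub>R v x)) (\<lambda>x. \<phi> c \<rho> x *\<^sub>R axis i 1)"
      by (simp add: eq_diff_eq add.commute)
    then show ?thesis using C2(2)[OF \<rho>, of i] by (simp add: cdot_axis)
  qed
  obtain C\<eta> where C\<eta>: "\<And>x y. x \<in> cyl (closure (ray \<theta>m h)) {-M..M} \<Longrightarrow> y \<in> cyl (closure (ray \<theta>m h)) {-M..M} \<Longrightarrow>
      \<bar>\<eta> x - \<eta> y\<bar> \<le> C\<eta> * dist x y powr \<alpha>"
    using \<eta>_holder by (auto simp: holder_on_def)
  have \<eta>_est: "\<bar>\<eta> x - \<eta> 0\<bar> \<le> \<bar>C\<eta>\<bar> * dist x (p c) powr \<alpha>" if "x \<in> face \<theta>m" for x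
    by (rule face_holder_estimate[OF _ _ \<alpha> that]) (fact C\<eta> \<eta>_indep)+
  have Fm: "face \<theta>m \<subseteq> frontier \<Omega>" using \<Gamma>(2) \<Gamma>f by blast
  obtain C \<rho>0 where C: "C \<ge> 0" "\<rho>0 > 0"
    "\<And>\<rho> g Jg L e. 0 < \<rho> \<Longrightarrow> \<rho> \<le> \<rho>0 \<Longrightarrow> c1_on UNIV g Jg \<Longrightarrow> (\<And>x. norm (g x - g (p c)) \<le> L * norm (x - p c)) \<Longrightarrow> L \<ge> 0 \<Longrightarrow>
       H1_norm D (\<lambda>x. v x - g x) \<le> e \<Longrightarrow> e > 0 \<Longrightarrow> norm (g (p c)) \<le> C * (\<rho> powr \<alpha> + sqrt \<rho> + L * \<rho> + e / sqrt \<rho>)"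
  proof (rule value_estimate[OF r0 Fm H1(1) tr(1) \<alpha> \<eta> \<eta>_nonzero \<eta>_est C2(1) boundary], goal_cases)
    case (5 C \<rho>0)
    show ?case by (rule 5(1)[OF 5(2,3)]) (rule 5(4); assumption)
  qed
  define \<beta> where "\<beta> = max \<beta>1 \<beta>2"
  define S where "S = sqrt (measure (surface_on (sphere 0 1)) (sphere 0 1))"
  define A where "A = S * (\<bar>kp\<bar> + \<bar>ks\<bar>)"
  have A0: "A \<ge> 0" by (simp add: A_def S_def)
  have "\<exists>J. c1_on UNIV (herglotz kp ks (gp j) (gs j)) J \<and>
      (\<forall>x y. norm (herglotz kp ks (gp j) (gs j) x - herglotz kp ks (gp j) (gs j) y) \<le> A * real j powr \<beta> * norm (x - y))" if j: "j \<ge> 1" for j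
  proof -
    obtain J where J: "c1_on UNIV (herglotz kp ks (gp j) (gs j)) J"
      "\<And>x y. norm (herglotz kp ks (gp j) (gs j) x - herglotz kp ks (gp j) (gs j) y) \<le>
        S * (\<bar>kp\<bar> * L2_norm (surface_on (sphere 0 1)) (gp j) + \<bar>ks\<bar> * L2_norm (surface_on (sphere 0 1)) (gs j)) * norm (x - y)"
      unfolding S_def by (rule herglotz_regular[OF H kernels(1)[OF j] kernels(2)[OF j]]) blast
    \<comment> \<open>For \<open>j\<close> at least 1 both kernel bounds are dominated by the larger
      exponent, so one rate \<beta> serves both kernels.\<close>
    have "real j powr \<beta>1 \<le> real j powr \<beta>" "real j powr \<beta>2 \<le> real j powr \<beta>"
      using j by (auto simp: \<beta>_def intro!: powr_mono)
    then have "L2_norm (surface_on (sphere 0 1)) (gp j) \<le> real j powr \<beta>" "L2_norm (surface_on (sphere 0 1)) (gs j) \<le> real j powr \<beta>"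
      using approx(2,3)[OF j] by linarith+
    then have "S * (\<bar>kp\<bar> * L2_norm (surface_on (sphere 0 1)) (gp j) + \<bar>ks\<bar> * L2_norm (surface_on (sphere 0 1)) (gs j)) \<le>
        S * (\<bar>kp\<bar> * real j powr \<beta> + \<bar>ks\<bar> * real j powr \<beta>)"
      by (intro mult_left_mono add_mono) (auto simp: S_def)
    also have "\<dots> = A * real j powr \<beta>" by (simp add: A_def algebra_simps)
    finally show ?thesis using J by (meson mult_right_mono norm_ge_zero order_trans)
  qed
  then obtain Jg where g: "\<And>j. j \<ge> 1 \<Longrightarrow> c1_on UNIV (herglotz kp ks (gp j) (gs j)) (Jg j)"
    "\<And>j x y. j \<ge> 1 \<Longrightarrow> norm (herglotz kp ks (gp j) (gs j) x - herglotz kp ks (gp j) (gs j) y) \<le> A * real j powr \<beta> * norm (x - y)"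
    by metis
  have \<beta>: "0 < \<beta>" "\<beta> < \<gamma>" using rates by (simp_all add: \<beta>_def)
  let ?F = "\<lambda>r. integral\<^sup>L (lebesgue_on (nbhd c r)) (\<lambda>x. norm (v x)) / measure lebesgue (nbhd c r)"
  have "((\<lambda>\<sigma>. ?F (\<sigma> * r0)) \<longlongrightarrow> 0) (at_right 0)"
  proof (rule average_vanishes[where g = "\<lambda>j. herglotz kp ks (gp j) (gs j)" and Jg = Jg, OF r0 H1(1) tr(1) \<alpha> \<beta> A0 C(1,2) _ g approx(1)])
    show "norm (g (p c)) \<le> C * (\<rho> powr \<alpha> + sqrt \<rho> + L * \<rho> + e / sqrt \<rho>)"
      if "0 < \<rho>" "\<rho> \<le> \<rho>0" "c1_on UNIV g Jg" "\<And>x. norm (g x - g (p c)) \<le> L * norm (x - p c)" "L \<ge> 0"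
        "H1_norm D (\<lambda>x. v x - g x) \<le> e" "e > 0" for \<rho> g Jg L e
      using that by (rule C(3)[of \<rho> g])
  qed
  \<comment> \<open>Averages were parametrised by the dilation factor \<sigma>; the radius is
    \<sigma> r0.\<close>
  moreover have "filterlim (\<lambda>\<rho>. \<rho> / r0) (at_right 0) (at_right 0)"
    unfolding filterlim_at using r0
    by (auto intro!: tendsto_eq_intros simp: eventually_at_right_field exI[of _ 1])
  ultimately have "((\<lambda>\<rho>. ?F (\<rho> / r0 * r0)) \<longlongrightarrow> 0) (at_right 0)" by (rule filterlim_compose)
  then have "(?F \<longlongrightarrow> 0) (at_right 0)" using r0 by simp
  moreover have "\<forall>\<^sub>F \<rho> in at_right 0. ?F \<rho> = integral\<^sup>L (lebesgue_on (ball (p c) \<rho> \<inter> \<Omega>)) (\<lambda>x. norm (v x)) / measure lebesgue (ball (p c) \<rho> \<inter> \<Omega>)"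
    unfolding eventually_at_right_field
  proof (intro exI[of _ r0] conjI allI impI r0(1))
    fix \<rho> assume "\<rho> > 0" "\<rho> < r0"
    then have "ball (p c) \<rho> \<inter> \<Omega> = nbhd c \<rho>" unfolding nbhd_def[OF r0] using r0 by (intro ball_near_edge) auto
    then show "?F \<rho> = integral\<^sup>L (lebesgue_on (ball (p c) \<rho> \<inter> \<Omega>)) (\<lambda>x. norm (v x)) / measure lebesgue (ball (p c) \<rho> \<inter> \<Omega>)"
      by simp
  qed
  ultimately show ?thesis by (rule Lim_transform_eventually)
qed

end

theorem theorem3p1:
  fixes la mu \<omega> h M \<theta>m \<theta>M \<alpha> \<gamma> \<beta>1 \<beta>2 :: real
    and \<Omega> \<Gamma> :: "(real^3) set"
    and V \<eta> :: "real^3 \<Rightarrow> real"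
    and v w :: "real^3 \<Rightarrow> complex^3"
    and gp gs :: "nat \<Rightarrow> real^3 \<Rightarrow> complex^3"
  defines "D \<equiv> cyl (sector \<theta>m \<theta>M h) {-M<..<M}"
    and "K \<equiv> cyl (closure (sector \<theta>m \<theta>M h)) {-M..M}"
    and "F \<equiv> cyl (ray \<theta>m h) {-M<..<M} \<union> cyl (ray \<theta>M h) {-M<..<M}"
    and "kp \<equiv> \<omega> / sqrt (la + 2 * mu)"
    and "ks \<equiv> \<omega> / sqrt mu"
  assumes lame_constants: "mu > 0" "3 * la + 2 * mu > 0" "la \<noteq> 0"
    and omega: "\<omega> > 0"
    and domain: "lipschitz_domain \<Omega>" "bounded \<Omega>" "connected (- closure \<Omega>)" "0 \<in> frontier \<Omega>"
    and edge: "h > 0" "M > 0" "cyl (ball 0 h) {-M<..<M} \<inter> \<Omega> = D"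
    and V: "L_infty (lebesgue_on \<Omega>) V" "\<not> (AE x in lebesgue_on \<Omega>. V x = 0)"
    and \<eta>: "L_infty (surface_on (frontier \<Omega>)) \<eta>"
    and \<Gamma>: "openin (top_of_set (frontier \<Omega>)) \<Gamma>" "F \<subseteq> \<Gamma>"
    and eigen: "transmission_eigenfunctions la mu \<omega> \<Omega> \<Gamma> V \<eta> v w"
    and alpha: "0 < \<alpha>" "\<alpha> < 1"
    and qw_holder: "\<exists>f. holder_on K \<alpha> f \<and> (AE x in lebesgue_on D. (1 + V x) *\<^sub>R w x = f x)"
    and vw_holder: "\<exists>f. C1_holder_on K \<alpha> f \<and> (AE x in lebesgue_on D. v x - w x = f x)"
    and \<eta>_holder: "holder_on (cyl (closure (ray \<theta>m h)) {-M..M}) \<alpha> \<eta>"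
      "holder_on (cyl (closure (ray \<theta>M h)) {-M..M}) \<alpha> \<eta>"
    and rates: "\<gamma> > max \<beta>1 \<beta>2" "max \<beta>1 \<beta>2 > 0"
    and kernels: "\<And>j. j \<ge> 1 \<Longrightarrow> L2 (surface_on (sphere 0 1)) (gp j)"
      "\<And>j. j \<ge> 1 \<Longrightarrow> L2 (surface_on (sphere 0 1)) (gs j)"
    and approx: "\<And>j. j \<ge> 1 \<Longrightarrow>
        H1_norm D (\<lambda>x. v x - herglotz kp ks (gp j) (gs j) x) \<le> real j powr (-\<gamma>)"
      "\<And>j. j \<ge> 1 \<Longrightarrow> L2_norm (surface_on (sphere 0 1)) (gp j) \<le> real j powr \<beta>1"
      "\<And>j. j \<ge> 1 \<Longrightarrow> L2_norm (surface_on (sphere 0 1)) (gs j) \<le> real j powr \<beta>2"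
    and \<eta>_indep: "\<And>x y. x \<in> F \<Longrightarrow> y \<in> F \<Longrightarrow> proj12 x = proj12 y \<Longrightarrow> \<eta> x = \<eta> y"
    and \<eta>_nonzero: "\<eta> 0 \<noteq> 0"
    and angles: "-pi < \<theta>m" "\<theta>m < \<theta>M" "\<theta>M < pi" "\<theta>M - \<theta>m \<noteq> pi"
  shows "\<forall>c\<in>{-M<..<M}.
    ((\<lambda>\<rho>. integral\<^sup>L (lebesgue_on (ball (vector [0, 0, c]) \<rho> \<inter> \<Omega>)) (\<lambda>x. norm (v x))
          / measure lebesgue (ball (vector [0, 0, c]) \<rho> \<inter> \<Omega>)) \<longlongrightarrow> 0) (at_right 0)"
proof
  fix c assume "c \<in> {-M<..<M}"
  then have c: "\<bar>c\<bar> < M" by auto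
  note not_flat = angles(4)
  have \<Omega>: "open \<Omega>" using domain(1) by (simp add: lipschitz_domain_def)
  interpret wedge h M \<theta>m \<theta>M \<Omega>
    using edge angles \<Omega> domain(2) by unfold_locales (auto simp: D_def)
  show "((\<lambda>\<rho>. integral\<^sup>L (lebesgue_on (ball (vector [0, 0, c]) \<rho> \<inter> \<Omega>)) (\<lambda>x. norm (v x))
          / measure lebesgue (ball (vector [0, 0, c]) \<rho> \<inter> \<Omega>)) \<longlongrightarrow> 0) (at_right 0)"
  \<comment> \<open>Only a nondegenerate surface measure gives access to boundary estimates;
    otherwise the interior approximation hypothesis is enough.\<close>
  proof (cases hausdorff2_measure)
    case True
    interpret edge h M \<theta>m \<theta>M \<Omega>
      using True domain(1) by unfold_locales
    obtain fq where fq: "holder_on K \<alpha> fq" "AE x in lebesgue_on D. (1 + V x) *\<^sub>R w x = fq x" using qw_holder by blast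
    obtain f where f: "C1_holder_on K \<alpha> f" "AE x in lebesgue_on D. v x - w x = f x" using vw_holder by blast
    show ?thesis
    proof (rule average_tends_to_zero[OF V(1) \<eta> \<Gamma>(1) \<Gamma>(2)[unfolded F_def] eigen alpha(1) fq[unfolded D_def K_def] f[unfolded D_def K_def]
        \<eta>_holder(1) rates kernels approx[unfolded D_def] \<eta>_indep \<eta>_nonzero not_flat c])
    qed (auto simp: F_def)
  next
    case False
    have "H1 \<Omega> v" using eigen by (simp add: transmission_eigenfunctions_def)
    then have v: "H1 (cyl (sector \<theta>m \<theta>M h) {-M<..<M}) v" by (rule H1_subset[OF \<Omega> _ open_D D_subset])
    \<comment> \<open>The approximating fields are identically zero here, so the bound on the
      approximation error becomes one on \<open>v\<close> itself, for every
      \<open>j\<close>.\<close>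
    have le: "H1_norm D v \<le> real j powr (-\<gamma>)" if "j \<ge> 1" for j
      using approx(1)[OF that] by (simp add: herglotz_junk[OF False])
    have "(\<lambda>j. real j powr (-\<gamma>)) \<longlonglongrightarrow> 0"
      using rates by (intro tendsto_neg_powr filterlim_real_sequentially) auto
    then have "H1_norm D v \<le> 0" by (rule LIMSEQ_le_const) (use le in blast)
    moreover have "0 \<le> H1_norm D v" unfolding D_def by (rule H1_norm_nonneg[OF open_D bounded_D])
    ultimately have "H1_norm D v = 0" by (rule antisym)
    then show ?thesis using average_vanishes_of_norm_zero[OF v _ c] by (simp add: D_def)
  qed
qed

end
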